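(* Let $T>0$, $0<\rho<2$, $A\in\mathbb C^{N\times N}$, $B\in\mathbb C^{N\times\ell}$. Assume: (i) (Fattorini–Hautus) $\operatorname{rank}[\lambda I_N-A\mid B]=N$ for all $\lambda\in\sigma(A)$; (ii) (global spectral non-resonance) $\lambda_{j,m}^{\sigma}\ne\lambda_{k,n}^{\eta}$ whenever $(j,m)\ne(k,n)$, for all $1\le j,k\le p_0$, $m,n\ge1$, $\sigma,\eta\in\{+,-\}$; (iii) (transfer non-resonance) $(\lambda_{j,m}^{\sigma})^2+\gamma_j\ne0$ for all $1\le j\le p_0$, $m\ge1$, $\sigma\in\{+,-\}$. Then for every $(u^0,u^1)\in\mathcal X^3\times\mathcal X^1$ there is a control $f\in H_0^2(0,T;\mathbb C^\ell)$ such that the solution $u$ of $$u_{tt}+L^2u+\rho Lu_t+Au=0\ \text{ in }(0,\pi)\times(0,T),\qquad u(0,t)=u_{xx}(0,t)=0,\quad u(\pi,t)=Bf(t),\ u_{xx}(\pi,t)=0,\qquad u(\cdot,0)=u^0,\ u_t(\cdot,0)=u^1$$ satisfies $u(\cdot,T)=0$ and $u_t(\cdot,T)=0$. Moreover $$\|f\|_{H^2(0,T;\mathbb C^\ell)}\le C_T\left(\|u^0\|_{\mathcal X^3}+\|u^1\|_{\mathcal X^1}\right),$$ with $C_T$ independent of $(u^0,u^1)$.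
   Context: $L=-\partial_{xx}$ is the Dirichlet Laplacian in $L^2(0,\pi)$, with eigenfunctions $\varphi_m(x)=\sqrt{2/\pi}\,\sin(mx)$, $L\varphi_m=m^2\varphi_m$, $m\ge1$. For $s\in\mathbb R$, $X^s=\{y=\sum_{m\ge1}y_m\varphi_m:\ \|y\|_{X^s}^2:=\sum_m m^{2s}|y_m|^2<\infty\}$ (for $s<0$ the spectral completion), and $\mathcal X^s:=(X^s)^N$. $H_0^2(0,T;\mathbb C^\ell)=\{f\in H^2(0,T;\mathbb C^\ell): f(0)=f'(0)=f(T)=f'(T)=0\}$. $\sigma(A)=\{\gamma_1,\dots,\gamma_{p_0}\}$ are the distinct eigenvalues of $A$ ($A$ need not be diagonalizable). For $m\ge1$ the temporal roots are $\lambda_{j,m}^{\pm}=\tfrac12\bigl(-\rho m^2\pm\sqrt{\rho^2m^4-4(m^4+\gamma_j)}\bigr)$, the two roots of $z^2+\rho m^2z+m^4+\gamma_j=0$. The case $\lambda_{j,m}^+=\lambda_{j,m}^-$ is allowed. Solutions: for $f\in H^2(0,T;\mathbb C^\ell)$ with $f(0)=f'(0)=0$, the solution is $u=hBf+v$ with $h(x)=x/\pi$, where $v\in C([0,T];\mathcal X^3)\cap C^1([0,T];\mathcal X^1)\cap H^2(0,T;\mathcal X^{-1})$ is the unique solution, with homogeneous hinged boundary conditions, of $v_{tt}+L^2v+\rho Lv_t+Av=-h(Bf''+ABf)$, $(v(0),v_t(0))=(u^0,u^1)$. Equivalently, the Fourier coefficients $v_m(t)\in\mathbb C^N$ of $v$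 with respect to $\varphi_m$ satisfy $v_m''+\rho m^2v_m'+m^4v_m+Av_m=-x_m(Bf''+ABf)$ with $x_m=(-1)^{m+1}\sqrt{2/\pi}\,m^{-1}$, and with initial values the Fourier coefficients of $u^0,u^1$. *)

theory Defs
  imports "HOL-Analysis.Analysis"
begin

section \<open>Matrices and temporal roots\<close>

definition eigenvalues :: "complex^'n^'n \<Rightarrow> complex set" where
  "eigenvalues A = {\<gamma>. \<exists>x. x \<noteq> 0 \<and> A *v x = \<gamma> *s x}"

definition hautus_matrix :: "complex^'n^'n \<Rightarrow> complex^'l^'n \<Rightarrow> complex \<Rightarrow> complex^('n + 'l)^'n" where
  "hautus_matrix A B z =
     (\<chi> i k. (case k of Inl j \<Rightarrow> (mat z - A) $ i $ j | Inr j \<Rightarrow> B $ i $ j))"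

text \<open>The sign \<^term>\<open>\<sigma>\<close> ranges over \<^term>\<open>{1, - 1 :: complex}\<close>. The choice of branch
  made by \<^const>\<open>csqrt\<close> only decides which of the two roots is called the plus root.\<close>

definition temporal_root :: "real \<Rightarrow> complex \<Rightarrow> complex \<Rightarrow> nat \<Rightarrow> complex" where
  "temporal_root \<rho> \<gamma> \<sigma> m =
     (1 / 2) * (- of_real \<rho> * of_nat m ^ 2
        + \<sigma> * csqrt (of_real \<rho> ^ 2 * of_nat m ^ 4 - 4 * (of_nat m ^ 4 + \<gamma>)))"


section \<open>Spectral spaces\<close>

abbreviation dom_measure :: "real measure" where
  "dom_measure \<equiv> lebesgue_on {0<..<pi}"

definition sine_mode :: "nat \<Rightarrow> real \<Rightarrow> real" where
  "sine_mode m x = sqrt (2 / pi) * sin (real m * x)"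

definition sine_coeff :: "(real \<Rightarrow> complex^'n) \<Rightarrow> nat \<Rightarrow> complex^'n" where
  "sine_coeff y m = (LINT x|dom_measure. sine_mode m x *\<^sub>R y x)"

text \<open>Coefficient sequences are indexed by \<^term>\<open>m \<ge> (1::nat)\<close>; the entry at \<^term>\<open>0::nat\<close> is
  junk and never used. For negative \<^term>\<open>s\<close>, \<open>spec_space s\<close> is the spectral completion.\<close>

definition spec_space :: "real \<Rightarrow> (nat \<Rightarrow> complex^'n) set" where
  "spec_space s = {c. summable (\<lambda>k. real (Suc k) powr (2 * s) * (norm (c (Suc k)))\<^sup>2)}"

definition spec_norm :: "real \<Rightarrow> (nat \<Rightarrow> complex^'n) \<Rightarrow> real" where
  "spec_norm s c = sqrt (\<Sum>k. real (Suc k) powr (2 * s) * (norm (c (Suc k)))\<^sup>2)"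

text \<open>For \<^term>\<open>s \<ge> (0::real)\<close> the spectral space consists of the functions in
  \<open>L\<^sup>2(0,\<pi>)\<close> that are the \<open>L\<^sup>2\<close>-sum of their sine expansion, with coefficients in
  \<^term>\<open>spec_space s\<close>. Functions that agree almost everywhere represent the same element.\<close>

definition X_space :: "real \<Rightarrow> (real \<Rightarrow> complex^'n) set" where
  "X_space s = {y. y \<in> borel_measurable dom_measure
     \<and> integrable dom_measure (\<lambda>x. (norm (y x))\<^sup>2)
     \<and> (\<lambda>n. LINT x|dom_measure.
            (norm (y x - (\<Sum>m=1..n. sine_mode m x *\<^sub>R sine_coeff y m)))\<^sup>2) \<longlonglongrightarrow> 0
     \<and> sine_coeff y \<in> spec_space s}"

definition X_norm :: "real \<Rightarrow> (real \<Rightarrow> complex^'n) \<Rightarrow> real" where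
  "X_norm s y = spec_norm s (sine_coeff y)"


section \<open>Functions of time\<close>

text \<open>\<open>H2_control T f f1 f2\<close>: \<^term>\<open>f\<close> is the \<open>C\<^sup>1\<close> representative of an element of
  \<open>H\<^sup>2(0,T)\<close>, \<^term>\<open>f1\<close> is its (absolutely continuous) derivative and \<^term>\<open>f2\<close> is a
  representative of its second derivative in \<open>L\<^sup>2(0,T)\<close>.\<close>

definition H2_control ::
  "real \<Rightarrow> (real \<Rightarrow> complex^'l) \<Rightarrow> (real \<Rightarrow> complex^'l) \<Rightarrow> (real \<Rightarrow> complex^'l) \<Rightarrow> bool" where
  "H2_control T f f1 f2 \<longleftrightarrow>
     f2 \<in> borel_measurable (lebesgue_on {0..T})
     \<and> integrable (lebesgue_on {0..T}) (\<lambda>t. (norm (f2 t))\<^sup>2)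
     \<and> (\<forall>t\<in>{0..T}. f t = f 0 + (LINT r|lebesgue_on {0..t}. f1 r))
     \<and> (\<forall>t\<in>{0..T}. f1 t = f1 0 + (LINT r|lebesgue_on {0..t}. f2 r))"

definition H02_control ::
  "real \<Rightarrow> (real \<Rightarrow> complex^'l) \<Rightarrow> (real \<Rightarrow> complex^'l) \<Rightarrow> (real \<Rightarrow> complex^'l) \<Rightarrow> bool" where
  "H02_control T f f1 f2 \<longleftrightarrow>
     H2_control T f f1 f2 \<and> f 0 = 0 \<and> f1 0 = 0 \<and> f T = 0 \<and> f1 T = 0"

definition H2_norm ::
  "real \<Rightarrow> (real \<Rightarrow> complex^'l) \<Rightarrow> (real \<Rightarrow> complex^'l) \<Rightarrow> (real \<Rightarrow> complex^'l) \<Rightarrow> real" where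
  "H2_norm T f f1 f2 =
     sqrt (LINT t|lebesgue_on {0..T}. (norm (f t))\<^sup>2 + (norm (f1 t))\<^sup>2 + (norm (f2 t))\<^sup>2)"

definition C0_X :: "real \<Rightarrow> real \<Rightarrow> (real \<Rightarrow> real \<Rightarrow> complex^'n) \<Rightarrow> bool" where
  "C0_X T s v \<longleftrightarrow> (\<forall>t\<in>{0..T}. v t \<in> X_space s \<and>
     ((\<lambda>r. X_norm s (\<lambda>x. v r x - v t x)) \<longlongrightarrow> 0) (at t within {0..T}))"

text \<open>\<open>C1_X T s v vt\<close>: \<^term>\<open>v\<close> is continuously differentiable into the space of order
  \<^term>\<open>s\<close>, with derivative \<^term>\<open>vt\<close>.\<close>

definition C1_X ::
  "real \<Rightarrow> real \<Rightarrow> (real \<Rightarrow> real \<Rightarrow> complex^'n) \<Rightarrow> (real \<Rightarrow> real \<Rightarrow> complex^'n) \<Rightarrow> bool" where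
  "C1_X T s v vt \<longleftrightarrow> C0_X T s v \<and> C0_X T s vt \<and> (\<forall>t\<in>{0..T}.
     ((\<lambda>r. X_norm s (\<lambda>x. (v r x - v t x) /\<^sub>R (r - t) - vt t x)) \<longlongrightarrow> 0) (at t within {0..T}))"

text \<open>\<open>H1_spec T s c w\<close>: the sequence-valued function \<^term>\<open>c\<close> is the primitive of
  \<^term>\<open>w\<close>, which is square integrable with values in \<^term>\<open>spec_space s\<close>. That space is a
  separable weighted \<open>\<ell>\<^sup>2\<close>, so strong measurability and the Bochner integral are
  coordinatewise.\<close>

definition H1_spec ::
  "real \<Rightarrow> real \<Rightarrow> (real \<Rightarrow> nat \<Rightarrow> complex^'n) \<Rightarrow> (real \<Rightarrow> nat \<Rightarrow> complex^'n) \<Rightarrow> bool" where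
  "H1_spec T s c w \<longleftrightarrow>
     (\<forall>m\<ge>1. (\<lambda>t. w t m) \<in> borel_measurable (lebesgue_on {0..T}))
     \<and> (AE t in lebesgue_on {0..T}. w t \<in> spec_space s)
     \<and> integrable (lebesgue_on {0..T}) (\<lambda>t. (spec_norm s (w t))\<^sup>2)
     \<and> (\<forall>t\<in>{0..T}. \<forall>m\<ge>1. c t m = c 0 m + (LINT r|lebesgue_on {0..t}. w r m))"


section \<open>The boundary control problem\<close>

definition lift :: "real \<Rightarrow> real" where
  "lift x = x / pi"

text \<open>The lifted problem: \<open>v\<^sub>t\<^sub>t + L\<^sup>2 v + \<rho> L v\<^sub>t + A v = - h (B f'' + A B f)\<close> as an
  identity in the spectral space of order \<open>-1\<close> for almost every time. There \<open>L\<close> acts as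
  multiplication by \<open>m\<^sup>2\<close> on the coefficients, and \<^term>\<open>w\<close> is the coefficient sequence of
  \<open>v\<^sub>t\<^sub>t\<close>. The homogeneous hinged boundary conditions are part of \<open>v(t)\<close> lying in the
  spectral space of order 3.\<close>

definition lifted_solution ::
  "real \<Rightarrow> real \<Rightarrow> complex^'n^'n \<Rightarrow> complex^'l^'n \<Rightarrow> (real \<Rightarrow> complex^'l) \<Rightarrow> (real \<Rightarrow> complex^'l) \<Rightarrow>
   (real \<Rightarrow> complex^'n) \<Rightarrow> (real \<Rightarrow> complex^'n) \<Rightarrow>
   (real \<Rightarrow> real \<Rightarrow> complex^'n) \<Rightarrow> (real \<Rightarrow> real \<Rightarrow> complex^'n) \<Rightarrow> bool" where
  "lifted_solution T \<rho> A B f f2 u0 u1 v vt \<longleftrightarrow>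
     C0_X T 3 v \<and> C1_X T 1 v vt
     \<and> (AE x in dom_measure. v 0 x = u0 x)
     \<and> (AE x in dom_measure. vt 0 x = u1 x)
     \<and> (\<exists>w. H1_spec T (-1) (\<lambda>t. sine_coeff (vt t)) w
          \<and> (AE t in lebesgue_on {0..T}. \<forall>m\<ge>1.
               w t m + real m ^ 4 *\<^sub>R sine_coeff (v t) m
                 + (\<rho> * real m ^ 2) *\<^sub>R sine_coeff (vt t) m + A *v sine_coeff (v t) m
               = - sine_coeff (\<lambda>x. lift x *\<^sub>R (B *v f2 t + A *v (B *v f t))) m))"

text \<open>\<^term>\<open>u\<close> is the solution \<open>h B f + v\<close> and \<^term>\<open>ut\<close> its time derivative
  \<open>h B f' + v\<^sub>t\<close>.\<close>

definition controlled_solution ::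
  "real \<Rightarrow> real \<Rightarrow> complex^'n^'n \<Rightarrow> complex^'l^'n \<Rightarrow>
   (real \<Rightarrow> complex^'l) \<Rightarrow> (real \<Rightarrow> complex^'l) \<Rightarrow> (real \<Rightarrow> complex^'l) \<Rightarrow>
   (real \<Rightarrow> complex^'n) \<Rightarrow> (real \<Rightarrow> complex^'n) \<Rightarrow>
   (real \<Rightarrow> real \<Rightarrow> complex^'n) \<Rightarrow> (real \<Rightarrow> real \<Rightarrow> complex^'n) \<Rightarrow> bool" where
  "controlled_solution T \<rho> A B f f1 f2 u0 u1 u ut \<longleftrightarrow>
     lifted_solution T \<rho> A B f f2 u0 u1
       (\<lambda>t x. u t x - lift x *\<^sub>R (B *v f t))
       (\<lambda>t x. ut t x - lift x *\<^sub>R (B *v f1 t))"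

end

theory Submission
  imports Defs "HOL-Computational_Algebra.Fundamental_Theorem_Algebra" "HOL-Library.Function_Algebras"
begin

text \<open>The proof reduces controllability to a moment problem and solves it with an explicit control that is
supported in the middle third of the time interval.

\<^bold>\<open>Reduction to moments.\<close> With the state \<open>y = (m\<^sup>2 v\<^sub>m, v\<^sub>m')\<close> the mode \<open>m\<close> satisfies
\<open>y' = M\<^sub>m y - x\<^sub>m (0, B f'' + A B f)\<close>, where \<open>M\<^sub>m\<close> is \<open>gen_op \<rho> A m\<close>. Every solution in the
required class has modes with these equations, so it is at rest at time \<open>T\<close> as soon as
\<open>x\<^sub>m \<integral> exp (- s M\<^sub>m) (0, B f'' + A B f) ds\<close> is the initial state of each mode
(\<open>lifted_solution_final\<close>). For \<open>f\<close> that vanishes at both ends together with its derivative, integration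
by parts turns this integral into \<open>(M\<^sub>m\<^sup>2 + A) \<mu>\<^sub>m(f)\<close> with
\<open>\<mu>\<^sub>m(f) = \<integral> exp (- s M\<^sub>m) (0, B f) ds\<close>. Since \<open>M\<^sub>m\<^sup>2 + A = - m\<^sup>2 (\<rho> M\<^sub>m + m\<^sup>2)\<close>, the transfer
nonresonance makes it invertible, with inverses bounded in \<open>m\<close> (\<open>transfer_lower_bound\<close>). It
remains to prescribe all \<open>\<mu>\<^sub>m(f)\<close>.

\<^bold>\<open>Separating the modes.\<close> Let \<open>(g\<^sub>0 - A) \<cdots> (g\<^sub>d\<^sub>-\<^sub>1 - A) = 0\<close> with eigenvalues \<open>g\<^sub>k\<close> of \<open>A\<close>. From
\<open>M\<^sub>n\<^sup>2 + \<rho> n\<^sup>2 M\<^sub>n + n\<^sup>4 + A = 0\<close> the polynomial \<open>q\<^sub>n(z) = \<Prod>\<^sub>k (z\<^sup>2 + \<rho> n\<^sup>2 z + n\<^sup>4 + g\<^sub>k) / n\<^sup>4\<close>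
vanishes at \<open>M\<^sub>n\<close>. The product \<open>\<Phi>\<^sub>m\<close> of all \<open>q\<^sub>n\<close> with \<open>n \<noteq> m\<close> is entire with growth at
most of order \<open>3/4\<close>, so the operator \<open>\<Phi>\<^sub>m(d/dt)\<close> may be applied to functions of Gevrey order \<open>5/4 < 4/3\<close>.
It is applied to \<open>\<kappa>(t) exp (t M\<^sub>m) Z\<close> with a Gevrey bump \<open>\<kappa>\<close> of integral one. Integration by
parts turns \<open>d/dt\<close> into multiplication by \<open>M\<^sub>n\<close> under the moment of mode \<open>n\<close>, so the result has
zero moment for every \<open>n \<noteq> m\<close>, while for \<open>n = m\<close> the weight \<open>exp (- t M\<^sub>m)\<close> cancels the
exponential and \<open>\<Phi>\<^sub>m(M\<^sub>m) Z\<close> remains. By the spectral nonresonance \<open>\<Phi>\<^sub>m(M\<^sub>m)\<close> is invertible, with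
an inverse of size \<open>exp (C m\<^sup>3\<^sup>/\<^sup>2)\<close> (\<open>qproduct_modal_surjective\<close>). Multiple temporal roots and
Jordan blocks of \<open>A\<close> need no special treatment because no eigenvector expansion occurs.

\<^bold>\<open>Acting through \<open>B\<close>.\<close> The control enters only through \<open>B\<close> and only in the velocity. The rank
condition yields matrices with \<open>\<Sum>\<^sub>i (g\<^sub>0 - A) \<cdots> (g\<^sub>i\<^sub>-\<^sub>1 - A) B K\<^sub>i = 1\<close>
(\<open>hautus_reachability\<close>), and at \<open>M\<^sub>m\<close> the first \<open>i\<close> factors of \<open>q\<^sub>m\<close> become the products
in this sum up to a power of \<open>m\<close>; the position component is reached with one more time derivative
(\<open>state_reconstruction\<close>).

\<^bold>\<open>Size.\<close> On the support of \<open>\<kappa>\<close>, which starts at \<open>T/3\<close>, the factor \<open>exp (t M\<^sub>m)\<close> has size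
\<open>exp (- c m\<^sup>2)\<close> because \<open>0 < \<rho> < 2\<close> makes the damping act on the whole energy
(\<open>modal_semigroup_decay\<close>). This beats every loss \<open>exp (C m\<^sup>3\<^sup>/\<^sup>2)\<close>, so the controls of the
single modes can be summed, together with two derivatives, with a bound linear in the data.
The same decay, through Duhamel's formula, gives the existence of the solution in its regularity
class.\<close>

section \<open>The Banach algebra of operators on a Euclidean space\<close>

text \<open>A copy of the bounded endomorphisms that carries composition as multiplication: as an instance of
\<^class>\<open>banach\<close> and \<^class>\<open>real_normed_algebra_1\<close> it inherits \<^const>\<open>exp\<close> and power series.\<close>

typedef (overloaded) 'a eop = "UNIV :: ('a::euclidean_space \<Rightarrow>\<^sub>L 'a) set"
  by simp

instantiation eop :: (euclidean_space) real_normed_algebra_1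
begin

definition "0 = Abs_eop 0"
definition "1 = Abs_eop id_blinfun"
definition "x + y = Abs_eop (Rep_eop x + Rep_eop y)"
definition "x - y = Abs_eop (Rep_eop x - Rep_eop y)"
definition "- x = Abs_eop (- Rep_eop x)"
definition "x * y = Abs_eop (Rep_eop x o\<^sub>L Rep_eop y)"
definition "scaleR r x = Abs_eop (r *\<^sub>R Rep_eop x)"
definition "norm x = norm (Rep_eop x)"
definition "dist x y = norm (Rep_eop x - Rep_eop y)"
definition "sgn (x :: 'a eop) = Abs_eop (sgn (Rep_eop x))"
definition "uniformity = (INF e\<in>{0<..}. principal {(x, y :: 'a eop). dist x y < e})"
definition "open (S :: 'a eop set) \<longleftrightarrow>
  (\<forall>x\<in>S. eventually (\<lambda>(x', y). x' = x \<longrightarrow> y \<in> S) uniformity)"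

lemmas eop_defs = zero_eop_def one_eop_def plus_eop_def minus_eop_def uminus_eop_def
  times_eop_def scaleR_eop_def norm_eop_def dist_eop_def

instance
proof
  show "norm (1 :: 'a eop) = 1"
    by (simp add: eop_defs Abs_eop_inverse)
  have "norm (0 :: 'a eop) = 0" "norm (1 :: 'a eop) = 1"
    by (simp_all add: eop_defs Abs_eop_inverse)
  then show "(0 :: 'a eop) \<noteq> 1"
    by force
qed (auto simp: eop_defs sgn_eop_def sgn_div_norm uniformity_eop_def open_eop_def Abs_eop_inverse Rep_eop_inverse
        Rep_eop_inject[symmetric] algebra_simps norm_blinfun_compose norm_triangle_ineq
        blinfun.bilinear_simps intro!: blinfun_eqI)

end

instance eop :: (euclidean_space) banach
proof
  fix X :: "nat \<Rightarrow> 'a eop"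
  assume "Cauchy X"
  then have "Cauchy (\<lambda>n. Rep_eop (X n))"
    by (simp add: Cauchy_def dist_eop_def dist_norm)
  then obtain L where "(\<lambda>n. Rep_eop (X n)) \<longlonglongrightarrow> L"
    using Cauchy_convergent convergent_def by blast
  then have "X \<longlonglongrightarrow> Abs_eop L"
    by (simp add: tendsto_iff dist_eop_def Abs_eop_inverse dist_norm)
  then show "convergent X"
    by (auto simp: convergent_def)
qed

definition ap :: "'a::euclidean_space eop \<Rightarrow> 'a \<Rightarrow> 'a" where
  "ap x v = blinfun_apply (Rep_eop x) v"

definition mkop :: "('a::euclidean_space \<Rightarrow> 'a) \<Rightarrow> 'a eop" where
  "mkop f = Abs_eop (Blinfun f)"

lemma ap_mkop: "linear f \<Longrightarrow> ap (mkop f) v = f v"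
  by (simp add: ap_def mkop_def Abs_eop_inverse bounded_linear_Blinfun_apply linear_conv_bounded_linear)

lemma bounded_bilinear_ap: "bounded_bilinear ap"
  by (rule bounded_bilinear.intro)
    (auto simp: ap_def eop_defs Abs_eop_inverse blinfun.bilinear_simps norm_blinfun intro!: exI[of _ 1])

interpretation ap: bounded_bilinear ap
  by (rule bounded_bilinear_ap)

lemma ap_one [simp]: "ap 1 v = v"
  by (simp add: ap_def eop_defs Abs_eop_inverse)

lemma ap_mult: "ap (x * y) v = ap x (ap y v)"
  by (simp add: ap_def eop_defs Abs_eop_inverse)

lemma norm_ap: "norm (ap x v) \<le> norm x * norm v"
  by (simp add: ap_def norm_eop_def norm_blinfun)

lemma eop_eqI: "(\<And>v. ap x v = ap y v) \<Longrightarrow> x = y"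
  by (metis Rep_eop_inverse ap_def blinfun_eqI)

lemma linear_ap: "linear (ap x)"
  using ap.bounded_linear_right bounded_linear.linear by blast

lemma norm_eop_bound: "(\<And>v. norm (ap x v) \<le> b * norm v) \<Longrightarrow> 0 \<le> b \<Longrightarrow> norm x \<le> b"
  by (simp add: ap_def norm_eop_def norm_blinfun_bound)

section \<open>Complex scalars\<close>

lemma norm_vec_smult: "norm (c *s (x :: complex^'n)) = norm c * norm x"
  by (simp add: norm_vec_def norm_mult L2_set_right_distrib)

lemma vec_smult_scaleR: "(r *\<^sub>R x :: complex^'n) = of_real r *s x"
  by (vector scaleR_conv_of_real)

lemma linear_vec_smult: "linear ((*s) c :: complex^'n \<Rightarrow> complex^'n)"
  by (rule linearI) (vector algebra_simps scaleR_conv_of_real)+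

lemma matrix_smult: "A *v (c *s x) = c *s (A *v (x :: complex^'n))"
  by (simp add: vector_scalar_commute)

lemma linear_matrix_complex: "linear ((*v) (A :: complex^'n^'m))"
proof (rule linearI)
  show "A *v (r *\<^sub>R x) = r *\<^sub>R (A *v x)" for r and x :: "complex^'n"
    by (simp only: vec_smult_scaleR vector_scalar_commute)
qed (simp add: matrix_vector_right_distrib)

lemma matrix_scaleR: "(A :: complex^'n^'m) *v (r *\<^sub>R x) = r *\<^sub>R (A *v x)"
  using linear_matrix_complex[of A] by (simp add: linear_scale)

lemma bounded_linear_matrix: "bounded_linear ((*v) (A :: complex^'n^'m))"
  using linear_matrix_complex by (simp add: linear_conv_bounded_linear)

lemma matrix_bound: "\<exists>c\<ge>0. \<forall>x. norm ((A :: complex^'n^'m) *v x) \<le> c * norm x"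
  using bounded_linear.nonneg_bounded[OF bounded_linear_matrix[of A]]
  by (metis mult.commute)

section \<open>The modal first-order system\<close>

text \<open>States of a mode are the pairs \<open>(m\<^sup>2 v, v')\<close>. In this scaling the generator \<open>gen_op\<close> is \<open>m\<^sup>2\<close> times a
fixed matrix up to an error of size \<open>m\<^sup>-\<^sup>2\<close>.\<close>

type_synonym 'n st = "(complex^'n) \<times> (complex^'n)"

text \<open>\<open>scal_op\<close> and \<open>mat_op\<close> let scalars and matrices act on both components; \<open>input_fst X\<close> and
\<open>input_snd X\<close> feed one component, through \<open>X\<close>, into the velocity, which is where a control acts.\<close>

definition scal_op :: "complex \<Rightarrow> ('n::finite) st eop" where
  "scal_op c = mkop (\<lambda>(a, b). (c *s a, c *s b))"

definition mat_op :: "complex^'n^'n \<Rightarrow> ('n::finite) st eop" where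
  "mat_op A = mkop (\<lambda>(a, b). (A *v a, A *v b))"

definition gen_op :: "real \<Rightarrow> complex^'n^'n \<Rightarrow> nat \<Rightarrow> ('n::finite) st eop" where
  "gen_op \<rho> A m = mkop (\<lambda>(a, b). (real m ^ 2 *\<^sub>R b,
     - (real m ^ 2 *\<^sub>R a) - (\<rho> * real m ^ 2) *\<^sub>R b - (A *v a) /\<^sub>R real m ^ 2))"

definition input_fst :: "complex^'n^'n \<Rightarrow> ('n::finite) st eop" where
  "input_fst X = mkop (\<lambda>(a, b). (0, X *v a))"

definition input_snd :: "complex^'n^'n \<Rightarrow> ('n::finite) st eop" where
  "input_snd X = mkop (\<lambda>(a, b). (0, X *v b))"

lemmas complex_matrix_simps = matrix_vector_right_distrib matrix_vector_mult_add_rdistrib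
  matrix_scaleR matrix_smult linear_add[OF linear_vec_smult] linear_scale[OF linear_vec_smult]
  linear_diff[OF linear_vec_smult] linear_neg[OF linear_vec_smult]
  linear_diff[OF linear_matrix_complex] linear_neg[OF linear_matrix_complex]

lemma ap_scal_op: "ap (scal_op c) (a, b) = (c *s a, c *s b)"
  unfolding scal_op_def by (subst ap_mkop) (auto intro!: linearI simp: complex_matrix_simps)

lemma ap_mat_op: "ap (mat_op A) (a, b) = (A *v a, A *v b)"
  unfolding mat_op_def by (subst ap_mkop) (auto intro!: linearI simp: complex_matrix_simps)

lemma ap_gen_op: "ap (gen_op \<rho> A m) (a, b) = (real m ^ 2 *\<^sub>R b,
     - (real m ^ 2 *\<^sub>R a) - (\<rho> * real m ^ 2) *\<^sub>R b - (A *v a) /\<^sub>R real m ^ 2)"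
  unfolding gen_op_def by (subst ap_mkop) (auto intro!: linearI simp: complex_matrix_simps algebra_simps)

lemma ap_input_fst: "ap (input_fst A) (a, b) = (0, A *v a)"
  unfolding input_fst_def by (subst ap_mkop) (auto intro!: linearI simp: complex_matrix_simps)

lemma ap_input_snd: "ap (input_snd A) (a, b) = (0, A *v b)"
  unfolding input_snd_def by (subst ap_mkop) (auto intro!: linearI simp: complex_matrix_simps)

lemmas ap_simps = ap_scal_op ap_mat_op ap_gen_op ap_input_fst ap_input_snd ap_mult ap.add_left ap.add_right
  ap.diff_left ap.diff_right ap.scaleR_left ap.scaleR_right ap.minus_left ap.minus_right
  ap.zero_left ap.zero_right

lemma st_eqI: "(\<And>a b. ap x (a, b) = ap y (a, b)) \<Longrightarrow> x = y"
  by (rule eop_eqI) auto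

lemma scal_op_mat_op: "scal_op c * mat_op A = mat_op A * scal_op c"
  by (rule st_eqI) (simp add: ap_simps complex_matrix_simps)

lemma scal_op_gen_op: "scal_op c * gen_op \<rho> A m = gen_op \<rho> A m * scal_op c"
  by (rule st_eqI) (simp add: ap_simps complex_matrix_simps)

lemma scal_op_input_fst: "scal_op c * input_fst A = input_fst A * scal_op c"
  by (rule st_eqI) (simp add: ap_simps complex_matrix_simps)

lemma scal_op_input_snd: "scal_op c * input_snd A = input_snd A * scal_op c"
  by (rule st_eqI) (simp add: ap_simps complex_matrix_simps)

lemma mat_op_gen_op: "mat_op A * gen_op \<rho> A m = gen_op \<rho> A m * mat_op A"
  by (rule st_eqI) (simp add: ap_simps complex_matrix_simps)

lemma norm_scal_op: "norm (scal_op c :: ('n::finite) st eop) \<le> norm c"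
proof (rule norm_eop_bound)
  fix v :: "'n st"
  show "norm (ap (scal_op c) v) \<le> norm c * norm v"
    by (cases v) (simp add: ap_scal_op norm_Pair norm_vec_smult power_mult_distrib real_sqrt_mult flip: distrib_left)
qed simp

text \<open>This is the second-order equation of the mode, with \<open>M\<close> in place of the time derivative. It plays
the role of a characteristic equation with the matrix \<open>A\<close> as a coefficient.\<close>

lemma gen_op_quadratic:
  fixes A :: "complex^'n^'n"
  assumes "m \<ge> 1"
  shows "gen_op \<rho> A m * gen_op \<rho> A m + (\<rho> * real m ^ 2) *\<^sub>R gen_op \<rho> A m + real m ^ 4 *\<^sub>R 1 + mat_op A = 0"
proof (rule st_eqI)
  fix a b :: "complex^'n"
  have [simp]: "(real m)\<^sup>2 * (real m)\<^sup>2 = real m ^ 4"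
    by (simp flip: power_add)
  have "real m \<noteq> 0" using assms by simp
  then show "ap (gen_op \<rho> A m * gen_op \<rho> A m + (\<rho> * real m ^ 2) *\<^sub>R gen_op \<rho> A m + real m ^ 4 *\<^sub>R 1 + mat_op A) (a, b)
     = ap 0 (a, b)"
    by (simp add: ap_simps complex_matrix_simps scaleR_diff_right scaleR_add_right algebra_simps zero_prod_def)
qed

lemma norm_gen_op_bound:
  fixes A :: "complex^'n^'n"
  assumes "0 \<le> \<rho>"
  shows "\<exists>c\<ge>1. \<forall>m\<ge>1. norm (gen_op \<rho> A m) \<le> c * real m ^ 2"
proof -
  obtain cA where cA: "cA \<ge> 0" "\<And>x. norm (A *v x) \<le> cA * norm x"
    using matrix_bound[of A] by blast
  have "norm (gen_op \<rho> A m) \<le> (2 + \<rho> + cA) * real m ^ 2" if m: "m \<ge> 1" for m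
  proof (rule norm_eop_bound)
    show "0 \<le> (2 + \<rho> + cA) * (real m)\<^sup>2" using assms cA by simp
    fix v :: "'n st"
    obtain a b where v: "v = (a, b)" by (cases v)
    have na: "norm a \<le> norm v" "norm b \<le> norm v"
      unfolding v using norm_fst_le[of a b] norm_snd_le[of b a] by auto
    have m1: "1 \<le> (real m)\<^sup>2" using m by simp
    have m2: "inverse ((real m)\<^sup>2) \<le> (real m)\<^sup>2"
      using m1 by (meson inverse_le_1_iff order.trans)
    have "norm ((A *v a) /\<^sub>R (real m)\<^sup>2) \<le> (real m)\<^sup>2 * (cA * norm v)"
      using mult_mono[OF m2 order_trans[OF cA(2)[of a] mult_left_mono[OF na(1) cA(1)]]] m1 by simp
    moreover have "norm ((real m)\<^sup>2 *\<^sub>R a) \<le> (real m)\<^sup>2 * norm v" "norm ((real m)\<^sup>2 *\<^sub>R b) \<le> (real m)\<^sup>2 * norm v"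
      using na by (simp_all add: mult_left_mono)
    moreover have "norm ((\<rho> * (real m)\<^sup>2) *\<^sub>R b) \<le> \<rho> * (real m)\<^sup>2 * norm v"
      using na assms by (simp add: mult_left_mono)
    moreover have "norm (ap (gen_op \<rho> A m) v) \<le> norm ((real m)\<^sup>2 *\<^sub>R b) +
       norm (- ((real m)\<^sup>2 *\<^sub>R a) - (\<rho> * (real m)\<^sup>2) *\<^sub>R b - (A *v a) /\<^sub>R (real m)\<^sup>2)"
      unfolding v ap_gen_op by (rule norm_Pair_le)
    moreover have "norm (- ((real m)\<^sup>2 *\<^sub>R a) - (\<rho> * (real m)\<^sup>2) *\<^sub>R b - (A *v a) /\<^sub>R (real m)\<^sup>2)
       \<le> norm ((real m)\<^sup>2 *\<^sub>R a) + norm ((\<rho> * (real m)\<^sup>2) *\<^sub>R b) + norm ((A *v a) /\<^sub>R (real m)\<^sup>2)"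
      by (metis (no_types, lifting) add_right_mono norm_minus_cancel norm_triangle_ineq4 order.trans)
    ultimately show "norm (ap (gen_op \<rho> A m) v) \<le> (2 + \<rho> + cA) * (real m)\<^sup>2 * norm v"
      by (simp add: algebra_simps)
  qed
  then show ?thesis using assms cA by (intro exI[of _ "2 + \<rho> + cA"]) auto
qed

section \<open>Eigenvalues and the Hautus condition\<close>

text \<open>The value \<open>p(A) w\<close>, computed by Horner's scheme.\<close>

definition poly_vec :: "complex^'n^'n \<Rightarrow> complex^'n \<Rightarrow> complex poly \<Rightarrow> complex^'n" where
  "poly_vec A w p = fold_coeffs (\<lambda>a x. a *s w + A *v x) p 0"

lemma poly_vec_0 [simp]: "poly_vec A w 0 = 0"
  by (simp add: poly_vec_def)

lemma poly_vec_pCons [simp]: "poly_vec A w (pCons a p) = a *s w + A *v poly_vec A w p"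
  by (cases "p = 0 \<and> a = 0") (auto simp: poly_vec_def)

lemma poly_vec_add: "poly_vec A w (p + q) = poly_vec A w p + poly_vec A w q"
  by (induction p q rule: poly_induct2) (simp_all add: matrix_vector_right_distrib)

lemma poly_vec_smult: "poly_vec A w (smult c p) = c *s poly_vec A w p"
  by (induction p) (simp_all add: vector_smult_assoc vector_add_ldistrib vector_scalar_commute)

lemma poly_vec_diff: "poly_vec A w (p - q) = poly_vec A w p - poly_vec A w q"
  using poly_vec_add[of A w "p - q" q] by simp

lemma poly_vec_linear_factor:
  "poly_vec A w ([:- z, 1:] * q) = A *v poly_vec A w q - z *s poly_vec A w q"
  by (simp add: poly_vec_diff poly_vec_smult)

lemma poly_vec_commute:
  assumes "P ** A = A ** P"
  shows "poly_vec A (P *v w) p = P *v poly_vec A w p"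
proof (induction p)
  case (pCons a p)
  then show ?case
    by (simp add: matrix_vector_right_distrib vector_scalar_commute matrix_vector_mul_assoc assms)
qed simp

text \<open>Split off linear factors of \<open>p\<close> one at a time; the last nonzero vector is an eigenvector. Having it
in the form \<open>q(A) w\<close> matters: the range of any matrix that commutes with \<open>A\<close> then contains an
eigenvector.\<close>

lemma annihilated_vector_gives_eigenvector:
  assumes "w \<noteq> 0" "p \<noteq> 0" "poly_vec A w p = 0"
  shows "\<exists>q z. poly_vec A w q \<noteq> 0 \<and> A *v poly_vec A w q = z *s poly_vec A w q"
  using assms(2,3)
proof (induction "degree p" arbitrary: p)
  case 0
  then obtain a where "p = [:a:]" "a \<noteq> 0"
    by (metis degree_eq_zeroE pCons_0_0)
  with 0 assms(1) show ?case by (simp add: vector_mul_eq_0)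
next
  case (Suc n)
  have "\<not> constant (poly p)"
    using Suc.hyps(2) by (simp add: constant_degree)
  then obtain z where "poly p z = 0"
    using fundamental_theorem_of_algebra by blast
  then obtain q where q: "p = [:- z, 1:] * q"
    by (metis poly_eq_0_iff_dvd dvdE)
  show ?case
  proof (cases "poly_vec A w q = 0")
    case True
    have "q \<noteq> 0" using Suc.prems q by auto
    then have "n = degree q"
      using Suc.hyps(2) unfolding q by (subst (asm) degree_mult_eq) auto
    then show ?thesis
      using Suc.hyps(1) True \<open>q \<noteq> 0\<close> by blast
  next
    case False
    moreover have "A *v poly_vec A w q = z *s poly_vec A w q"
      using Suc.prems(2) unfolding q by (simp only: poly_vec_linear_factor) simp
    ultimately show ?thesis by blast
  qed
qed

lemma vector_annihilated:
  fixes A :: "complex^'n^'n"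
  shows "\<exists>p. p \<noteq> 0 \<and> poly_vec A w p = 0"
proof -
  define x where "x i = poly_vec A w (monom 1 i)" for i
  define S where "S k = {poly_vec A w q | q. \<forall>i\<ge>k. coeff q i = 0}" for k :: nat
  have subspace: "subspace (S k)" for k
    unfolding subspace_def S_def
  proof (safe, goal_cases)
    case 1
    show ?case by (rule exI[of _ 0]) simp
  next
    case (2 u v p q)
    then show ?case by (intro exI[of _ "p + q"]) (simp add: poly_vec_add)
  next
    case (3 c u p)
    then show ?case
      by (intro exI[of _ "smult (of_real c) p"])
        (simp add: poly_vec_smult, vector scaleR_conv_of_real)
  qed
  have span: "span (x ` {..<k}) \<subseteq> S k" for k
    using subspace by (intro span_minimal) (auto simp: x_def S_def coeff_monom)
  have "\<exists>k. x k \<in> span (x ` {..<k})"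
  proof (rule ccontr)
    assume *: "\<nexists>k. x k \<in> span (x ` {..<k})"
    have "independent (x ` {..<k}) \<and> card (x ` {..<k}) = k" for k
    proof (induction k)
      case (Suc k)
      have "x k \<notin> span (x ` {..<k})" using * by blast
      moreover have "x k \<notin> x ` {..<k}"
        using calculation span_base[of "x k" "x ` {..<k}"] by auto
      ultimately show ?case
        using Suc by (simp add: lessThan_Suc independent_insertI)
    qed (simp add: independent_empty)
    from this[of "Suc DIM(complex^'n)"] show False
      using independent_bound[of "x ` {..<Suc DIM(complex^'n)}"] by linarith
  qed
  then obtain k where "x k \<in> S k"
    using span by blast
  then obtain q where q: "x k = poly_vec A w q" "\<forall>i\<ge>k. coeff q i = 0"
    unfolding S_def by auto
  have "coeff (monom 1 k - q) k = 1" using q by simp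
  then have "monom 1 k - q \<noteq> 0" by (metis coeff_0 zero_neq_one)
  moreover have "poly_vec A w (monom 1 k - q) = 0"
    using q(1) by (simp add: poly_vec_diff x_def)
  ultimately show ?thesis by blast
qed

primrec shifted_prod :: "complex^'n^'n \<Rightarrow> (nat \<Rightarrow> complex) \<Rightarrow> nat \<Rightarrow> complex^'n^'n" where
  "shifted_prod A g 0 = mat 1"
| "shifted_prod A g (Suc k) = shifted_prod A g k ** (mat (g k) - A)"

lemma mat_commute: "mat z ** (A :: complex^'n^'n) = A ** mat z"
  by (simp add: matrix_matrix_mult_def mat_def vec_eq_iff if_distrib if_distribR
      sum.delta sum.delta' mult.commute cong: if_cong)

lemma matrix_sub_ldistrib: "A ** (B - C) = A ** B - A ** (C :: complex^'n^'m)"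
  using matrix_add_ldistrib[of A "B - C" C] by (simp add: algebra_simps)

lemma matrix_add_rdistrib: "(B + C) ** A = B ** A + C ** (A :: complex^'n^'m)"
  by (simp add: matrix_matrix_mult_def vec_eq_iff distrib_right sum.distrib)

lemma matrix_sub_rdistrib: "(B - C) ** A = B ** A - C ** (A :: complex^'n^'m)"
  using matrix_add_rdistrib[of "B - C" C A] by (simp add: algebra_simps)

lemma shift_commute: "(mat z - A) ** A = A ** (mat z - A :: complex^'n^'n)"
  by (simp only: matrix_sub_ldistrib matrix_sub_rdistrib mat_commute[of z A])

lemma shifted_prod_commute: "shifted_prod A g k ** A = A ** shifted_prod A g k"
proof (induction k)
  case (Suc k)
  have "shifted_prod A g (Suc k) ** A = shifted_prod A g k ** (A ** (mat (g k) - A))"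
    by (simp only: shifted_prod.simps matrix_mul_assoc[symmetric] shift_commute)
  also have "\<dots> = A ** shifted_prod A g (Suc k)"
    by (simp only: shifted_prod.simps matrix_mul_assoc Suc)
  finally show ?case .
qed simp

lemma shifted_prod_commute': "shifted_prod A g k ** (mat z - A) = (mat z - A) ** shifted_prod A g k"
  by (simp only: matrix_sub_ldistrib matrix_sub_rdistrib mat_commute[of z "shifted_prod A g k"] shifted_prod_commute)

lemma shifted_prod_cong: "(\<And>j. j < k \<Longrightarrow> g j = h j) \<Longrightarrow> shifted_prod A g k = shifted_prod A h k"
  by (induction k) auto

lemma mat_smult: "mat z *v (x :: complex^'n) = z *s x"
  by (simp add: matrix_vector_mult_def mat_def vec_eq_iff if_distrib if_distribR sum.delta cong: if_cong)

text \<open>As long as a product of shifted factors is nonzero, its range contains an eigenvector, and one more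
factor with the corresponding eigenvalue enlarges the kernel. This gives an annihilating polynomial
with roots in the spectrum, as the minimal polynomial would.\<close>

lemma eigenvalues_annihilate:
  fixes A :: "complex^'n^'n"
  shows "\<exists>d g. (\<forall>j<d. g j \<in> eigenvalues A) \<and> shifted_prod A g d = 0"
proof -
  let ?ker = "\<lambda>g k. {x. shifted_prod A g k *v x = 0}"
  have *: "\<exists>d g. (\<forall>j<d. g j \<in> eigenvalues A) \<and> shifted_prod A g d = 0"
    if "\<forall>j<k. g j \<in> eigenvalues A" for g :: "nat \<Rightarrow> complex" and k
    using that
  proof (induction "DIM(complex^'n) - dim (?ker g k)" arbitrary: g k rule: less_induct)
    case (less g k)
    show ?case
    proof (cases "shifted_prod A g k = 0")
      case False
      then obtain u where u: "shifted_prod A g k *v u \<noteq> 0"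
        using matrix_eq[of "shifted_prod A g k" 0] by auto
      obtain p where p: "p \<noteq> 0" "poly_vec A (shifted_prod A g k *v u) p = 0"
        using vector_annihilated by blast
      obtain q z where q: "poly_vec A (shifted_prod A g k *v u) q \<noteq> 0"
        "A *v poly_vec A (shifted_prod A g k *v u) q = z *s poly_vec A (shifted_prod A g k *v u) q"
        using annihilated_vector_gives_eigenvector[OF u p] by blast
      define x where "x = poly_vec A u q"
      have x: "shifted_prod A g k *v x \<noteq> 0" "A *v (shifted_prod A g k *v x) = z *s (shifted_prod A g k *v x)"
        using q by (simp_all add: x_def poly_vec_commute shifted_prod_commute)
      define h where "h = g(k := z)"
      have h: "shifted_prod A h (Suc k) = (mat z - A) ** shifted_prod A g k"
        using shifted_prod_cong[of k h g A] by (simp add: h_def shifted_prod_commute')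
      then have hx: "shifted_prod A h (Suc k) *v y = (mat z - A) *v (shifted_prod A g k *v y)" for y
        by (simp only: matrix_vector_mul_assoc)
      have sub: "subspace (?ker f j)" for f j
        by (auto simp: subspace_def matrix_vector_right_distrib vec_smult_scaleR vector_scalar_commute)
      have "?ker g k \<subseteq> ?ker h (Suc k)"
        by (auto simp only: hx mem_Collect_eq matrix_vector_mult_0_right)
      moreover have "x \<in> ?ker h (Suc k)" "x \<notin> ?ker g k"
        using x by (simp_all only: hx mem_Collect_eq matrix_vector_mult_diff_rdistrib mat_smult) simp_all
      ultimately have "?ker g k \<subset> ?ker h (Suc k)" by blast
      then have "dim (?ker g k) < dim (?ker h (Suc k))"
        using dim_psubset[of "?ker g k" "?ker h (Suc k)"]
        unfolding span_eq_iff[THEN iffD2, OF sub] by simp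
      moreover have "dim (?ker h (Suc k)) \<le> DIM(complex^'n)"
        by (rule dim_subset_UNIV)
      ultimately have "DIM(complex^'n) - dim (?ker h (Suc k)) < DIM(complex^'n) - dim (?ker g k)"
        by linarith
      moreover have "z \<in> eigenvalues A"
        using x by (auto simp: eigenvalues_def)
      then have "\<forall>j<Suc k. h j \<in> eigenvalues A"
        using less.prems by (auto simp: h_def less_Suc_eq)
      ultimately show ?thesis
        by (rule less.hyps)
    next
      case True
      with less.prems show ?thesis by blast
    qed
  qed
  show ?thesis using *[of 0] by simp
qed

lemma full_rank_right_inverse:
  fixes H :: "'a::field^'m^'n"
  assumes "rank H = CARD('n)"
  shows "\<exists>R. H ** R = mat 1"
  unfolding matrix_right_invertible_independent_rows
proof (intro allI impI)
  fix c and k :: 'n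
  assume c: "(\<Sum>i\<in>UNIV. c i *s row i H) = 0"
  let ?W = "(\<lambda>i. row i H) ` (UNIV - {k})"
  show "c k = 0"
  proof (rule ccontr)
    assume ck: "c k \<noteq> 0"
    have "c k *s row k H = - (\<Sum>i\<in>UNIV - {k}. c i *s row i H)"
      using c by (simp add: sum.remove[of _ k] add_eq_0_iff)
    also have "\<dots> \<in> vec.span ?W"
      by (intro vec.span_neg vec.span_sum vec.span_scale vec.span_base) auto
    finally have "inverse (c k) *s (c k *s row k H) \<in> vec.span ?W"
      by (rule vec.span_scale)
    then have "row k H \<in> vec.span ?W"
      using ck by (simp add: vector_smult_assoc)
    then have "row i H \<in> vec.span ?W" for i
      by (cases "i = k") (auto intro: vec.span_base)
    then have "rows H \<subseteq> vec.span ?W"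
      by (auto simp: rows_def)
    then have "vec.dim (rows H) \<le> card ?W"
      by (rule vec.dim_le_card) simp
    also have "\<dots> \<le> card (UNIV - {k})"
      by (rule card_image_le) simp
    also have "\<dots> < CARD('n)"
      by (simp add: card_Diff_singleton card_gt_0_iff)
    finally show False
      using assms by (simp add: row_rank_def_gen)
  qed
qed

text \<open>Full row rank of the Hautus matrix is a right inverse, cut into the blocks that belong to
\<open>z - A\<close> and to \<open>B\<close>.\<close>

lemma hautus_right_inverse:
  fixes A :: "complex^'n^'n" and B :: "complex^'l^'n"
  assumes "rank (hautus_matrix A B z) = CARD('n)"
  shows "\<exists>S T. (mat z - A) ** S + B ** T = mat 1"
proof -
  obtain R where R: "hautus_matrix A B z ** R = mat 1"
    using full_rank_right_inverse[OF assms] by blast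
  define S :: "complex^'n^'n" where "S = (\<chi> i j. R $ Inl i $ j)"
  define T :: "complex^'n^'l" where "T = (\<chi> i j. R $ Inr i $ j)"
  have "hautus_matrix A B z ** R = (mat z - A) ** S + B ** T"
    by (simp add: matrix_matrix_mult_def hautus_matrix_def S_def T_def vec_eq_iff
        UNIV_Plus_UNIV[symmetric] sum.Plus del: UNIV_Plus_UNIV)
  with R show ?thesis by metis
qed

text \<open>The right inverse for \<open>g\<^sub>d\<close> replaces the identity behind the product by \<open>(g\<^sub>d - A) S + B T\<close>: the
first part lengthens the product, the second adds a term to the sum. For an annihilating product
only the sum remains, which is the Kalman reachability condition in a factored form.\<close>

lemma hautus_reachability:
  fixes A :: "complex^'n^'n" and B :: "complex^'l^'n"
  assumes "\<And>z. z \<in> eigenvalues A \<Longrightarrow> rank (hautus_matrix A B z) = CARD('n)"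
    and "\<forall>j<d. g j \<in> eigenvalues A"
  shows "\<exists>X K. shifted_prod A g d ** X + (\<Sum>i<d. shifted_prod A g i ** B ** K i) = mat 1"
  using assms(2)
proof (induction d)
  case 0
  show ?case by (intro exI[of _ "mat 1"]) simp
next
  case (Suc d)
  then obtain X K where XK: "shifted_prod A g d ** X + (\<Sum>i<d. shifted_prod A g i ** B ** K i) = mat 1"
    by auto
  obtain S T where ST: "(mat (g d) - A) ** S + B ** T = mat 1"
    using hautus_right_inverse[of A B "g d"] assms(1) Suc.prems by auto
  define K' where "K' = K(d := T ** X)"
  have "shifted_prod A g d ** X = shifted_prod A g d ** (((mat (g d) - A) ** S + B ** T) ** X)"
    by (simp add: ST)
  also have "\<dots> = shifted_prod A g (Suc d) ** (S ** X) + shifted_prod A g d ** B ** (T ** X)"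
    by (simp add: matrix_add_ldistrib matrix_add_rdistrib matrix_mul_assoc)
  finally have "shifted_prod A g (Suc d) ** (S ** X) + (\<Sum>i<Suc d. shifted_prod A g i ** B ** K' i) = mat 1"
    using XK unfolding K'_def by (simp add: add.assoc add.commute add.left_commute)
  then show ?case by blast
qed

section \<open>Products of quadratic factors\<close>

text \<open>The polynomial \<open>(z\<^sup>2 + \<rho> \<nu>\<^sup>2 z + \<nu>\<^sup>4 + g) / \<nu>\<^sup>4\<close> with \<open>z\<close> replaced by the map \<open>D\<close> and \<open>g\<close> by the map
\<open>G\<close>. It is kept for arbitrary maps because it is needed twice: for coefficient sequences, with the
shift as \<open>D\<close>, and for states of a mode, with the generator as \<open>D\<close>. The normalisation
by \<open>\<nu>\<^sup>4\<close> makes the infinite product converge.\<close>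

definition qfactor :: "real \<Rightarrow> ('x \<Rightarrow> 'x) \<Rightarrow> ('x \<Rightarrow> 'x) \<Rightarrow> nat \<Rightarrow> 'x \<Rightarrow> 'x::real_vector" where
  "qfactor \<rho> D G \<nu> x = x + (1 / real \<nu> ^ 4) *\<^sub>R (G x + (\<rho> * real \<nu> ^ 2) *\<^sub>R D x + D (D x))"

primrec qfactors :: "real \<Rightarrow> ('x \<Rightarrow> 'x) \<Rightarrow> (nat \<Rightarrow> 'x \<Rightarrow> 'x) \<Rightarrow> nat \<Rightarrow> nat \<Rightarrow> 'x \<Rightarrow> 'x::real_vector" where
  "qfactors \<rho> D G \<nu> 0 x = x"
| "qfactors \<rho> D G \<nu> (Suc k) x = qfactor \<rho> D (G k) \<nu> (qfactors \<rho> D G \<nu> k x)"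

text \<open>The product of all factors up to \<open>K\<close> that belong to modes other than \<open>m\<close>.\<close>

primrec qproduct :: "real \<Rightarrow> ('x \<Rightarrow> 'x) \<Rightarrow> (nat \<Rightarrow> 'x \<Rightarrow> 'x) \<Rightarrow> nat \<Rightarrow> nat \<Rightarrow> nat \<Rightarrow> 'x \<Rightarrow> 'x::real_vector" where
  "qproduct \<rho> D G d m 0 x = x"
| "qproduct \<rho> D G d m (Suc K) x =
     (if Suc K = m then qproduct \<rho> D G d m K x else qfactors \<rho> D G (Suc K) d (qproduct \<rho> D G d m K x))"

text \<open>Bounds the distance of \<open>qfactor\<close> from the identity when \<open>D\<close> has size \<open>r\<close> and \<open>G\<close> has size \<open>c\<close>.\<close>

definition qweight :: "real \<Rightarrow> real \<Rightarrow> real \<Rightarrow> nat \<Rightarrow> real" where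
  "qweight \<rho> c r \<nu> = (c + \<rho> * real \<nu> ^ 2 * r + r ^ 2) / real \<nu> ^ 4"

lemma qweight_nonneg: "0 \<le> \<rho> \<Longrightarrow> 0 \<le> c \<Longrightarrow> 0 \<le> r \<Longrightarrow> 0 \<le> qweight \<rho> c r \<nu>"
  by (simp add: qweight_def)

lemma qweight_le:
  assumes "0 \<le> \<rho>" "0 \<le> c" "0 \<le> r" "1 \<le> \<nu>"
  shows "qweight \<rho> c r \<nu> \<le> (c + \<rho> * r + r ^ 2) / real \<nu> ^ 2"
proof -
  have 1: "1 \<le> real \<nu> ^ 2" using assms by simp
  have "c + \<rho> * real \<nu> ^ 2 * r + r ^ 2 \<le> (c + \<rho> * r + r ^ 2) * real \<nu> ^ 2"
    using mult_left_mono[OF 1, of c] mult_left_mono[OF 1, of "r ^ 2"] assms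
    by (simp add: algebra_simps)
  then have "qweight \<rho> c r \<nu> \<le> ((c + \<rho> * r + r ^ 2) * real \<nu> ^ 2) / real \<nu> ^ 4"
    unfolding qweight_def by (rule divide_right_mono) simp
  also have "\<dots> = (c + \<rho> * r + r ^ 2) / real \<nu> ^ 2"
    using assms by (simp add: power4_eq_xxxx power2_eq_square)
  finally show ?thesis .
qed

lemma one_plus_le_exp_powr:
  assumes "0 \<le> (y::real)"
  shows "1 + y \<le> exp (4 * y powr (3/4))"
proof (cases "y \<le> 1")
  case True
  have "y powr 1 \<le> y powr (3/4)"
    using assms True powr_mono'[of "3/4" 1 y] by simp
  then have "y \<le> 4 * y powr (3/4)" using assms by auto
  then show ?thesis using exp_ge_add_one_self[of "4 * y powr (3/4)"] by linarith
next
  case False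
  define s where "s = y powr (3/4)"
  have s1: "1 \<le> s" using False by (auto simp: s_def ge_one_powr_ge_zero)
  have "y powr 1 \<le> y powr (3/2)" using False by (intro powr_mono) auto
  also have "\<dots> = s ^ 2" using False by (simp add: s_def powr_powr flip: powr_numeral)
  finally have "y \<le> s ^ 2" using False by simp
  then have "1 + y \<le> 1 + 4 * s + (4 * s) ^ 2 / 2"
    using s1 zero_le_square[of s] unfolding power2_eq_square by (simp only: mult_ac)
  also have "\<dots> \<le> exp (4 * s)" using s1 by (intro exp_lower_Taylor_quadratic) auto
  finally show ?thesis by (simp add: s_def)
qed

text \<open>The exponent \<open>3/4\<close> leaves room on both sides: it exceeds the true order \<open>1/2\<close> of the product, so
that the powers \<open>\<nu>\<^sup>-\<^sup>3\<^sup>/\<^sup>2\<close> are summable, and it is small enough for functions of Gevrey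
order \<open>5/4 < 4/3\<close>.\<close>

lemma qweight_exp_bound:
  assumes "0 \<le> \<rho>" "0 \<le> c" "0 \<le> r" "1 \<le> \<nu>"
  shows "1 + qweight \<rho> c r \<nu> \<le> exp (8 * (1 + \<rho> + c) * (1 + r) powr (3/4) * real \<nu> powr (-3/2))"
proof -
  define C where "C = 1 + \<rho> + c"
  define y where "y = C * (1 + r) / real \<nu> ^ 2"
  have C: "1 \<le> C" "\<rho> \<le> C" "c \<le> C" using assms by (auto simp: C_def)
  have y0: "0 \<le> y" using C assms by (simp add: y_def)
  have "c + r ^ 2 \<le> C ^ 2 * (1 + r) ^ 2"
  proof -
    have "c \<le> C ^ 2" using C self_le_power[of C 2] by linarith
    moreover have "r ^ 2 \<le> C ^ 2 * r ^ 2" using C assms mult_right_mono[of 1 "C ^ 2" "r ^ 2"] by simp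
    moreover have "0 \<le> C ^ 2 * r" using assms by simp
    ultimately show ?thesis by (simp add: power2_eq_square algebra_simps)
  qed
  then have 1: "(c + r ^ 2) / real \<nu> ^ 4 \<le> y ^ 2"
    by (simp add: y_def power_divide power_mult_distrib divide_right_mono flip: power_mult)
  have "\<rho> * r \<le> 2 * (C * (1 + r))"
    using mult_mono[of \<rho> C r "1 + r"] mult_nonneg_nonneg[of C "1 + r"] C assms by linarith
  then have 2: "\<rho> * r / real \<nu> ^ 2 \<le> 2 * y"
    using divide_right_mono[of "\<rho> * r" "2 * (C * (1 + r))" "real \<nu> ^ 2"] by (simp add: y_def)
  have "1 + qweight \<rho> c r \<nu> = 1 + \<rho> * r / real \<nu> ^ 2 + (c + r ^ 2) / real \<nu> ^ 4"
    using assms by (simp add: qweight_def add_divide_distrib power4_eq_xxxx power2_eq_square)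
  also have "\<dots> \<le> (1 + y) ^ 2"
    using 1 2 by (simp add: power2_eq_square algebra_simps)
  also have "\<dots> \<le> exp (4 * y powr (3/4)) ^ 2"
    using one_plus_le_exp_powr[OF y0] y0 by (intro power_mono) auto
  also have "\<dots> = exp (8 * y powr (3/4))"
    by (simp flip: exp_of_nat_mult)
  also have "\<dots> \<le> exp (8 * (C * (1 + r) powr (3/4) * real \<nu> powr (-3/2)))"
  proof -
    have "y powr (3/4) = C powr (3/4) * (1 + r) powr (3/4) / (real \<nu> ^ 2) powr (3/4)"
      using C assms by (simp add: y_def powr_mult powr_divide)
    also have "(real \<nu> ^ 2) powr (3/4) = real \<nu> powr (3/2)"
      using assms by (simp add: powr_powr flip: powr_numeral)
    also have "C powr (3/4) \<le> C powr 1" using C by (intro powr_mono) auto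
    finally have "y powr (3/4) \<le> C * (1 + r) powr (3/4) / real \<nu> powr (3/2)"
      using C assms by (simp add: divide_right_mono mult_right_mono)
    then show ?thesis by (simp add: powr_minus_divide)
  qed
  finally show ?thesis by (simp only: C_def mult.assoc)
qed

lemma summable_powr_three_halves: "summable (\<lambda>n. real (Suc n) powr (-3/2))"
proof -
  have "summable (\<lambda>n. real n powr (-3/2))"
    by (subst summable_real_powr_iff) simp
  then show ?thesis by (subst summable_Suc_iff)
qed

definition zeta_three_halves :: real where "zeta_three_halves = (\<Sum>n. real (Suc n) powr (-3/2))"

lemma zeta_three_halves_ge: "(\<Sum>n<K. real (Suc n) powr (-3/2)) \<le> zeta_three_halves"
  unfolding zeta_three_halves_def by (intro sum_le_suminf summable_powr_three_halves) auto

lemma zeta_three_halves_ge_one: "1 \<le> zeta_three_halves"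
  using zeta_three_halves_ge[of 1] by simp

definition order_const :: "real \<Rightarrow> real \<Rightarrow> nat \<Rightarrow> real" where
  "order_const \<rho> c d = real d * (8 * (1 + \<rho> + c)) * zeta_three_halves"

lemma order_const_nonneg: "0 \<le> \<rho> \<Longrightarrow> 0 \<le> c \<Longrightarrow> 0 \<le> order_const \<rho> c d"
  using zeta_three_halves_ge_one by (simp add: order_const_def)

lemma qweight_prod_bound:
  assumes "0 \<le> \<rho>" "0 \<le> c" "0 \<le> r"
  shows "(\<Prod>\<nu><K. (1 + qweight \<rho> c r (Suc \<nu>)) ^ d) \<le> exp (order_const \<rho> c d * (1 + r) powr (3/4))"
proof -
  let ?b = "8 * (1 + \<rho> + c) * (1 + r) powr (3/4)"
  have "(\<Prod>\<nu><K. (1 + qweight \<rho> c r (Suc \<nu>)) ^ d) \<le> (\<Prod>\<nu><K. exp (?b * real (Suc \<nu>) powr (-3/2)) ^ d)"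
    using qweight_exp_bound[OF assms] qweight_nonneg[OF assms]
    by (intro prod_mono conjI power_mono zero_le_power add_nonneg_nonneg) (simp_all del: of_nat_Suc)
  also have "\<dots> = exp (\<Sum>\<nu><K. real d * (?b * real (Suc \<nu>) powr (-3/2)))"
    by (simp add: exp_sum exp_of_nat_mult)
  also have "(\<Sum>\<nu><K. real d * (?b * real (Suc \<nu>) powr (-3/2)))
      = real d * ?b * (\<Sum>\<nu><K. real (Suc \<nu>) powr (-3/2))"
    by (simp add: sum_distrib_left mult.assoc)
  also have "\<dots> \<le> real d * ?b * zeta_three_halves"
    using assms by (intro mult_left_mono zeta_three_halves_ge) auto
  finally show ?thesis by (simp add: order_const_def mult_ac)
qed

lemma qweight_single_bound:
  assumes "0 \<le> \<rho>" "0 \<le> c" "0 \<le> r" "1 \<le> \<nu>" "k \<le> d"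
  shows "(1 + qweight \<rho> c r \<nu>) ^ k \<le> exp (order_const \<rho> c d * (1 + r) powr (3/4))"
proof -
  let ?b = "8 * (1 + \<rho> + c) * (1 + r) powr (3/4)"
  have "(1 + qweight \<rho> c r \<nu>) ^ k \<le> exp (?b * real \<nu> powr (-3/2)) ^ k"
    using assms by (intro power_mono qweight_exp_bound) (auto simp: qweight_nonneg intro: add_nonneg_nonneg)
  also have "\<dots> = exp (real k * (?b * real \<nu> powr (-3/2)))"
    by (simp add: exp_of_nat_mult)
  also have "real k * (?b * real \<nu> powr (-3/2)) \<le> real d * (?b * zeta_three_halves)"
  proof (intro mult_mono)
    have "real \<nu> powr (-3/2) \<le> real \<nu> powr 0" using assms by (intro powr_mono) auto
    then show "real \<nu> powr (-3/2) \<le> zeta_three_halves" using zeta_three_halves_ge_one assms by simp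
  qed (use assms zeta_three_halves_ge_one in auto)
  finally show ?thesis by (simp add: order_const_def mult_ac)
qed

lemma summable_inverse_squares: "summable (\<lambda>k. 1 / real (Suc k) ^ 2)"
  using inverse_power_summable[of 2, where 'a = real] by (subst summable_Suc_iff) (simp add: inverse_eq_divide)

lemma qweight_summable:
  assumes "0 \<le> \<rho>" "0 \<le> c" "0 \<le> r"
  shows "summable (\<lambda>\<nu>. (1 + qweight \<rho> c r (Suc \<nu>)) ^ d - 1)"
proof -
  define b where "b = c + \<rho> * r + r ^ 2"
  have b: "0 \<le> b" using assms by (simp add: b_def)
  have *: "norm ((1 + qweight \<rho> c r (Suc \<nu>)) ^ d - 1) \<le> real d * b * exp (real d * b) * (1 / real (Suc \<nu>) ^ 2)" for \<nu>
  proof -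
    let ?w = "qweight \<rho> c r (Suc \<nu>)"
    have w: "0 \<le> ?w" "?w \<le> b * (1 / real (Suc \<nu>) ^ 2)"
      using qweight_nonneg[OF assms] qweight_le[OF assms, of "Suc \<nu>"] by (auto simp: b_def)
    have "b * (1 / real (Suc \<nu>) ^ 2) \<le> b * 1" using b by (intro mult_left_mono) auto
    then have majorant: "?w \<le> b" using w by linarith
    have "(1 + ?w) ^ d \<le> exp ?w ^ d"
      using w exp_ge_add_one_self[of ?w] by (intro power_mono) auto
    also have "\<dots> = exp (real d * ?w)" by (simp add: exp_of_nat_mult)
    finally have 1: "(1 + ?w) ^ d - 1 \<le> exp (real d * ?w) - 1" by simp
    let ?x = "real d * ?w"
    have "1 - ?x \<le> exp (- ?x)" using exp_ge_add_one_self[of "- ?x"] by simp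
    then have "exp ?x * (1 - ?x) \<le> exp ?x * exp (- ?x)" by (intro mult_left_mono) auto
    then have "exp ?x - 1 \<le> ?x * exp ?x" by (simp add: algebra_simps flip: exp_add)
    also have "\<dots> \<le> (real d * (b * (1 / real (Suc \<nu>) ^ 2))) * exp (real d * b)"
      using w majorant b by (intro mult_mono mult_left_mono) (auto intro!: mult_left_mono)
    finally have 2: "exp ?x - 1 \<le> real d * b * exp (real d * b) * (1 / real (Suc \<nu>) ^ 2)"
      by (simp add: mult_ac)
    have "1 \<le> (1 + ?w) ^ d" using w by (intro one_le_power) auto
    with 1 2 show ?thesis by simp
  qed
  have "summable (\<lambda>\<nu>. real d * b * exp (real d * b) * (1 / real (Suc \<nu>) ^ 2))"
    by (rule summable_mult[OF summable_inverse_squares])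
  then show ?thesis by (rule summable_comparison_test') (use * in blast)
qed

text \<open>\<open>P x b\<close> says that \<open>x\<close> has size at most \<open>b\<close>. A relation instead of a norm covers the norm of
states as well as the weighted sums of coefficient sequences, which may be infinite.\<close>

locale sized_module =
  fixes P :: "'x::real_vector \<Rightarrow> real \<Rightarrow> bool" and D :: "'x \<Rightarrow> 'x" and G :: "nat \<Rightarrow> 'x \<Rightarrow> 'x"
    and \<rho> r c :: real
  assumes P_D: "P x b \<Longrightarrow> P (D x) (r * b)"
    and P_G: "P x b \<Longrightarrow> P (G k x) (c * b)"
    and P_add: "P x b \<Longrightarrow> P y b' \<Longrightarrow> P (x + y) (b + b')"
    and P_scale: "P x b \<Longrightarrow> P (s *\<^sub>R x) (\<bar>s\<bar> * b)"
    and P_mono: "P x b \<Longrightarrow> b \<le> b' \<Longrightarrow> P x b'"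
    and P_nonneg: "P x b \<Longrightarrow> 0 \<le> b"
    and nonneg: "0 \<le> \<rho>" "0 \<le> r" "0 \<le> c"
begin

lemma qfactor_diff_sized:
  assumes "P x b"
  shows "P (qfactor \<rho> D (G k) \<nu> x - x) (qweight \<rho> c r \<nu> * b)"
proof -
  have "P ((1 / real \<nu> ^ 4) *\<^sub>R (G k x + (\<rho> * real \<nu> ^ 2) *\<^sub>R D x + D (D x)))
     (\<bar>1 / real \<nu> ^ 4\<bar> * (c * b + \<bar>\<rho> * real \<nu> ^ 2\<bar> * (r * b) + r * (r * b)))"
    by (intro P_scale P_add P_G P_D assms)
  moreover have "\<bar>1 / real \<nu> ^ 4\<bar> * (c * b + \<bar>\<rho> * real \<nu> ^ 2\<bar> * (r * b) + r * (r * b)) = qweight \<rho> c r \<nu> * b"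
    using nonneg by (simp add: qweight_def abs_mult field_simps power2_eq_square)
  ultimately show ?thesis by (simp add: qfactor_def)
qed

lemma qfactor_sized: "P x b \<Longrightarrow> P (qfactor \<rho> D (G k) \<nu> x) ((1 + qweight \<rho> c r \<nu>) * b)"
  using P_add[OF _ qfactor_diff_sized, of x b x b k \<nu>] by (simp add: distrib_right)

lemma qfactors_sized: "P x b \<Longrightarrow> P (qfactors \<rho> D G \<nu> k x) ((1 + qweight \<rho> c r \<nu>) ^ k * b)"
proof (induction k)
  case (Suc k)
  then show ?case using qfactor_sized[of "qfactors \<rho> D G \<nu> k x"] by (simp add: mult.assoc)
qed simp

lemma qfactors_diff_sized: "P x b \<Longrightarrow> P (qfactors \<rho> D G \<nu> k x - x) (((1 + qweight \<rho> c r \<nu>) ^ k - 1) * b)"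
proof (induction k)
  case 0
  then show ?case using P_scale[of x b 0] by simp
next
  case (Suc k)
  have "P ((qfactor \<rho> D (G k) \<nu> (qfactors \<rho> D G \<nu> k x) - qfactors \<rho> D G \<nu> k x) + (qfactors \<rho> D G \<nu> k x - x))
     (qweight \<rho> c r \<nu> * ((1 + qweight \<rho> c r \<nu>) ^ k * b) + ((1 + qweight \<rho> c r \<nu>) ^ k - 1) * b)"
    by (intro P_add qfactor_diff_sized qfactors_sized Suc)
  then show ?case by (simp add: algebra_simps)
qed

lemma qproduct_sized: "P x b \<Longrightarrow> P (qproduct \<rho> D G d m K x) ((\<Prod>\<nu><K. (1 + qweight \<rho> c r (Suc \<nu>)) ^ d) * b)"
proof (induction K)
  case (Suc K)
  let ?p = "\<Prod>\<nu><K. (1 + qweight \<rho> c r (Suc \<nu>)) ^ d"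
  have IH: "P (qproduct \<rho> D G d m K x) (?p * b)" using Suc by simp
  have w: "1 \<le> (1 + qweight \<rho> c r (Suc K)) ^ d"
    using qweight_nonneg[of \<rho> c r "Suc K"] nonneg by (intro one_le_power) auto
  show ?case
  proof (cases "Suc K = m")
    case True
    have "?p * b \<le> (1 + qweight \<rho> c r (Suc K)) ^ d * (?p * b)"
      using mult_right_mono[OF w P_nonneg[OF IH]] by simp
    moreover have "qproduct \<rho> D G d m (Suc K) x = qproduct \<rho> D G d m K x"
      by (subst qproduct.simps(2)) (use True in simp)
    ultimately show ?thesis using P_mono[OF IH] by (simp only: prod.lessThan_Suc mult_ac)
  next
    case False
    with qfactors_sized[OF IH, of "Suc K" d] show ?thesis by (simp add: mult_ac)
  qed
qed simp

lemma qproduct_bound: "P x b \<Longrightarrow> P (qproduct \<rho> D G d m K x) (exp (order_const \<rho> c d * (1 + r) powr (3/4)) * b)"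
  using P_mono[OF qproduct_sized mult_right_mono[OF qweight_prod_bound]] nonneg P_nonneg by blast

lemma qfactors_bound: "P x b \<Longrightarrow> 1 \<le> \<nu> \<Longrightarrow> k \<le> d \<Longrightarrow>
    P (qfactors \<rho> D G \<nu> k x) (exp (order_const \<rho> c d * (1 + r) powr (3/4)) * b)"
  using P_mono[OF qfactors_sized mult_right_mono[OF qweight_single_bound]] nonneg P_nonneg by blast

lemma qproduct_diff_bound:
  assumes "P x b"
  shows "P (qproduct \<rho> D G d m (Suc K) x - qproduct \<rho> D G d m K x)
     (((1 + qweight \<rho> c r (Suc K)) ^ d - 1) * (exp (order_const \<rho> c d * (1 + r) powr (3/4)) * b))"
proof (cases "Suc K = m")
  case True
  have "1 \<le> (1 + qweight \<rho> c r (Suc K)) ^ d"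
    using qweight_nonneg[of \<rho> c r "Suc K"] nonneg by (intro one_le_power) auto
  then have "0 \<le> ((1 + qweight \<rho> c r (Suc K)) ^ d - 1) * (exp (order_const \<rho> c d * (1 + r) powr (3/4)) * b)"
    using P_nonneg[OF assms] by simp
  with P_scale[OF assms, of 0] P_mono True show ?thesis by fastforce
next
  case False
  with qfactors_diff_sized[OF qproduct_bound[OF assms]] show ?thesis by simp
qed

end

text \<open>A map \<open>W\<close> that intertwines \<open>D\<close> with \<open>D'\<close> and \<open>G\<close> with \<open>G'\<close> intertwines all products built from
them. The moment map will be such a \<open>W\<close>; as it respects the operations only on
sequences of admissible growth, the invariant \<open>Q\<close> is carried along.\<close>

lemma qfactor_intertwine:
  assumes "\<And>x. Q x \<Longrightarrow> Q (D x)" "\<And>x. Q x \<Longrightarrow> Q (G x)"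
    "\<And>x y. Q x \<Longrightarrow> Q y \<Longrightarrow> Q (x + y)" "\<And>s x. Q x \<Longrightarrow> Q (s *\<^sub>R x)"
    "\<And>x y. Q x \<Longrightarrow> Q y \<Longrightarrow> W (x + y) = W x + W y" "\<And>s x. Q x \<Longrightarrow> W (s *\<^sub>R x) = s *\<^sub>R W x"
    "\<And>x. Q x \<Longrightarrow> W (D x) = D' (W x)" "\<And>x. Q x \<Longrightarrow> W (G x) = G' (W x)" "Q x"
  shows "Q (qfactor \<rho> D G \<nu> x) \<and> W (qfactor \<rho> D G \<nu> x) = qfactor \<rho> D' G' \<nu> (W x)"
  using assms by (simp add: qfactor_def)

lemma qfactors_intertwine:
  assumes "\<And>x. Q x \<Longrightarrow> Q (D x)" "\<And>k x. Q x \<Longrightarrow> Q (G k x)"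
    "\<And>x y. Q x \<Longrightarrow> Q y \<Longrightarrow> Q (x + y)" "\<And>s x. Q x \<Longrightarrow> Q (s *\<^sub>R x)"
    "\<And>x y. Q x \<Longrightarrow> Q y \<Longrightarrow> W (x + y) = W x + W y" "\<And>s x. Q x \<Longrightarrow> W (s *\<^sub>R x) = s *\<^sub>R W x"
    "\<And>x. Q x \<Longrightarrow> W (D x) = D' (W x)" "\<And>k x. Q x \<Longrightarrow> W (G k x) = G' k (W x)" "Q x"
  shows "Q (qfactors \<rho> D G \<nu> k x) \<and> W (qfactors \<rho> D G \<nu> k x) = qfactors \<rho> D' G' \<nu> k (W x)"
proof (induction k)
  case (Suc k)
  have "Q (qfactor \<rho> D (G k) \<nu> (qfactors \<rho> D G \<nu> k x)) \<and>
    W (qfactor \<rho> D (G k) \<nu> (qfactors \<rho> D G \<nu> k x)) = qfactor \<rho> D' (G' k) \<nu> (W (qfactors \<rho> D G \<nu> k x))"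
    by (rule qfactor_intertwine[of Q]) (use assms Suc in auto)
  with Suc show ?case by simp
qed (use assms in simp)

lemma qproduct_intertwine:
  assumes "\<And>x. Q x \<Longrightarrow> Q (D x)" "\<And>k x. Q x \<Longrightarrow> Q (G k x)"
    "\<And>x y. Q x \<Longrightarrow> Q y \<Longrightarrow> Q (x + y)" "\<And>s x. Q x \<Longrightarrow> Q (s *\<^sub>R x)"
    "\<And>x y. Q x \<Longrightarrow> Q y \<Longrightarrow> W (x + y) = W x + W y" "\<And>s x. Q x \<Longrightarrow> W (s *\<^sub>R x) = s *\<^sub>R W x"
    "\<And>x. Q x \<Longrightarrow> W (D x) = D' (W x)" "\<And>k x. Q x \<Longrightarrow> W (G k x) = G' k (W x)" "Q x"
  shows "Q (qproduct \<rho> D G d m K x) \<and> W (qproduct \<rho> D G d m K x) = qproduct \<rho> D' G' d m K (W x)"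
proof (induction K)
  case (Suc K)
  have "Q (qfactors \<rho> D G (Suc K) d (qproduct \<rho> D G d m K x)) \<and>
    W (qfactors \<rho> D G (Suc K) d (qproduct \<rho> D G d m K x)) = qfactors \<rho> D' G' (Suc K) d (W (qproduct \<rho> D G d m K x))"
    by (rule qfactors_intertwine[of Q]) (use assms Suc in auto)
  with Suc show ?case by simp
qed (use assms in simp)

lemma linear_qfactor: "linear D \<Longrightarrow> linear G \<Longrightarrow> linear (qfactor \<rho> D G \<nu>)"
  unfolding qfactor_def
  by (rule linearI) (simp_all add: linear_add linear_scale scaleR_add_right mult.commute)

lemma linear_qfactors: "linear D \<Longrightarrow> (\<And>k. linear (G k)) \<Longrightarrow> linear (qfactors \<rho> D G \<nu> k)"
proof (induction k)
  case 0
  have "qfactors \<rho> D G \<nu> 0 = (\<lambda>x. x)" by auto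
  then show ?case by (simp add: linear_ident)
next
  case (Suc k)
  then have "linear (qfactor \<rho> D (G k) \<nu> \<circ> qfactors \<rho> D G \<nu> k)"
    by (intro linear_compose linear_qfactor) auto
  then show ?case by (simp add: o_def)
qed

lemma linear_qproduct: "linear D \<Longrightarrow> (\<And>k. linear (G k)) \<Longrightarrow> linear (qproduct \<rho> D G d m K)"
proof (induction K)
  case 0
  have "qproduct \<rho> D G d m 0 = (\<lambda>x. x)" by auto
  then show ?case by (simp add: linear_ident)
next
  case (Suc K)
  then have "linear (qfactors \<rho> D G (Suc K) d \<circ> qproduct \<rho> D G d m K)"
    by (intro linear_compose linear_qfactors) auto
  moreover have "qproduct \<rho> D G d m (Suc K) =
      (if Suc K = m then qproduct \<rho> D G d m K else qfactors \<rho> D G (Suc K) d \<circ> qproduct \<rho> D G d m K)"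
    by auto
  ultimately show ?case using Suc by simp
qed

lemma qproduct_eq_zero:
  assumes "linear D" "\<And>k. linear (G k)" "\<And>x. qfactors \<rho> D G n d x = 0" "1 \<le> n" "n \<noteq> m" "n \<le> K"
  shows "qproduct \<rho> D G d m K x = 0"
  using \<open>n \<le> K\<close>
proof (induction K rule: dec_induct)
  case base
  obtain l where "n = Suc l" using assms(4) by (cases n) auto
  then show ?case using assms by simp
next
  case (step K)
  then show ?case
    using linear_0[OF linear_qfactors[of D G \<rho> "Suc K" d]] assms(1,2) by simp
qed

section \<open>Coefficient sequences\<close>

instantiation "fun" :: (type, real_vector) real_vector
begin

definition "scaleR s f = (\<lambda>x. s *\<^sub>R f x)"

instance
  by standard (auto simp: scaleR_fun_def plus_fun_def scaleR_add_right scaleR_add_left)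

end

definition shift :: "(nat \<Rightarrow> 'a::zero) \<Rightarrow> nat \<Rightarrow> 'a" where
  "shift a p = (case p of 0 \<Rightarrow> 0 | Suc q \<Rightarrow> a q)"

lemma shift_simps [simp]: "shift a 0 = 0" "shift a (Suc p) = a p"
  by (simp_all add: shift_def)

text \<open>The power series with coefficients \<open>a\<close> has a majorant of size \<open>B\<close> at radius \<open>r\<close>. Bounding all
partial sums makes the notion stable under coefficientwise limits.\<close>

definition majorant :: "real \<Rightarrow> (nat \<Rightarrow> 'a::real_normed_algebra_1) \<Rightarrow> real \<Rightarrow> bool" where
  "majorant r a B \<longleftrightarrow> (\<forall>K. (\<Sum>p<K. norm (a p) * r ^ p) \<le> B)"

lemma majorant_nonneg: "majorant r a B \<Longrightarrow> 0 \<le> B"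
  unfolding majorant_def by (metis lessThan_0 sum.empty)

lemma majorant_mono: "majorant r a B \<Longrightarrow> B \<le> B' \<Longrightarrow> majorant r a B'"
  unfolding majorant_def using order_trans by blast

lemma majorant_coeff:
  assumes "majorant r a B" "0 \<le> r"
  shows "norm (a p) * r ^ p \<le> B"
proof -
  have "norm (a p) * r ^ p \<le> (\<Sum>q<Suc p. norm (a q) * r ^ q)"
    using assms(2) by (intro member_le_sum) auto
  with assms(1) show ?thesis unfolding majorant_def using order_trans by blast
qed

lemma majorant_shift:
  assumes "majorant r a B" "0 \<le> r"
  shows "majorant r (shift a) (r * B)"
  unfolding majorant_def
proof
  fix K
  show "(\<Sum>p<K. norm (shift a p) * r ^ p) \<le> r * B"
  proof (cases K)
    case (Suc L)
    have "(\<Sum>p<K. norm (shift a p) * r ^ p) = r * (\<Sum>p<L. norm (a p) * r ^ p)"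
      unfolding Suc sum.lessThan_Suc_shift by (simp add: sum_distrib_left mult_ac)
    also have "\<dots> \<le> r * B" using assms unfolding majorant_def by (intro mult_left_mono) auto
    finally show ?thesis .
  qed (use mult_nonneg_nonneg[OF assms(2) majorant_nonneg[OF assms(1)]] in simp)
qed

lemma majorant_add:
  assumes "majorant r a B" "majorant r b B'" "0 \<le> r"
  shows "majorant r (a + b) (B + B')"
  unfolding majorant_def
proof
  fix K
  have "(\<Sum>p<K. norm ((a + b) p) * r ^ p) \<le> (\<Sum>p<K. norm (a p) * r ^ p + norm (b p) * r ^ p)"
    using assms(3) by (intro sum_mono) (auto simp: norm_triangle_ineq mult_right_mono simp flip: distrib_right)
  also have "\<dots> \<le> B + B'"
    using assms unfolding majorant_def by (simp add: sum.distrib add_mono)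
  finally show "(\<Sum>p<K. norm ((a + b) p) * r ^ p) \<le> B + B'" .
qed

lemma majorant_le_mult:
  assumes "majorant r a B" "0 \<le> r" "0 \<le> s" "\<And>p. norm (b p) \<le> s * norm (a p)"
  shows "majorant r b (s * B)"
  unfolding majorant_def
proof
  fix K
  have "(\<Sum>p<K. norm (b p) * r ^ p) \<le> (\<Sum>p<K. s * (norm (a p) * r ^ p))"
    using assms by (intro sum_mono) (auto simp: mult_right_mono simp flip: mult.assoc)
  also have "\<dots> = s * (\<Sum>p<K. norm (a p) * r ^ p)"
    by (simp add: sum_distrib_left)
  also have "\<dots> \<le> s * B" using assms unfolding majorant_def by (intro mult_left_mono) auto
  finally show "(\<Sum>p<K. norm (b p) * r ^ p) \<le> s * B" .
qed

lemma majorant_limit: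
  assumes "\<And>K. majorant r (a K) B" "\<And>p. (\<lambda>K. a K p) \<longlonglongrightarrow> b p"
  shows "majorant r b B"
  unfolding majorant_def
proof
  fix L
  have "(\<lambda>K. \<Sum>p<L. norm (a K p) * r ^ p) \<longlonglongrightarrow> (\<Sum>p<L. norm (b p) * r ^ p)"
    by (intro tendsto_intros assms)
  moreover have "\<forall>K. (\<Sum>p<L. norm (a K p) * r ^ p) \<le> B"
    using assms(1) unfolding majorant_def by blast
  ultimately show "(\<Sum>p<L. norm (b p) * r ^ p) \<le> B"
    by (meson LIMSEQ_le_const2)
qed

definition unit_seq :: "nat \<Rightarrow> 'a::zero_neq_one" where
  "unit_seq p = (if p = 0 then 1 else 0)"

lemma majorant_unit_seq: "majorant r (unit_seq :: nat \<Rightarrow> 'a::real_normed_algebra_1) 1"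
  unfolding majorant_def
proof
  fix K
  have "(\<Sum>p<K. norm (unit_seq p :: 'a) * r ^ p) = (\<Sum>p<K. if p = 0 then 1 else 0)"
    by (intro sum.cong) (auto simp: unit_seq_def)
  then show "(\<Sum>p<K. norm (unit_seq p :: 'a) * r ^ p) \<le> 1"
    by simp
qed

lemma sized_sequences:
  fixes g :: "nat \<Rightarrow> 'a::real_normed_algebra_1"
  assumes "0 \<le> \<rho>" "0 \<le> r" "\<And>k. norm (g k) \<le> c"
  shows "sized_module (\<lambda>a. majorant r a) shift (\<lambda>k a p. g k * a p) \<rho> r c"
proof
  show "0 \<le> c" using assms(3)[of 0] norm_ge_zero order_trans by blast
  moreover have "norm (g k * a p) \<le> c * norm (a p)" for k a and p :: nat
    using mult_right_mono[OF assms(3)[of k], of "norm (a p)"] norm_mult_ineq[of "g k" "a p"] by simp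
  ultimately show "majorant r (\<lambda>p. g k * a p) (c * b)" if "majorant r a b" for k a b
    using that assms by (intro majorant_le_mult[where a = a]) auto
  show "majorant r (s *\<^sub>R a) (\<bar>s\<bar> * b)" if "majorant r a b" for s b and a :: "nat \<Rightarrow> 'a"
    using that assms by (intro majorant_le_mult[where a = a]) (auto simp: scaleR_fun_def)
qed (use assms in \<open>auto intro: majorant_shift majorant_add majorant_mono majorant_nonneg\<close>)

text \<open>The coefficients belong to an entire function of order \<open>3/4\<close> and type at most \<open>C\<close>.\<close>

definition entire_bound :: "real \<Rightarrow> (nat \<Rightarrow> 'a::real_normed_algebra_1) \<Rightarrow> bool" where
  "entire_bound C a \<longleftrightarrow> (\<forall>r\<ge>0. majorant r a (exp (C * (1 + r) powr (3/4))))"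

lemma entire_bound_shift:
  assumes "entire_bound C a"
  shows "entire_bound (C + 4) (shift a)"
  unfolding entire_bound_def
proof (intro allI impI)
  fix r :: real assume r: "0 \<le> r"
  have "majorant r (shift a) (r * exp (C * (1 + r) powr (3/4)))"
    using assms r by (intro majorant_shift) (auto simp: entire_bound_def)
  moreover have "r \<le> exp (4 * (1 + r) powr (3/4))"
  proof -
    have "r \<le> exp (4 * r powr (3/4))" using one_plus_le_exp_powr[OF r] by linarith
    also have "\<dots> \<le> exp (4 * (1 + r) powr (3/4))" using r by (auto intro: powr_mono2)
    finally show ?thesis .
  qed
  then have "r * exp (C * (1 + r) powr (3/4)) \<le> exp ((C + 4) * (1 + r) powr (3/4))"
    by (simp add: distrib_right exp_add mult_right_mono mult.commute)
  ultimately show "majorant r (shift a) (exp ((C + 4) * (1 + r) powr (3/4)))"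
    by (rule majorant_mono)
qed

lemma entire_bound_mono: "entire_bound C a \<Longrightarrow> C \<le> C' \<Longrightarrow> entire_bound C' a"
  unfolding entire_bound_def
proof (intro allI impI)
  fix r :: real
  assume "\<forall>r\<ge>0. majorant r a (exp (C * (1 + r) powr (3/4)))" "C \<le> C'" "0 \<le> r"
  then show "majorant r a (exp (C' * (1 + r) powr (3/4)))"
    using majorant_mono[of r a "exp (C * (1 + r) powr (3/4))" "exp (C' * (1 + r) powr (3/4))"]
    by (simp add: mult_right_mono)
qed

lemma entire_bound_funpow_shift: "entire_bound C a \<Longrightarrow> entire_bound (C + 4 * real j) ((shift ^^ j) a)"
proof (induction j)
  case (Suc j)
  then show ?case using entire_bound_shift[of "C + 4 * real j" "(shift ^^ j) a"] by (simp add: algebra_simps)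
qed simp

lemma entire_bound_qproduct:
  assumes "0 \<le> \<rho>" "\<And>k. norm (g k :: 'a::real_normed_algebra_1) \<le> c"
  shows "entire_bound (order_const \<rho> c d) (qproduct \<rho> shift (\<lambda>k a p. g k * a p) d m K unit_seq)"
  unfolding entire_bound_def
proof (intro allI impI)
  fix r :: real assume "0 \<le> r"
  then interpret sized_module "\<lambda>a. majorant r a" shift "\<lambda>k a p. g k * a p" \<rho> r c
    using assms by (intro sized_sequences)
  show "majorant r (qproduct \<rho> shift (\<lambda>k a p. g k * a p) d m K unit_seq) (exp (order_const \<rho> c d * (1 + r) powr (3/4)))"
    using qproduct_bound[OF majorant_unit_seq] by simp
qed

lemma entire_bound_qfactors:
  assumes "0 \<le> \<rho>" "\<And>k. norm (g k :: 'a::real_normed_algebra_1) \<le> c" "entire_bound C a" "1 \<le> \<nu>" "k \<le> d"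
  shows "entire_bound (order_const \<rho> c d + C) (qfactors \<rho> shift (\<lambda>k a p. g k * a p) \<nu> k a)"
  unfolding entire_bound_def
proof (intro allI impI)
  fix r :: real assume r: "0 \<le> r"
  then interpret sized_module "\<lambda>a. majorant r a" shift "\<lambda>k a p. g k * a p" \<rho> r c
    using assms by (intro sized_sequences)
  show "majorant r (qfactors \<rho> shift (\<lambda>k a p. g k * a p) \<nu> k a) (exp ((order_const \<rho> c d + C) * (1 + r) powr (3/4)))"
    using qfactors_bound[of a _ \<nu> k d] assms r unfolding entire_bound_def by (simp add: distrib_right exp_add)
qed

lemma telescoping_converges:
  fixes x :: "nat \<Rightarrow> 'a::banach"
  assumes "\<And>K. norm (x (Suc K) - x K) \<le> b K" "summable b"
  shows "convergent x"
proof -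
  have "summable (\<lambda>K. x (Suc K) - x K)"
    by (rule summable_comparison_test'[OF assms(2)]) (use assms(1) in blast)
  then have "(\<lambda>n. x n - x 0) \<longlonglongrightarrow> (\<Sum>K. x (Suc K) - x K)"
    using summable_LIMSEQ by (fastforce simp: sum_lessThan_telescope)
  then have "(\<lambda>n. (x n - x 0) + x 0) \<longlonglongrightarrow> (\<Sum>K. x (Suc K) - x K) + x 0"
    by (intro tendsto_intros)
  then show ?thesis by (auto simp: convergent_def)
qed

text \<open>The Taylor coefficients of \<open>\<Phi>\<^sub>m\<close>: with the shift in the role of multiplication by the variable, the
product is applied to the coefficients of the constant function one.\<close>

definition qproduct_inf :: "real \<Rightarrow> (nat \<Rightarrow> 'a::{real_normed_algebra_1,banach}) \<Rightarrow> nat \<Rightarrow> nat \<Rightarrow> nat \<Rightarrow> 'a" where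
  "qproduct_inf \<rho> g d m p = lim (\<lambda>K. qproduct \<rho> shift (\<lambda>k a p. g k * a p) d m K unit_seq p)"

lemma qproduct_coeff_tendsto:
  assumes "0 \<le> \<rho>" "\<And>k. norm (g k :: 'a::{real_normed_algebra_1,banach}) \<le> c"
  shows "(\<lambda>K. qproduct \<rho> shift (\<lambda>k a p. g k * a p) d m K unit_seq p) \<longlonglongrightarrow> qproduct_inf \<rho> g d m p"
proof -
  interpret sized_module "\<lambda>a. majorant 1 a" shift "\<lambda>k a p. g k * a p" \<rho> 1 c
    using assms by (intro sized_sequences) auto
  let ?x = "\<lambda>K. qproduct \<rho> shift (\<lambda>k a p. g k * a p) d m K unit_seq"
  let ?e = "exp (order_const \<rho> c d * (1 + 1) powr (3/4))"
  have "majorant 1 (?x (Suc K) - ?x K) (((1 + qweight \<rho> c 1 (Suc K)) ^ d - 1) * (?e * 1))" for K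
    by (rule qproduct_diff_bound[OF majorant_unit_seq])
  from majorant_coeff[OF this, where p = p]
  have "norm (?x (Suc K) p - ?x K p) \<le> ((1 + qweight \<rho> c 1 (Suc K)) ^ d - 1) * ?e" for K
    by simp
  moreover have "summable (\<lambda>K. ((1 + qweight \<rho> c 1 (Suc K)) ^ d - 1) * ?e)"
    using nonneg by (intro summable_mult2 qweight_summable) auto
  ultimately have "convergent (\<lambda>K. ?x K p)"
    by (rule telescoping_converges)
  then show ?thesis unfolding qproduct_inf_def by (simp add: convergent_LIMSEQ_iff)
qed

lemma entire_bound_qproduct_inf:
  assumes "0 \<le> \<rho>" "\<And>k. norm (g k :: 'a::{real_normed_algebra_1,banach}) \<le> c"
  shows "entire_bound (order_const \<rho> c d) (qproduct_inf \<rho> g d m)"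
  unfolding entire_bound_def
proof (intro allI impI)
  fix r :: real assume r: "0 \<le> r"
  show "majorant r (qproduct_inf \<rho> g d m) (exp (order_const \<rho> c d * (1 + r) powr (3/4)))"
  proof (rule majorant_limit)
    show "majorant r (qproduct \<rho> shift (\<lambda>k a p. g k * a p) d m K unit_seq) (exp (order_const \<rho> c d * (1 + r) powr (3/4)))" for K
      using entire_bound_qproduct[where g = g and d = d and m = m and K = K, OF assms] r unfolding entire_bound_def by blast
  qed (rule qproduct_coeff_tendsto[OF assms])
qed

section \<open>Differential operators of infinite order\<close>

lemma has_vector_derivative_suminf:
  fixes f :: "nat \<Rightarrow> real \<Rightarrow> 'a::banach"
  assumes "convex S" "\<And>n t. t \<in> S \<Longrightarrow> (f n has_vector_derivative f' n t) (at t within S)"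
    and "\<And>n t. t \<in> S \<Longrightarrow> norm (f' n t) \<le> b n" "summable b"
    and "\<And>t. t \<in> S \<Longrightarrow> summable (\<lambda>n. f n t)" "t \<in> S"
  shows "((\<lambda>t. \<Sum>n. f n t) has_vector_derivative (\<Sum>n. f' n t)) (at t within S)"
proof -
  have ul: "uniform_limit S (\<lambda>n t. \<Sum>i<n. f' i t) (\<lambda>t. \<Sum>i. f' i t) sequentially"
    by (rule Weierstrass_m_test) (use assms in auto)
  have "\<exists>g. \<forall>x\<in>S. (\<lambda>n. f n x) sums (g x) \<and>
      (g has_derivative (\<lambda>h. h *\<^sub>R (\<Sum>i. f' i x))) (at x within S)"
  proof (rule has_derivative_series[OF assms(1), where f' = "\<lambda>n x h. h *\<^sub>R f' n x"])
    show "(f n has_derivative (\<lambda>h. h *\<^sub>R f' n x)) (at x within S)" if "x \<in> S" for n x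
      using assms(2)[OF that] by (simp add: has_vector_derivative_def)
    show "\<forall>\<^sub>F n in sequentially. \<forall>x\<in>S. \<forall>h.
        norm ((\<Sum>i<n. h *\<^sub>R f' i x) - h *\<^sub>R (\<Sum>i. f' i x)) \<le> e * norm h" if "e > 0" for e
      using uniform_limitD[OF ul that]
    proof eventually_elim
      case (elim n)
      show ?case
      proof (intro ballI allI)
        fix x h assume x: "x \<in> S"
        have "norm ((\<Sum>i<n. h *\<^sub>R f' i x) - h *\<^sub>R (\<Sum>i. f' i x))
            = norm h * dist (\<Sum>i<n. f' i x) (\<Sum>i. f' i x)"
          by (simp add: dist_norm flip: scaleR_sum_right scaleR_diff_right)
        also have "\<dots> \<le> norm h * e" using elim x by (intro mult_left_mono) auto
        finally show "norm ((\<Sum>i<n. h *\<^sub>R f' i x) - h *\<^sub>R (\<Sum>i. f' i x)) \<le> e * norm h"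
          by (simp add: mult.commute)
      qed
    qed
    show "(\<lambda>n. f n t) sums (\<Sum>n. f n t)" using assms(5,6) by (simp add: summable_sums)
  qed (fact assms(6))
  then obtain g where *: "\<forall>x\<in>S. (\<lambda>n. f n x) sums (g x) \<and>
      (g has_derivative (\<lambda>h. h *\<^sub>R (\<Sum>i. f' i x))) (at x within S)" ..
  then have g: "\<And>x. x \<in> S \<Longrightarrow> (\<lambda>n. f n x) sums (g x)"
    "(g has_derivative (\<lambda>h. h *\<^sub>R (\<Sum>i. f' i t))) (at t within S)"
    using assms(6) by auto
  have "((\<lambda>t. \<Sum>n. f n t) has_derivative (\<lambda>h. h *\<^sub>R (\<Sum>i. f' i t))) (at t within S)"
    by (rule has_derivative_transform[OF assms(6) _ g(2)]) (use sums_unique[OF g(1)] in simp)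
  then show ?thesis by (simp add: has_vector_derivative_def)
qed

text \<open>The \<open>p\<close>-th derivative of \<open>\<kappa>(t) exp (t M)\<close> by Leibniz' rule, with \<open>\<kappa> k\<close> as the \<open>k\<close>-th derivative of
\<open>\<kappa>\<close>.\<close>

definition leibniz :: "(nat \<Rightarrow> real \<Rightarrow> real) \<Rightarrow> 'a::{real_normed_algebra_1,banach} \<Rightarrow> nat \<Rightarrow> real \<Rightarrow> 'a" where
  "leibniz \<kappa> M p t = (\<Sum>k\<le>p. (real (p choose k) * \<kappa> k t) *\<^sub>R (M ^ (p - k) * exp (t *\<^sub>R M)))"

lemma pascal_sum:
  fixes h :: "nat \<Rightarrow> 'a::real_vector"
  shows "(\<Sum>k\<le>p. real (p choose k) *\<^sub>R (h (Suc k) + h k)) = (\<Sum>k\<le>Suc p. real (Suc p choose k) *\<^sub>R h k)"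
proof -
  have "(\<Sum>k\<le>p. real (p choose k) *\<^sub>R h k) = (\<Sum>k\<le>Suc p. real (p choose k) *\<^sub>R h k)"
    by simp
  also have "\<dots> = h 0 + (\<Sum>k\<le>p. real (p choose Suc k) *\<^sub>R h (Suc k))"
    by (subst sum.atMost_Suc_shift) simp
  finally have 1: "(\<Sum>k\<le>p. real (p choose k) *\<^sub>R h k) = h 0 + (\<Sum>k\<le>p. real (p choose Suc k) *\<^sub>R h (Suc k))" .
  have "(\<Sum>k\<le>Suc p. real (Suc p choose k) *\<^sub>R h k) = h 0 + (\<Sum>k\<le>p. real (Suc p choose Suc k) *\<^sub>R h (Suc k))"
    by (subst sum.atMost_Suc_shift) simp
  with 1 show ?thesis by (simp add: scaleR_add_right scaleR_add_left sum.distrib)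
qed

lemma leibniz_deriv:
  assumes "\<And>k t. (\<kappa> k has_real_derivative \<kappa> (Suc k) t) (at t)"
  shows "(leibniz \<kappa> M p has_vector_derivative leibniz \<kappa> M (Suc p) t) (at t)"
proof -
  let ?h = "\<lambda>k. \<kappa> k t *\<^sub>R (M ^ (Suc p - k) * exp (t *\<^sub>R M))"
  have "((\<lambda>t. (real (p choose k) * \<kappa> k t) *\<^sub>R (M ^ (p - k) * exp (t *\<^sub>R M)))
     has_vector_derivative real (p choose k) *\<^sub>R (?h (Suc k) + ?h k)) (at t)" if "k \<le> p" for k
  proof -
    have "((\<lambda>t. exp (t *\<^sub>R M)) has_vector_derivative M * exp (t *\<^sub>R M)) (at t)"
      by (rule exp_scaleR_has_vector_derivative_left)
    then have 1: "((\<lambda>t. M ^ (p - k) * exp (t *\<^sub>R M)) has_vector_derivative M ^ (p - k) * (M * exp (t *\<^sub>R M))) (at t)"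
      by (rule has_vector_derivative_mult_right)
    have "M ^ (p - k) * (M * exp (t *\<^sub>R M)) = M ^ (Suc p - k) * exp (t *\<^sub>R M)"
      using that by (simp add: Suc_diff_le power_commutes flip: mult.assoc)
    with has_vector_derivative_scaleR[OF assms 1, of k]
    have "((\<lambda>t. \<kappa> k t *\<^sub>R (M ^ (p - k) * exp (t *\<^sub>R M))) has_vector_derivative (?h (Suc k) + ?h k)) (at t)"
      by (simp add: add.commute)
    then have "((\<lambda>t. real (p choose k) *\<^sub>R (\<kappa> k t *\<^sub>R (M ^ (p - k) * exp (t *\<^sub>R M))))
       has_vector_derivative real (p choose k) *\<^sub>R (?h (Suc k) + ?h k)) (at t)"
      by (rule bounded_linear.has_vector_derivative[OF bounded_linear_scaleR_right])
    then show ?thesis by simp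
  qed
  then have "((\<lambda>t. \<Sum>k\<le>p. (real (p choose k) * \<kappa> k t) *\<^sub>R (M ^ (p - k) * exp (t *\<^sub>R M)))
     has_vector_derivative (\<Sum>k\<le>p. real (p choose k) *\<^sub>R (?h (Suc k) + ?h k))) (at t)"
    by (intro has_vector_derivative_sum) auto
  then show ?thesis
    unfolding pascal_sum[of p ?h] leibniz_def[abs_def] by (simp only: scaleR_scaleR)
qed

lemma leibniz_eq_0: "(\<And>k. \<kappa> k t = 0) \<Longrightarrow> leibniz \<kappa> M p t = 0"
  by (simp add: leibniz_def)

text \<open>A function together with all its derivatives, of Gevrey order \<open>5/4\<close>: the factor
\<open>(k+1)\<^sup>5\<^sup>k\<^sup>/\<^sup>4\<close> stands for \<open>(k!)\<^sup>5\<^sup>/\<^sup>4\<close>.\<close>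

definition gevrey :: "(nat \<Rightarrow> real \<Rightarrow> real) \<Rightarrow> real \<Rightarrow> real \<Rightarrow> bool" where
  "gevrey \<kappa> G R \<longleftrightarrow> 0 \<le> G \<and> 1 \<le> R \<and> (\<forall>k t. \<bar>\<kappa> k t\<bar> \<le> G * R ^ k * (real (Suc k) powr (5/4)) ^ k)
     \<and> (\<forall>k t. (\<kappa> k has_real_derivative \<kappa> (Suc k) t) (at t))"

text \<open>Bounds the \<open>p\<close>-th derivative of \<open>\<kappa>(t) exp (t M)\<close> relative to the exponential, for \<open>norm M \<le> \<mu>\<close>. The
two summands separate the derivatives of the bump from those of the exponential.\<close>

definition gevrey_weight :: "real \<Rightarrow> real \<Rightarrow> real \<Rightarrow> nat \<Rightarrow> real" where
  "gevrey_weight G R \<mu> p = G * ((2 * R) ^ p * (real (Suc p) powr (5/4)) ^ p + (2 * R * \<mu>) ^ p)"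

lemma add_power_le: "0 \<le> x \<Longrightarrow> 0 \<le> y \<Longrightarrow> (x + y) ^ p \<le> 2 ^ p * (x ^ p + (y::real) ^ p)"
proof -
  assume xy: "0 \<le> x" "0 \<le> y"
  have "(x + y) ^ p \<le> (2 * max x y) ^ p" using xy by (intro power_mono) auto
  also have "\<dots> \<le> 2 ^ p * (x ^ p + y ^ p)"
    using xy by (auto simp: power_mult_distrib max_def)
  finally show ?thesis .
qed

lemma norm_leibniz:
  assumes "gevrey \<kappa> G R" "norm M \<le> \<mu>"
  shows "norm (leibniz \<kappa> M p t) \<le> gevrey_weight G R \<mu> p * norm (exp (t *\<^sub>R M))"
proof -
  let ?z = "norm (exp (t *\<^sub>R M))"
  define X where "X = real (Suc p) powr (5/4)"
  have G: "0 \<le> G" "1 \<le> R" "\<And>k. \<bar>\<kappa> k t\<bar> \<le> G * R ^ k * (real (Suc k) powr (5/4)) ^ k"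
    using assms by (auto simp: gevrey_def)
  have mu: "0 \<le> \<mu>" using assms(2) norm_ge_zero order_trans by blast
  have X0: "0 \<le> X" by (simp add: X_def)
  have "norm (leibniz \<kappa> M p t) \<le> (\<Sum>k\<le>p. norm ((real (p choose k) * \<kappa> k t) *\<^sub>R (M ^ (p - k) * exp (t *\<^sub>R M))))"
    unfolding leibniz_def by (rule norm_sum)
  also have "\<dots> \<le> (\<Sum>k\<le>p. real (p choose k) * (G * R ^ p * X ^ k) * (\<mu> ^ (p - k) * ?z))"
  proof (rule sum_mono)
    fix k assume "k \<in> {..p}"
    then have k: "k \<le> p" by simp
    have "R ^ k \<le> R ^ p" using G k by (intro power_increasing) auto
    moreover have "(real (Suc k) powr (5/4)) ^ k \<le> X ^ k"
      using k by (auto simp: X_def intro!: power_mono powr_mono2)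
    ultimately have "G * R ^ k * (real (Suc k) powr (5/4)) ^ k \<le> G * R ^ p * X ^ k"
      using G X0 by (intro mult_mono) (auto intro: mult_left_mono)
    with G(3)[of k] have 1: "\<bar>\<kappa> k t\<bar> \<le> G * R ^ p * X ^ k" by linarith
    have "norm (M ^ (p - k) * exp (t *\<^sub>R M)) \<le> norm M ^ (p - k) * ?z"
      by (intro order_trans[OF norm_mult_ineq] mult_right_mono norm_power_ineq) auto
    also have "\<dots> \<le> \<mu> ^ (p - k) * ?z" using assms(2) by (intro mult_right_mono power_mono) auto
    finally have 2: "norm (M ^ (p - k) * exp (t *\<^sub>R M)) \<le> \<mu> ^ (p - k) * ?z" .
    show "norm ((real (p choose k) * \<kappa> k t) *\<^sub>R (M ^ (p - k) * exp (t *\<^sub>R M)))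
       \<le> real (p choose k) * (G * R ^ p * X ^ k) * (\<mu> ^ (p - k) * ?z)"
      unfolding norm_scaleR abs_mult
      using 1 2 G X0 by (intro mult_mono mult_nonneg_nonneg) auto
  qed
  also have "\<dots> = G * R ^ p * (\<Sum>k\<le>p. real (p choose k) * X ^ k * \<mu> ^ (p - k)) * ?z"
    by (simp add: sum_distrib_left sum_distrib_right mult_ac)
  also have "(\<Sum>k\<le>p. real (p choose k) * X ^ k * \<mu> ^ (p - k)) = (X + \<mu>) ^ p"
    by (simp add: binomial_ring)
  also have "G * R ^ p * (X + \<mu>) ^ p * ?z \<le> G * R ^ p * (2 ^ p * (X ^ p + \<mu> ^ p)) * ?z"
    using G X0 mu by (intro mult_right_mono mult_left_mono add_power_le) auto
  also have "\<dots> = gevrey_weight G R \<mu> p * ?z"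
    by (simp add: gevrey_weight_def X_def power_mult_distrib algebra_simps)
  finally show ?thesis .
qed

definition cauchy_radius :: "nat \<Rightarrow> real" where "cauchy_radius p = real (Suc p) powr (4/3)"

definition cauchy_bound :: "real \<Rightarrow> nat \<Rightarrow> real" where
  "cauchy_bound C p = exp (C * (1 + cauchy_radius p) powr (3/4)) / cauchy_radius p ^ p"

definition gevrey_term :: "real \<Rightarrow> real \<Rightarrow> nat \<Rightarrow> real" where
  "gevrey_term C R p = cauchy_bound C p * ((2 * R) ^ p * (real (Suc p) powr (5/4)) ^ p)"

lemma cauchy_radius_ge_1: "1 \<le> cauchy_radius p"
  by (simp add: cauchy_radius_def ge_one_powr_ge_zero)

text \<open>Cauchy's estimate on the circle of radius \<open>(p+1)\<^sup>4\<^sup>/\<^sup>3\<close>, which is nearly optimal for order \<open>3/4\<close>.\<close>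

lemma entire_bound_coeff:
  assumes "entire_bound C a"
  shows "norm (a p) \<le> cauchy_bound C p"
proof -
  have "norm (a p) * cauchy_radius p ^ p \<le> exp (C * (1 + cauchy_radius p) powr (3/4))"
    using assms cauchy_radius_ge_1[of p] by (intro majorant_coeff) (auto simp: entire_bound_def)
  then show ?thesis using cauchy_radius_ge_1[of p] by (simp add: cauchy_bound_def pos_le_divide_eq)
qed

text \<open>The coefficients decay like \<open>p\<^sup>-\<^sup>4\<^sup>p\<^sup>/\<^sup>3\<close> and the derivatives grow like \<open>p\<^sup>5\<^sup>p\<^sup>/\<^sup>4\<close>, up to geometric
factors: the order \<open>3/4\<close> of the product and the Gevrey order \<open>5/4\<close> fit together because \<open>5/4 < 4/3\<close>.\<close>

lemma summable_gevrey_term: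
  assumes "0 \<le> C" "0 \<le> R"
  shows "summable (gevrey_term C R)"
proof (rule summable_comparison_test_ev)
  define L where "L = 2 * R * exp (2 * C)"
  have "((\<lambda>p. L * real (Suc p) powr (-1/12)) \<longlongrightarrow> L * 0) sequentially"
    by (intro tendsto_intros tendsto_neg_powr filterlim_compose[OF filterlim_real_sequentially filterlim_Suc]) auto
  then have "\<forall>\<^sub>F p in sequentially. L * real (Suc p) powr (-1/12) < 1/2"
    by (rule order_tendstoD) simp
  then show "\<forall>\<^sub>F p in sequentially. norm (gevrey_term C R p) \<le> exp (2 * C) * (1/2) ^ p"
  proof eventually_elim
    case (elim p)
    let ?q = "real (Suc p)"
    have r1: "1 \<le> cauchy_radius p" by (rule cauchy_radius_ge_1)
    have "(1 + cauchy_radius p) powr (3/4) \<le> (2 * cauchy_radius p) powr (3/4)"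
      using r1 by (intro powr_mono2) auto
    also have "\<dots> = 2 powr (3/4) * cauchy_radius p powr (3/4)" using r1 by (simp add: powr_mult)
    also have "cauchy_radius p powr (3/4) = ?q" by (simp add: cauchy_radius_def powr_powr)
    also have "2 powr (3/4) * ?q \<le> 2 powr 1 * ?q" by (intro mult_right_mono powr_mono) auto
    finally have "C * (1 + cauchy_radius p) powr (3/4) \<le> C * (2 * ?q)" using assms by (intro mult_left_mono) auto
    then have "exp (C * (1 + cauchy_radius p) powr (3/4)) \<le> exp (2 * C + real p * (2 * C))"
      by (simp add: algebra_simps)
    also have "\<dots> = exp (2 * C) * exp (2 * C) ^ p"
      by (simp only: exp_add exp_of_nat_mult)
    finally have e: "exp (C * (1 + cauchy_radius p) powr (3/4)) \<le> exp (2 * C) * exp (2 * C) ^ p" .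
    have "gevrey_term C R p = exp (C * (1 + cauchy_radius p) powr (3/4)) * (2 * R * (?q powr (5/4) / cauchy_radius p)) ^ p"
      by (simp add: gevrey_term_def cauchy_bound_def power_mult_distrib power_divide)
    also have "?q powr (5/4) / cauchy_radius p = ?q powr (-1/12)"
      by (simp add: cauchy_radius_def flip: powr_diff)
    also have "exp (C * (1 + cauchy_radius p) powr (3/4)) * (2 * R * ?q powr (-1/12)) ^ p
        \<le> exp (2 * C) * exp (2 * C) ^ p * (2 * R * ?q powr (-1/12)) ^ p"
      using assms by (intro mult_right_mono e) auto
    also have "\<dots> = exp (2 * C) * (L * ?q powr (-1/12)) ^ p"
      by (simp add: L_def power_mult_distrib mult_ac)
    also have "\<dots> \<le> exp (2 * C) * (1/2) ^ p"
      using elim assms by (intro mult_left_mono power_mono) (auto simp: L_def)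
    finally show ?case
      using assms by (simp add: gevrey_term_def cauchy_bound_def cauchy_radius_def)
  qed
  show "summable (\<lambda>p. exp (2 * C) * (1/2) ^ p :: real)"
    by (intro summable_mult summable_geometric) simp
qed

lemma majorant_summable:
  assumes "majorant r a B" "0 \<le> r"
  shows "summable (\<lambda>p. norm (a p) * r ^ p)" "(\<Sum>p. norm (a p) * r ^ p) \<le> B"
proof -
  show "summable (\<lambda>p. norm (a p) * r ^ p)"
  proof (rule bounded_imp_summable[where B = B])
    show "(\<Sum>k\<le>n. norm (a k) * r ^ k) \<le> B" for n
      using assms(1) unfolding majorant_def lessThan_Suc_atMost[symmetric] by blast
  qed (use assms in auto)
  then show "(\<Sum>p. norm (a p) * r ^ p) \<le> B"
    using assms by (intro suminf_le_const) (auto simp: majorant_def)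
qed

definition gevrey_bound :: "real \<Rightarrow> real \<Rightarrow> real \<Rightarrow> real \<Rightarrow> real" where
  "gevrey_bound C G R \<mu> = G * ((\<Sum>p. gevrey_term C R p) + exp (C * (1 + 2 * R * \<mu>) powr (3/4)))"

lemma entire_bound_weighted_sum:
  assumes "entire_bound C a" "0 \<le> C" "0 \<le> G" "0 \<le> R" "0 \<le> \<mu>"
  shows "summable (\<lambda>p. norm (a p) * gevrey_weight G R \<mu> p)" "(\<Sum>p. norm (a p) * gevrey_weight G R \<mu> p) \<le> gevrey_bound C G R \<mu>"
proof -
  let ?x = "\<lambda>p. norm (a p) * ((2 * R) ^ p * (real (Suc p) powr (5/4)) ^ p)"
  let ?y = "\<lambda>p. norm (a p) * (2 * R * \<mu>) ^ p"
  have x: "?x p \<le> gevrey_term C R p" for p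
    unfolding gevrey_term_def using entire_bound_coeff[OF assms(1), of p] assms by (intro mult_right_mono) auto
  have sx: "summable ?x"
    by (rule summable_comparison_test'[OF summable_gevrey_term[OF assms(2,4)], of 0]) (use x assms in auto)
  have w: "majorant (2 * R * \<mu>) a (exp (C * (1 + 2 * R * \<mu>) powr (3/4)))"
    using assms by (auto simp: entire_bound_def)
  have sy: "summable ?y" "suminf ?y \<le> exp (C * (1 + 2 * R * \<mu>) powr (3/4))"
    using majorant_summable[OF w] assms by auto
  have eq: "(\<lambda>p. norm (a p) * gevrey_weight G R \<mu> p) = (\<lambda>p. G * (?x p + ?y p))"
    by (auto simp: gevrey_weight_def algebra_simps)
  show "summable (\<lambda>p. norm (a p) * gevrey_weight G R \<mu> p)"
    unfolding eq by (intro summable_mult summable_add sx sy)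
  have "(\<Sum>p. norm (a p) * gevrey_weight G R \<mu> p) = G * (suminf ?x + suminf ?y)"
    unfolding eq suminf_add[OF sx sy(1)] by (rule suminf_mult) (intro summable_add sx sy)
  also have "\<dots> \<le> gevrey_bound C G R \<mu>"
    unfolding gevrey_bound_def using x sx sy summable_gevrey_term[OF assms(2,4)] assms
    by (intro mult_left_mono add_mono suminf_le) auto
  finally show "(\<Sum>p. norm (a p) * gevrey_weight G R \<mu> p) \<le> gevrey_bound C G R \<mu>" .
qed

lemma gevrey_weight_nonneg: "0 \<le> G \<Longrightarrow> 0 \<le> R \<Longrightarrow> 0 \<le> \<mu> \<Longrightarrow> 0 \<le> gevrey_weight G R \<mu> p"
  by (simp add: gevrey_weight_def)

text \<open>The differential operator of infinite order with symbol \<open>\<Sum> a\<^sub>p z\<^sup>p\<close>, applied to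
\<open>\<kappa>(t) exp (t M)\<close>.\<close>

definition gevrey_series :: "(nat \<Rightarrow> real \<Rightarrow> real) \<Rightarrow> 'a::{real_normed_algebra_1,banach} \<Rightarrow> (nat \<Rightarrow> 'a) \<Rightarrow> real \<Rightarrow> 'a" where
  "gevrey_series \<kappa> M a t = (\<Sum>p. a p * leibniz \<kappa> M p t)"

lemma gevrey_series_eq_0: "(\<And>k. \<kappa> k t = 0) \<Longrightarrow> gevrey_series \<kappa> M a t = 0"
  by (simp add: gevrey_series_def leibniz_eq_0)

locale gevrey_family =
  fixes \<kappa> :: "nat \<Rightarrow> real \<Rightarrow> real" and M :: "'a::{real_normed_algebra_1,banach}" and G R :: real
  assumes gevrey: "gevrey \<kappa> G R"
begin

abbreviation "\<mu> \<equiv> norm M"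

lemma GR: "0 \<le> G" "0 \<le> R" using gevrey by (auto simp: gevrey_def)

lemma norm_gevrey_series_term:
  "norm (a p * leibniz \<kappa> M p t) \<le> norm (a p) * gevrey_weight G R \<mu> p * norm (exp (t *\<^sub>R M))"
  using order_trans[OF norm_mult_ineq mult_left_mono[OF norm_leibniz[OF gevrey order_refl], of "norm (a p)"]]
  by (simp add: mult.assoc)

lemma gevrey_series_summable:
  assumes "entire_bound C a" "0 \<le> C"
  shows "summable (\<lambda>p. a p * leibniz \<kappa> M p t)"
  by (rule summable_comparison_test'[OF summable_mult2[OF entire_bound_weighted_sum(1)[OF assms GR norm_ge_zero]], of 0])
    (rule norm_gevrey_series_term)

text \<open>The dependence on \<open>M\<close> matters: \<open>gevrey_bound\<close> grows only like \<open>exp (C \<mu>\<^sup>3\<^sup>/\<^sup>4)\<close>, hence like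
\<open>exp (C m\<^sup>3\<^sup>/\<^sup>2)\<close> for the generator of mode \<open>m\<close>, whose norm is of order \<open>m\<^sup>2\<close>.\<close>

lemma norm_gevrey_series:
  assumes "entire_bound C a" "0 \<le> C"
  shows "norm (gevrey_series \<kappa> M a t) \<le> gevrey_bound C G R \<mu> * norm (exp (t *\<^sub>R M))"
proof -
  note s = entire_bound_weighted_sum[OF assms GR norm_ge_zero[of M]]
  have "norm (gevrey_series \<kappa> M a t) \<le> (\<Sum>p. norm (a p) * gevrey_weight G R \<mu> p * norm (exp (t *\<^sub>R M)))"
    unfolding gevrey_series_def by (rule norm_suminf_le[OF norm_gevrey_series_term]) (rule summable_mult2[OF s(1)])
  also have "\<dots> = (\<Sum>p. norm (a p) * gevrey_weight G R \<mu> p) * norm (exp (t *\<^sub>R M))"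
    by (rule suminf_mult2[OF s(1), symmetric])
  also have "\<dots> \<le> gevrey_bound C G R \<mu> * norm (exp (t *\<^sub>R M))"
    by (intro mult_right_mono s) auto
  finally show ?thesis .
qed

lemma exp_bounded_on: "t \<in> {0..T} \<Longrightarrow> norm (exp (t *\<^sub>R M)) \<le> exp (T * \<mu>)"
  by (rule order_trans[OF norm_exp]) (auto intro: mult_right_mono)

lemma gevrey_series_has_derivative:
  assumes "entire_bound C a" "0 \<le> C" "t \<in> {0..T}"
  shows "(gevrey_series \<kappa> M a has_vector_derivative gevrey_series \<kappa> M (shift a) t) (at t within {0..T})"
proof -
  let ?f = "\<lambda>p t. a p * leibniz \<kappa> M p t" and ?f' = "\<lambda>p t. a p * leibniz \<kappa> M (Suc p) t"
  have entire_bound': "entire_bound (C + 4) (shift a)" using entire_bound_shift[OF assms(1)] .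
  have C': "0 \<le> C + 4" using assms by simp
  define b where "b p = norm (shift a p) * gevrey_weight G R \<mu> p * exp (T * \<mu>)" for p
  have "summable b"
    unfolding b_def by (rule summable_mult2[OF entire_bound_weighted_sum(1)[OF entire_bound' C' GR norm_ge_zero]])
  then have sb: "summable (\<lambda>p. b (Suc p))"
    by (simp only: summable_Suc_iff)
  have "((\<lambda>t. \<Sum>p. ?f p t) has_vector_derivative (\<Sum>p. ?f' p t)) (at t within {0..T})"
  proof (rule has_vector_derivative_suminf[where b = "\<lambda>p. b (Suc p)"])
    show "(?f p has_vector_derivative ?f' p t) (at t within {0..T})" for p t
      using gevrey unfolding gevrey_def
      by (intro has_vector_derivative_at_within[OF has_vector_derivative_mult_right[OF leibniz_deriv]]) auto
    show "norm (?f' p t) \<le> b (Suc p)" if "t \<in> {0..T}" for p t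
    proof -
      have "norm (?f' p t) \<le> norm (a p) * gevrey_weight G R \<mu> (Suc p) * norm (exp (t *\<^sub>R M))"
        using norm_gevrey_series_term[of "shift a" "Suc p" t] by simp
      also have "\<dots> \<le> b (Suc p)"
        unfolding b_def shift_simps
        by (intro mult_left_mono mult_nonneg_nonneg exp_bounded_on[OF that] gevrey_weight_nonneg[OF GR] norm_ge_zero)
      finally show ?thesis .
    qed
    show "summable (\<lambda>n. ?f n t)" for t by (rule gevrey_series_summable[OF assms(1,2)])
  qed (use sb assms(3) in \<open>simp_all\<close>)
  moreover have "(\<Sum>p. ?f' p t) = gevrey_series \<kappa> M (shift a) t"
    using suminf_split_head[OF gevrey_series_summable[OF entire_bound' C', of t]] by (simp add: gevrey_series_def)
  ultimately show ?thesis by (simp add: gevrey_series_def[abs_def])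
qed

lemma gevrey_series_continuous: "entire_bound C a \<Longrightarrow> 0 \<le> C \<Longrightarrow> continuous_on {0..T} (gevrey_series \<kappa> M a)"
  by (rule continuous_on_vector_derivative) (rule gevrey_series_has_derivative)

lemma gevrey_series_uniform_limit:
  assumes "\<And>K. entire_bound C (a K)" "entire_bound C b" "0 \<le> C" "\<And>p. (\<lambda>K. a K p) \<longlonglongrightarrow> b p"
  shows "uniform_limit {0..T} (\<lambda>K. gevrey_series \<kappa> M (a K)) (gevrey_series \<kappa> M b) sequentially"
proof (rule uniform_limitI)
  fix e :: real assume e: "e > 0"
  let ?g = "\<lambda>p. 2 * (cauchy_bound C p * gevrey_weight G R \<mu> p)"
  have cf0: "0 \<le> cauchy_bound C p" for p using cauchy_radius_ge_1[of p] by (simp add: cauchy_bound_def)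
  let ?d = "\<lambda>K. \<Sum>p. norm (a K p - b p) * gevrey_weight G R \<mu> p"
  have w0: "0 \<le> gevrey_weight G R \<mu> p" for p using gevrey_weight_nonneg[OF GR norm_ge_zero] .
  have sm: "summable (\<lambda>p. norm (a K p - b p) * gevrey_weight G R \<mu> p)" for K
    by (rule summable_comparison_test'[OF summable_add[OF entire_bound_weighted_sum(1)[OF assms(1)[of K] assms(3) GR norm_ge_zero[of M]]
          entire_bound_weighted_sum(1)[OF assms(2,3) GR norm_ge_zero[of M]]], of 0])
      (simp add: w0 norm_triangle_ineq4 mult_right_mono flip: distrib_right)
  have g0: "0 \<le> gevrey_term C R' p" if "0 \<le> R'" for R' p
    using that cf0 by (simp add: gevrey_term_def)
  have sg: "summable ?g"
  proof (rule summable_comparison_test')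
    let ?h = "\<lambda>p. 2 * (G * (gevrey_term C R p + gevrey_term C (R * \<mu>) p))"
    show "summable ?h"
      using assms(3) GR by (intro summable_mult summable_add summable_gevrey_term) auto
    show "norm (?g p) \<le> ?h p" for p
    proof -
      have "1 \<le> (real (Suc p) powr (5/4)) ^ p"
        by (intro one_le_power ge_one_powr_ge_zero) auto
      then have "cauchy_bound C p * (2 * R * \<mu>) ^ p * 1 \<le> cauchy_bound C p * (2 * R * \<mu>) ^ p * (real (Suc p) powr (5/4)) ^ p"
        using cf0 GR by (intro mult_left_mono) auto
      also have "\<dots> = gevrey_term C (R * \<mu>) p" by (simp add: gevrey_term_def mult_ac)
      finally have "cauchy_bound C p * gevrey_weight G R \<mu> p \<le> G * (gevrey_term C R p + gevrey_term C (R * \<mu>) p)"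
        using GR by (simp add: gevrey_weight_def gevrey_term_def distrib_left mult.left_commute[of "cauchy_bound C p"] mult_left_mono)
      then show ?thesis using cf0[of p] w0[of p] by simp
    qed
  qed
  have "((\<lambda>K. \<Sum>p. norm (a K p - b p) * gevrey_weight G R \<mu> p) \<longlongrightarrow> (\<Sum>p. 0)) sequentially"
  proof (intro tannerys_theorem[THEN conjunct2, THEN conjunct2] sg)
    show "((\<lambda>K. norm (a K p - b p) * gevrey_weight G R \<mu> p) \<longlongrightarrow> 0) sequentially" for p
      using assms(4)[of p] by (intro tendsto_mult_left_zero tendsto_norm_zero) (simp add: LIM_zero)
    have "norm (norm (a K p - b p) * gevrey_weight G R \<mu> p) \<le> ?g p" for p K
      using mult_right_mono[OF order_trans[OF norm_triangle_ineq4 add_mono[OF entire_bound_coeff[OF assms(1)[of K], of p] entire_bound_coeff[OF assms(2), of p]]] w0[of p]]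
        w0[of p] by simp
    then show "\<forall>\<^sub>F (p, K) in sequentially \<times>\<^sub>F sequentially. norm (norm (a K p - b p) * gevrey_weight G R \<mu> p) \<le> ?g p"
      by (intro always_eventually) auto
  qed (use sg in simp_all)
  then have "?d \<longlonglongrightarrow> 0" by simp
  then have "(\<lambda>K. ?d K * exp (T * \<mu>)) \<longlonglongrightarrow> 0 * exp (T * \<mu>)"
    by (intro tendsto_intros)
  then have "\<forall>\<^sub>F K in sequentially. ?d K * exp (T * \<mu>) < e"
    using e by (intro order_tendstoD) auto
  then show "\<forall>\<^sub>F K in sequentially. \<forall>t\<in>{0..T}. dist (gevrey_series \<kappa> M (a K) t) (gevrey_series \<kappa> M b t) < e"
  proof eventually_elim
    case (elim K)
    show ?case
    proof
      fix t assume t: "t \<in> {0..T}"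
      have "gevrey_series \<kappa> M (a K) t - gevrey_series \<kappa> M b t = (\<Sum>p. (a K p - b p) * leibniz \<kappa> M p t)"
        unfolding gevrey_series_def left_diff_distrib
        by (rule suminf_diff[OF gevrey_series_summable[OF assms(1,3)] gevrey_series_summable[OF assms(2,3)]])
      also have "norm \<dots> \<le> (\<Sum>p. norm (a K p - b p) * gevrey_weight G R \<mu> p * norm (exp (t *\<^sub>R M)))"
        by (rule norm_suminf_le[OF norm_gevrey_series_term[of "\<lambda>p. a K p - b p"]]) (rule summable_mult2[OF sm])
      also have "\<dots> = ?d K * norm (exp (t *\<^sub>R M))" by (rule suminf_mult2[OF sm, symmetric])
      also have "\<dots> \<le> ?d K * exp (T * \<mu>)"
        using exp_bounded_on[OF t] by (intro mult_left_mono suminf_nonneg sm) (auto simp: w0)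
      finally show "dist (gevrey_series \<kappa> M (a K) t) (gevrey_series \<kappa> M b t) < e"
        using elim by (simp add: dist_norm)
    qed
  qed
qed

end

section \<open>A Gevrey function with compact support\<close>

definition antiderivative :: "(real \<Rightarrow> real) \<Rightarrow> real \<Rightarrow> real" where
  "antiderivative u = (SOME F. \<forall>x. (F has_real_derivative u x) (at x))"

lemma antiderivative:
  assumes "continuous_on UNIV u"
  shows "(antiderivative u has_real_derivative u x) (at x)"
proof -
  have "\<exists>F. \<forall>x::real. (-\<infinity>::ereal) < x \<longrightarrow> x < (\<infinity>::ereal) \<longrightarrow> (F has_vector_derivative u x) (at x)"
    using assms by (intro einterval_antiderivative) (auto simp: continuous_on_eq_continuous_at)
  then have "\<exists>F. \<forall>x. (F has_real_derivative u x) (at x)"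
    by (auto simp: has_real_derivative_iff_has_vector_derivative)
  from someI_ex[OF this] show ?thesis unfolding antiderivative_def by blast
qed

text \<open>The mean of \<open>u\<close> over the window from \<open>t - d\<close> to \<open>t\<close>. Writing it with an antiderivative makes its
derivative a difference quotient of \<open>u\<close>.\<close>

definition avg :: "real \<Rightarrow> (real \<Rightarrow> real) \<Rightarrow> real \<Rightarrow> real" where
  "avg d u t = (antiderivative u t - antiderivative u (t - d)) / d"

definition nonexpansive :: "(real \<Rightarrow> real) \<Rightarrow> bool" where
  "nonexpansive u \<longleftrightarrow> (\<forall>s t. \<bar>u s - u t\<bar> \<le> \<bar>s - t\<bar>)"

lemma nonexpansive_continuous: "nonexpansive u \<Longrightarrow> continuous_on UNIV u"
  unfolding continuous_on_iff nonexpansive_def dist_real_def by (meson le_less_trans)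

lemma mean_value_real:
  assumes "\<And>x. (F has_real_derivative f x) (at x)" "0 < d"
  shows "\<exists>z. t - d < z \<and> z < t \<and> F t - F (t - d) = d * f z"
proof -
  have "\<exists>z>t - d. z < t \<and> F t - F (t - d) = (t - (t - d)) * f z"
    using assms by (intro MVT2) auto
  then show ?thesis by auto
qed

lemma avg_value:
  assumes "nonexpansive u" "0 < d"
  shows "\<exists>z. t - d < z \<and> z < t \<and> avg d u t = u z"
proof -
  obtain z where "t - d < z" "z < t" "antiderivative u t - antiderivative u (t - d) = d * u z"
    using mean_value_real[OF antiderivative[OF nonexpansive_continuous[OF assms(1)]] assms(2)] by blast
  then show ?thesis using assms(2) by (intro exI[of _ z]) (simp add: avg_def)
qed

lemma avg_diff_le:
  assumes "nonexpansive u" "nonexpansive v" "0 < d" "\<And>x. \<bar>u x - v x\<bar> \<le> e"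
  shows "\<bar>avg d u t - avg d v t\<bar> \<le> e"
proof -
  have "((\<lambda>x. antiderivative u x - antiderivative v x) has_real_derivative u x - v x) (at x)" for x
    by (intro derivative_intros antiderivative nonexpansive_continuous assms)
  from mean_value_real[OF this assms(3), of t] obtain z where
    "antiderivative u t - antiderivative v t - (antiderivative u (t - d) - antiderivative v (t - d)) = d * (u z - v z)" by blast
  then have "avg d u t - avg d v t = u z - v z"
    using assms(3) by (simp add: avg_def diff_divide_distrib[symmetric] field_simps)
  then show ?thesis using assms(4) by simp
qed

lemma nonexpansive_avg:
  assumes "nonexpansive u" "0 < d"
  shows "nonexpansive (avg d u)"
  unfolding nonexpansive_def
proof (intro allI)
  fix s t
  let ?F = "antiderivative u"
  have "((\<lambda>x. ?F x - ?F (x + (t - s))) has_real_derivative u x - u (x + (t - s))) (at x)" for x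
  proof -
    have "(?F has_real_derivative u (x + (t - s))) (at (x + (t - s)))"
      by (intro antiderivative nonexpansive_continuous assms)
    then have "((\<lambda>x. ?F (x + (t - s))) has_real_derivative u (x + (t - s))) (at x)"
      by (simp only: DERIV_shift)
    then show ?thesis by (intro DERIV_diff antiderivative nonexpansive_continuous assms)
  qed
  from mean_value_real[OF this assms(2), of s] obtain z where
    z: "?F s - ?F t - (?F (s - d) - ?F (s - d + (t - s))) = d * (u z - u (z + (t - s)))" by auto
  have "s - d + (t - s) = t - d" by simp
  with z have "avg d u s - avg d u t = u z - u (z + (t - s))"
    using assms(2) by (simp add: avg_def diff_divide_distrib[symmetric] field_simps)
  also have "\<bar>\<dots>\<bar> \<le> \<bar>z - (z + (t - s))\<bar>" using assms(1) unfolding nonexpansive_def by blast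
  finally show "\<bar>avg d u s - avg d u t\<bar> \<le> \<bar>s - t\<bar>" by (simp add: abs_minus_commute)
qed

lemma avg_close:
  assumes "nonexpansive u" "0 < d"
  shows "\<bar>avg d u t - u t\<bar> \<le> d"
proof -
  obtain z where "t - d < z" "z < t" "avg d u t = u z" using avg_value[OF assms] by blast
  moreover have "\<bar>u z - u t\<bar> \<le> \<bar>z - t\<bar>" using assms unfolding nonexpansive_def by blast
  ultimately show ?thesis by simp
qed

definition diff_quot :: "real \<Rightarrow> (real \<Rightarrow> real) \<Rightarrow> real \<Rightarrow> real" where
  "diff_quot d u t = (u t - u (t - d)) / d"

lemma avg_deriv:
  assumes "nonexpansive u"
  shows "(avg d u has_real_derivative diff_quot d u t) (at t)"
proof -
  have "(antiderivative u has_real_derivative u (t + (- d))) (at (t + (- d)))"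
    by (intro antiderivative nonexpansive_continuous assms)
  then have "((\<lambda>x. antiderivative u (x + (- d))) has_real_derivative u (t + (- d))) (at t)"
    by (simp only: DERIV_shift)
  then have "((\<lambda>t. (antiderivative u t - antiderivative u (t - d)) / d) has_real_derivative (u t - u (t - d)) / d) (at t)"
    by (intro DERIV_cdivide DERIV_diff antiderivative nonexpansive_continuous assms) simp_all
  then show ?thesis by (simp add: avg_def[abs_def] diff_quot_def)
qed

text \<open>Averages over windows of widths \<open>\<delta>\<^sub>p, \<delta>\<^sub>p\<^sub>+\<^sub>1, \<dots>\<close>. The index \<open>p\<close> allows to strip off the outermost
averages one by one, and each of them pays for one derivative.\<close>

primrec iterated_avg :: "(nat \<Rightarrow> real) \<Rightarrow> (real \<Rightarrow> real) \<Rightarrow> nat \<Rightarrow> nat \<Rightarrow> real \<Rightarrow> real" where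
  "iterated_avg \<delta> w p 0 = w"
| "iterated_avg \<delta> w p (Suc K) = avg (\<delta> p) (iterated_avg \<delta> w (Suc p) K)"

primrec diff_quots :: "(nat \<Rightarrow> real) \<Rightarrow> nat \<Rightarrow> (real \<Rightarrow> real) \<Rightarrow> real \<Rightarrow> real" where
  "diff_quots \<delta> 0 u = u"
| "diff_quots \<delta> (Suc k) u = diff_quots \<delta> k (diff_quot (\<delta> k) u)"

lemma diff_quots_deriv:
  "(\<And>t. (u has_real_derivative u' t) (at t)) \<Longrightarrow> (diff_quots \<delta> k u has_real_derivative diff_quots \<delta> k u' t) (at t)"
proof (induction k arbitrary: u u' t)
  case (Suc k)
  have "(diff_quot (\<delta> k) u has_real_derivative diff_quot (\<delta> k) u' t) (at t)" for t
  proof -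
    have "(u has_real_derivative u' (t + (- \<delta> k))) (at (t + (- \<delta> k)))" by (rule Suc.prems)
    then have "((\<lambda>x. u (x + (- \<delta> k))) has_real_derivative u' (t + (- \<delta> k))) (at t)"
      by (simp only: DERIV_shift)
    then have "((\<lambda>t. (u t - u (t - \<delta> k)) / \<delta> k) has_real_derivative (u' t - u' (t - \<delta> k)) / \<delta> k) (at t)"
      by (intro DERIV_cdivide DERIV_diff Suc.prems) simp_all
    then show ?thesis by (simp add: diff_quot_def[abs_def])
  qed
  then show ?case using Suc.IH by simp
qed simp

lemma diff_quots_bound:
  assumes "\<And>j. 0 < \<delta> j" "\<And>t. \<bar>u t\<bar> \<le> b"
  shows "\<bar>diff_quots \<delta> k u t\<bar> \<le> (\<Prod>j<k. 2 / \<delta> j) * b"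
  using assms(2)
proof (induction k arbitrary: u b t)
  case (Suc k)
  have "\<bar>diff_quot (\<delta> k) u t\<bar> \<le> 2 / \<delta> k * b" for t
    using Suc.prems[of t] Suc.prems[of "t - \<delta> k"] assms(1)[of k] by (simp add: diff_quot_def field_simps)
  from Suc.IH[OF this] show ?case by (simp add: mult_ac)
qed simp

locale averaging =
  fixes \<delta> :: "nat \<Rightarrow> real" and w :: "real \<Rightarrow> real"
  assumes pos: "\<And>j. 0 < \<delta> j" and summ: "summable \<delta>" and nonexpansive_w: "nonexpansive w"
begin

abbreviation V where "V \<equiv> iterated_avg \<delta> w"

lemma nonexpansive_V: "nonexpansive (V p K)"
  by (induction K arbitrary: p) (simp_all add: nonexpansive_w nonexpansive_avg pos)

text \<open>The two functions differ only in the innermost average, which moves the profile by at most its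
width; the outer averages do not increase the distance.\<close>

lemma V_step: "\<bar>V p (Suc K) t - V p K t\<bar> \<le> \<delta> (p + K)"
proof (induction K arbitrary: p t)
  case 0
  then show ?case using avg_close[OF nonexpansive_w pos] by simp
next
  case (Suc K)
  have "\<bar>avg (\<delta> p) (V (Suc p) (Suc K)) t - avg (\<delta> p) (V (Suc p) K) t\<bar> \<le> \<delta> (Suc p + K)"
    by (intro avg_diff_le nonexpansive_V pos Suc.IH)
  then show ?case by simp
qed

definition W :: "nat \<Rightarrow> real \<Rightarrow> real" where "W p t = lim (\<lambda>K. V p K t)"

lemma summ_shift: "summable (\<lambda>K. \<delta> (p + K))"
  using summ by (simp add: add.commute summable_iff_shift)

lemma V_tendsto: "(\<lambda>K. V p K t) \<longlonglongrightarrow> W p t"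
proof -
  have "convergent (\<lambda>K. V p K t)"
    by (rule telescoping_converges[OF _ summ_shift[of p]]) (use V_step[of p _ t] in simp)
  then show ?thesis by (simp add: W_def convergent_LIMSEQ_iff)
qed

definition tail :: "nat \<Rightarrow> real" where "tail p = (\<Sum>j. \<delta> (p + j))"

lemma tail_sum: "(\<Sum>j<K. \<delta> (p + j)) \<le> tail p"
  unfolding tail_def by (intro sum_le_suminf summ_shift) (auto intro: less_imp_le pos)

lemma W_close: "\<bar>W p t - V p K t\<bar> \<le> tail (p + K)"
proof -
  have "\<bar>V p (K + L) t - V p K t\<bar> \<le> (\<Sum>j<L. \<delta> (p + K + j))" for L
  proof (induction L)
    case (Suc L)
    have "\<bar>V p (Suc (K + L)) t - V p (K + L) t\<bar> \<le> \<delta> (p + (K + L))" by (rule V_step)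
    then show ?case using Suc by (simp add: add.assoc)
  qed simp
  then have *: "\<bar>V p (L + K) t - V p K t\<bar> \<le> tail (p + K)" for L
    using tail_sum order_trans by (metis add.commute)
  have "(\<lambda>L. \<bar>V p (L + K) t - V p K t\<bar>) \<longlonglongrightarrow> \<bar>W p t - V p K t\<bar>"
    by (intro tendsto_intros LIMSEQ_ignore_initial_segment V_tendsto)
  then show ?thesis by (rule LIMSEQ_le_const2) (use * in auto)
qed

lemma tail_tendsto: "tail \<longlonglongrightarrow> 0"
  using suminf_exist_split2[OF summ] by (simp add: tail_def[abs_def] add.commute)

lemma nonexpansive_W: "nonexpansive (W p)"
  unfolding nonexpansive_def
proof (intro allI)
  fix s t
  have "(\<lambda>K. \<bar>V p K s - V p K t\<bar>) \<longlonglongrightarrow> \<bar>W p s - W p t\<bar>"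
    by (intro tendsto_intros V_tendsto)
  then show "\<bar>W p s - W p t\<bar> \<le> \<bar>s - t\<bar>"
    by (rule LIMSEQ_le_const2) (use nonexpansive_V in \<open>auto simp: nonexpansive_def\<close>)
qed

lemma W_avg: "W p = avg (\<delta> p) (W (Suc p))"
proof
  fix t
  have "\<bar>V p (Suc K) t - avg (\<delta> p) (W (Suc p)) t\<bar> \<le> tail (Suc p + K)" for K
    unfolding iterated_avg.simps
    by (intro avg_diff_le nonexpansive_V nonexpansive_W pos) (use W_close[of "Suc p" _ K] in \<open>simp add: abs_minus_commute\<close>)
  moreover have "(\<lambda>K. tail (K + Suc p)) \<longlonglongrightarrow> 0"
    by (rule LIMSEQ_ignore_initial_segment[OF tail_tendsto])
  ultimately have "(\<lambda>K. V p (Suc K) t - avg (\<delta> p) (W (Suc p)) t) \<longlonglongrightarrow> 0"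
    using Lim_null_comparison[of "\<lambda>K. V p (Suc K) t - avg (\<delta> p) (W (Suc p)) t" "\<lambda>K. tail (K + Suc p)" sequentially]
    by (simp add: add.commute)
  then have "(\<lambda>K. V p (Suc K) t) \<longlonglongrightarrow> avg (\<delta> p) (W (Suc p)) t"
    by (rule LIM_zero_cancel)
  moreover have "(\<lambda>K. V p (Suc K) t) \<longlonglongrightarrow> W p t"
    using V_tendsto[of p t] by (rule LIMSEQ_Suc)
  ultimately show "W p t = avg (\<delta> p) (W (Suc p)) t"
    using LIMSEQ_unique by blast
qed

text \<open>The \<open>k\<close>-th derivative of the limit \<open>W 0\<close>: each differentiation turns an average into a difference
quotient of the next \<open>W\<close>.\<close>

definition kap :: "nat \<Rightarrow> real \<Rightarrow> real" where "kap k = diff_quots \<delta> k (W k)"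

lemma kap_deriv: "(kap k has_real_derivative kap (Suc k) t) (at t)"
proof -
  have "(W k has_real_derivative diff_quot (\<delta> k) (W (Suc k)) t) (at t)" for t
    unfolding W_avg[of k] by (rule avg_deriv[OF nonexpansive_W])
  then show ?thesis unfolding kap_def diff_quots.simps by (rule diff_quots_deriv)
qed

lemma V_nonneg: "(\<And>x. 0 \<le> w x) \<Longrightarrow> 0 \<le> V p K t"
proof (induction K arbitrary: p t)
  case (Suc K)
  obtain z where "avg (\<delta> p) (V (Suc p) K) t = V (Suc p) K z"
    using avg_value[OF nonexpansive_V pos] by blast
  then show ?case using Suc by simp
qed simp

lemma V_bound: "(\<And>x. \<bar>w x\<bar> \<le> h) \<Longrightarrow> \<bar>V p K t\<bar> \<le> h"
proof (induction K arbitrary: p t)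
  case (Suc K)
  obtain z where "avg (\<delta> p) (V (Suc p) K) t = V (Suc p) K z"
    using avg_value[OF nonexpansive_V pos] by blast
  then show ?case using Suc by simp
qed simp

lemma V_support:
  assumes "\<And>x. x \<le> a \<or> b \<le> x \<Longrightarrow> w x = 0"
  shows "t \<le> a \<or> b + (\<Sum>j<K. \<delta> (p + j)) \<le> t \<Longrightarrow> V p K t = 0"
proof (induction K arbitrary: p t)
  case (Suc K)
  obtain z where z: "t - \<delta> p < z" "z < t" "avg (\<delta> p) (V (Suc p) K) t = V (Suc p) K z"
    using avg_value[OF nonexpansive_V pos] by blast
  have "(\<Sum>j<Suc K. \<delta> (p + j)) = \<delta> p + (\<Sum>j<K. \<delta> (Suc p + j))"
    by (subst sum.lessThan_Suc_shift) simp
  with z(1,2) Suc.prems have "z \<le> a \<or> b + (\<Sum>j<K. \<delta> (Suc p + j)) \<le> z" by auto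
  with Suc.IH z(3) show ?case by simp
qed (use assms in simp)

lemma W_nonneg: "(\<And>x. 0 \<le> w x) \<Longrightarrow> 0 \<le> W p t"
  by (rule LIMSEQ_le_const[OF V_tendsto]) (use V_nonneg in auto)

lemma W_bound: "(\<And>x. \<bar>w x\<bar> \<le> h) \<Longrightarrow> \<bar>W p t\<bar> \<le> h"
  by (rule LIMSEQ_le_const2[OF tendsto_rabs[OF V_tendsto]]) (use V_bound in auto)

lemma W_support:
  assumes "\<And>x. x \<le> a \<or> b \<le> x \<Longrightarrow> w x = 0" "t \<le> a \<or> b + tail 0 \<le> t"
  shows "W 0 t = 0"
proof -
  have "V 0 K t = 0" for K
    using V_support[OF assms(1), where t = t and K = K and p = 0] assms(2) tail_sum[of 0 K] by force
  then have "(\<lambda>K. 0) \<longlonglongrightarrow> W 0 t" using V_tendsto[of 0 t] by simp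
  then show ?thesis by (simp add: LIMSEQ_const_iff)
qed

lemma kap_support:
  assumes "\<And>x. x \<le> a \<or> b \<le> x \<Longrightarrow> w x = 0" "t < a \<or> b + tail 0 < t"
  shows "kap k t = 0"
  using assms(2)
proof (induction k arbitrary: t)
  case 0
  then show ?case using W_support[OF assms(1)] by (auto simp: kap_def)
next
  case (Suc k)
  have "open ({..<a} \<union> {b + tail 0<..})" by auto
  moreover have "t \<in> {..<a} \<union> {b + tail 0<..}" using Suc.prems by auto
  ultimately have "\<forall>\<^sub>F x in nhds t. x \<in> {..<a} \<union> {b + tail 0<..}"
    by (rule eventually_nhds_in_open)
  then have "\<forall>\<^sub>F x in nhds t. kap k x = 0"
    by eventually_elim (use Suc.IH in auto)
  then have "(kap k has_real_derivative kap (Suc k) t) (at t) \<longleftrightarrow> ((\<lambda>_. 0) has_real_derivative kap (Suc k) t) (at t)"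
    by (intro DERIV_cong_ev) auto
  then have "((\<lambda>_. 0::real) has_real_derivative kap (Suc k) t) (at t)" using kap_deriv by simp
  from DERIV_unique[OF this DERIV_const] show ?case .
qed

end

text \<open>The classical construction as an infinite convolution of box functions. With window widths proportional to
\<open>(j+1)\<^sup>-\<^sup>5\<^sup>/\<^sup>4\<close>, which are summable, the \<open>k\<close>-th derivative costs the product of their first \<open>k\<close>
reciprocals, which is Gevrey growth of order \<open>5/4\<close>. The tent profile supplies the Lipschitz start.\<close>

lemma gevrey_bump_exists:
  assumes T: "0 < (T::real)"
  shows "\<exists>\<kappa> G R. gevrey \<kappa> G R \<and> (\<forall>k t. t \<le> T / 3 \<or> 2 * T / 3 \<le> t \<longrightarrow> \<kappa> k t = 0)
    \<and> (\<kappa> 0 has_integral 1) {0..T}"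
proof -
  define S where "S = (\<Sum>j. real (Suc j) powr (-5/4))"
  have sm: "summable (\<lambda>j. real (Suc j) powr (-5/4))"
    using summable_Suc_iff[of "\<lambda>n. real n powr (-5/4)"] summable_real_powr_iff[of "-5/4"] by simp
  have S: "1 \<le> S"
    unfolding S_def using sum_le_suminf[OF sm, of "{0}"] by simp
  \<comment> \<open>The windows have total width \<open>T/24\<close> and the tent has half-width \<open>T/12\<close> around \<open>T/2\<close>, so the
    smoothed bump stays inside the middle third.\<close>
  define c where "c = T / (24 * S)"
  define \<delta> where "\<delta> j = c * real (Suc j) powr (-5/4)" for j
  define h where "h = T / 12"
  define w where "w x = max 0 (h - \<bar>x - T / 2\<bar>)" for x
  have c: "0 < c" using T S by (simp add: c_def)
  interpret averaging \<delta> w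
  proof
    show "0 < \<delta> j" for j using c by (simp add: \<delta>_def)
    show "summable \<delta>" unfolding \<delta>_def[abs_def] by (rule summable_mult[OF sm])
    show "nonexpansive w" unfolding nonexpansive_def w_def by (auto simp: max_def)
  qed
  have tail0: "tail 0 = T / 24"
  proof -
    have "tail 0 = c * S"
      unfolding tail_def \<delta>_def S_def add_0 by (rule suminf_mult[OF sm])
    then show ?thesis using S by (simp add: c_def)
  qed
  have supp: "w x = 0" if "x \<le> T / 2 - h \<or> T / 2 + h \<le> x" for x
    using that by (auto simp: w_def)
  have kap0: "kap k t = 0" if "t \<le> T / 3 \<or> 2 * T / 3 \<le> t" for k t
    by (rule kap_support[where a = "T / 2 - h" and b = "T / 2 + h", OF supp]) (use that T in \<open>auto simp: h_def tail0\<close>)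
  have k0: "kap 0 = W 0" by (simp add: kap_def)
  have Wnn: "0 \<le> W 0 t" for t by (rule W_nonneg) (simp add: w_def)
  define I where "I = integral {0..T} (W 0)"
  have cont: "continuous_on S' (W 0)" for S'
    using nonexpansive_continuous[OF nonexpansive_W] continuous_on_subset by blast
  have int: "(W 0 has_integral I) {0..T}"
    unfolding I_def by (intro integrable_integral integrable_continuous_real cont)
  have "\<bar>W 0 (T / 2) - w (T / 2)\<bar> \<le> T / 24"
    using W_close[of 0 "T / 2" 0] tail0 by simp
  then have "w (T / 2) - T / 24 \<le> W 0 (T / 2)" by linarith
  moreover have "w (T / 2) = T / 12" using T by (simp add: w_def h_def)
  ultimately have Wpos: "0 < W 0 (T / 2)" using T by linarith
  have "I \<noteq> 0"
  proof
    assume "I = 0"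
    then have "(W 0 has_integral 0) (cbox 0 T)" using int by simp
    then have "W 0 (T / 2) = 0"
      by (rule has_integral_0_cbox_imp_0[rotated 2]) (use cont Wnn T in auto)
    with Wpos show False by simp
  qed
  moreover have "0 \<le> I" using has_integral_nonneg[OF int] Wnn by auto
  ultimately have I: "0 < I" by simp
  define \<kappa> where "\<kappa> k t = kap k t / I" for k t
  define R where "R = max 1 (2 / c)"
  have bound: "\<bar>kap k t\<bar> \<le> h * R ^ k * (real (Suc k) powr (5/4)) ^ k" for k t
  proof -
    have "\<bar>kap k t\<bar> \<le> (\<Prod>j<k. 2 / \<delta> j) * h"
      unfolding kap_def by (intro diff_quots_bound pos W_bound) (use T in \<open>auto simp: w_def h_def max_def\<close>)
    also have "(\<Prod>j<k. 2 / \<delta> j) \<le> (\<Prod>j<k. R * real (Suc k) powr (5/4))"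
    proof (intro prod_mono conjI)
      fix j assume "j \<in> {..<k}"
      have "2 / \<delta> j = 2 / c * real (Suc j) powr (5/4)"
        by (simp add: \<delta>_def powr_minus_divide)
      also have "\<dots> \<le> R * real (Suc k) powr (5/4)"
        using \<open>j \<in> {..<k}\<close> c by (intro mult_mono powr_mono2) (auto simp: R_def)
      finally show "2 / \<delta> j \<le> R * real (Suc k) powr (5/4)" .
      show "0 \<le> 2 / \<delta> j" using pos[of j] by simp
    qed
    also have "\<dots> = R ^ k * (real (Suc k) powr (5/4)) ^ k" by (simp add: power_mult_distrib)
    finally show ?thesis using T by (simp add: h_def mult_ac)
  qed
  have "gevrey \<kappa> (h / I) R"
    unfolding gevrey_def
  proof (intro conjI allI)
    show "0 \<le> h / I" using T I by (simp add: h_def)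
    show "1 \<le> R" by (simp add: R_def)
    show "\<bar>\<kappa> k t\<bar> \<le> h / I * R ^ k * (real (Suc k) powr (5/4)) ^ k" for k t
      using divide_right_mono[OF bound[of k t], of I] I by (simp add: \<kappa>_def)
    show "(\<kappa> k has_real_derivative \<kappa> (Suc k) t) (at t)" for k t
      unfolding \<kappa>_def[abs_def] by (intro DERIV_cdivide kap_deriv)
  qed
  moreover have "(\<kappa> 0 has_integral I / I) {0..T}"
    unfolding \<kappa>_def[abs_def] k0 by (rule has_integral_divide[OF int])
  ultimately show ?thesis
    using kap0 I by (intro exI[of _ \<kappa>] exI[of _ "h / I"] exI[of _ R]) (auto simp: \<kappa>_def)
qed

section \<open>Modal operators away from resonance\<close>

lemma scal_op_add: "scal_op (a + b) = scal_op a + scal_op b"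
  by (rule st_eqI) (simp add: ap_simps vector_sadd_rdistrib)

lemma scal_op_mult: "scal_op a * scal_op b = scal_op (a * b)"
  by (rule st_eqI) (simp add: ap_simps vector_smult_assoc)

lemma scal_op_of_real: "scal_op (of_real r) = r *\<^sub>R 1"
  by (rule st_eqI) (simp add: ap_simps vec_smult_scaleR)

lemma mat_op_mult: "mat_op (A ** B) = mat_op A * mat_op B"
  by (rule st_eqI) (simp add: ap_simps matrix_vector_mul_assoc)

lemma mat_op_shift: "mat_op (mat z - A) = scal_op z - mat_op A"
  by (rule st_eqI) (simp add: ap_simps matrix_vector_mult_diff_rdistrib mat_smult)

lemma mat_op_one: "mat_op (mat 1) = 1"
  by (rule st_eqI) (simp add: ap_simps)

lemma gen_op_square:
  assumes "m \<ge> 1"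
  shows "gen_op \<rho> A m * gen_op \<rho> A m = - ((\<rho> * real m ^ 2) *\<^sub>R gen_op \<rho> A m) - real m ^ 4 *\<^sub>R 1 - mat_op A"
proof -
  have "gen_op \<rho> A m * gen_op \<rho> A m + ((\<rho> * real m ^ 2) *\<^sub>R gen_op \<rho> A m + real m ^ 4 *\<^sub>R 1 + mat_op A) = 0"
    using gen_op_quadratic[OF assms, of \<rho> A] by (simp only: add.assoc)
  then have "gen_op \<rho> A m * gen_op \<rho> A m = - ((\<rho> * real m ^ 2) *\<^sub>R gen_op \<rho> A m + real m ^ 4 *\<^sub>R 1 + mat_op A)"
    by (rule eq_neg_iff_add_eq_0[THEN iffD2])
  then show ?thesis by simp
qed

definition gen_map :: "real \<Rightarrow> complex^'n^'n \<Rightarrow> nat \<Rightarrow> ('n::finite) st \<Rightarrow> 'n st" where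
  "gen_map \<rho> A m = ap (gen_op \<rho> A m)"

definition scal_map :: "(nat \<Rightarrow> complex) \<Rightarrow> nat \<Rightarrow> ('n::finite) st \<Rightarrow> 'n st" where
  "scal_map g k = ap (scal_op (g k))"

lemma linear_gen_map: "linear (gen_map \<rho> A m)" and linear_scal_map: "linear (scal_map g k)"
  unfolding gen_map_def scal_map_def by (rule linear_ap)+

text \<open>Eliminating \<open>M\<^sup>2\<close> by the quadratic equation of mode \<open>m\<close> leaves a first-order expression in \<open>M\<close>.
The factor \<open>n\<^sup>2 - m\<^sup>2\<close> shows the gain away from the diagonal; on the diagonal only \<open>g - A\<close> remains.\<close>

lemma qfactor_modal:
  assumes "m \<ge> 1" "n \<ge> 1"
  shows "real n ^ 4 *\<^sub>R qfactor \<rho> (gen_map \<rho> A m) (scal_map g k) n v =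
    (real n ^ 2 - real m ^ 2) *\<^sub>R ap (\<rho> *\<^sub>R gen_op \<rho> A m + (real n ^ 2 + real m ^ 2) *\<^sub>R 1) v + ap (scal_op (g k) - mat_op A) v"
proof -
  let ?M = "gen_op \<rho> A m"
  have "real n ^ 4 *\<^sub>R qfactor \<rho> (gen_map \<rho> A m) (scal_map g k) n v =
     ap (real n ^ 4 *\<^sub>R 1 + scal_op (g k) + (\<rho> * real n ^ 2) *\<^sub>R ?M + ?M * ?M) v"
    using assms by (simp add: qfactor_def gen_map_def scal_map_def scaleR_add_right ap.add_left ap.scaleR_left ap_mult)
  also have "real n ^ 4 *\<^sub>R 1 + scal_op (g k) + (\<rho> * real n ^ 2) *\<^sub>R ?M + ?M * ?M
     = (real n ^ 2 - real m ^ 2) *\<^sub>R (\<rho> *\<^sub>R ?M + (real n ^ 2 + real m ^ 2) *\<^sub>R 1) + (scal_op (g k) - mat_op A)"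
    unfolding gen_op_square[OF assms(1)]
    by (simp add: algebra_simps power4_eq_xxxx power2_eq_square)
  finally show ?thesis by (simp add: ap.add_left ap.scaleR_left)
qed

lemma qfactor_diagonal:
  assumes "m \<ge> 1"
  shows "qfactor \<rho> (gen_map \<rho> A m) (scal_map g k) m v = (1 / real m ^ 4) *\<^sub>R ap (mat_op (mat (g k) - A)) v"
proof -
  have "(1 / real m ^ 4) *\<^sub>R (real m ^ 4 *\<^sub>R qfactor \<rho> (gen_map \<rho> A m) (scal_map g k) m v) = (1 / real m ^ 4) *\<^sub>R ap (mat_op (mat (g k) - A)) v"
    unfolding qfactor_modal[OF assms assms] mat_op_shift by simp
  then show ?thesis using assms by simp
qed

lemma qfactors_diagonal:
  assumes "m \<ge> 1"
  shows "qfactors \<rho> (gen_map \<rho> A m) (scal_map g) m k v = (1 / real m ^ 4) ^ k *\<^sub>R ap (mat_op (shifted_prod A g k)) v"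
proof (induction k)
  case 0
  then show ?case by (simp add: mat_op_one)
next
  case (Suc k)
  have "ap (mat_op (mat (g k) - A)) (ap (mat_op (shifted_prod A g k)) v) = ap (mat_op (shifted_prod A g (Suc k))) v"
    by (simp add: mat_op_mult[symmetric] shifted_prod_commute' flip: ap_mult)
  then show ?case by (simp add: qfactor_diagonal[OF assms] Suc ap.scaleR_right)
qed

lemma shifted_modal_inverse:
  assumes "m \<ge> 1"
  shows "(- (\<rho>^2 * real m ^ 2) *\<^sub>R 1 - \<rho> *\<^sub>R gen_op \<rho> A m + s *\<^sub>R 1) * (\<rho> *\<^sub>R gen_op \<rho> A m + s *\<^sub>R 1)
     = (s^2 - \<rho>^2 * real m ^ 2 * s + \<rho>^2 * real m ^ 4) *\<^sub>R 1 + \<rho>^2 *\<^sub>R mat_op A"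
proof -
  let ?M = "gen_op \<rho> A m"
  have "(- (\<rho>^2 * real m ^ 2) *\<^sub>R 1 - \<rho> *\<^sub>R ?M + s *\<^sub>R 1) * (\<rho> *\<^sub>R ?M + s *\<^sub>R 1)
     = (s^2 - \<rho>^2 * real m ^ 2 * s) *\<^sub>R 1 - (\<rho> ^ 3 * real m ^ 2) *\<^sub>R ?M - \<rho>^2 *\<^sub>R (?M * ?M)"
    by (simp add: algebra_simps power2_eq_square power3_eq_cube)
  then show ?thesis
    unfolding gen_op_square[OF assms] by (simp add: algebra_simps power2_eq_square power3_eq_cube)
qed

lemma quadratic_form_lower_bound:
  assumes "0 < \<rho>" "\<rho> < (2::real)"
  shows "\<exists>c>0. \<forall>x y. c * (x + y)^2 \<le> x^2 - \<rho>^2 * y * x + \<rho>^2 * y^2"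
proof -
  \<comment> \<open>The constant for which the discriminant of the difference vanishes.\<close>
  define c where "c = \<rho>^2 * (4 - \<rho>^2) / (8 * \<rho>^2 + 4)"
  have r: "0 < \<rho>^2" "\<rho>^2 < 4"
    using assms power_strict_mono[of \<rho> 2 2] by auto
  have den: "0 < 8 * \<rho>^2 + 4" using r by linarith
  have c0: "0 < c" unfolding c_def using r den by (intro divide_pos_pos mult_pos_pos) simp_all
  have "\<rho>^2 * (4 - \<rho>^2) \<le> 4"
    using zero_le_power2[of "\<rho>^2 - 2"] by (simp add: power2_eq_square algebra_simps)
  then have "\<rho>^2 * (4 - \<rho>^2) < 8 * \<rho>^2 + 4" using r by linarith
  then have c1: "c < 1" using den unfolding c_def by (simp only: pos_divide_less_eq mult_1)
  have cd: "c * (8 * \<rho>^2 + 4) = \<rho>^2 * (4 - \<rho>^2)" using den by (simp add: c_def)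
  have "c * (x + y)^2 \<le> x^2 - \<rho>^2 * y * x + \<rho>^2 * y^2" for x y
  proof -
    have "0 \<le> (2 * (1 - c) * x - (\<rho>^2 + 2 * c) * y)^2" by simp
    also have "\<dots> = 4 * (1 - c) * (x^2 - \<rho>^2 * y * x + \<rho>^2 * y^2 - c * (x + y)^2)
        + (\<rho>^2 * \<rho>^2 - 4 * \<rho>^2 + c * (8 * \<rho>^2 + 4)) * y^2"
      by (simp add: power2_eq_square algebra_simps)
    also have "\<rho>^2 * \<rho>^2 - 4 * \<rho>^2 + c * (8 * \<rho>^2 + 4) = 0" unfolding cd by (simp add: algebra_simps)
    finally have "0 \<le> 4 * (1 - c) * (x^2 - \<rho>^2 * y * x + \<rho>^2 * y^2 - c * (x + y)^2)" by simp
    then have "0 \<le> x^2 - \<rho>^2 * y * x + \<rho>^2 * y^2 - c * (x + y)^2"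
      using c1 by (simp add: zero_le_mult_iff)
    then show ?thesis by simp
  qed
  with c0 show ?thesis by blast
qed

text \<open>Multiplied with its conjugate, \<open>\<rho> M + s\<close> becomes the scalar \<open>s\<^sup>2 - \<rho>\<^sup>2 m\<^sup>2 s + \<rho>\<^sup>2 m\<^sup>4\<close> plus
\<open>\<rho>\<^sup>2 A\<close>. The quadratic form is positive definite exactly because \<open>0 < \<rho> < 2\<close>, so it dominates
\<open>A\<close> once \<open>s + m\<^sup>2\<close> is large.\<close>

lemma shifted_modal_lower_bound:
  fixes A :: "complex^'n^'n"
  assumes "0 < \<rho>" "\<rho> < 2"
  shows "\<exists>c>0. \<exists>N0. \<forall>m\<ge>1. \<forall>s\<ge>0. N0 \<le> s + real m ^ 2 \<longrightarrow>
    (\<forall>v. c * (s + real m ^ 2) * norm v \<le> norm (ap (\<rho> *\<^sub>R gen_op \<rho> A m + s *\<^sub>R 1) v))"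
proof -
  obtain c where c: "c > 0" "\<And>x y. c * (x + y)^2 \<le> x^2 - \<rho>^2 * y * x + \<rho>^2 * y^2"
    using quadratic_form_lower_bound[OF assms] by blast
  obtain cM where cM: "cM \<ge> 1" "\<And>m. m \<ge> 1 \<Longrightarrow> norm (gen_op \<rho> A m) \<le> cM * real m ^ 2"
    using norm_gen_op_bound[of \<rho> A] assms by auto
  define a where "a = norm (mat_op A)"
  define X where "X = \<rho>^2 + \<rho> * cM + 1"
  define N0 where "N0 = max 1 (2 * \<rho>^2 * a / c)"
  have X: "0 < X" using assms cM by (simp add: X_def add_pos_nonneg add_nonneg_pos)
  have "c / (2 * X) * (s + real m ^ 2) * norm v \<le> norm (ap (\<rho> *\<^sub>R gen_op \<rho> A m + s *\<^sub>R 1) v)"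
    if m: "m \<ge> 1" and s: "s \<ge> 0" and N: "N0 \<le> s + real m ^ 2" for m s and v :: "'n st"
  proof -
    define t where "t = s + real m ^ 2"
    let ?L = "\<rho> *\<^sub>R gen_op \<rho> A m + s *\<^sub>R 1"
    let ?R = "- (\<rho>^2 * real m ^ 2) *\<^sub>R 1 - \<rho> *\<^sub>R gen_op \<rho> A m + s *\<^sub>R 1"
    define q where "q = s^2 - \<rho>^2 * real m ^ 2 * s + \<rho>^2 * real m ^ 4"
    have t1: "1 \<le> t" "2 * \<rho>^2 * a / c \<le> t" using N by (auto simp: t_def N0_def)
    have q: "c * t^2 \<le> q"
      using c(2)[of s "real m ^ 2"] by (simp add: q_def t_def flip: power_mult)
    have "norm ?R \<le> norm (- (\<rho>^2 * real m ^ 2) *\<^sub>R (1 :: 'n st eop)) + norm (\<rho> *\<^sub>R gen_op \<rho> A m) + norm (s *\<^sub>R (1 :: 'n st eop))"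
      by (meson add_right_mono norm_triangle_ineq norm_triangle_ineq4 order_trans)
    also have "\<dots> \<le> \<rho>^2 * real m ^ 2 + \<rho> * (cM * real m ^ 2) + s"
      using assms cM(2)[OF m] s by (simp add: abs_mult)
    also have "\<dots> \<le> X * t"
    proof -
      have "0 \<le> (\<rho>^2 + \<rho> * cM) * s + real m ^ 2" using assms cM s by simp
      then show ?thesis by (simp add: X_def t_def algebra_simps)
    qed
    finally have R: "norm ?R \<le> X * t" .
    have "2 * \<rho>^2 * a \<le> c * t" using t1(2) c(1) by (simp add: pos_divide_le_eq mult.commute)
    also have "\<dots> \<le> c * t^2" using t1(1) c(1) by (simp add: power2_eq_square)
    finally have "c * t^2 / 2 \<le> q - \<rho>^2 * a" using q by linarith
    then have "c * t^2 / 2 * norm v \<le> (q - \<rho>^2 * a) * norm v" by (rule mult_right_mono) simp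
    also have "\<dots> \<le> norm (q *\<^sub>R v) - norm (\<rho>^2 *\<^sub>R ap (mat_op A) v)"
    proof -
      have "q * norm v \<le> norm (q *\<^sub>R v)" by (simp add: mult_right_mono)
      moreover have "norm (\<rho>^2 *\<^sub>R ap (mat_op A) v) \<le> \<rho>^2 * (a * norm v)"
        using norm_ap[of "mat_op A" v] by (simp add: a_def mult_left_mono)
      ultimately show ?thesis by (simp add: algebra_simps)
    qed
    also have "\<dots> \<le> norm (q *\<^sub>R v + \<rho>^2 *\<^sub>R ap (mat_op A) v)" by (rule norm_diff_ineq)
    also have "q *\<^sub>R v + \<rho>^2 *\<^sub>R ap (mat_op A) v = ap ?R (ap ?L v)"
      unfolding ap_mult[symmetric] shifted_modal_inverse[OF m]
      by (simp add: ap.add_left ap.scaleR_left q_def)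
    also have "norm (ap ?R (ap ?L v)) \<le> X * t * norm (ap ?L v)"
      by (rule order_trans[OF norm_ap mult_right_mono[OF R]]) simp
    finally have "(c * t / 2 * norm v) * t \<le> (X * norm (ap ?L v)) * t"
      by (simp add: power2_eq_square mult_ac)
    then have "c * t / 2 * norm v \<le> X * norm (ap ?L v)"
      by (rule mult_right_le_imp_le) (use t1(1) in simp)
    then have "c * t / 2 * norm v / X \<le> norm (ap ?L v)"
      using X by (simp only: pos_divide_le_eq mult.commute)
    then show ?thesis by (simp add: t_def)
  qed
  then show ?thesis using c(1) X by (intro exI[of _ "c / (2 * X)"] conjI exI[of _ N0]) auto
qed

lemma eigenvector_modal:
  fixes w :: "('n::finite) st"
  assumes "m \<ge> 1" "w \<noteq> 0" "ap (gen_op \<rho> A m) w = ap (scal_op z) w"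
  shows "- (z^2 + of_real \<rho> * of_nat m ^ 2 * z + of_nat m ^ 4) \<in> eigenvalues A"
proof -
  obtain a b where w: "w = (a, b)" by (cases w)
  have m0: "real m \<noteq> 0" using assms(1) by simp
  from assms(3) have 1: "real m ^ 2 *\<^sub>R b = z *s a"
    and 2: "- (real m ^ 2 *\<^sub>R a) - (\<rho> * real m ^ 2) *\<^sub>R b - (A *v a) /\<^sub>R real m ^ 2 = z *s b"
    by (auto simp: w ap_simps)
  have "a \<noteq> 0"
  proof
    assume "a = 0"
    with 1 m0 have "b = 0" by simp
    with \<open>a = 0\<close> assms(2) show False by (simp add: w zero_prod_def)
  qed
  have "real m ^ 2 *\<^sub>R (- (real m ^ 2 *\<^sub>R a) - (\<rho> * real m ^ 2) *\<^sub>R b - (A *v a) /\<^sub>R real m ^ 2)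
      = z *s (real m ^ 2 *\<^sub>R b)"
    unfolding 2 by (simp add: linear_scale[OF linear_vec_smult])
  then have "A *v a = - (real m ^ 4 *\<^sub>R a) - (\<rho> * real m ^ 2) *\<^sub>R (real m ^ 2 *\<^sub>R b) - z *s (real m ^ 2 *\<^sub>R b)"
    using m0 by (simp add: scaleR_diff_right algebra_simps power4_eq_xxxx power2_eq_square)
  also have "\<dots> = (- (z^2 + of_real \<rho> * of_nat m ^ 2 * z + of_nat m ^ 4)) *s a"
    unfolding 1 unfolding vec_smult_scaleR
    by (vector power2_eq_square algebra_simps)
  finally show ?thesis using \<open>a \<noteq> 0\<close> by (auto simp: eigenvalues_def)
qed

lemma two_temporal_root:
  "2 * temporal_root \<rho> \<gamma> \<sigma> m = - of_real \<rho> * of_nat m ^ 2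
     + \<sigma> * csqrt (of_real \<rho> ^ 2 * of_nat m ^ 4 - 4 * (of_nat m ^ 4 + \<gamma>))"
proof -
  have "2 * (1 / 2 * X) = X" for X :: complex by simp
  then show ?thesis unfolding temporal_root_def .
qed

lemma temporal_root_quadratic:
  assumes "\<sigma> \<in> {1, -1}"
  shows "(temporal_root \<rho> \<gamma> \<sigma> m)^2 + of_real \<rho> * of_nat m ^ 2 * temporal_root \<rho> \<gamma> \<sigma> m + of_nat m ^ 4 + \<gamma> = 0"
proof -
  define r where "r = csqrt (of_real \<rho> ^ 2 * of_nat m ^ 4 - 4 * (of_nat m ^ 4 + \<gamma>))"
  have r: "r^2 = of_real \<rho> ^ 2 * of_nat m ^ 4 - 4 * (of_nat m ^ 4 + \<gamma>)" by (simp add: r_def)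
  have s: "\<sigma>^2 = 1" using assms by auto
  define z where "z = temporal_root \<rho> \<gamma> \<sigma> m"
  have z: "2 * z + of_real \<rho> * of_nat m ^ 2 = \<sigma> * r" unfolding z_def two_temporal_root r_def by simp
  have "(2 * z + of_real \<rho> * of_nat m ^ 2)^2 = r^2"
    unfolding z by (simp add: power_mult_distrib s)
  then have "4 * (z^2 + of_real \<rho> * of_nat m ^ 2 * z + of_nat m ^ 4 + \<gamma>) = 0"
    unfolding r by (simp add: power2_eq_square power4_eq_xxxx algebra_simps)
  then have "z^2 + of_real \<rho> * of_nat m ^ 2 * z + of_nat m ^ 4 + \<gamma> = 0"
    by (metis mult_eq_0_iff zero_neq_numeral)
  then show ?thesis by (simp only: z_def)
qed

lemma temporal_root_cases:
  assumes "z^2 + of_real \<rho> * of_nat m ^ 2 * z + of_nat m ^ 4 + \<gamma> = 0"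
  shows "\<exists>\<sigma>\<in>{1, -1}. z = temporal_root \<rho> \<gamma> \<sigma> m"
proof -
  define r where "r = csqrt (of_real \<rho> ^ 2 * of_nat m ^ 4 - 4 * (of_nat m ^ 4 + \<gamma>))"
  have r: "r^2 = of_real \<rho> ^ 2 * of_nat m ^ 4 - 4 * (of_nat m ^ 4 + \<gamma>)" by (simp add: r_def)
  have "(2 * z + of_real \<rho> * of_nat m ^ 2)^2 - r^2 = 4 * (z^2 + of_real \<rho> * of_nat m ^ 2 * z + of_nat m ^ 4 + \<gamma>)"
    unfolding r by (simp add: power2_eq_square power4_eq_xxxx algebra_simps)
  then have "(2 * z + of_real \<rho> * of_nat m ^ 2)^2 = r^2" using assms by simp
  then have "2 * z + of_real \<rho> * of_nat m ^ 2 = r \<or> 2 * z + of_real \<rho> * of_nat m ^ 2 = - r"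
    by (simp add: power2_eq_iff)
  then show ?thesis
  proof
    assume "2 * z + of_real \<rho> * of_nat m ^ 2 = r"
    then have "2 * z = 2 * temporal_root \<rho> \<gamma> 1 m"
      unfolding two_temporal_root r_def[symmetric] by (simp add: algebra_simps)
    then have "z = temporal_root \<rho> \<gamma> 1 m" by simp
    then show ?thesis by blast
  next
    assume "2 * z + of_real \<rho> * of_nat m ^ 2 = - r"
    then have "2 * z = 2 * temporal_root \<rho> \<gamma> (- 1) m"
      unfolding two_temporal_root r_def[symmetric] by (simp add: algebra_simps)
    then have "z = temporal_root \<rho> \<gamma> (- 1) m" by simp
    then show ?thesis by blast
  qed
qed

lemma temporal_root_sum: "temporal_root \<rho> \<gamma> 1 m + temporal_root \<rho> \<gamma> (- 1) m = - (of_real \<rho> * of_nat m ^ 2)"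
proof -
  have "2 * (temporal_root \<rho> \<gamma> 1 m + temporal_root \<rho> \<gamma> (- 1) m) = 2 * (- (of_real \<rho> * of_nat m ^ 2))"
    unfolding distrib_left two_temporal_root by simp
  then show ?thesis by (metis mult_left_cancel zero_neq_numeral)
qed

lemma temporal_root_prod: "temporal_root \<rho> \<gamma> 1 m * temporal_root \<rho> \<gamma> (- 1) m = of_nat m ^ 4 + \<gamma>"
proof -
  let ?z = "temporal_root \<rho> \<gamma> 1 m"
  have "temporal_root \<rho> \<gamma> (- 1) m = - (of_real \<rho> * of_nat m ^ 2) - ?z"
    using temporal_root_sum[of \<rho> \<gamma> m] by (simp add: eq_diff_eq add.commute)
  then have "?z * temporal_root \<rho> \<gamma> (- 1) m = ?z * (- (of_real \<rho> * of_nat m ^ 2) - ?z)"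
    by (rule arg_cong)
  also have "\<dots> = - (?z^2 + of_real \<rho> * of_nat m ^ 2 * ?z)"
    by (simp add: power2_eq_square algebra_simps)
  also have "\<dots> = of_nat m ^ 4 + \<gamma>"
    using temporal_root_quadratic[of 1 \<rho> \<gamma> m] by (simp only: neg_eq_iff_add_eq_0 add.assoc) simp
  finally show ?thesis .
qed

section \<open>Lower bounds from the nonresonance conditions\<close>

text \<open>The nonresonance conditions in terms of the spectrum itself, free of its enumeration.\<close>

definition spectral_gap :: "real \<Rightarrow> complex^'n^'n \<Rightarrow> bool" where
  "spectral_gap \<rho> A \<longleftrightarrow> (\<forall>\<gamma>\<in>eigenvalues A. \<forall>\<gamma>'\<in>eigenvalues A. \<forall>m\<ge>1. \<forall>n\<ge>1. m \<noteq> n \<longrightarrow>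
     (\<forall>\<sigma>\<in>{1,-1}. \<forall>\<eta>\<in>{1,-1}. temporal_root \<rho> \<gamma> \<sigma> m \<noteq> temporal_root \<rho> \<gamma>' \<eta> n))"

definition transfer_gap :: "real \<Rightarrow> complex^'n^'n \<Rightarrow> bool" where
  "transfer_gap \<rho> A \<longleftrightarrow> (\<forall>\<gamma>\<in>eigenvalues A. \<forall>m\<ge>1. \<forall>\<sigma>\<in>{1,-1}. (temporal_root \<rho> \<gamma> \<sigma> m)\<^sup>2 + \<gamma> \<noteq> 0)"

lemma modal_eigenvalue:
  fixes w :: "('n::finite) st"
  assumes "m \<ge> 1" "w \<noteq> 0" "ap (gen_op \<rho> A m) w = ap (scal_op z) w"
  shows "\<exists>\<gamma>\<in>eigenvalues A. (\<exists>\<sigma>\<in>{1,-1}. z = temporal_root \<rho> \<gamma> \<sigma> m)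
     \<and> \<gamma> = - (z^2 + of_real \<rho> * of_nat m ^ 2 * z + of_nat m ^ 4)"
proof -
  let ?\<gamma> = "- (z^2 + of_real \<rho> * of_nat m ^ 2 * z + of_nat m ^ 4)"
  have "z^2 + of_real \<rho> * of_nat m ^ 2 * z + of_nat m ^ 4 + ?\<gamma> = 0" by simp
  from temporal_root_cases[OF this] eigenvector_modal[OF assms] show ?thesis by blast
qed

text \<open>The factor splits into \<open>(M - z\<^sub>+) (M - z\<^sub>-)\<close> with the two temporal roots of mode \<open>n\<close>. A kernel vector
would make one of them an eigenvalue of the generator of mode \<open>m\<close>, that is, a temporal root of mode \<open>m\<close>.\<close>

lemma qfactor_modal_injective:
  fixes v :: "('n::finite) st"
  assumes gap: "spectral_gap \<rho> A" and "g k \<in> eigenvalues A" "m \<ge> 1" "n \<ge> 1" "m \<noteq> n"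
    and zero: "qfactor \<rho> (gen_map \<rho> A m) (scal_map g k) n v = 0"
  shows "v = 0"
proof (rule ccontr)
  assume v: "v \<noteq> 0"
  let ?M = "gen_op \<rho> A m"
  let ?z1 = "temporal_root \<rho> (g k) 1 n" and ?z2 = "temporal_root \<rho> (g k) (- 1) n"
  have "0 = real n ^ 4 *\<^sub>R qfactor \<rho> (gen_map \<rho> A m) (scal_map g k) n v" by (simp add: zero)
  also have "\<dots> = ap (real n ^ 4 *\<^sub>R 1 + scal_op (g k) + (\<rho> * real n ^ 2) *\<^sub>R ?M + ?M * ?M) v"
    using \<open>n \<ge> 1\<close> by (simp add: qfactor_def gen_map_def scal_map_def scaleR_add_right ap.add_left ap.scaleR_left ap_mult)
  also have "real n ^ 4 *\<^sub>R 1 + scal_op (g k) + (\<rho> * real n ^ 2) *\<^sub>R ?M + ?M * ?M = (?M - scal_op ?z1) * (?M - scal_op ?z2)"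
  proof -
    have s: "scal_op ?z1 + scal_op ?z2 = - ((\<rho> * real n ^ 2) *\<^sub>R (1 :: 'n st eop))"
      unfolding scal_op_add[symmetric] temporal_root_sum
      using scal_op_of_real[of "- (\<rho> * real n ^ 2)"] by simp
    have p: "scal_op ?z1 * scal_op ?z2 = real n ^ 4 *\<^sub>R (1 :: 'n st eop) + scal_op (g k)"
      unfolding scal_op_mult temporal_root_prod scal_op_add
      using scal_op_of_real[of "real n ^ 4"] by simp
    have "(?M - scal_op ?z1) * (?M - scal_op ?z2) = ?M * ?M - (scal_op ?z1 + scal_op ?z2) * ?M + scal_op ?z1 * scal_op ?z2"
      by (simp add: algebra_simps scal_op_gen_op)
    then show ?thesis unfolding s p by (simp add: algebra_simps)
  qed
  finally have prod: "ap (?M - scal_op ?z1) (ap (?M - scal_op ?z2) v) = 0" by (simp add: ap_mult)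
  have "\<exists>w. w \<noteq> 0 \<and> (ap ?M w = ap (scal_op ?z1) w \<or> ap ?M w = ap (scal_op ?z2) w)"
  proof (cases "ap (?M - scal_op ?z2) v = 0")
    case True
    with v show ?thesis by (intro exI[of _ v]) (simp add: ap.diff_left)
  next
    case False
    with prod show ?thesis by (intro exI[of _ "ap (?M - scal_op ?z2) v"]) (simp add: ap.diff_left)
  qed
  then obtain w \<sigma> where w: "w \<noteq> 0" "\<sigma> \<in> {1, -1}" "ap ?M w = ap (scal_op (temporal_root \<rho> (g k) \<sigma> n)) w"
    by blast
  from modal_eigenvalue[OF \<open>m \<ge> 1\<close> w(1,3)] obtain \<gamma> \<eta> where
    "\<gamma> \<in> eigenvalues A" "\<eta> \<in> {1,-1}" "temporal_root \<rho> (g k) \<sigma> n = temporal_root \<rho> \<gamma> \<eta> m" by blast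
  moreover have "temporal_root \<rho> \<gamma> \<eta> m \<noteq> temporal_root \<rho> (g k) \<sigma> n"
    using gap assms(2-5) calculation(1,2) w(2) unfolding spectral_gap_def by blast
  ultimately show False by simp
qed

text \<open>A kernel vector is an eigenvector of \<open>M\<close> for \<open>z = - m\<^sup>2 / \<rho>\<close>. For this \<open>z\<close> the terms \<open>\<rho> m\<^sup>2 z\<close> and
\<open>m\<^sup>4\<close> of the temporal equation cancel, leaving \<open>z\<^sup>2 + \<gamma> = 0\<close>.\<close>

lemma transfer_injective:
  fixes v :: "('n::finite) st"
  assumes gap: "transfer_gap \<rho> A" and "0 < \<rho>" "m \<ge> 1"
    and zero: "ap (\<rho> *\<^sub>R gen_op \<rho> A m + real m ^ 2 *\<^sub>R 1) v = 0"
  shows "v = 0"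
proof (rule ccontr)
  assume v: "v \<noteq> 0"
  define z :: complex where "z = of_real (- (real m ^ 2 / \<rho>))"
  have "\<rho> *\<^sub>R ap (gen_op \<rho> A m) v = - (real m ^ 2 *\<^sub>R v)"
    using zero by (simp add: ap.add_left ap.scaleR_left eq_neg_iff_add_eq_0)
  then have "(1 / \<rho>) *\<^sub>R (\<rho> *\<^sub>R ap (gen_op \<rho> A m) v) = (1 / \<rho>) *\<^sub>R (- (real m ^ 2 *\<^sub>R v))" by simp
  then have "ap (gen_op \<rho> A m) v = ap (scal_op z) v"
    using assms(2) unfolding z_def scal_op_of_real by (simp add: ap.scaleR_left ap.minus_left)
  from modal_eigenvalue[OF assms(3) v this] obtain \<gamma> \<sigma> where
    g: "\<gamma> \<in> eigenvalues A" "\<sigma> \<in> {1,-1}" "z = temporal_root \<rho> \<gamma> \<sigma> m"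
    "\<gamma> = - (z^2 + of_real \<rho> * of_nat m ^ 2 * z + of_nat m ^ 4)" by blast
  have "of_real \<rho> * of_nat m ^ 2 * z = - (of_nat m ^ 4)"
    using assms(2) by (simp add: z_def power4_eq_xxxx power2_eq_square)
  then have "z^2 + \<gamma> = 0" using g(4) by simp
  moreover have "(temporal_root \<rho> \<gamma> \<sigma> m)\<^sup>2 + \<gamma> \<noteq> 0"
    using gap g assms(3) unfolding transfer_gap_def by blast
  ultimately show False using g(3) by simp
qed

lemma transfer_operator:
  assumes "m \<ge> 1"
  shows "gen_op \<rho> A m * gen_op \<rho> A m + mat_op A = (- (real m ^ 2)) *\<^sub>R (\<rho> *\<^sub>R gen_op \<rho> A m + real m ^ 2 *\<^sub>R 1)"
  unfolding gen_op_square[OF assms] by (simp add: algebra_simps power4_eq_xxxx power2_eq_square)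

text \<open>Turns the nonresonance conditions, which give some constant for every index, into one constant:
all but finitely many indices are covered by an asymptotic estimate.\<close>

lemma uniform_from_cofinite:
  fixes Q :: "'i \<Rightarrow> real \<Rightarrow> bool"
  assumes "\<And>i. \<exists>c>0. Q i c" "\<And>i c c'. Q i c \<Longrightarrow> c' \<le> c \<Longrightarrow> Q i c'"
    and "finite F" "0 < c0" "\<And>i. i \<notin> F \<Longrightarrow> Q i c0"
  shows "\<exists>c>0. \<forall>i. Q i c"
proof -
  obtain f where f: "\<And>i. f i > 0" "\<And>i. Q i (f i)" using assms(1) by metis
  define c where "c = Min (insert c0 (f ` F))"
  have "c > 0" using assms(3,4) f(1) by (simp add: c_def)
  moreover have "Q i c" for i
  proof (cases "i \<in> F")
    case True
    then have "c \<le> f i" using assms(3) by (simp add: c_def)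
    with assms(2) f(2) show ?thesis by blast
  next
    case False
    have "c \<le> c0" using assms(3) by (simp add: c_def)
    with assms(2,5) False show ?thesis by blast
  qed
  ultimately show ?thesis by blast
qed

text \<open>For large \<open>m\<^sup>2 + n\<^sup>2\<close> the first-order expression of \<open>qfactor_modal\<close> dominates the bounded
perturbation by \<open>A\<close>, since \<open>n\<^sup>2 - m\<^sup>2\<close> is a nonzero integer; the finitely many remaining pairs are
covered by injectivity.\<close>

lemma qfactor_modal_lower_bound:
  fixes A :: "complex^'n^'n"
  assumes rho: "0 < \<rho>" "\<rho> < 2" and gap: "spectral_gap \<rho> A" and g: "\<And>k. g k \<in> eigenvalues A"
    and gb: "\<And>k. norm (g k) \<le> cg"
  shows "\<exists>c>0. \<forall>m\<ge>1. \<forall>n\<ge>1. m \<noteq> n \<longrightarrow> (\<forall>k<d. \<forall>v.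
    c * (\<bar>real n ^ 2 - real m ^ 2\<bar> * (real n ^ 2 + real m ^ 2)) * norm v
      \<le> real n ^ 4 * norm (qfactor \<rho> (gen_map \<rho> A m) (scal_map g k) n v))"
proof -
  let ?S = "\<lambda>m n. \<bar>real n ^ 2 - real m ^ 2\<bar> * (real n ^ 2 + real m ^ 2)"
  define Q where "Q i c \<longleftrightarrow> (case i of (m, n, k) \<Rightarrow> 1 \<le> m \<longrightarrow> 1 \<le> n \<longrightarrow> m \<noteq> n \<longrightarrow> k < d \<longrightarrow> (\<forall>v.
    c * ?S m n * norm v \<le> real n ^ 4 * norm (qfactor \<rho> (gen_map \<rho> A m) (scal_map g k) n v)))" for i :: "nat \<times> nat \<times> nat" and c
  obtain c N0 where c: "c > 0" "\<And>m s v. m \<ge> 1 \<Longrightarrow> s \<ge> 0 \<Longrightarrow> N0 \<le> s + real m ^ 2 \<Longrightarrow>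
      c * (s + real m ^ 2) * norm v \<le> norm (ap (\<rho> *\<^sub>R gen_op \<rho> A m + s *\<^sub>R 1) v)"
    using shifted_modal_lower_bound[OF rho, of A] by blast
  define b where "b = cg + norm (mat_op A)"
  have b0: "0 \<le> b" using order_trans[OF norm_ge_zero gb] by (simp add: b_def)
  define N1 where "N1 = nat \<lceil>max N0 (2 * b / c)\<rceil>"
  define F where "F = {..N1} \<times> {..N1} \<times> {..d}"
  have sep: "1 \<le> \<bar>real n ^ 2 - real m ^ 2\<bar>" if "m \<noteq> n" for m n :: nat
  proof -
    have "int n ^ 2 \<noteq> int m ^ 2" using that by (simp flip: of_nat_power)
    then have "1 \<le> \<bar>int n ^ 2 - int m ^ 2\<bar>" by linarith
    then have "real_of_int 1 \<le> real_of_int \<bar>int n ^ 2 - int m ^ 2\<bar>" by (rule of_int_le_iff[THEN iffD2])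
    then show ?thesis by simp
  qed
  have "\<exists>c>0. \<forall>i. Q i c"
  proof (rule uniform_from_cofinite)
    show "finite F" by (simp add: F_def)
    show "0 < c / 2" using c(1) by simp
    show "Q i c'" if "Q i c" "c' \<le> c" for i c c'
      using that unfolding Q_def
      by (auto split: prod.splits intro: order_trans[OF mult_right_mono[OF mult_right_mono]])
    show "\<exists>c>0. Q i c" for i
    proof -
      obtain m n k where i: "i = (m, n, k)" by (cases i)
      show ?thesis
      proof (cases "1 \<le> m \<and> 1 \<le> n \<and> m \<noteq> n")
        case True
        let ?f = "qfactor \<rho> (gen_map \<rho> A m) (scal_map g k) n"
        have lin: "linear ?f" by (intro linear_qfactor linear_gen_map linear_scal_map)
        have "inj ?f" unfolding linear_injective_0[OF lin]
          using qfactor_modal_injective[of \<rho> A g k m n] gap g True by blast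
        from linear_inj_bounded_below_pos[OF lin this]
        obtain e where e: "e > 0" "\<And>v. e * norm v \<le> norm (?f v)" by blast
        have S: "0 < ?S m n" using sep[of m n] True by (intro mult_pos_pos add_pos_pos) auto
        have "e / ?S m n * ?S m n * norm v \<le> real n ^ 4 * norm (?f v)" for v
        proof -
          have "norm (?f v) \<le> real n ^ 4 * norm (?f v)"
            using True mult_right_mono[of 1 "real n ^ 4" "norm (?f v)"] by simp
          with e(2)[of v] S show ?thesis by simp
        qed
        then show ?thesis using e S unfolding Q_def i by (intro exI[of _ "e / ?S m n"]) auto
      next
        case False
        then show ?thesis unfolding Q_def i by (intro exI[of _ 1]) auto
      qed
    qed
    show "Q i (c / 2)" if "i \<notin> F" for i
    proof -
      obtain m n k where i: "i = (m, n, k)" by (cases i)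
      have "c / 2 * ?S m n * norm v \<le> real n ^ 4 * norm (qfactor \<rho> (gen_map \<rho> A m) (scal_map g k) n v)"
        if mn: "1 \<le> m" "1 \<le> n" "m \<noteq> n" "k < d" for v
      proof -
        let ?N = "real n ^ 2 + real m ^ 2" and ?D = "\<bar>real n ^ 2 - real m ^ 2\<bar>"
        have "N1 < m \<or> N1 < n" using \<open>i \<notin> F\<close> mn by (auto simp: F_def i)
        then have "real N1 \<le> ?N"
        proof
          assume "N1 < m"
          then have "real N1 \<le> real m ^ 2" using self_le_power[of "real m" 2] mn(1) by simp
          then show ?thesis by (simp add: add_increasing)
        next
          assume "N1 < n"
          then have "real N1 \<le> real n ^ 2" using self_le_power[of "real n" 2] mn(2) by simp
          then show ?thesis by (simp add: add_increasing2)
        qed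
        moreover have "max N0 (2 * b / c) \<le> real N1" by (simp add: N1_def real_nat_ceiling_ge)
        ultimately have N: "N0 \<le> ?N" "2 * b / c \<le> ?N" by linarith+
        have "c * ?N * norm v \<le> c * (?N + real m ^ 2) * norm v"
          using c(1) by (intro mult_right_mono mult_left_mono) auto
        also have "\<dots> \<le> norm (ap (\<rho> *\<^sub>R gen_op \<rho> A m + ?N *\<^sub>R 1) v)"
        proof (rule c(2)[OF mn(1)])
          show "N0 \<le> ?N + real m ^ 2" using N(1) zero_le_power2[of "real m"] by linarith
        qed simp
        finally have 1: "?D * (c * ?N * norm v) \<le> norm ((real n ^ 2 - real m ^ 2) *\<^sub>R ap (\<rho> *\<^sub>R gen_op \<rho> A m + ?N *\<^sub>R 1) v)"
          by (simp add: mult_left_mono)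
        have "norm (scal_op (g k) - mat_op A) \<le> b"
          using norm_triangle_ineq4[of "scal_op (g k)" "mat_op A"] norm_scal_op[of "g k", where 'n = 'n] gb[of k] by (simp add: b_def)
        then have 2: "norm (ap (scal_op (g k) - mat_op A) v) \<le> b * norm v"
          by (rule order_trans[OF norm_ap mult_right_mono]) simp
        have "2 * b \<le> c * ?N" using N(2) c(1) by (simp add: pos_divide_le_eq mult.commute)
        also have "\<dots> \<le> ?D * (c * ?N)" using sep[of m n] mn c(1) mult_right_mono[of 1 ?D "c * ?N"] by simp
        finally have "b * norm v \<le> ?D * (c * ?N) / 2 * norm v" by (intro mult_right_mono) auto
        then have "c / 2 * ?S m n * norm v \<le> ?D * (c * ?N * norm v) - b * norm v"
          by (simp add: algebra_simps)
        also have "\<dots> \<le> norm ((real n ^ 2 - real m ^ 2) *\<^sub>R ap (\<rho> *\<^sub>R gen_op \<rho> A m + ?N *\<^sub>R 1) v) - norm (ap (scal_op (g k) - mat_op A) v)"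
          using 1 2 by linarith
        also have "\<dots> \<le> norm (real n ^ 4 *\<^sub>R qfactor \<rho> (gen_map \<rho> A m) (scal_map g k) n v)"
          unfolding qfactor_modal[OF mn(1,2)] by (rule norm_diff_ineq)
        finally show ?thesis by simp
      qed
      then show ?thesis unfolding Q_def i by simp
    qed
  qed
  then obtain c0 where c0: "c0 > 0" "\<forall>i. Q i c0" by blast
  show ?thesis
  proof (intro exI[of _ c0] conjI allI impI c0(1))
    fix m n k :: nat and v :: "'n st"
    assume "1 \<le> m" "1 \<le> n" "m \<noteq> n" "k < d"
    then show "c0 * ?S m n * norm v \<le> real n ^ 4 * norm (qfactor \<rho> (gen_map \<rho> A m) (scal_map g k) n v)"
      by (rule c0(2)[rule_format, of "(m, n, k)", unfolded Q_def prod.case, rule_format])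
  qed
qed

lemma transfer_lower_bound:
  fixes A :: "complex^'n^'n"
  assumes rho: "0 < \<rho>" "\<rho> < 2" and gap: "transfer_gap \<rho> A"
  shows "\<exists>c>0. \<forall>m\<ge>1. \<forall>v. c * norm v \<le> norm (ap (gen_op \<rho> A m * gen_op \<rho> A m + mat_op A) v)"
proof -
  let ?L = "\<lambda>m. ap (\<rho> *\<^sub>R gen_op \<rho> A m + real m ^ 2 *\<^sub>R 1)"
  define Q where "Q m c \<longleftrightarrow> (1 \<le> m \<longrightarrow> (\<forall>v. c * norm v \<le> norm (?L m v)))" for m :: nat and c
  obtain c N0 where c: "c > 0" "\<And>m s v. m \<ge> 1 \<Longrightarrow> s \<ge> 0 \<Longrightarrow> N0 \<le> s + real m ^ 2 \<Longrightarrow>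
      c * (s + real m ^ 2) * norm v \<le> norm (ap (\<rho> *\<^sub>R gen_op \<rho> A m + s *\<^sub>R 1) v)"
    using shifted_modal_lower_bound[OF rho, of A] by blast
  have "\<exists>c>0. \<forall>m. Q m c"
  proof (rule uniform_from_cofinite)
    show "finite {..nat \<lceil>N0\<rceil>}" by simp
    show "0 < c" by fact
    show "Q i c'" if "Q i c" "c' \<le> c" for i c c'
      using that unfolding Q_def by (auto intro: order_trans[OF mult_right_mono])
    show "\<exists>c>0. Q m c" for m
    proof (cases "1 \<le> m")
      case True
      have "inj (?L m)" unfolding linear_injective_0[OF linear_ap]
        using transfer_injective[OF gap rho(1) True] by blast
      from linear_inj_bounded_below_pos[OF linear_ap this]
      obtain e where "e > 0" "\<And>v. e * norm v \<le> norm (?L m v)" by blast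
      then show ?thesis unfolding Q_def by (intro exI[of _ e]) auto
    next
      case False
      then show ?thesis unfolding Q_def by (intro exI[of _ 1]) auto
    qed
    show "Q m c" if "m \<notin> {..nat \<lceil>N0\<rceil>}" for m
      unfolding Q_def
    proof (intro impI allI)
      fix v :: "'n st" assume m: "1 \<le> m"
      have m2: "real m \<le> real m ^ 2" using self_le_power[of "real m" 2] m by simp
      have "N0 \<le> real (nat \<lceil>N0\<rceil>)" by (rule real_nat_ceiling_ge)
      also have "\<dots> \<le> real m" using that by (simp only: of_nat_le_iff atMost_iff not_le less_imp_le)
      finally have "N0 \<le> real m ^ 2 + real m ^ 2" using m2 m by linarith
      then have "c * (real m ^ 2 + real m ^ 2) * norm v \<le> norm (?L m v)"
        by (rule c(2)[OF m zero_le_power2])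
      moreover have "c * norm v \<le> c * (real m ^ 2 + real m ^ 2) * norm v"
      proof (rule mult_right_mono)
        have "1 \<le> real m ^ 2 + real m ^ 2" using m2 m by linarith
        from mult_left_mono[OF this, of c] c(1) show "c \<le> c * (real m ^ 2 + real m ^ 2)" by simp
      qed simp
      ultimately show "c * norm v \<le> norm (?L m v)" by linarith
    qed
  qed
  then obtain c' where c': "c' > 0" "\<And>m v. 1 \<le> m \<Longrightarrow> c' * norm v \<le> norm (?L m v)" unfolding Q_def by blast
  have "c' * norm v \<le> norm (ap (gen_op \<rho> A m * gen_op \<rho> A m + mat_op A) v)" if "m \<ge> 1" for m v
  proof -
    have "norm (?L m v) \<le> real m ^ 2 * norm (?L m v)"
      using that mult_right_mono[of 1 "real m ^ 2" "norm (?L m v)"] by simp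
    with c'(2)[OF that, of v] show ?thesis
      unfolding transfer_operator[OF that] ap.scaleR_left by simp
  qed
  with c'(1) show ?thesis by blast
qed

section \<open>The infinite product on a mode\<close>

lemma sized_modal:
  assumes "0 \<le> \<rho>" "\<And>k. norm (g k) \<le> c"
  shows "sized_module (\<lambda>v b. norm v \<le> b) (gen_map \<rho> A m) (scal_map g) \<rho> (norm (gen_op \<rho> A m)) c"
proof
  show c0: "0 \<le> c" using assms(2)[of 0] norm_ge_zero order_trans by blast
  show "norm (gen_map \<rho> A m x) \<le> norm (gen_op \<rho> A m) * b" if "norm x \<le> b" for x b
    unfolding gen_map_def by (rule order_trans[OF norm_ap mult_left_mono[OF that]]) simp
  show "norm (scal_map g k x) \<le> c * b" if "norm x \<le> b" for x k b
    unfolding scal_map_def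
    by (intro order_trans[OF norm_ap] mult_mono order_trans[OF norm_scal_op] assms(2) that c0 norm_ge_zero)
qed (use assms in \<open>auto intro: order_trans[OF norm_triangle_ineq] add_mono mult_left_mono order_trans[OF norm_ge_zero]\<close>)

text \<open>The exponent lost in the factor of mode \<open>n\<close> when it is inverted on mode \<open>m\<close>. The square root
absorbs a loss of a power of \<open>m\<close> in the \<open>O(m)\<close> factors with \<open>n < \<kappa> m\<close>; beyond them the factor is
close to the identity.\<close>

definition factor_loss :: "nat \<Rightarrow> nat \<Rightarrow> nat \<Rightarrow> real" where
  "factor_loss \<kappa> m n = (if n < \<kappa> * m then sqrt (real m) else 0) + real m powr (3/2) * real n powr (-3/2)"

lemma factor_loss_sum:
  assumes "1 \<le> m"
  shows "(\<Sum>\<nu><K. factor_loss \<kappa> m (Suc \<nu>)) \<le> (real \<kappa> + zeta_three_halves) * real m powr (3/2)"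
proof -
  have "(\<Sum>\<nu><K. if Suc \<nu> < \<kappa> * m then sqrt (real m) else 0) \<le> (\<Sum>\<nu><\<kappa> * m. sqrt (real m))"
  proof -
    have "(\<Sum>\<nu><K. if Suc \<nu> < \<kappa> * m then sqrt (real m) else 0) = (\<Sum>\<nu>\<in>{\<nu>\<in>{..<K}. Suc \<nu> < \<kappa> * m}. sqrt (real m))"
      by (rule sum.inter_filter[symmetric]) simp
    also have "\<dots> \<le> (\<Sum>\<nu><\<kappa> * m. sqrt (real m))" by (intro sum_mono2) auto
    finally show ?thesis .
  qed
  also have "\<dots> = real \<kappa> * (real m powr 1 * real m powr (1/2))"
    using assms by (simp add: powr_half_sqrt)
  also have "real m powr 1 * real m powr (1/2) = real m powr (3/2)"
    by (simp only: powr_add[symmetric]) simp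
  finally have 1: "(\<Sum>\<nu><K. if Suc \<nu> < \<kappa> * m then sqrt (real m) else 0) \<le> real \<kappa> * real m powr (3/2)" .
  have 2: "(\<Sum>\<nu><K. real m powr (3/2) * real (Suc \<nu>) powr (-3/2)) \<le> real m powr (3/2) * zeta_three_halves"
    unfolding sum_distrib_left[symmetric] by (intro mult_left_mono zeta_three_halves_ge) auto
  show ?thesis
    unfolding factor_loss_def sum.distrib using 1 2 by (simp add: algebra_simps)
qed

text \<open>Far from the diagonal the factor is within \<open>O((m/n)\<^sup>2)\<close> of the identity. Near the diagonal a loss of
a power of \<open>m\<close> for each of the \<open>O(m)\<close> factors is affordable: the total loss \<open>exp (- C m\<^sup>3\<^sup>/\<^sup>2)\<close> is
negligible against the dissipation \<open>exp (- c m\<^sup>2)\<close>.\<close>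

lemma qfactor_modal_exp_bound:
  fixes A :: "complex^'n^'n"
  assumes rho: "0 < \<rho>" "\<rho> < 2" and gap: "spectral_gap \<rho> A" and g: "\<And>k. g k \<in> eigenvalues A"
    and gb: "\<And>k. norm (g k) \<le> cg"
  shows "\<exists>C\<ge>0. \<exists>\<kappa>. \<forall>m\<ge>1. \<forall>n\<ge>1. m \<noteq> n \<longrightarrow> (\<forall>k<d. \<forall>v.
    exp (- C * factor_loss \<kappa> m n) * norm v \<le> norm (qfactor \<rho> (gen_map \<rho> A m) (scal_map g k) n v))"
proof -
  obtain c1 where c1: "c1 > 0" "\<forall>m\<ge>1. \<forall>n\<ge>1. m \<noteq> n \<longrightarrow> (\<forall>k<d. \<forall>v.
    c1 * (\<bar>real n ^ 2 - real m ^ 2\<bar> * (real n ^ 2 + real m ^ 2)) * norm v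
      \<le> real n ^ 4 * norm (qfactor \<rho> (gen_map \<rho> A m) (scal_map g k) n v))"
    using qfactor_modal_lower_bound[where g = g and d = d, OF rho gap g gb] by blast
  obtain cM where cM: "cM \<ge> 1" "\<And>m. m \<ge> 1 \<Longrightarrow> norm (gen_op \<rho> A m) \<le> cM * real m ^ 2"
    using norm_gen_op_bound[of \<rho> A] rho by auto
  have cg: "0 \<le> cg" using order_trans[OF norm_ge_zero gb] .
  define C2 where "C2 = cg + \<rho> * cM + cM^2"
  have C2: "0 \<le> C2" using cg rho cM by (simp add: C2_def)
  \<comment> \<open>For \<open>n \<ge> \<kappa> m\<close> the distance from the identity is at most \<open>1/2\<close>.\<close>
  define \<kappa> where "\<kappa> = nat \<lceil>2 * C2\<rceil> + 1"
  have \<kappa>: "1 \<le> \<kappa>" "2 * C2 \<le> real \<kappa>" using real_nat_ceiling_ge[of "2 * C2"] by (simp_all add: \<kappa>_def)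
  define c3 where "c3 = min 1 (c1 / real \<kappa> ^ 4)"
  have c3: "0 < c3" "c3 \<le> 1" using c1(1) \<kappa> by (auto simp: c3_def)
  define C where "C = 2 + ln (1 / c3) + 2 * C2"
  have lnc3: "0 \<le> ln (1 / c3)" using c3 by simp
  have "exp (- C * factor_loss \<kappa> m n) * norm v \<le> norm (qfactor \<rho> (gen_map \<rho> A m) (scal_map g k) n v)"
    if mn: "1 \<le> m" "1 \<le> n" "m \<noteq> n" "k < d" for m n k and v :: "'n st"
  proof (cases "n < \<kappa> * m")
    case True
    let ?s = "sqrt (real m)"
    have s1: "1 \<le> ?s" using mn by simp
    have C0: "0 \<le> C" using lnc3 C2 by (simp add: C_def)
    have "real n ^ 4 * c3 / real m \<le> c1 * (\<bar>real n ^ 2 - real m ^ 2\<bar> * (real n ^ 2 + real m ^ 2))"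
    proof -
      have n: "real n \<le> real \<kappa> * real m" using True by (metis less_imp_le of_nat_le_iff of_nat_mult)
      have "real n ^ 4 \<le> (real \<kappa> * real m) ^ 4" using n by (intro power_mono) auto
      also have "\<dots> = real \<kappa> ^ 4 * real m ^ 4" by (rule power_mult_distrib)
      finally have "real n ^ 4 * c3 \<le> (real \<kappa> ^ 4 * real m ^ 4) * (c1 / real \<kappa> ^ 4)"
        using c3 by (intro mult_mono) (auto simp: c3_def)
      also have "\<dots> = c1 * real m ^ 4" using \<kappa> by simp
      finally have 1: "real n ^ 4 * c3 / real m \<le> c1 * real m ^ 4 / real m"
        by (rule divide_right_mono) simp
      have "\<bar>real n - real m\<bar> \<ge> 1" using mn(3) by linarith
      then have "1 * real m \<le> \<bar>real n - real m\<bar> * (real n + real m)" by (intro mult_mono) auto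
      also have "\<dots> = \<bar>real n ^ 2 - real m ^ 2\<bar>"
        by (simp add: power2_eq_square square_diff_square_factored abs_mult)
      finally have "real m * real m ^ 2 \<le> \<bar>real n ^ 2 - real m ^ 2\<bar> * (real n ^ 2 + real m ^ 2)"
        by (intro mult_mono) auto
      then have "c1 * (real m * real m ^ 2) \<le> c1 * (\<bar>real n ^ 2 - real m ^ 2\<bar> * (real n ^ 2 + real m ^ 2))"
        using c1(1) by (intro mult_left_mono) auto
      moreover have "c1 * real m ^ 4 / real m = c1 * (real m * real m ^ 2)"
        using mn(1) by (simp add: power4_eq_xxxx power2_eq_square)
      ultimately show ?thesis using 1 by linarith
    qed
    then have "real n ^ 4 * c3 / real m * norm v \<le> real n ^ 4 * norm (qfactor \<rho> (gen_map \<rho> A m) (scal_map g k) n v)"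
      by (rule order_trans[OF mult_right_mono[OF _ norm_ge_zero] c1(2)[rule_format, OF mn]])
    then have "real n ^ 4 * (c3 / real m * norm v) \<le> real n ^ 4 * norm (qfactor \<rho> (gen_map \<rho> A m) (scal_map g k) n v)"
      by simp
    then have 2: "c3 / real m * norm v \<le> norm (qfactor \<rho> (gen_map \<rho> A m) (scal_map g k) n v)"
      using mn(2) by (simp only: mult_le_cancel_left_pos zero_less_power of_nat_0_less_iff)
    have "exp (- C * factor_loss \<kappa> m n) \<le> c3 / real m"
    proof -
      have "ln (1 / c3) \<le> ln (1 / c3) * ?s" using lnc3 s1 by (simp add: mult_le_cancel_left1)
      moreover have "2 * ?s + ln (1 / c3) * ?s \<le> C * ?s"
        using C2 s1 by (simp add: C_def distrib_right)
      moreover have "?s \<le> factor_loss \<kappa> m n" using True by (simp add: factor_loss_def)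
      then have "C * ?s \<le> C * factor_loss \<kappa> m n" using C0 by (intro mult_left_mono) auto
      ultimately have "2 * ?s + ln (1 / c3) \<le> C * factor_loss \<kappa> m n" by linarith
      then have "exp (2 * ?s) * (1 / c3) \<le> exp (C * factor_loss \<kappa> m n)"
        using c3 by (metis exp_add exp_le_cancel_iff exp_ln zero_less_divide_1_iff)
      moreover have "real m \<le> exp (2 * ?s)"
      proof -
        have "1 + 2 * ?s + (2 * ?s)^2 / 2 \<le> exp (2 * ?s)" using s1 by (intro exp_lower_Taylor_quadratic) auto
        moreover have "(2 * ?s)^2 / 2 = 2 * real m" by (simp add: power_mult_distrib)
        ultimately show ?thesis using s1 by linarith
      qed
      then have "real m * (1 / c3) \<le> exp (2 * ?s) * (1 / c3)" using c3 by (intro mult_right_mono) auto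
      ultimately have "real m / c3 \<le> exp (C * factor_loss \<kappa> m n)" by simp
      then have "inverse (exp (C * factor_loss \<kappa> m n)) \<le> inverse (real m / c3)"
        using mn(1) c3 by (intro le_imp_inverse_le) auto
      then show ?thesis by (simp add: exp_minus)
    qed
    then have "exp (- C * factor_loss \<kappa> m n) * norm v \<le> c3 / real m * norm v" by (rule mult_right_mono) simp
    with 2 show ?thesis by linarith
  next
    case False
    then have nm: "\<kappa> * m \<le> n" by simp
    then have nm': "m \<le> n" using \<kappa>(1) by (metis mult_le_mono1 nat_mult_1 order_trans)
    have cg': "\<And>k. norm (g k) \<le> cg" by (rule gb)
    interpret sized_module "\<lambda>(v :: 'n st) b. norm v \<le> b" "gen_map \<rho> A m" "scal_map g" \<rho> "norm (gen_op \<rho> A m)" cg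
      using rho by (intro sized_modal cg') auto
    let ?w = "qweight \<rho> cg (norm (gen_op \<rho> A m)) n"
    define q where "q = real m / real n"
    have q: "0 < q" "q \<le> 1" "q * real \<kappa> \<le> 1"
      using mn nm nm' by (auto simp: q_def field_simps simp flip: of_nat_mult)
    have w0: "0 \<le> ?w" using rho cg by (intro qweight_nonneg) auto
    have "?w \<le> C2 * q^2"
    proof -
      have "cg + \<rho> * real n ^ 2 * norm (gen_op \<rho> A m) + norm (gen_op \<rho> A m) ^ 2
          \<le> cg * (real m ^ 2 * real n ^ 2) + \<rho> * real n ^ 2 * (cM * real m ^ 2) + cM^2 * (real m ^ 2 * real n ^ 2)"
      proof (intro add_mono)
        have "1 \<le> real m ^ 2 * real n ^ 2" using mn by (intro mult_ge1_I) auto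
        then show "cg \<le> cg * (real m ^ 2 * real n ^ 2)" using cg mult_left_mono[of 1 _ cg] by simp
        show "\<rho> * real n ^ 2 * norm (gen_op \<rho> A m) \<le> \<rho> * real n ^ 2 * (cM * real m ^ 2)"
          using rho cM(2)[OF mn(1)] by (intro mult_left_mono) auto
        have "norm (gen_op \<rho> A m) ^ 2 \<le> (cM * real m ^ 2) ^ 2" using cM(2)[OF mn(1)] by (intro power_mono) auto
        also have "\<dots> = cM^2 * (real m ^ 2 * real m ^ 2)" by (simp add: power2_eq_square)
        also have "\<dots> \<le> cM^2 * (real m ^ 2 * real n ^ 2)"
          using nm' by (intro mult_left_mono power_mono) auto
        finally show "norm (gen_op \<rho> A m) ^ 2 \<le> cM^2 * (real m ^ 2 * real n ^ 2)" .
      qed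
      also have "\<dots> = C2 * (q^2 * real n ^ 4)"
      proof -
        have "q^2 * real n ^ 4 = real m ^ 2 * real n ^ 2"
          using mn by (simp add: q_def power_divide power4_eq_xxxx power2_eq_square)
        then show ?thesis by (simp add: C2_def algebra_simps)
      qed
      finally show ?thesis
        using mn by (simp add: qweight_def pos_divide_le_eq)
    qed
    moreover have "C2 * q^2 \<le> C2 * q powr (3/2)"
    proof -
      have "q powr 2 \<le> q powr (3/2)" using q by (intro powr_mono') auto
      then show ?thesis using q C2 by (intro mult_left_mono) auto
    qed
    ultimately have w: "?w \<le> C2 * q powr (3/2)" by linarith
    have "2 * (C2 * q^2) \<le> real \<kappa> * q^2" using \<kappa>(2) by (simp add: mult_right_mono flip: mult.assoc)
    also have "\<dots> = (q * real \<kappa>) * q" by (simp add: power2_eq_square)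
    also have "\<dots> \<le> 1 * 1" using q by (intro mult_mono) auto
    finally have wh: "?w \<le> 1 / 2" using \<open>?w \<le> C2 * q^2\<close> by linarith
    have "factor_loss \<kappa> m n = q powr (3/2)"
      using False mn by (simp add: factor_loss_def q_def powr_divide powr_minus_divide)
    then have e1: "2 * ?w \<le> C * factor_loss \<kappa> m n"
    proof -
      have "2 * C2 * q powr (3/2) \<le> C * q powr (3/2)"
        using lnc3 by (intro mult_right_mono) (auto simp: C_def)
      with w \<open>factor_loss \<kappa> m n = q powr (3/2)\<close> show ?thesis by simp
    qed
    have e2: "exp (- (2 * ?w)) \<le> 1 - ?w"
    proof -
      have "1 \<le> (1 - ?w) * (1 + 2 * ?w)"
      proof -
        have "0 \<le> ?w * (1 - 2 * ?w)" using w0 wh by (intro mult_nonneg_nonneg) auto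
        then show ?thesis by (simp add: algebra_simps)
      qed
      also have "\<dots> \<le> (1 - ?w) * exp (2 * ?w)" using wh exp_ge_add_one_self[of "2 * ?w"] by (intro mult_left_mono) auto
      finally have "exp (- (2 * ?w)) * 1 \<le> exp (- (2 * ?w)) * ((1 - ?w) * exp (2 * ?w))" by (intro mult_left_mono) auto
      also have "\<dots> = 1 - ?w" by (simp add: exp_minus)
      finally show ?thesis by simp
    qed
    have "exp (- C * factor_loss \<kappa> m n) \<le> exp (- (2 * ?w))" using e1 by simp
    with e2 have "exp (- C * factor_loss \<kappa> m n) \<le> 1 - ?w" by linarith
    then have "exp (- C * factor_loss \<kappa> m n) * norm v \<le> (1 - ?w) * norm v" by (rule mult_right_mono) simp
    also have "\<dots> = norm v - ?w * norm v" by (simp add: algebra_simps)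
    also have "\<dots> \<le> norm v - norm (qfactor \<rho> (gen_map \<rho> A m) (scal_map g k) n v - v)"
      using qfactor_diff_sized[of v "norm v" k n] by simp
    also have "\<dots> \<le> norm (qfactor \<rho> (gen_map \<rho> A m) (scal_map g k) n v)"
      using norm_triangle_ineq2[of v "v - qfactor \<rho> (gen_map \<rho> A m) (scal_map g k) n v"] by (simp add: norm_minus_commute)
    finally show ?thesis .
  qed
  moreover have "0 \<le> C" using lnc3 C2 by (simp add: C_def)
  ultimately show ?thesis by blast
qed

lemma qproduct_modal_lower_bound:
  fixes A :: "complex^'n^'n"
  assumes rho: "0 < \<rho>" "\<rho> < 2" and gap: "spectral_gap \<rho> A" and g: "\<And>k. g k \<in> eigenvalues A"
    and gb: "\<And>k. norm (g k) \<le> cg"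
  shows "\<exists>C\<ge>0. \<forall>m\<ge>1. \<forall>K v. exp (- C * real m powr (3/2)) * norm v \<le> norm (qproduct \<rho> (gen_map \<rho> A m) (scal_map g) d m K v)"
proof -
  obtain C \<kappa> where C: "C \<ge> 0" and bd: "\<forall>m\<ge>1. \<forall>n\<ge>1. m \<noteq> n \<longrightarrow> (\<forall>k<d. \<forall>v.
    exp (- C * factor_loss \<kappa> m n) * norm v \<le> norm (qfactor \<rho> (gen_map \<rho> A m) (scal_map g k) n v))"
    using qfactor_modal_exp_bound[where g = g and d = d, OF rho gap g gb] by blast
  have st: "exp (- C * factor_loss \<kappa> m n) ^ k * norm v \<le> norm (qfactors \<rho> (gen_map \<rho> A m) (scal_map g) n k v)"
    if mn: "1 \<le> m" "1 \<le> n" "m \<noteq> n" "k \<le> d" for m n k and v :: "'n st"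
    using mn(4)
  proof (induction k)
    case (Suc k)
    have "exp (- C * factor_loss \<kappa> m n) ^ Suc k * norm v = exp (- C * factor_loss \<kappa> m n) * (exp (- C * factor_loss \<kappa> m n) ^ k * norm v)" by simp
    also have "\<dots> \<le> exp (- C * factor_loss \<kappa> m n) * norm (qfactors \<rho> (gen_map \<rho> A m) (scal_map g) n k v)"
      using Suc by (intro mult_left_mono) auto
    also have "\<dots> \<le> norm (qfactors \<rho> (gen_map \<rho> A m) (scal_map g) n (Suc k) v)"
      using bd[rule_format, OF mn(1-3), of k] Suc.prems by simp
    finally show ?case .
  qed simp
  have ph: "exp (- (real d * C * (\<Sum>\<nu><K. factor_loss \<kappa> m (Suc \<nu>)))) * norm v \<le> norm (qproduct \<rho> (gen_map \<rho> A m) (scal_map g) d m K v)"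
    if m: "1 \<le> m" for m K and v :: "'n st"
  proof (induction K)
    case (Suc K)
    let ?x = "qproduct \<rho> (gen_map \<rho> A m) (scal_map g) d m K v"
    let ?o = "factor_loss \<kappa> m (Suc K)" and ?S = "\<Sum>\<nu><K. factor_loss \<kappa> m (Suc \<nu>)"
    have o: "0 \<le> ?o" by (simp add: factor_loss_def)
    have "exp (- (real d * C * (?S + ?o))) * norm v = exp (- C * ?o) ^ d * (exp (- (real d * C * ?S)) * norm v)"
    proof -
      have "- (real d * C * (?S + ?o)) = real d * (- C * ?o) + - (real d * C * ?S)"
        by (simp add: algebra_simps)
      then show ?thesis by (simp only: exp_add exp_of_nat_mult mult.assoc)
    qed
    also have "\<dots> \<le> exp (- C * ?o) ^ d * norm ?x" by (intro mult_left_mono Suc) auto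
    finally have 1: "exp (- (real d * C * (?S + ?o))) * norm v \<le> exp (- C * ?o) ^ d * norm ?x" .
    show ?case
    proof (cases "Suc K = m")
      case True
      have "exp (- C * ?o) ^ d \<le> 1" using C o by (intro power_le_one) auto
      then have "exp (- C * ?o) ^ d * norm ?x \<le> norm ?x" by (rule mult_left_le_one_le[rotated 2]) auto
      moreover have "qproduct \<rho> (gen_map \<rho> A m) (scal_map g) d m (Suc K) v = ?x" by (subst qproduct.simps(2)) (use True in simp)
      ultimately show ?thesis using 1 by simp
    next
      case False
      then show ?thesis using 1 st[OF m, of "Suc K" d ?x] by simp
    qed
  qed simp
  have "exp (- (real d * C * (real \<kappa> + zeta_three_halves)) * real m powr (3/2)) * norm v \<le> norm (qproduct \<rho> (gen_map \<rho> A m) (scal_map g) d m K v)"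
    if m: "1 \<le> m" for m K and v :: "'n st"
  proof -
    have "real d * C * (\<Sum>\<nu><K. factor_loss \<kappa> m (Suc \<nu>)) \<le> real d * C * ((real \<kappa> + zeta_three_halves) * real m powr (3/2))"
      using C by (intro mult_left_mono factor_loss_sum m) auto
    then have "exp (- (real d * C * (real \<kappa> + zeta_three_halves)) * real m powr (3/2)) \<le> exp (- (real d * C * (\<Sum>\<nu><K. factor_loss \<kappa> m (Suc \<nu>))))"
      by (simp add: mult.assoc)
    then show ?thesis using ph[OF m, of K v] by (meson mult_right_mono norm_ge_zero order_trans)
  qed
  moreover have "0 \<le> real d * C * (real \<kappa> + zeta_three_halves)" using C zeta_three_halves_ge_one by simp
  ultimately show ?thesis by blast
qed

text \<open>The lower bound is uniform in the number of factors, so the limit operator \<open>\<Phi>\<^sub>m(M\<^sub>m)\<close> is injective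
on a space of finite dimension, hence onto.\<close>

lemma qproduct_modal_surjective:
  fixes A :: "complex^'n^'n"
  assumes rho: "0 < \<rho>" "\<rho> < 2" and gap: "spectral_gap \<rho> A" and g: "\<And>k. g k \<in> eigenvalues A"
    and gb: "\<And>k. norm (g k) \<le> cg"
  shows "\<exists>C\<ge>0. \<forall>m\<ge>1. \<forall>y. \<exists>z. (\<lambda>K. qproduct \<rho> (gen_map \<rho> A m) (scal_map g) d m K z) \<longlonglongrightarrow> y
     \<and> norm z \<le> exp (C * real m powr (3/2)) * norm y"
proof -
  obtain C where C: "C \<ge> 0" and lb: "\<And>m K v. m \<ge> 1 \<Longrightarrow>
      exp (- C * real m powr (3/2)) * norm v \<le> norm (qproduct \<rho> (gen_map \<rho> A m) (scal_map g) d m K v)"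
    using qproduct_modal_lower_bound[where g = g and d = d, OF rho gap g gb] by blast
  have "\<exists>z. (\<lambda>K. qproduct \<rho> (gen_map \<rho> A m) (scal_map g) d m K z) \<longlonglongrightarrow> y \<and> norm z \<le> exp (C * real m powr (3/2)) * norm y"
    if m: "m \<ge> 1" for m and y :: "'n st"
  proof -
    interpret sized_module "\<lambda>(v :: 'n st) b. norm v \<le> b" "gen_map \<rho> A m" "scal_map g" \<rho> "norm (gen_op \<rho> A m)" cg
      using rho gb by (intro sized_modal) auto
    let ?p = "\<lambda>K v. qproduct \<rho> (gen_map \<rho> A m) (scal_map g) d m K v"
    let ?X = "\<lambda>v. lim (\<lambda>K. ?p K v)"
    have lim: "(\<lambda>K. ?p K v) \<longlonglongrightarrow> ?X v" for v
    proof -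
      have "convergent (\<lambda>K. ?p K v)"
      proof (rule telescoping_converges)
        show "norm (?p (Suc K) v - ?p K v) \<le> ((1 + qweight \<rho> cg (norm (gen_op \<rho> A m)) (Suc K)) ^ d - 1)
          * (exp (order_const \<rho> cg d * (1 + norm (gen_op \<rho> A m)) powr (3/4)) * norm v)" for K
          by (rule qproduct_diff_bound) simp
        show "summable (\<lambda>K. ((1 + qweight \<rho> cg (norm (gen_op \<rho> A m)) (Suc K)) ^ d - 1)
          * (exp (order_const \<rho> cg d * (1 + norm (gen_op \<rho> A m)) powr (3/4)) * norm v))"
          using nonneg by (intro summable_mult2 qweight_summable) auto
      qed
      then show ?thesis by (simp add: convergent_LIMSEQ_iff)
    qed
    have linp: "linear (?p K)" for K by (intro linear_qproduct linear_gen_map linear_scal_map)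
    have "linear ?X"
    proof (rule linearI)
      fix v w :: "'n st" and r :: real
      have "(\<lambda>K. ?p K v + ?p K w) \<longlonglongrightarrow> ?X v + ?X w" by (intro tendsto_add lim)
      then have "(\<lambda>K. ?p K (v + w)) \<longlonglongrightarrow> ?X v + ?X w" by (simp add: linear_add[OF linp])
      then show "?X (v + w) = ?X v + ?X w" by (rule limI)
      have "(\<lambda>K. r *\<^sub>R ?p K v) \<longlonglongrightarrow> r *\<^sub>R ?X v" by (intro tendsto_scaleR tendsto_const lim)
      then have "(\<lambda>K. ?p K (r *\<^sub>R v)) \<longlonglongrightarrow> r *\<^sub>R ?X v" by (simp add: linear_scale[OF linp])
      then show "?X (r *\<^sub>R v) = r *\<^sub>R ?X v" by (rule limI)
    qed
    moreover have Xlb: "exp (- C * real m powr (3/2)) * norm v \<le> norm (?X v)" for v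
      by (rule LIMSEQ_le_const[OF tendsto_norm[OF lim]]) (use lb[OF m] in auto)
    have "inj ?X"
      unfolding linear_injective_0[OF \<open>linear ?X\<close>]
    proof (intro allI impI)
      fix v assume "?X v = 0"
      then have "exp (- C * real m powr (3/2)) * norm v \<le> 0" using Xlb[of v] by simp
      then show "v = 0" by (simp add: mult_le_0_iff)
    qed
    ultimately have "surj ?X" by (rule linear_injective_imp_surjective) (rule refl)
    then obtain z where z: "?X z = y" by (metis surjD)
    have "norm z = exp (C * real m powr (3/2)) * (exp (- C * real m powr (3/2)) * norm z)"
      by (simp add: mult.assoc[symmetric] exp_add[symmetric])
    also have "\<dots> \<le> exp (C * real m powr (3/2)) * norm y" using Xlb[of z] z by (intro mult_left_mono) auto
    finally show ?thesis using lim[of z] z by blast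
  qed
  with C show ?thesis by blast
qed

section \<open>Decay of the modal semigroups\<close>

text \<open>The cross term with weight \<open>\<rho>/2\<close> keeps the form equivalent to the square of the norm, and it transfers
part of the damping of the velocity to the position.\<close>

definition energy :: "real \<Rightarrow> ('n::finite) st \<Rightarrow> real" where
  "energy \<rho> v = fst v \<bullet> fst v + snd v \<bullet> snd v + (\<rho> / 2) * (fst v \<bullet> snd v)"

lemma norm_st: "norm (v :: ('n::finite) st) ^ 2 = norm (fst v) ^ 2 + norm (snd v) ^ 2"
  by (cases v) (simp add: norm_Pair)

lemma inner_bound: "\<bar>a \<bullet> b\<bar> \<le> (norm a ^ 2 + norm b ^ 2) / 2"
proof -
  have "0 \<le> (norm a - norm b)^2" by simp
  then have "norm a * norm b \<le> (norm a ^ 2 + norm b ^ 2) / 2" by (simp add: power2_eq_square algebra_simps)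
  with Cauchy_Schwarz_ineq2[of a b] show ?thesis by linarith
qed

lemma energy_bounds:
  assumes "0 < \<rho>" "\<rho> < 2"
  shows "norm v ^ 2 / 2 \<le> energy \<rho> v" "energy \<rho> v \<le> 3 / 2 * norm v ^ 2"
proof -
  have "\<bar>(\<rho> / 2) * (fst v \<bullet> snd v)\<bar> \<le> 1 * ((norm (fst v) ^ 2 + norm (snd v) ^ 2) / 2)"
    unfolding abs_mult using assms inner_bound[of "fst v" "snd v"] by (intro mult_mono) auto
  then have 1: "\<bar>(\<rho> / 2) * (fst v \<bullet> snd v)\<bar> \<le> norm v ^ 2 / 2" by (simp only: norm_st mult_1)
  have 2: "energy \<rho> v = norm v ^ 2 + (\<rho> / 2) * (fst v \<bullet> snd v)"
    by (simp add: energy_def norm_st power2_norm_eq_inner)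
  show "norm v ^ 2 / 2 \<le> energy \<rho> v" using 1 unfolding 2 by linarith
  show "energy \<rho> v \<le> 3 / 2 * norm v ^ 2" using 1 unfolding 2 by linarith
qed

definition energy_rate :: "real \<Rightarrow> ('n::finite) st \<Rightarrow> 'n st \<Rightarrow> real" where
  "energy_rate \<rho> v w = 2 * (fst v \<bullet> fst w) + 2 * (snd v \<bullet> snd w) + (\<rho> / 2) * (fst w \<bullet> snd v + fst v \<bullet> snd w)"

lemma energy_has_derivative:
  assumes "(y has_vector_derivative w) (at t)"
  shows "((\<lambda>t. energy \<rho> (y t)) has_real_derivative energy_rate \<rho> (y t) w) (at t)"
proof -
  have f: "((\<lambda>t. fst (y t)) has_vector_derivative fst w) (at t)"
    by (rule bounded_linear.has_vector_derivative[OF bounded_linear_fst assms])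
  have s: "((\<lambda>t. snd (y t)) has_vector_derivative snd w) (at t)"
    by (rule bounded_linear.has_vector_derivative[OF bounded_linear_snd assms])
  have i: "((\<lambda>t. p t \<bullet> q t) has_real_derivative p t \<bullet> q' + p' \<bullet> q t) (at t)"
    if "(p has_vector_derivative p') (at t)" "(q has_vector_derivative q') (at t)" for p q :: "real \<Rightarrow> complex^'a" and p' q'
    using bounded_bilinear.has_vector_derivative[OF bounded_bilinear_inner that]
    by (simp add: has_real_derivative_iff_has_vector_derivative)
  show ?thesis unfolding energy_def energy_rate_def
    by (rule DERIV_cong[OF DERIV_add[OF DERIV_add[OF i[OF f f] i[OF s s]] DERIV_cmult[OF i[OF f s]]]])
      (simp add: inner_commute algebra_simps)
qed

text \<open>The cross term turns the damping of the velocity into damping of the whole energy at the rate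
\<open>m\<^sup>2\<close>; the matrix \<open>A\<close> only contributes a bounded rate.\<close>

lemma energy_dissipation:
  fixes A :: "complex^'n^'n"
  assumes rho: "0 < \<rho>" "\<rho> < 2" and cA: "0 \<le> cA" "\<And>x. norm (A *v x) \<le> cA * norm x" and m: "m \<ge> 1"
  shows "energy_rate \<rho> v (ap (gen_op \<rho> A m) v) \<le> (4 * cA - \<rho> / 6 * real m ^ 2) * energy \<rho> v"
proof -
  obtain a b where v: "v = (a, b)" by (cases v)
  let ?M = "real m ^ 2"
  have M: "1 \<le> ?M" using m by simp
  have Mi: "inverse ?M \<le> 1" using M by (simp add: inverse_le_1_iff)
  have split: "energy_rate \<rho> v (ap (gen_op \<rho> A m) v)
     = ?M * (- (3 / 2 * \<rho>) * (b \<bullet> b) - \<rho> / 2 * (a \<bullet> a) - \<rho>^2 / 2 * (a \<bullet> b))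
      - inverse ?M * (2 * (b \<bullet> (A *v a)) + \<rho> / 2 * (a \<bullet> (A *v a)))"
    unfolding v energy_rate_def ap_gen_op
    by (simp add: inner_diff_right inner_commute[of b a] power2_eq_square algebra_simps)
  have nv: "norm v ^ 2 = norm a ^ 2 + norm b ^ 2" by (simp add: norm_st v)
  have cross: "- (\<rho>^2 / 2 * (a \<bullet> b)) \<le> \<rho> * (norm a ^ 2 / 4 + norm b ^ 2)"
  proof -
    have "\<rho>^2 / 2 \<le> \<rho>" using rho by (simp add: power2_eq_square)
    then have "\<rho>^2 / 2 * \<bar>a \<bullet> b\<bar> \<le> \<rho> * (norm a * norm b)"
      using Cauchy_Schwarz_ineq2[of a b] rho by (intro mult_mono) auto
    also have "norm a * norm b \<le> norm a ^ 2 / 4 + norm b ^ 2"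
    proof -
      have "0 \<le> (norm a / 2 - norm b)^2" by simp
      then show ?thesis by (simp add: power2_eq_square algebra_simps)
    qed
    finally have "\<rho>^2 / 2 * \<bar>a \<bullet> b\<bar> \<le> \<rho> * (norm a ^ 2 / 4 + norm b ^ 2)" using rho by simp
    moreover have "- (\<rho>^2 / 2 * (a \<bullet> b)) \<le> \<rho>^2 / 2 * \<bar>a \<bullet> b\<bar>"
      using abs_ge_minus_self[of "\<rho>^2 / 2 * (a \<bullet> b)"] rho by (simp add: abs_mult)
    ultimately show ?thesis by linarith
  qed
  have 1: "- (3 / 2 * \<rho>) * (b \<bullet> b) - \<rho> / 2 * (a \<bullet> a) - \<rho>^2 / 2 * (a \<bullet> b) \<le> - (\<rho> / 4) * norm v ^ 2"
  proof -
    have "0 \<le> \<rho> * norm b ^ 2" using rho by simp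
    with cross show ?thesis
      unfolding nv power2_norm_eq_inner[symmetric] by (simp add: algebra_simps)
  qed
  have "\<bar>2 * (b \<bullet> (A *v a)) + \<rho> / 2 * (a \<bullet> (A *v a))\<bar> \<le> 2 * cA * norm v ^ 2"
  proof -
    have "\<bar>b \<bullet> (A *v a)\<bar> \<le> norm b * (cA * norm a)"
      by (rule order_trans[OF Cauchy_Schwarz_ineq2 mult_left_mono[OF cA(2)]]) simp
    also have "\<dots> \<le> cA * (norm v ^ 2 / 2)"
    proof -
      have "0 \<le> (norm a - norm b)^2" by simp
      then have "norm b * norm a \<le> norm v ^ 2 / 2" unfolding nv by (simp add: power2_eq_square algebra_simps)
      from mult_left_mono[OF this cA(1)] show ?thesis by (simp add: mult_ac)
    qed
    finally have x: "\<bar>b \<bullet> (A *v a)\<bar> \<le> cA * (norm v ^ 2 / 2)" .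
    have "\<bar>a \<bullet> (A *v a)\<bar> \<le> norm a * (cA * norm a)"
      by (rule order_trans[OF Cauchy_Schwarz_ineq2 mult_left_mono[OF cA(2)]]) simp
    also have "\<dots> = cA * norm a ^ 2" by (simp add: power2_eq_square)
    also have "\<dots> \<le> cA * norm v ^ 2" unfolding nv using cA by (intro mult_left_mono) auto
    finally have y: "\<rho> / 2 * \<bar>a \<bullet> (A *v a)\<bar> \<le> 1 * (cA * norm v ^ 2)"
      using rho by (intro mult_mono) auto
    have "\<bar>2 * (b \<bullet> (A *v a)) + \<rho> / 2 * (a \<bullet> (A *v a))\<bar> \<le> 2 * \<bar>b \<bullet> (A *v a)\<bar> + \<rho> / 2 * \<bar>a \<bullet> (A *v a)\<bar>"
      using abs_triangle_ineq[of "2 * (b \<bullet> (A *v a))" "\<rho> / 2 * (a \<bullet> (A *v a))"] rho by (simp add: abs_mult)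
    with x y show ?thesis by linarith
  qed
  then have "inverse ?M * \<bar>2 * (b \<bullet> (A *v a)) + \<rho> / 2 * (a \<bullet> (A *v a))\<bar> \<le> 1 * (2 * cA * norm v ^ 2)"
    using Mi by (intro mult_mono) auto
  moreover have "- (inverse ?M * (2 * (b \<bullet> (A *v a)) + \<rho> / 2 * (a \<bullet> (A *v a))))
     \<le> inverse ?M * \<bar>2 * (b \<bullet> (A *v a)) + \<rho> / 2 * (a \<bullet> (A *v a))\<bar>"
    using abs_ge_minus_self[of "inverse ?M * (2 * (b \<bullet> (A *v a)) + \<rho> / 2 * (a \<bullet> (A *v a)))"] by (simp add: abs_mult)
  moreover have "?M * (- (3 / 2 * \<rho>) * (b \<bullet> b) - \<rho> / 2 * (a \<bullet> a) - \<rho>^2 / 2 * (a \<bullet> b)) \<le> ?M * (- (\<rho> / 4) * norm v ^ 2)"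
    by (rule mult_left_mono[OF 1]) simp
  ultimately have "energy_rate \<rho> v (ap (gen_op \<rho> A m) v) \<le> - (\<rho> / 4) * ?M * norm v ^ 2 + 2 * cA * norm v ^ 2"
    unfolding split by (simp add: mult_ac)
  moreover have "2 * cA * norm v ^ 2 \<le> 4 * cA * energy \<rho> v"
    using mult_left_mono[OF energy_bounds(1)[OF rho, of v], of "4 * cA"] cA by simp
  moreover have "\<rho> / 6 * ?M * energy \<rho> v \<le> \<rho> / 6 * ?M * (3 / 2 * norm v ^ 2)"
    using rho by (intro mult_left_mono energy_bounds rho) auto
  ultimately show ?thesis by (simp add: algebra_simps)
qed

lemma modal_semigroup_decay:
  fixes A :: "complex^'n^'n"
  assumes rho: "0 < \<rho>" "\<rho> < 2"
  shows "\<exists>c>0. \<exists>C\<ge>0. \<forall>m\<ge>1. \<forall>t\<ge>0. norm (exp (t *\<^sub>R gen_op \<rho> A m)) \<le> 2 * exp ((C - c * real m ^ 2) * t)"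
proof -
  obtain cA where cA: "cA \<ge> 0" "\<And>x. norm (A *v x) \<le> cA * norm x"
    using matrix_bound[of A] by blast
  have "norm (exp (t *\<^sub>R gen_op \<rho> A m)) \<le> 2 * exp ((2 * cA - \<rho> / 12 * real m ^ 2) * t)"
    if m: "m \<ge> 1" and t: "t \<ge> 0" for m t
  proof (rule norm_eop_bound)
    fix v :: "'n st"
    let ?M = "gen_op \<rho> A m"
    define l where "l = 4 * cA - \<rho> / 6 * real m ^ 2"
    define y where "y s = ap (exp (s *\<^sub>R ?M)) v" for s
    have dy: "(y has_vector_derivative ap ?M (y s)) (at s)" for s
      unfolding y_def ap_mult[symmetric]
      by (rule bounded_linear.has_vector_derivative[OF ap.bounded_linear_left exp_scaleR_has_vector_derivative_left])
    let ?F = "\<lambda>s. exp (- l * s) * energy \<rho> (y s)"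
    have F: "(?F has_real_derivative (exp (- l * s) * (energy_rate \<rho> (y s) (ap ?M (y s)) - l * energy \<rho> (y s)))) (at s)" for s
      by (rule DERIV_cong[OF DERIV_mult[OF _ energy_has_derivative[OF dy]]])
        (auto intro!: derivative_eq_intros simp: algebra_simps)
    have "?F t \<le> ?F 0"
    proof (rule DERIV_nonpos_imp_nonincreasing[OF t])
      fix s
      have "energy_rate \<rho> (y s) (ap ?M (y s)) - l * energy \<rho> (y s) \<le> 0"
        using energy_dissipation[OF rho cA m, of "y s"] by (simp add: l_def)
      then have "exp (- l * s) * (energy_rate \<rho> (y s) (ap ?M (y s)) - l * energy \<rho> (y s)) \<le> 0"
        by (simp add: mult_le_0_iff)
      with F show "\<exists>y'. (?F has_real_derivative y') (at s) \<and> y' \<le> 0" by blast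
    qed
    then have "exp (- l * t) * energy \<rho> (y t) \<le> energy \<rho> v" by (simp add: y_def)
    then have "exp (l * t) * (exp (- l * t) * energy \<rho> (y t)) \<le> exp (l * t) * energy \<rho> v"
      by (intro mult_left_mono) auto
    then have "energy \<rho> (y t) \<le> exp (l * t) * energy \<rho> v"
      by (simp add: mult.assoc[symmetric] exp_add[symmetric])
    also have "\<dots> \<le> exp (l * t) * (3 / 2 * norm v ^ 2)" by (intro mult_left_mono energy_bounds rho) auto
    finally have "norm (y t) ^ 2 \<le> 3 * exp (l * t) * norm v ^ 2" using energy_bounds(1)[OF rho, of "y t"] by linarith
    also have "\<dots> \<le> 4 * exp (l * t) * norm v ^ 2" by (intro mult_right_mono) auto
    also have "\<dots> = (2 * exp ((2 * cA - \<rho> / 12 * real m ^ 2) * t) * norm v) ^ 2"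
    proof -
      have "exp (l * t) = exp ((2 * cA - \<rho> / 12 * real m ^ 2) * t) ^ 2"
        by (simp add: l_def algebra_simps flip: exp_of_nat_mult)
      then show ?thesis by (simp add: power_mult_distrib)
    qed
    finally show "norm (ap (exp (t *\<^sub>R ?M)) v) \<le> 2 * exp ((2 * cA - \<rho> / 12 * real m ^ 2) * t) * norm v"
      unfolding y_def[symmetric] by (rule power2_le_imp_le) auto
  qed simp
  then show ?thesis using rho cA(1) by (intro exI[of _ "\<rho> / 12"] conjI exI[of _ "2 * cA"]) auto
qed

section \<open>Sine series\<close>

lemma dom_continuous:
  fixes g :: "real \<Rightarrow> 'a::euclidean_space"
  assumes "continuous_on {0..pi} g"
  shows "integrable dom_measure g" "(LINT x|dom_measure. g x) = integral {0..pi} g"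
proof -
  have "g absolutely_integrable_on {0..pi}"
    using assms by (rule absolutely_integrable_continuous_real)
  then have "g absolutely_integrable_on {0<..<pi}"
    by (rule set_integrable_subset) auto
  then show i: "integrable dom_measure g"
    by (simp add: set_integrable_def integrable_restrict_space)
  then have "(LINT x|dom_measure. g x) = integral {0<..<pi} g"
    by (intro lebesgue_integral_eq_integral) auto
  then show "(LINT x|dom_measure. g x) = integral {0..pi} g"
    by (simp add: integral_open_interval_real)
qed

lemma dom_measurable: "continuous_on UNIV g \<Longrightarrow> g \<in> borel_measurable dom_measure"
  for g :: "real \<Rightarrow> 'a::euclidean_space"
  by (intro continuous_imp_measurable_on_sets_lebesgue) (auto intro: continuous_on_subset)

interpretation dom: finite_measure dom_measure
  by (rule finite_measureI) (simp add: emeasure_restrict_space)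

lemma sine_mode_continuous: "continuous_on S (sine_mode m)"
  unfolding sine_mode_def by (intro continuous_intros)

lemma sine_mode_bound: "\<bar>sine_mode m x\<bar> \<le> 1"
proof -
  have "sqrt (2 / pi) \<le> 1" using pi_ge_two by simp
  then have "sqrt (2 / pi) * \<bar>sin (real m * x)\<bar> \<le> 1 * 1" by (intro mult_mono) auto
  then show ?thesis by (simp add: sine_mode_def abs_mult)
qed

lemma integral_cos:
  "integral {0..pi} (\<lambda>x. cos (of_int k * x)) = (if k = 0 then pi else 0)"
proof (cases "k = 0")
  case False
  have "((\<lambda>x. cos (of_int k * x)) has_integral (sin (of_int k * pi) / of_int k - sin (of_int k * 0) / of_int k)) {0..pi}"
    using False
    by (intro fundamental_theorem_of_calculus)
      (auto intro!: derivative_eq_intros simp: has_real_derivative_iff_has_vector_derivative[symmetric])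
  then show ?thesis using False by (simp add: integral_unique sin_integer_2pi sin_zero_iff_int2 mult.commute)
qed simp

lemma sine_orthonormal:
  assumes "1 \<le> m" "1 \<le> n"
  shows "(LINT x|dom_measure. sine_mode m x * sine_mode n x) = (if m = n then 1 else 0)"
proof -
  let ?c = "\<lambda>k x. cos (of_int k * x :: real)"
  have prod: "(\<lambda>x. sine_mode m x * sine_mode n x) = (\<lambda>x. 1 / pi * (?c (int m - int n) x - ?c (int m + int n) x))"
  proof
    fix x
    have q: "sqrt (2 / pi) * sqrt (2 / pi) = 2 / pi" by simp
    have "sine_mode m x * sine_mode n x = (sqrt (2 / pi) * sqrt (2 / pi)) * (sin (real m * x) * sin (real n * x))"
      unfolding sine_mode_def by (simp only: mult_ac)
    also have "\<dots> = 2 / pi * (sin (real m * x) * sin (real n * x))" unfolding q ..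
    also have "\<dots> = 1 / pi * (?c (int m - int n) x - ?c (int m + int n) x)"
      by (simp add: sin_times_sin left_diff_distrib distrib_right field_simps)
    finally show "sine_mode m x * sine_mode n x = 1 / pi * (?c (int m - int n) x - ?c (int m + int n) x)" .
  qed
  have "(LINT x|dom_measure. sine_mode m x * sine_mode n x) = integral {0..pi} (\<lambda>x. sine_mode m x * sine_mode n x)"
    by (intro dom_continuous continuous_intros sine_mode_continuous)
  also have "\<dots> = integral {0..pi} (\<lambda>x. 1 / pi * (?c (int m - int n) x - ?c (int m + int n) x))"
    by (simp only: prod)
  also have "\<dots> = 1 / pi * (integral {0..pi} (?c (int m - int n)) - integral {0..pi} (?c (int m + int n)))"
    by (subst integral_diff[symmetric]) (auto intro!: integrable_continuous_real continuous_intros)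
  also have "\<dots> = (if m = n then 1 else 0)"
    unfolding integral_cos using assms by auto
  finally show ?thesis .
qed

definition L2dom :: "(real \<Rightarrow> complex^'n) \<Rightarrow> bool" where
  "L2dom y \<longleftrightarrow> y \<in> borel_measurable dom_measure \<and> integrable dom_measure (\<lambda>x. (norm (y x))\<^sup>2)"

lemma X_space_L2: "y \<in> X_space s \<Longrightarrow> L2dom y"
  by (simp add: X_space_def L2dom_def)

lemma L2dom_bounded_continuous:
  assumes "continuous_on UNIV y"
  shows "L2dom y"
  unfolding L2dom_def using assms dom_measurable[OF assms]
  by (auto intro!: dom_continuous(1) continuous_intros intro: continuous_on_subset)

lemma norm_add_squared: "(norm (y + z))\<^sup>2 \<le> 2 * (norm y)\<^sup>2 + 2 * (norm (z :: 'a::real_normed_vector))\<^sup>2"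
proof -
  have "(norm (y + z))\<^sup>2 \<le> (norm y + norm z)\<^sup>2" by (intro power_mono norm_triangle_ineq) auto
  also have "\<dots> \<le> 2 * (norm y)\<^sup>2 + 2 * (norm z)\<^sup>2"
    using zero_le_power2[of "norm y - norm z"] by (simp add: power2_eq_square algebra_simps)
  finally show ?thesis .
qed

lemma L2dom_add:
  assumes "L2dom y" "L2dom z"
  shows "L2dom (\<lambda>x. y x + z x)"
  unfolding L2dom_def
proof
  show m: "(\<lambda>x. y x + z x) \<in> borel_measurable dom_measure"
    using assms unfolding L2dom_def by (intro borel_measurable_add) auto
  show "integrable dom_measure (\<lambda>x. (norm (y x + z x))\<^sup>2)"
  proof (rule Bochner_Integration.integrable_bound)
    show "integrable dom_measure (\<lambda>x. 2 * (norm (y x))\<^sup>2 + 2 * (norm (z x))\<^sup>2)"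
      using assms unfolding L2dom_def by (intro Bochner_Integration.integrable_add integrable_mult_right) auto
    show "(\<lambda>x. (norm (y x + z x))\<^sup>2) \<in> borel_measurable dom_measure"
      by (intro borel_measurable_power measurable_compose[OF m borel_measurable_norm])
  qed (auto simp: norm_add_squared)
qed

lemma L2dom_scaleR:
  assumes "L2dom y"
  shows "L2dom (\<lambda>x. r *\<^sub>R y x)"
  using assms unfolding L2dom_def by (auto simp: power_mult_distrib intro!: borel_measurable_scaleR)

lemma L2dom_diff: "L2dom y \<Longrightarrow> L2dom z \<Longrightarrow> L2dom (\<lambda>x. y x - z x)"
  using L2dom_add[of y "\<lambda>x. (- 1) *\<^sub>R z x"] L2dom_scaleR[of z "- 1"] by simp

lemma L2dom_integrable:
  assumes "L2dom y"
  shows "integrable dom_measure (\<lambda>x. sine_mode m x *\<^sub>R y x)"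
proof (rule Bochner_Integration.integrable_bound)
  show "integrable dom_measure (\<lambda>x. 1 + (norm (y x))\<^sup>2)"
    using assms unfolding L2dom_def by (intro Bochner_Integration.integrable_add) auto
  show "(\<lambda>x. sine_mode m x *\<^sub>R y x) \<in> borel_measurable dom_measure"
    using assms unfolding L2dom_def
    by (intro borel_measurable_scaleR dom_measurable[OF sine_mode_continuous]) auto
  have "norm (sine_mode m x *\<^sub>R y x) \<le> 1 + (norm (y x))\<^sup>2" for x
  proof -
    have "norm (sine_mode m x *\<^sub>R y x) \<le> 1 * norm (y x)"
      unfolding norm_scaleR by (intro mult_right_mono sine_mode_bound) auto
    also have "\<dots> \<le> 1 + (norm (y x))\<^sup>2"
    proof -
      have "2 * norm (y x) \<le> 1 + (norm (y x))\<^sup>2"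
        using zero_le_power2[of "norm (y x) - 1"] by (simp add: power2_eq_square algebra_simps)
      then show ?thesis using norm_ge_zero[of "y x"] by linarith
    qed
    finally show ?thesis .
  qed
  then show "AE x in dom_measure. norm (sine_mode m x *\<^sub>R y x) \<le> norm (1 + (norm (y x))\<^sup>2)"
    by (intro AE_I2) (simp add: add_nonneg_nonneg)
qed

lemma sine_coeff_diff: "L2dom y \<Longrightarrow> L2dom z \<Longrightarrow> sine_coeff (\<lambda>x. y x - z x) m = sine_coeff y m - sine_coeff z m"
  unfolding sine_coeff_def scaleR_diff_right
  by (rule Bochner_Integration.integral_diff) (auto intro: L2dom_integrable)

lemma sine_coeff_scaleR: "sine_coeff (\<lambda>x. r *\<^sub>R y x) m = r *\<^sub>R sine_coeff y m"
  unfolding sine_coeff_def scaleR_left_commute[of _ r]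
  by (rule Bochner_Integration.integral_scaleR_right)

lemma spec_space_diff:
  assumes "c \<in> spec_space s" "c' \<in> spec_space s"
  shows "(\<lambda>m. c m - c' m) \<in> spec_space s"
proof -
  let ?w = "\<lambda>k. real (Suc k) powr (2 * s)"
  have "summable (\<lambda>k. 2 * (?w k * (norm (c (Suc k)))\<^sup>2) + 2 * (?w k * (norm (c' (Suc k)))\<^sup>2))"
    using assms unfolding spec_space_def by (intro summable_add summable_mult) auto
  moreover have "norm (?w k * (norm (c (Suc k) - c' (Suc k)))\<^sup>2)
     \<le> 2 * (?w k * (norm (c (Suc k)))\<^sup>2) + 2 * (?w k * (norm (c' (Suc k)))\<^sup>2)" for k
    using mult_left_mono[OF norm_add_squared[of "c (Suc k)" "- c' (Suc k)"], of "?w k"]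
    by (simp add: algebra_simps)
  ultimately show ?thesis unfolding spec_space_def by (auto intro: summable_comparison_test')
qed

lemma spec_space_scaleR: "c \<in> spec_space s \<Longrightarrow> (\<lambda>m. r *\<^sub>R c m) \<in> spec_space s"
  unfolding spec_space_def
  by (auto simp: power_mult_distrib mult.left_commute[of _ "r\<^sup>2"] intro!: summable_mult)

lemma spec_space_cong: "(\<And>m. c (Suc m) = c' (Suc m)) \<Longrightarrow> c \<in> spec_space s \<longleftrightarrow> c' \<in> spec_space s"
  by (simp add: spec_space_def)

lemma spec_norm_cong: "(\<And>m. c (Suc m) = c' (Suc m)) \<Longrightarrow> spec_norm s c = spec_norm s c'"
  by (simp add: spec_norm_def)

lemma spec_norm_coeff:
  assumes "c \<in> spec_space s" "1 \<le> m"
  shows "real m powr s * norm (c m) \<le> spec_norm s c"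
proof -
  obtain k where m: "m = Suc k" using assms(2) by (cases m) auto
  have "(real m powr s * norm (c m))\<^sup>2 = real (Suc k) powr (2 * s) * (norm (c (Suc k)))\<^sup>2"
    unfolding m by (simp add: power_mult_distrib powr_power mult.commute)
  also have "\<dots> \<le> (\<Sum>k. real (Suc k) powr (2 * s) * (norm (c (Suc k)))\<^sup>2)"
    using assms(1) unfolding spec_space_def by (intro sum_le_suminf[of _ "{k}", simplified]) auto
  finally show ?thesis unfolding spec_norm_def by (rule real_le_rsqrt)
qed

text \<open>Converges uniformly for coefficients in \<open>spec_space s\<close> with \<open>s \<ge> 1\<close>, hence is defined pointwise.\<close>

definition sine_series :: "(nat \<Rightarrow> complex^'n) \<Rightarrow> real \<Rightarrow> complex^'n" where
  "sine_series c x = (\<Sum>k. sine_mode (Suc k) x *\<^sub>R c (Suc k))"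

lemma spec_space_summable:
  assumes "c \<in> spec_space s" "1 \<le> s"
  shows "summable (\<lambda>k. norm (c (Suc k)))"
proof (rule summable_comparison_test'[of "\<lambda>k. real (Suc k) powr (2 * s) * (norm (c (Suc k)))\<^sup>2 + 1 / real (Suc k) ^ 2" 0])
  show "summable (\<lambda>k. real (Suc k) powr (2 * s) * (norm (c (Suc k)))\<^sup>2 + 1 / real (Suc k) ^ 2)"
    using assms(1) summable_inverse_squares unfolding spec_space_def by (intro summable_add) auto
  fix k
  let ?q = "real (Suc k)"
  have "(q * n - 1 / q)\<^sup>2 = q ^ 2 * n\<^sup>2 + 1 / q ^ 2 - 2 * n" if "0 < q" for q n :: real
    using that by (simp add: power2_eq_square field_simps)
  from this[of ?q "norm (c (Suc k))"]
  have "0 \<le> ?q ^ 2 * (norm (c (Suc k)))\<^sup>2 + 1 / ?q ^ 2 - 2 * norm (c (Suc k))"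
    by (metis of_nat_0_less_iff zero_le_power2 zero_less_Suc)
  then have *: "norm (c (Suc k)) \<le> ?q ^ 2 * (norm (c (Suc k)))\<^sup>2 + 1 / ?q ^ 2"
    using norm_ge_zero[of "c (Suc k)"] by linarith
  have "?q ^ 2 = ?q powr 2" by (simp del: of_nat_Suc)
  also have "\<dots> \<le> ?q powr (2 * s)" using assms(2) by (intro powr_mono) auto
  finally have "?q ^ 2 * (norm (c (Suc k)))\<^sup>2 \<le> ?q powr (2 * s) * (norm (c (Suc k)))\<^sup>2"
    by (rule mult_right_mono) simp
  with * show "norm (norm (c (Suc k))) \<le> ?q powr (2 * s) * (norm (c (Suc k)))\<^sup>2 + 1 / ?q ^ 2"
    by (simp del: of_nat_Suc)
qed

lemma sine_series_term_bound: "norm (sine_mode (Suc k) x *\<^sub>R c (Suc k)) \<le> norm (c (Suc k))"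
  using mult_right_mono[OF sine_mode_bound[of "Suc k" x], of "norm (c (Suc k))"] by simp

lemma sine_series_uniform_limit:
  assumes "summable (\<lambda>k. norm (c (Suc k)))"
  shows "uniform_limit UNIV (\<lambda>n x. \<Sum>k<n. sine_mode (Suc k) x *\<^sub>R c (Suc k)) (sine_series c) sequentially"
  unfolding sine_series_def[abs_def] by (rule Weierstrass_m_test[OF _ assms]) (rule sine_series_term_bound)

lemma sine_series_continuous:
  assumes "summable (\<lambda>k. norm (c (Suc k)))"
  shows "continuous_on UNIV (sine_series c)"
  by (rule uniform_limit_theorem[OF always_eventually sine_series_uniform_limit[OF assms]])
    (auto intro!: continuous_intros sine_mode_continuous)

lemma sine_coeff_sine_series:
  assumes "summable (\<lambda>k. norm (c (Suc k)))" "1 \<le> m"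
  shows "sine_coeff (sine_series c) m = c m"
proof -
  let ?t = "\<lambda>k x. sine_mode m x *\<^sub>R (sine_mode (Suc k) x *\<^sub>R c (Suc k))"
  have int: "integrable dom_measure (?t k)" for k
    by (intro dom_continuous(1) continuous_intros sine_mode_continuous)
  have nb: "norm (?t k x) \<le> norm (c (Suc k))" for k x
    using mult_mono[OF sine_mode_bound[of m x] sine_series_term_bound[of k x c]] by (simp add: abs_mult)
  have sm: "summable (\<lambda>k. norm (?t k x))" for x
    by (rule summable_comparison_test'[OF assms(1)]) (use nb in simp)
  have "(LINT x|dom_measure. norm (?t k x)) \<le> pi * norm (c (Suc k))" for k
  proof -
    have "(LINT x|dom_measure. norm (?t k x)) \<le> (LINT x|dom_measure. norm (c (Suc k)))"
      by (intro integral_mono integrable_norm int dom.integrable_const nb)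
    then show ?thesis by (simp add: measure_restrict_space)
  qed
  then have "summable (\<lambda>k. (LINT x|dom_measure. norm (?t k x)))"
    by (intro summable_comparison_test'[OF summable_mult[OF assms(1), of pi], of 0]) auto
  then have "(LINT x|dom_measure. (\<Sum>k. ?t k x)) = (\<Sum>k. (LINT x|dom_measure. ?t k x))"
    using int sm by (intro integral_suminf) auto
  moreover have "(\<Sum>k. ?t k x) = sine_mode m x *\<^sub>R sine_series c x" for x
  proof -
    have "summable (\<lambda>k. sine_mode (Suc k) x *\<^sub>R c (Suc k))"
      by (rule summable_comparison_test'[OF assms(1), of 0]) (rule sine_series_term_bound)
    from suminf_scaleR_right[OF this] show ?thesis by (simp add: sine_series_def)
  qed
  moreover have "(LINT x|dom_measure. ?t k x) = (if k = m - 1 then c m else 0)" for k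
  proof -
    have "(LINT x|dom_measure. ?t k x) = (LINT x|dom_measure. sine_mode m x * sine_mode (Suc k) x) *\<^sub>R c (Suc k)"
      unfolding scaleR_scaleR
      by (rule integral_scaleR_left) (intro dom_continuous(1) continuous_intros sine_mode_continuous)
    also have "\<dots> = (if k = m - 1 then c m else 0)"
      using assms(2) by (subst sine_orthonormal) auto
    finally show ?thesis .
  qed
  moreover have "(\<Sum>k. if k = m - 1 then c m else 0) = c m"
    by (rule sums_unique[OF sums_single[of "m - 1" "\<lambda>_. c m"], symmetric])
  ultimately show ?thesis by (simp add: sine_coeff_def)
qed

text \<open>For coefficients in \<open>spec_space s\<close> with \<open>s \<ge> 1\<close> the partial sums converge uniformly, hence in the mean,
and orthonormality recovers the coefficients.\<close>

lemma sine_series_X_space: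
  assumes "c \<in> spec_space s" "1 \<le> s"
  shows "sine_series c \<in> X_space s"
proof -
  have sm: "summable (\<lambda>k. norm (c (Suc k)))" by (rule spec_space_summable[OF assms])
  have cont: "continuous_on UNIV (sine_series c)" by (rule sine_series_continuous[OF sm])
  have coeff: "sine_coeff (sine_series c) m = c m" if "1 \<le> m" for m by (rule sine_coeff_sine_series[OF sm that])
  have part: "(\<Sum>m=1..n. sine_mode m x *\<^sub>R sine_coeff (sine_series c) m) = (\<Sum>k<n. sine_mode (Suc k) x *\<^sub>R c (Suc k))" for n x
    by (simp add: coeff sum.atLeast1_atMost_eq)
  have "(\<lambda>n. LINT x|dom_measure. (norm (sine_series c x - (\<Sum>m=1..n. sine_mode m x *\<^sub>R sine_coeff (sine_series c) m)))\<^sup>2) \<longlonglongrightarrow> 0"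
  proof (rule LIMSEQ_I)
    fix e :: real assume e: "0 < e"
    define d where "d = min 1 (e / 4)"
    have d: "0 < d" "d\<^sup>2 \<le> e / 4"
    proof -
      show "0 < d" using e by (simp add: d_def)
      have "d\<^sup>2 \<le> d * 1" unfolding power2_eq_square using e by (intro mult_left_mono) (auto simp: d_def)
      then show "d\<^sup>2 \<le> e / 4" by (simp add: d_def)
    qed
    from uniform_limitD[OF sine_series_uniform_limit[OF sm] d(1)]
    obtain N where N: "\<And>n x. n \<ge> N \<Longrightarrow> dist (\<Sum>k<n. sine_mode (Suc k) x *\<^sub>R c (Suc k)) (sine_series c x) < d"
      unfolding eventually_sequentially by auto
    have "norm ((LINT x|dom_measure. (norm (sine_series c x - (\<Sum>m=1..n. sine_mode m x *\<^sub>R sine_coeff (sine_series c) m)))\<^sup>2) - 0) < e"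
      if n: "n \<ge> N" for n
    proof -
      let ?g = "\<lambda>x. (norm (sine_series c x - (\<Sum>k<n. sine_mode (Suc k) x *\<^sub>R c (Suc k))))\<^sup>2"
      have int: "integrable dom_measure ?g"
        by (intro dom_continuous(1) continuous_intros sine_mode_continuous continuous_on_subset[OF cont]) auto
      have "(LINT x|dom_measure. ?g x) \<le> (LINT x|dom_measure. d\<^sup>2)"
        using int N[OF n] by (intro integral_mono power_mono) (auto simp: dist_norm norm_minus_commute less_imp_le)
      also have "\<dots> = pi * d\<^sup>2" by (simp add: measure_restrict_space)
      also have "\<dots> < 4 * d\<^sup>2" using d pi_less_4 by (intro mult_strict_right_mono) auto
      also have "\<dots> \<le> e" using d by linarith
      finally have "(LINT x|dom_measure. ?g x) < e" .
      moreover have "0 \<le> (LINT x|dom_measure. ?g x)" by (rule integral_nonneg_AE) simp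
      ultimately show ?thesis by (simp only: part) simp
    qed
    then show "\<exists>no. \<forall>n\<ge>no. norm ((LINT x|dom_measure. (norm (sine_series c x - (\<Sum>m=1..n. sine_mode m x *\<^sub>R sine_coeff (sine_series c) m)))\<^sup>2) - 0) < e"
      by blast
  qed
  moreover have "sine_coeff (sine_series c) \<in> spec_space s"
    using assms(1) spec_space_cong[of "sine_coeff (sine_series c)" c s] coeff by simp
  ultimately show ?thesis
    using L2dom_bounded_continuous[OF cont] by (simp add: X_space_def L2dom_def)
qed

text \<open>Elements of the spectral spaces are the limits of their sine expansions in the mean, so the
coefficients determine them.\<close>

lemma sine_coeff_determines:
  assumes "y \<in> X_space s" "z \<in> X_space s'" "\<And>m. 1 \<le> m \<Longrightarrow> sine_coeff y m = sine_coeff z m"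
  shows "AE x in dom_measure. y x = z x"
proof -
  let ?S = "\<lambda>n x. \<Sum>m=1..n. sine_mode m x *\<^sub>R sine_coeff y m"
  have Sz: "?S n x = (\<Sum>m=1..n. sine_mode m x *\<^sub>R sine_coeff z m)" for n x
    using assms(3) by (intro sum.cong) auto
  have lim: "(\<lambda>n. LINT x|dom_measure. (norm (y x - ?S n x))\<^sup>2) \<longlonglongrightarrow> 0"
    "(\<lambda>n. LINT x|dom_measure. (norm (z x - ?S n x))\<^sup>2) \<longlonglongrightarrow> 0"
  proof -
    show "(\<lambda>n. LINT x|dom_measure. (norm (y x - ?S n x))\<^sup>2) \<longlonglongrightarrow> 0"
      using assms(1) by (simp add: X_space_def)
    show "(\<lambda>n. LINT x|dom_measure. (norm (z x - ?S n x))\<^sup>2) \<longlonglongrightarrow> 0"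
      using assms(2) unfolding Sz by (simp add: X_space_def)
  qed
  have L: "L2dom y" "L2dom z" using assms X_space_L2 by auto
  have LS: "L2dom (?S n)" for n
    by (intro L2dom_bounded_continuous continuous_intros sine_mode_continuous)
  have int: "integrable dom_measure (\<lambda>x. (norm (y x - z x))\<^sup>2)"
    "integrable dom_measure (\<lambda>x. (norm (y x - ?S n x))\<^sup>2)"
    "integrable dom_measure (\<lambda>x. (norm (z x - ?S n x))\<^sup>2)" for n
    using L2dom_diff[OF L] L2dom_diff[OF L(1) LS[of n]] L2dom_diff[OF L(2) LS[of n]] by (auto simp: L2dom_def)
  have "(LINT x|dom_measure. (norm (y x - z x))\<^sup>2)
     \<le> 2 * (LINT x|dom_measure. (norm (y x - ?S n x))\<^sup>2) + 2 * (LINT x|dom_measure. (norm (z x - ?S n x))\<^sup>2)" for n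
  proof -
    have "(norm (y x - z x))\<^sup>2 \<le> 2 * (norm (y x - ?S n x))\<^sup>2 + 2 * (norm (z x - ?S n x))\<^sup>2" for x
      using norm_add_squared[of "y x - ?S n x" "?S n x - z x"] by (simp add: norm_minus_commute)
    then have "(LINT x|dom_measure. (norm (y x - z x))\<^sup>2)
      \<le> (LINT x|dom_measure. 2 * (norm (y x - ?S n x))\<^sup>2 + 2 * (norm (z x - ?S n x))\<^sup>2)"
      using int by (intro integral_mono) auto
    also have "\<dots> = 2 * (LINT x|dom_measure. (norm (y x - ?S n x))\<^sup>2) + 2 * (LINT x|dom_measure. (norm (z x - ?S n x))\<^sup>2)"
      using int by (subst Bochner_Integration.integral_add) auto
    finally show ?thesis .
  qed
  moreover have "(\<lambda>n. 2 * (LINT x|dom_measure. (norm (y x - ?S n x))\<^sup>2) + 2 * (LINT x|dom_measure. (norm (z x - ?S n x))\<^sup>2)) \<longlonglongrightarrow> 2 * 0 + 2 * 0"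
    by (intro tendsto_intros lim)
  ultimately have "(LINT x|dom_measure. (norm (y x - z x))\<^sup>2) \<le> 2 * 0 + 2 * 0"
    by (intro LIMSEQ_le_const) auto
  moreover have "0 \<le> (LINT x|dom_measure. (norm (y x - z x))\<^sup>2)" by (rule integral_nonneg_AE) simp
  ultimately have "(LINT x|dom_measure. (norm (y x - z x))\<^sup>2) = 0" by simp
  then have "AE x in dom_measure. (norm (y x - z x))\<^sup>2 = 0"
    using integral_nonneg_eq_0_iff_AE[OF int(1)] by simp
  then show ?thesis by (rule AE_mp) (rule AE_I2, simp)
qed

text \<open>The sine coefficients of \<^const>\<open>lift\<close>. They decay only like \<open>1/m\<close>, which is the weight with which
the boundary control reaches mode \<open>m\<close>.\<close>

definition lift_coeff :: "nat \<Rightarrow> real" where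
  "lift_coeff m = sqrt (2 / pi) * (- ((- 1) ^ m) / real m)"

lemma integral_x_sin:
  assumes "1 \<le> m"
  shows "integral {0..pi} (\<lambda>x. sin (real m * x) * (x / pi)) = - ((- 1) ^ m) / real m"
proof -
  let ?F = "\<lambda>x. (sin (real m * x) / real m ^ 2 - x * cos (real m * x) / real m) / pi"
  have "((\<lambda>x. sin (real m * x) * (x / pi)) has_integral (?F pi - ?F 0)) {0..pi}"
  proof (intro fundamental_theorem_of_calculus)
    fix x
    have "(?F has_real_derivative sin (real m * x) * (x / pi)) (at x within {0..pi})"
      using assms by (auto intro!: derivative_eq_intros simp: field_simps power2_eq_square)
    then show "(?F has_vector_derivative sin (real m * x) * (x / pi)) (at x within {0..pi})"
      by (simp add: has_real_derivative_iff_has_vector_derivative)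
  qed simp
  moreover have "?F pi - ?F 0 = - ((- 1) ^ m) / real m"
    using assms by (simp add: sin_npi cos_npi)
  ultimately show ?thesis by (metis integral_unique)
qed

lemma sine_coeff_lift:
  assumes "1 \<le> m"
  shows "sine_coeff (\<lambda>x. lift x *\<^sub>R w) m = lift_coeff m *\<^sub>R w"
proof -
  have "(LINT x|dom_measure. sine_mode m x * lift x) = integral {0..pi} (\<lambda>x. sine_mode m x * lift x)"
    unfolding lift_def by (intro dom_continuous continuous_intros sine_mode_continuous) auto
  also have "\<dots> = sqrt (2 / pi) * integral {0..pi} (\<lambda>x. sin (real m * x) * (x / pi))"
    by (simp add: sine_mode_def lift_def mult.assoc)
  finally have "(LINT x|dom_measure. sine_mode m x * lift x) = lift_coeff m"
    unfolding integral_x_sin[OF assms] lift_coeff_def .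
  moreover have "integrable dom_measure (\<lambda>x. sine_mode m x * lift x)"
    unfolding lift_def by (intro dom_continuous continuous_intros sine_mode_continuous) auto
  ultimately show ?thesis
    unfolding sine_coeff_def scaleR_scaleR by (subst integral_scaleR_left) auto
qed

lemma lift_coeff_bounds:
  assumes "1 \<le> m"
  shows "lift_coeff m \<noteq> 0" "\<bar>lift_coeff m\<bar> \<le> 1 / real m" "1 / \<bar>lift_coeff m\<bar> \<le> 2 * real m"
proof -
  have a: "\<bar>lift_coeff m\<bar> = sqrt (2 / pi) / real m"
    by (simp add: lift_coeff_def abs_mult power_abs)
  have s: "sqrt (2 / pi) \<le> 1" using pi_ge_two by simp
  have "(1 / 2)\<^sup>2 \<le> 2 / pi" using pi_less_4 by (simp add: field_simps power2_eq_square)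
  then have s2: "1 / 2 \<le> sqrt (2 / pi)" by (rule real_le_rsqrt)
  show "lift_coeff m \<noteq> 0" using a s2 assms by auto
  show "\<bar>lift_coeff m\<bar> \<le> 1 / real m" unfolding a using s by (rule divide_right_mono) simp
  have "1 / \<bar>lift_coeff m\<bar> = real m / sqrt (2 / pi)" unfolding a by simp
  also have "\<dots> \<le> real m / (1 / 2)" using s2 by (intro divide_left_mono) auto
  finally show "1 / \<bar>lift_coeff m\<bar> \<le> 2 * real m" by simp
qed

section \<open>Continuity of curves given by their sine coefficients\<close>

text \<open>Dominated convergence for the series that defines the norm.\<close>

lemma spec_norm_tendsto_0:
  assumes "\<And>k. ((\<lambda>r. c r (Suc k)) \<longlongrightarrow> 0) F" "F \<noteq> bot" "summable \<beta>"
    and "\<forall>\<^sub>F r in F. \<forall>k. real (Suc k) powr (2 * s) * (norm (c r (Suc k)))\<^sup>2 \<le> \<beta> k"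
  shows "((\<lambda>r. spec_norm s (c r)) \<longlongrightarrow> 0) F"
proof -
  let ?a = "\<lambda>k r. real (Suc k) powr (2 * s) * (norm (c r (Suc k)))\<^sup>2"
  have "((\<lambda>r. \<Sum>k. ?a k r) \<longlongrightarrow> (\<Sum>k. 0 :: real)) F"
  proof (intro tannerys_theorem[THEN conjunct2, THEN conjunct2])
    show "((\<lambda>r. ?a k r) \<longlongrightarrow> 0) F" for k
      using tendsto_mult[OF tendsto_const tendsto_power[OF tendsto_norm[OF assms(1)[of k]], of 2], of "real (Suc k) powr (2 * s)"]
      by simp
    have "\<forall>\<^sub>F (k, r) in sequentially \<times>\<^sub>F F. \<forall>k. ?a k r \<le> \<beta> k"
      using eventually_prod2[of sequentially "\<lambda>r. \<forall>k. ?a k r \<le> \<beta> k" F] assms(4)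
      by (simp add: case_prod_unfold)
    then show "\<forall>\<^sub>F (k, r) in sequentially \<times>\<^sub>F F. norm (?a k r) \<le> \<beta> k"
      by eventually_elim auto
  qed (use assms in auto)
  then have "((\<lambda>r. sqrt (\<Sum>k. ?a k r)) \<longlongrightarrow> sqrt 0) F" by (intro tendsto_real_sqrt) simp
  then show ?thesis by (simp add: spec_norm_def)
qed

lemma C0_X_sine_series:
  assumes "1 \<le> s" "summable \<beta>"
    and bd: "\<And>t k. t \<in> {0..T} \<Longrightarrow> real (Suc k) powr (2 * s) * (norm (c t (Suc k)))\<^sup>2 \<le> \<beta> k"
    and cont: "\<And>k. continuous_on {0..T} (\<lambda>t. c t (Suc k))" and "0 < T"
  shows "C0_X T s (\<lambda>t. sine_series (c t))"
  unfolding C0_X_def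
proof (intro ballI conjI)
  have sp: "c t \<in> spec_space s" if "t \<in> {0..T}" for t
    unfolding spec_space_def using bd[OF that]
    by (auto intro!: summable_comparison_test'[OF assms(2), of 0])
  fix t assume t: "t \<in> {0..T}"
  show "sine_series (c t) \<in> X_space s" by (rule sine_series_X_space[OF sp[OF t] assms(1)])
  have eq: "X_norm s (\<lambda>x. sine_series (c r) x - sine_series (c t) x) = spec_norm s (\<lambda>m. c r m - c t m)" if r: "r \<in> {0..T}" for r
    unfolding X_norm_def
  proof (rule spec_norm_cong)
    fix m
    have L: "L2dom (sine_series (c r))" "L2dom (sine_series (c t))"
      using sine_series_X_space[OF sp assms(1)] r t X_space_L2 by blast+
    show "sine_coeff (\<lambda>x. sine_series (c r) x - sine_series (c t) x) (Suc m) = c r (Suc m) - c t (Suc m)"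
      using sine_coeff_diff[OF L] sine_coeff_sine_series[OF spec_space_summable[OF sp assms(1)]] r t by simp
  qed
  have "((\<lambda>r. spec_norm s (\<lambda>m. c r m - c t m)) \<longlongrightarrow> 0) (at t within {0..T})"
  proof (rule spec_norm_tendsto_0[where \<beta> = "\<lambda>k. 4 * \<beta> k"])
    show "((\<lambda>r. c r (Suc k) - c t (Suc k)) \<longlongrightarrow> 0) (at t within {0..T})" for k
      using cont[of k] t by (simp add: continuous_on_def LIM_zero)
    show "at t within {0..T} \<noteq> bot" using t \<open>0 < T\<close> by (simp add: trivial_limit_within islimpt_Icc)
    show "summable (\<lambda>k. 4 * \<beta> k)" by (rule summable_mult[OF assms(2)])
    have "real (Suc k) powr (2 * s) * (norm (c r (Suc k) - c t (Suc k)))\<^sup>2 \<le> 4 * \<beta> k" if "r \<in> {0..T}" for r k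
      using mult_left_mono[OF norm_add_squared[of "c r (Suc k)" "- c t (Suc k)"], of "real (Suc k) powr (2 * s)"]
        bd[OF that, of k] bd[OF t, of k] by (simp add: algebra_simps)
    then show "\<forall>\<^sub>F r in at t within {0..T}. \<forall>k. real (Suc k) powr (2 * s) * (norm (c r (Suc k) - c t (Suc k)))\<^sup>2 \<le> 4 * \<beta> k"
      by (auto simp: eventually_at_filter)
  qed
  moreover have "\<forall>\<^sub>F r in at t within {0..T}. X_norm s (\<lambda>x. sine_series (c r) x - sine_series (c t) x) = spec_norm s (\<lambda>m. c r m - c t m)"
    using eq by (auto simp: eventually_at_filter)
  ultimately show "((\<lambda>r. X_norm s (\<lambda>x. sine_series (c r) x - sine_series (c t) x)) \<longlongrightarrow> 0) (at t within {0..T})"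
    by (simp add: tendsto_cong)
qed

section \<open>Moments of the control\<close>

lemma mat_op_commute_gen_op:
  assumes "S ** A = A ** S"
  shows "mat_op S * gen_op \<rho> A m = gen_op \<rho> A m * mat_op S"
  by (rule st_eqI) (simp add: ap_simps complex_matrix_simps matrix_vector_mul_assoc assms)

lemma mat_op_input_fst: "mat_op S * input_fst X = input_fst (S ** X)"
  by (rule st_eqI) (simp add: ap_simps matrix_vector_mul_assoc)

lemma mat_op_input_snd: "mat_op S * input_snd X = input_snd (S ** X)"
  by (rule st_eqI) (simp add: ap_simps matrix_vector_mul_assoc)

lemma input_fst_sum: "input_fst (\<Sum>i\<in>I. X i) = (\<Sum>i\<in>I. input_fst (X i))"
proof (induction I rule: infinite_finite_induct)
  case (insert i I)
  have "input_fst (X i + sum X I) = input_fst (X i) + input_fst (sum X I)"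
    by (rule st_eqI) (simp add: ap_simps complex_matrix_simps)
  with insert show ?case by simp
next
  case empty
  show ?case by (simp, rule st_eqI) (simp add: ap_simps zero_prod_def)
next
  case (infinite I)
  then show ?case by (simp, intro st_eqI) (simp add: ap_simps zero_prod_def)
qed

lemma input_snd_sum: "input_snd (\<Sum>i\<in>I. X i) = (\<Sum>i\<in>I. input_snd (X i))"
proof (induction I rule: infinite_finite_induct)
  case (insert i I)
  have "input_snd (X i + sum X I) = input_snd (X i) + input_snd (sum X I)"
    by (rule st_eqI) (simp add: ap_simps complex_matrix_simps)
  with insert show ?case by simp
next
  case empty
  show ?case by (simp, rule st_eqI) (simp add: ap_simps zero_prod_def)
next
  case (infinite I)
  then show ?case by (simp, intro st_eqI) (simp add: ap_simps zero_prod_def)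
qed

text \<open>The generator moves the velocity into the position with weight \<open>m\<^sup>2\<close>. Hence a state is recovered
from inputs into the velocity if one application of \<open>M\<close>, that is, one more time derivative of the
control, is allowed.\<close>

lemma state_reconstruction:
  assumes "1 \<le> m"
  shows "input_snd (mat 1) + \<rho> *\<^sub>R input_fst (mat 1) + (1 / real m ^ 2) *\<^sub>R (gen_op \<rho> A m * input_fst (mat 1)) = 1"
  by (rule st_eqI) (use assms in \<open>simp add: ap_simps\<close>)

lemma exp_commute:
  fixes M X :: "'a::{real_normed_algebra_1,banach}"
  assumes "X * M = M * X"
  shows "X * exp (s *\<^sub>R M) = exp (s *\<^sub>R M) * X"
proof -
  have "(s *\<^sub>R M) ^ n * X = X * (s *\<^sub>R M) ^ n" for n
    by (rule power_commuting_commutes) (simp add: assms)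
  then have "(\<lambda>n. X * ((s *\<^sub>R M) ^ n /\<^sub>R fact n)) = (\<lambda>n. ((s *\<^sub>R M) ^ n /\<^sub>R fact n) * X)"
    by (simp only: mult_scaleR_left mult_scaleR_right)
  then have "(\<Sum>n. X * ((s *\<^sub>R M) ^ n /\<^sub>R fact n)) = (\<Sum>n. ((s *\<^sub>R M) ^ n /\<^sub>R fact n) * X)"
    by (rule arg_cong)
  then show ?thesis
    unfolding exp_def suminf_mult[OF summable_exp_generic] suminf_mult2[OF summable_exp_generic, symmetric] .
qed

lemma entire_bound_add:
  assumes "entire_bound C a" "entire_bound C' b"
  shows "entire_bound (max C C' + 1) (a + b)"
  unfolding entire_bound_def
proof (intro allI impI)
  fix r :: real assume r: "0 \<le> r"
  let ?h = "(1 + r) powr (3/4)"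
  have h: "1 \<le> ?h" using r by (simp add: ge_one_powr_ge_zero)
  have "C * ?h \<le> max C C' * ?h" "C' * ?h \<le> max C C' * ?h" using h by (auto intro!: mult_right_mono)
  then have "exp (C * ?h) \<le> exp (max C C' * ?h)" "exp (C' * ?h) \<le> exp (max C C' * ?h)" by simp_all
  then have "exp (C * ?h) + exp (C' * ?h) \<le> exp (max C C' * ?h) * 2" by linarith
  also have "\<dots> \<le> exp (max C C' * ?h) * exp ?h"
  proof (rule mult_left_mono)
    show "2 \<le> exp ?h" using exp_ge_add_one_self[of ?h] h by linarith
  qed simp
  also have "\<dots> = exp ((max C C' + 1) * ?h)" by (simp only: exp_add[symmetric] distrib_right mult_1)
  finally have le: "exp (C * ?h) + exp (C' * ?h) \<le> exp ((max C C' + 1) * ?h)" .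
  have "majorant r (a + b) (exp (C * ?h) + exp (C' * ?h))"
    by (rule majorant_add[OF _ _ r]) (use assms r in \<open>auto simp: entire_bound_def\<close>)
  then show "majorant r (a + b) (exp ((max C C' + 1) * ?h))" by (rule majorant_mono[OF _ le])
qed

lemma entire_bound_le_mult:
  assumes "entire_bound C a" "0 \<le> s" "\<And>p. norm (b p) \<le> s * norm (a p)"
  shows "entire_bound (C + s) b"
  unfolding entire_bound_def
proof (intro allI impI)
  fix r :: real assume r: "0 \<le> r"
  let ?h = "(1 + r) powr (3/4)"
  have h: "1 \<le> ?h" using r by (simp add: ge_one_powr_ge_zero)
  have "s \<le> exp s" using exp_ge_add_one_self[of s] by linarith
  also have "\<dots> \<le> exp (s * ?h)" using mult_left_mono[OF h assms(2)] by simp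
  finally have "s * exp (C * ?h) \<le> exp (s * ?h) * exp (C * ?h)" by (intro mult_right_mono) auto
  then have le: "s * exp (C * ?h) \<le> exp ((C + s) * ?h)" by (simp add: distrib_right exp_add mult.commute)
  have "majorant r b (s * exp (C * ?h))"
    by (rule majorant_le_mult[OF _ r assms(2,3)]) (use assms(1) r in \<open>auto simp: entire_bound_def\<close>)
  then show "majorant r b (exp ((C + s) * ?h))" by (rule majorant_mono[OF _ le])
qed

lemma entire_bound_unit_seq: "entire_bound 0 (unit_seq :: nat \<Rightarrow> 'a::real_normed_algebra_1)"
  by (simp add: entire_bound_def majorant_unit_seq)

text \<open>The data of the construction: \<open>g\<close> enumerates the roots of an annihilating polynomial of \<open>A\<close>
(beyond \<open>d\<close> with arbitrary eigenvalues), \<open>K\<close> realises the reachability condition, and \<open>\<kappa>\<close> is the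
Gevrey bump with its derivatives.\<close>

locale moment_control =
  fixes T \<rho> :: real and A :: "complex^'n^'n" and B :: "complex^'l^'n"
    and g :: "nat \<Rightarrow> complex" and d :: nat and K :: "nat \<Rightarrow> complex^'n^'l"
    and \<kappa> :: "nat \<Rightarrow> real \<Rightarrow> real" and G R cg :: real
  assumes T: "0 < T" and rho: "0 < \<rho>" "\<rho> < 2"
    and eig: "\<And>k. g k \<in> eigenvalues A" and gb: "\<And>k. norm (g k) \<le> cg"
    and ann: "shifted_prod A g d = 0"
    and reach: "(\<Sum>i<d. shifted_prod A g i ** B ** K i) = mat 1"
    and gevrey: "gevrey \<kappa> G R"
    and supp: "\<And>k t. t \<le> T / 3 \<or> 2 * T / 3 \<le> t \<Longrightarrow> \<kappa> k t = 0"
    and unit: "(\<kappa> 0 has_integral 1) {0..T}"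
begin

abbreviation M :: "nat \<Rightarrow> 'n st eop" where "M m \<equiv> gen_op \<rho> A m"
abbreviation gs :: "nat \<Rightarrow> 'n st eop" where "gs k \<equiv> scal_op (g k)"
abbreviation mul :: "nat \<Rightarrow> (nat \<Rightarrow> 'n st eop) \<Rightarrow> nat \<Rightarrow> 'n st eop" where "mul \<equiv> \<lambda>k a p. gs k * a p"

lemma gs_bound: "norm (gs k) \<le> cg"
  using norm_scal_op[of "g k"] gb[of k] order_trans by blast

lemma cg0: "0 \<le> cg" using gs_bound[of 0] norm_ge_zero order_trans by blast

lemma gevM: "gevrey_family \<kappa> G R"
  using gevrey by unfold_locales

definition E :: "nat \<Rightarrow> real \<Rightarrow> 'n st eop" where "E n s = exp (s *\<^sub>R (- M n))"

lemma E_deriv: "(E n has_vector_derivative - M n * E n s) (at s within S)"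
  unfolding E_def[abs_def]
  by (rule has_vector_derivative_at_within[OF exp_scaleR_has_vector_derivative_left])

lemma E_continuous: "continuous_on S (E n)"
  by (rule continuous_on_vector_derivative) (rule E_deriv)

lemma E_commute: "X * M n = M n * X \<Longrightarrow> X * E n s = E n s * X"
  unfolding E_def by (rule exp_commute) simp

lemma E_inverse: "E n s * exp (s *\<^sub>R M n) = 1"
proof -
  have "exp (s *\<^sub>R (- M n) + s *\<^sub>R M n) = exp (s *\<^sub>R (- M n)) * exp (s *\<^sub>R M n)"
    by (rule exp_add_commuting) simp
  then show ?thesis by (simp add: E_def)
qed

text \<open>The moment of mode \<open>n\<close> of the operator-valued function built from the bump of mode \<open>m\<close>, fed into
the velocity through \<open>U\<close>.\<close>

definition mode_moment :: "nat \<Rightarrow> nat \<Rightarrow> 'n st eop \<Rightarrow> (nat \<Rightarrow> 'n st eop) \<Rightarrow> 'n st eop" where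
  "mode_moment n m U a = integral {0..T} (\<lambda>s. E n s * (U * gevrey_series \<kappa> (M m) a s))"

text \<open>Sequences of admissible growth, the domain on which the moment map is an intertwiner.\<close>

definition Q :: "(nat \<Rightarrow> 'n st eop) \<Rightarrow> bool" where "Q a \<longleftrightarrow> (\<exists>C\<ge>0. entire_bound C a)"

lemma Q_shift: "Q a \<Longrightarrow> Q (shift a)"
  unfolding Q_def using entire_bound_shift by (metis add_nonneg_nonneg zero_le_numeral)

lemma Q_add: "Q a \<Longrightarrow> Q b \<Longrightarrow> Q (a + b)"
  unfolding Q_def using entire_bound_add by (metis add_nonneg_nonneg max.coboundedI1 zero_le_one)

lemma Q_scaleR:
  assumes "Q a" shows "Q (s *\<^sub>R a)"
proof -
  from assms obtain C where C: "0 \<le> C" "entire_bound C a" unfolding Q_def by blast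
  have "entire_bound (C + \<bar>s\<bar>) (s *\<^sub>R a)" by (rule entire_bound_le_mult[OF C(2)]) (auto simp: scaleR_fun_def)
  with C(1) show ?thesis unfolding Q_def by (intro exI[of _ "C + \<bar>s\<bar>"]) auto
qed

lemma Q_mul:
  assumes "Q a" shows "Q (mul k a)"
proof -
  from assms obtain C where C: "0 \<le> C" "entire_bound C a" unfolding Q_def by blast
  have "entire_bound (C + norm (gs k)) (mul k a)" by (rule entire_bound_le_mult[OF C(2)]) (auto simp: norm_mult_ineq)
  with C(1) show ?thesis unfolding Q_def by (intro exI[of _ "C + norm (gs k)"]) auto
qed

lemma Q_unit_seq: "Q unit_seq"
  unfolding Q_def using entire_bound_unit_seq by blast

lemma gevrey_series_cont: "Q a \<Longrightarrow> continuous_on {0..T} (gevrey_series \<kappa> (M m) a)"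
  unfolding Q_def using gevrey_family.gevrey_series_continuous[OF gevM] by blast

lemma gevrey_series_deriv: "Q a \<Longrightarrow> t \<in> {0..T} \<Longrightarrow>
    (gevrey_series \<kappa> (M m) a has_vector_derivative gevrey_series \<kappa> (M m) (shift a) t) (at t within {0..T})"
  unfolding Q_def using gevrey_family.gevrey_series_has_derivative[OF gevM] by blast

lemma gevrey_series_sum: "Q a \<Longrightarrow> summable (\<lambda>p. a p * leibniz \<kappa> (M m) p t)"
  unfolding Q_def using gevrey_family.gevrey_series_summable[OF gevM] by blast

lemma mode_moment_cont: "Q a \<Longrightarrow> continuous_on {0..T} (\<lambda>s. E n s * (U * gevrey_series \<kappa> (M m) a s))"
  by (intro continuous_intros E_continuous gevrey_series_cont)

lemma mode_moment_add:
  assumes "Q a" "Q b"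
  shows "mode_moment n m U (a + b) = mode_moment n m U a + mode_moment n m U b"
proof -
  have "gevrey_series \<kappa> (M m) (a + b) s = gevrey_series \<kappa> (M m) a s + gevrey_series \<kappa> (M m) b s" for s
    unfolding gevrey_series_def using suminf_add[OF gevrey_series_sum[OF assms(1)] gevrey_series_sum[OF assms(2)]]
    by (simp add: distrib_right)
  then have "(\<lambda>s. E n s * (U * gevrey_series \<kappa> (M m) (a + b) s)) =
     (\<lambda>s. E n s * (U * gevrey_series \<kappa> (M m) a s) + E n s * (U * gevrey_series \<kappa> (M m) b s))"
    by (simp add: distrib_left)
  then show ?thesis unfolding mode_moment_def
    using integral_add[OF integrable_continuous_real[OF mode_moment_cont[OF assms(1)]] integrable_continuous_real[OF mode_moment_cont[OF assms(2)]]]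
    by simp
qed

lemma mode_moment_scaleR:
  assumes "Q a"
  shows "mode_moment n m U (s *\<^sub>R a) = s *\<^sub>R mode_moment n m U a"
proof -
  have "gevrey_series \<kappa> (M m) (s *\<^sub>R a) r = s *\<^sub>R gevrey_series \<kappa> (M m) a r" for r
    unfolding gevrey_series_def using suminf_scaleR_right[OF gevrey_series_sum[OF assms], of s]
    by (simp add: scaleR_fun_def)
  then show ?thesis unfolding mode_moment_def by simp
qed

lemma mode_moment_mul:
  assumes "Q a" "gs k * U = U * gs k"
  shows "mode_moment n m U (mul k a) = gs k * mode_moment n m U a"
proof -
  have "gevrey_series \<kappa> (M m) (mul k a) r = gs k * gevrey_series \<kappa> (M m) a r" for r
    unfolding gevrey_series_def using suminf_mult[OF gevrey_series_sum[OF assms(1)], of "gs k"]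
    by (simp add: mult.assoc)
  moreover have "E n r * (U * (gs k * X)) = gs k * (E n r * (U * X))" for r X
  proof -
    have c: "gs k * E n r = E n r * gs k" by (rule E_commute[OF scal_op_gen_op])
    have "E n r * (U * (gs k * X)) = E n r * ((U * gs k) * X)" by (simp only: mult.assoc)
    also have "\<dots> = (E n r * gs k) * (U * X)" unfolding assms(2)[symmetric] by (simp only: mult.assoc)
    also have "\<dots> = gs k * (E n r * (U * X))" unfolding c[symmetric] by (simp only: mult.assoc)
    finally show ?thesis .
  qed
  ultimately have "mode_moment n m U (mul k a) = integral {0..T} (\<lambda>s. gs k * (E n s * (U * gevrey_series \<kappa> (M m) a s)))"
    unfolding mode_moment_def by simp
  also have "\<dots> = gs k * mode_moment n m U a"
    unfolding mode_moment_def using integral_linear[OF integrable_continuous_real[OF mode_moment_cont[OF assms(1)]] bounded_linear_mult_right]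
    by (simp add: o_def)
  finally show ?thesis .
qed

lemma gevrey_series_ends: "gevrey_series \<kappa> (M m) a 0 = 0" "gevrey_series \<kappa> (M m) a T = 0"
  using T by (auto intro!: gevrey_series_eq_0 supp)

text \<open>Integration by parts: shifting the coefficients differentiates the function, and under the weight
\<open>exp (- s M\<^sub>n)\<close> the derivative becomes multiplication by \<open>M\<^sub>n\<close>. The boundary terms vanish with the bump.\<close>

lemma mode_moment_shift:
  assumes "Q a"
  shows "mode_moment n m U (shift a) = M n * mode_moment n m U a"
proof -
  let ?h = "\<lambda>s. E n s * (U * gevrey_series \<kappa> (M m) a s)"
  have d: "(?h has_vector_derivative E n s * (U * gevrey_series \<kappa> (M m) (shift a) s) + (- M n * E n s) * (U * gevrey_series \<kappa> (M m) a s))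
      (at s within {0..T})" if "s \<in> {0..T}" for s
    by (rule has_vector_derivative_mult[OF E_deriv has_vector_derivative_mult_right[OF gevrey_series_deriv[OF assms that]]])
  have "((\<lambda>s. E n s * (U * gevrey_series \<kappa> (M m) (shift a) s) + (- M n * E n s) * (U * gevrey_series \<kappa> (M m) a s)) has_integral (?h T - ?h 0)) {0..T}"
    using T by (intro fundamental_theorem_of_calculus d) auto
  then have "((\<lambda>s. E n s * (U * gevrey_series \<kappa> (M m) (shift a) s) - M n * ?h s) has_integral 0) {0..T}"
    by (simp add: gevrey_series_ends mult.assoc)
  moreover have "((\<lambda>s. M n * ?h s) has_integral (M n * mode_moment n m U a)) {0..T}"
    unfolding mode_moment_def
    using has_integral_linear[OF integrable_integral[OF integrable_continuous_real[OF mode_moment_cont[OF assms]]] bounded_linear_mult_right]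
    by (simp add: o_def)
  ultimately have "((\<lambda>s. (E n s * (U * gevrey_series \<kappa> (M m) (shift a) s) - M n * ?h s) + M n * ?h s) has_integral (0 + M n * mode_moment n m U a)) {0..T}"
    by (rule has_integral_add)
  then show ?thesis unfolding mode_moment_def by (simp add: integral_unique)
qed

definition Phi :: "nat \<Rightarrow> nat \<Rightarrow> 'n st eop" where "Phi m = qproduct_inf \<rho> gs d m"

lemma entire_bound_Phi: "entire_bound (order_const \<rho> cg d) (Phi m)"
  unfolding Phi_def using rho gs_bound by (intro entire_bound_qproduct_inf) auto

lemma ordc0: "0 \<le> order_const \<rho> cg d" using rho cg0 by (intro order_const_nonneg) auto

lemma Q_Phi: "Q (Phi m)"
  unfolding Q_def using entire_bound_Phi ordc0 by blast

text \<open>By integration by parts the moment map intertwines the shift with the generator of mode \<open>n\<close>, so the product of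
differential operators becomes the product of modal factors.\<close>

lemma mode_moment_qproduct:
  assumes "\<And>k. gs k * U = U * gs k"
  shows "ap (mode_moment n m U (qproduct \<rho> shift mul d m L unit_seq)) Z = qproduct \<rho> (gen_map \<rho> A n) (scal_map g) d m L (ap (mode_moment n m U unit_seq) Z)"
proof -
  have "Q (qproduct \<rho> shift mul d m L unit_seq) \<and>
     ap (mode_moment n m U (qproduct \<rho> shift mul d m L unit_seq)) Z = qproduct \<rho> (gen_map \<rho> A n) (scal_map g) d m L (ap (mode_moment n m U unit_seq) Z)"
  proof (rule qproduct_intertwine[where W = "\<lambda>a. ap (mode_moment n m U a) Z"])
    show "ap (mode_moment n m U (shift a)) Z = gen_map \<rho> A n (ap (mode_moment n m U a) Z)" if "Q a" for a
      by (simp add: mode_moment_shift[OF that] gen_map_def ap_mult)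
    show "ap (mode_moment n m U (mul k a)) Z = scal_map g k (ap (mode_moment n m U a) Z)" if "Q a" for k a
      by (simp add: mode_moment_mul[OF that assms] scal_map_def ap_mult)
    show "ap (mode_moment n m U (a + b)) Z = ap (mode_moment n m U a) Z + ap (mode_moment n m U b) Z" if "Q a" "Q b" for a b
      by (simp only: mode_moment_add[OF that] ap.add_left)
    show "ap (mode_moment n m U (s *\<^sub>R a)) Z = s *\<^sub>R ap (mode_moment n m U a) Z" if "Q a" for s a
      by (simp only: mode_moment_scaleR[OF that] ap.scaleR_left)
  qed (rule Q_shift Q_mul Q_add Q_scaleR Q_unit_seq; assumption)+
  then show ?thesis ..
qed

lemma mode_moment_qfactors:
  assumes "\<And>k. gs k * U = U * gs k" "Q a"
  shows "Q (qfactors \<rho> shift mul \<nu> i a)"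
    "ap (mode_moment n m U (qfactors \<rho> shift mul \<nu> i a)) Z = qfactors \<rho> (gen_map \<rho> A n) (scal_map g) \<nu> i (ap (mode_moment n m U a) Z)"
proof -
  have "Q (qfactors \<rho> shift mul \<nu> i a) \<and>
     ap (mode_moment n m U (qfactors \<rho> shift mul \<nu> i a)) Z = qfactors \<rho> (gen_map \<rho> A n) (scal_map g) \<nu> i (ap (mode_moment n m U a) Z)"
  proof (rule qfactors_intertwine[where W = "\<lambda>a. ap (mode_moment n m U a) Z"])
    show "ap (mode_moment n m U (shift a)) Z = gen_map \<rho> A n (ap (mode_moment n m U a) Z)" if "Q a" for a
      by (simp add: mode_moment_shift[OF that] gen_map_def ap_mult)
    show "ap (mode_moment n m U (mul k a)) Z = scal_map g k (ap (mode_moment n m U a) Z)" if "Q a" for k a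
      by (simp add: mode_moment_mul[OF that assms(1)] scal_map_def ap_mult)
    show "ap (mode_moment n m U (a + b)) Z = ap (mode_moment n m U a) Z + ap (mode_moment n m U b) Z" if "Q a" "Q b" for a b
      by (simp only: mode_moment_add[OF that] ap.add_left)
    show "ap (mode_moment n m U (s *\<^sub>R a)) Z = s *\<^sub>R ap (mode_moment n m U a) Z" if "Q a" for s a
      by (simp only: mode_moment_scaleR[OF that] ap.scaleR_left)
  qed (rule Q_shift Q_mul Q_add Q_scaleR assms(2); assumption)+
  then show "Q (qfactors \<rho> shift mul \<nu> i a)"
    "ap (mode_moment n m U (qfactors \<rho> shift mul \<nu> i a)) Z = qfactors \<rho> (gen_map \<rho> A n) (scal_map g) \<nu> i (ap (mode_moment n m U a) Z)" by auto
qed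

lemma mode_moment_Phi_limit: "(\<lambda>L. mode_moment n m U (qproduct \<rho> shift mul d m L unit_seq)) \<longlonglongrightarrow> mode_moment n m U (Phi m)"
proof -
  let ?a = "\<lambda>L. qproduct \<rho> shift mul d m L unit_seq"
  have a: "entire_bound (order_const \<rho> cg d) (?a L)" for L using rho gs_bound by (intro entire_bound_qproduct) auto
  have lim: "(\<lambda>L. ?a L p) \<longlonglongrightarrow> Phi m p" for p
    unfolding Phi_def by (rule qproduct_coeff_tendsto) (use rho gs_bound in auto)
  have u1: "uniform_limit {0..T} (\<lambda>L. gevrey_series \<kappa> (M m) (?a L)) (gevrey_series \<kappa> (M m) (Phi m)) sequentially"
    by (rule gevrey_family.gevrey_series_uniform_limit[OF gevM a entire_bound_Phi ordc0 lim])
  have bl: "bounded_linear (\<lambda>x. U * x)" by (rule bounded_linear_mult_right)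
  have u2: "uniform_limit {0..T} (\<lambda>L s. U * gevrey_series \<kappa> (M m) (?a L) s) (\<lambda>s. U * gevrey_series \<kappa> (M m) (Phi m) s) sequentially"
    by (rule bounded_linear.uniform_limit[OF bl u1])
  have bE: "bounded (E n ` {0..T})"
    by (intro compact_imp_bounded compact_continuous_image E_continuous) simp
  have bU: "bounded ((\<lambda>s. U * gevrey_series \<kappa> (M m) (Phi m) s) ` {0..T})"
    by (intro compact_imp_bounded compact_continuous_image continuous_intros gevrey_series_cont Q_Phi) simp
  have u3: "uniform_limit {0..T} (\<lambda>L s. E n s * (U * gevrey_series \<kappa> (M m) (?a L) s)) (\<lambda>s. E n s * (U * gevrey_series \<kappa> (M m) (Phi m) s)) sequentially"
    by (rule bounded_bilinear.bounded_uniform_limit[OF bounded_bilinear_mult _ u2 bU bE]) (rule uniform_limit_const)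
  have Qa: "Q (?a L)" for L unfolding Q_def using a ordc0 by blast
  obtain I J where I: "\<And>L. ((\<lambda>s. E n s * (U * gevrey_series \<kappa> (M m) (?a L) s)) has_integral I L) {0..T}"
    and J: "((\<lambda>s. E n s * (U * gevrey_series \<kappa> (M m) (Phi m) s)) has_integral J) {0..T}" "I \<longlonglongrightarrow> J"
  proof (rule uniform_limit_integral[OF u3 mode_moment_cont[OF Qa] trivial_limit_sequentially])
    fix I J
    assume "\<And>L. ((\<lambda>s. E n s * (U * gevrey_series \<kappa> (M m) (?a L) s)) has_integral I L) {0..T}"
      "((\<lambda>s. E n s * (U * gevrey_series \<kappa> (M m) (Phi m) s)) has_integral J) {0..T}" "I \<longlonglongrightarrow> J"
    then show thesis by (rule that[of I J])
  qed
  have Ieq: "I = (\<lambda>L. mode_moment n m U (?a L))"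
    unfolding mode_moment_def by (rule ext) (rule integral_unique[OF I, symmetric])
  have Jeq: "J = mode_moment n m U (Phi m)"
    unfolding mode_moment_def by (rule integral_unique[OF J(1), symmetric])
  show ?thesis using J(2) unfolding Ieq Jeq .
qed

lemma mode_moment_Phi_tendsto:
  assumes "\<And>k. gs k * U = U * gs k"
  shows "(\<lambda>L. qproduct \<rho> (gen_map \<rho> A n) (scal_map g) d m L (ap (mode_moment n m U unit_seq) Z)) \<longlonglongrightarrow> ap (mode_moment n m U (Phi m)) Z"
  unfolding mode_moment_qproduct[OF assms, symmetric]
  by (rule bounded_linear.tendsto[OF ap.bounded_linear_left mode_moment_Phi_limit])

lemma qfactors_zero: "qfactors \<rho> (gen_map \<rho> A n) (scal_map g) \<nu> i 0 = 0"
  by (rule linear_0[OF linear_qfactors[OF linear_gen_map linear_scal_map]])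

text \<open>The product \<open>\<Phi>\<^sub>m\<close> contains the factor of mode \<open>n\<close>, which vanishes on mode \<open>n\<close> because there it is the
annihilating polynomial of \<open>A\<close>.\<close>

lemma mode_moment_Phi_offdiagonal:
  assumes "\<And>k. gs k * U = U * gs k" "1 \<le> n" "n \<noteq> m"
  shows "ap (mode_moment n m U (Phi m)) Z = 0"
proof -
  have s: "qfactors \<rho> (gen_map \<rho> A n) (scal_map g) n d x = 0" for x
    unfolding qfactors_diagonal[OF assms(2)] ann
    by (cases x) (simp add: ap_simps zero_prod_def)
  have "qproduct \<rho> (gen_map \<rho> A n) (scal_map g) d m L (ap (mode_moment n m U unit_seq) Z) = 0" if "n \<le> L" for L
    by (rule qproduct_eq_zero[OF linear_gen_map linear_scal_map s assms(2,3) that])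
  then have "\<forall>\<^sub>F L in sequentially. qproduct \<rho> (gen_map \<rho> A n) (scal_map g) d m L (ap (mode_moment n m U unit_seq) Z) = 0"
    unfolding eventually_sequentially by blast
  then have "(\<lambda>L. qproduct \<rho> (gen_map \<rho> A n) (scal_map g) d m L (ap (mode_moment n m U unit_seq) Z)) \<longlonglongrightarrow> 0"
    by (rule tendsto_eventually)
  with mode_moment_Phi_tendsto[OF assms(1)] show ?thesis using LIMSEQ_unique by blast
qed

end

context moment_control
begin

lemma mode_moment_left_mult:
  assumes "Q a" "X * M n = M n * X"
  shows "X * mode_moment n m U a = mode_moment n m (X * U) a"
proof -
  have "X * (E n s * (U * Y)) = E n s * (X * U * Y)" for s Y
    using E_commute[OF assms(2), of s] by (simp only: mult.assoc[symmetric])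
  moreover have "X * mode_moment n m U a = integral {0..T} (\<lambda>s. X * (E n s * (U * gevrey_series \<kappa> (M m) a s)))"
    unfolding mode_moment_def using integral_linear[OF integrable_continuous_real[OF mode_moment_cont[OF assms(1)]] bounded_linear_mult_right, of X]
    by (simp add: o_def)
  ultimately show ?thesis by (simp add: mode_moment_def)
qed

lemma mode_moment_U_add:
  assumes "Q a"
  shows "mode_moment n m (U + U') a = mode_moment n m U a + mode_moment n m U' a"
  unfolding mode_moment_def distrib_left distrib_right
  by (rule integral_add) (intro integrable_continuous_real mode_moment_cont[OF assms])+

lemma mode_moment_U_sum: "Q a \<Longrightarrow> mode_moment n m (\<Sum>i<(k::nat). U i) a = (\<Sum>i<k. mode_moment n m (U i) a)"
proof (induction k)
  case 0
  then show ?case by (simp add: mode_moment_def)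
qed (simp add: mode_moment_U_add)

lemma gevrey_series_unit_seq: "gevrey_series \<kappa> (M m) unit_seq s = \<kappa> 0 s *\<^sub>R exp (s *\<^sub>R M m)"
proof -
  have "(\<lambda>p. unit_seq p * leibniz \<kappa> (M m) p s) = (\<lambda>p. if p = 0 then leibniz \<kappa> (M m) 0 s else 0)"
    by (auto simp: unit_seq_def)
  moreover have "(\<Sum>p. if p = 0 then leibniz \<kappa> (M m) 0 s else 0) = leibniz \<kappa> (M m) 0 s"
    by (rule sums_unique[OF sums_single[of 0 "\<lambda>_. leibniz \<kappa> (M m) 0 s"], symmetric])
  ultimately show ?thesis by (simp add: gevrey_series_def leibniz_def)
qed

text \<open>On the diagonal the weight \<open>exp (- s M\<^sub>m)\<close> cancels the exponential, leaving the integral of the bump.\<close>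

lemma mode_moment_one_unit_seq: "mode_moment m m 1 unit_seq = 1"
proof -
  have "E m s * (1 * gevrey_series \<kappa> (M m) unit_seq s) = \<kappa> 0 s *\<^sub>R 1" for s
    by (simp add: gevrey_series_unit_seq E_inverse)
  moreover have "((\<lambda>s. \<kappa> 0 s *\<^sub>R (1 :: 'n st eop)) has_integral 1 *\<^sub>R 1) {0..T}"
    using has_integral_linear[OF unit bounded_linear_scaleR_left[of "1 :: 'n st eop"]] by (simp add: o_def)
  ultimately show ?thesis by (simp add: mode_moment_def integral_unique)
qed

text \<open>The two inputs of \<open>state_reconstruction\<close>, composed with \<open>B K\<^sub>i\<close>; \<open>U2\<close> belongs to the term with the
additional factor \<open>M\<close>.\<close>

definition U1 :: "nat \<Rightarrow> 'n st eop" where "U1 i = input_snd (B ** K i) + \<rho> *\<^sub>R input_fst (B ** K i)"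
definition U2 :: "nat \<Rightarrow> nat \<Rightarrow> 'n st eop" where "U2 m i = (1 / real m ^ 2) *\<^sub>R input_fst (B ** K i)"

lemma scal_op_U: "gs k * U1 i = U1 i * gs k" "gs k * U2 m i = U2 m i * gs k"
  by (simp_all add: U1_def U2_def distrib_left distrib_right scal_op_input_fst scal_op_input_snd)

abbreviation Sp :: "nat \<Rightarrow> 'n st eop" where "Sp i \<equiv> mat_op (shifted_prod A g i)"

lemma Sp_M: "Sp i * M m = M m * Sp i"
  by (rule mat_op_commute_gen_op[OF shifted_prod_commute])

lemma reconstruction_sum:
  assumes "1 \<le> m"
  shows "(\<Sum>i<d. Sp i * U1 i + (M m * Sp i) * U2 m i) = 1"
proof -
  have 1: "Sp i * U1 i + (M m * Sp i) * U2 m i = input_snd (shifted_prod A g i ** B ** K i)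
      + \<rho> *\<^sub>R input_fst (shifted_prod A g i ** B ** K i) + (1 / real m ^ 2) *\<^sub>R (M m * input_fst (shifted_prod A g i ** B ** K i))" for i
    by (simp add: U1_def U2_def distrib_left mult.assoc mat_op_input_fst mat_op_input_snd matrix_mul_assoc)
  show ?thesis
    unfolding 1 sum.distrib scaleR_sum_right[symmetric] sum_distrib_left[symmetric] input_snd_sum[symmetric] input_fst_sum[symmetric] reach
    by (rule state_reconstruction[OF assms])
qed

text \<open>The symbol \<open>\<Phi>\<^sub>m\<close> times the first \<open>i\<close> factors of mode \<open>m\<close>; on mode \<open>m\<close> these factors become
\<open>(g\<^sub>0 - A) \<cdots> (g\<^sub>i\<^sub>-\<^sub>1 - A) / m\<^sup>4\<^sup>i\<close>.\<close>

definition ctrl_seq :: "nat \<Rightarrow> nat \<Rightarrow> nat \<Rightarrow> 'n st eop" where "ctrl_seq m i = qfactors \<rho> shift mul m i (Phi m)"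

lemma Q_ctrl_seq: "Q (ctrl_seq m i)"
  unfolding ctrl_seq_def by (rule mode_moment_qfactors(1)[of 0, OF _ Q_Phi]) simp

lemma entire_bound_ctrl_seq: "1 \<le> m \<Longrightarrow> i \<le> d \<Longrightarrow> entire_bound (2 * order_const \<rho> cg d) (ctrl_seq m i)"
  unfolding ctrl_seq_def using entire_bound_qfactors[of \<rho> gs cg "order_const \<rho> cg d" "Phi m" m i d] entire_bound_Phi gs_bound rho by simp

text \<open>Read a control value off a state-valued function: feeding \<open>L1\<close> through \<open>B\<close> into the velocity is the
action of \<open>U1\<close>, and likewise for \<open>L2\<close> and \<open>U2\<close>.\<close>

definition L1 :: "nat \<Rightarrow> 'n st \<Rightarrow> 'n st eop \<Rightarrow> complex^'l" where
  "L1 i Z X = K i *v (snd (ap X Z) + \<rho> *\<^sub>R fst (ap X Z))"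

definition L2 :: "nat \<Rightarrow> nat \<Rightarrow> 'n st \<Rightarrow> 'n st eop \<Rightarrow> complex^'l" where
  "L2 m i Z X = K i *v ((1 / real m ^ 2) *\<^sub>R fst (ap X Z))"

lemma bounded_linear_L1: "bounded_linear (L1 i Z)"
  unfolding L1_def[abs_def]
  by (intro bounded_linear_compose[OF bounded_linear_matrix] bounded_linear_add
      bounded_linear_compose[OF bounded_linear_scaleR_right] bounded_linear_compose[OF bounded_linear_fst]
      bounded_linear_compose[OF bounded_linear_snd] ap.bounded_linear_left)

lemma bounded_linear_L2: "bounded_linear (L2 m i Z)"
  unfolding L2_def[abs_def]
  by (intro bounded_linear_compose[OF bounded_linear_matrix]
      bounded_linear_compose[OF bounded_linear_scaleR_right] bounded_linear_compose[OF bounded_linear_fst]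
      ap.bounded_linear_left)

text \<open>The \<open>j\<close>-th derivative of the control that steers mode \<open>m\<close> and leaves all other modes alone. The factor \<open>m\<^sup>4\<^sup>i\<close>
undoes the normalisation of the \<open>i\<close> diagonal factors.\<close>

definition mode_control :: "nat \<Rightarrow> nat \<Rightarrow> 'n st \<Rightarrow> real \<Rightarrow> complex^'l" where
  "mode_control m j Z t = (\<Sum>i<d. real m ^ (4 * i) *\<^sub>R (L1 i Z (gevrey_series \<kappa> (M m) ((shift ^^ j) (ctrl_seq m i)) t)
     + L2 m i Z (gevrey_series \<kappa> (M m) ((shift ^^ Suc j) (ctrl_seq m i)) t)))"

lemma Q_shift_ctrl_seq: "Q ((shift ^^ j) (ctrl_seq m i))"
  by (induction j) (simp_all add: Q_ctrl_seq Q_shift)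

lemma mode_control_deriv:
  assumes "t \<in> {0..T}"
  shows "(mode_control m j Z has_vector_derivative mode_control m (Suc j) Z t) (at t within {0..T})"
proof -
  have s: "(gevrey_series \<kappa> (M m) ((shift ^^ j) (ctrl_seq m i)) has_vector_derivative gevrey_series \<kappa> (M m) ((shift ^^ Suc j) (ctrl_seq m i)) t)
      (at t within {0..T})" for j i
    using gevrey_series_deriv[OF Q_shift_ctrl_seq assms, of m j m i] by simp
  show ?thesis
    unfolding mode_control_def[abs_def]
    by (intro has_vector_derivative_sum bounded_linear.has_vector_derivative[OF bounded_linear_scaleR_right]
        has_vector_derivative_add bounded_linear.has_vector_derivative[OF bounded_linear_L1]
        bounded_linear.has_vector_derivative[OF bounded_linear_L2] s)
qed

lemma mode_control_support:
  assumes "t \<le> T / 3 \<or> 2 * T / 3 \<le> t"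
  shows "mode_control m j Z t = 0"
proof -
  have "gevrey_series \<kappa> (M m) a t = 0" for a by (rule gevrey_series_eq_0) (rule supp[OF assms])
  then show ?thesis
    by (simp add: mode_control_def linear_0[OF bounded_linear.linear[OF bounded_linear_L1]]
        linear_0[OF bounded_linear.linear[OF bounded_linear_L2]])
qed

definition moment :: "nat \<Rightarrow> (real \<Rightarrow> complex^'l) \<Rightarrow> 'n st" where
  "moment n h = integral {0..T} (\<lambda>s. ap (E n s) (0, B *v h s))"

lemma moment_mode_control_sum:
  assumes "1 \<le> m"
  shows "moment n (mode_control m 0 Z) = (\<Sum>i<d. real m ^ (4 * i) *\<^sub>R (ap (mode_moment n m (U1 i) (ctrl_seq m i)) Z + ap (mode_moment n m (U2 m i) (shift (ctrl_seq m i))) Z))"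
proof -
  have u1: "(0, B *v L1 i Z X) = ap (U1 i) (ap X Z)" for i X
    by (cases "ap X Z") (simp add: L1_def U1_def ap_simps complex_matrix_simps matrix_vector_mul_assoc)
  have u2: "(0, B *v L2 m i Z X) = ap (U2 m i) (ap X Z)" for i X
    by (cases "ap X Z") (simp add: L2_def U2_def ap_simps complex_matrix_simps matrix_vector_mul_assoc)
  have lin: "linear (\<lambda>w. ap (E n s) (0, B *v w))" for s
    by (rule linearI) (simp_all add: complex_matrix_simps ap.add_right[symmetric] ap.scaleR_right[symmetric])
  have eq: "ap (E n s) (0, B *v mode_control m 0 Z s) = (\<Sum>i<d. real m ^ (4 * i) *\<^sub>R
     (ap (E n s * (U1 i * gevrey_series \<kappa> (M m) (ctrl_seq m i) s)) Z + ap (E n s * (U2 m i * gevrey_series \<kappa> (M m) (shift (ctrl_seq m i)) s)) Z))" for s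
    unfolding mode_control_def linear_sum[OF lin] linear_scale[OF lin] linear_add[OF lin] u1 u2
    by (simp add: ap_mult)
  have hi: "((\<lambda>s. ap (E n s * (U * gevrey_series \<kappa> (M m) a s)) Z) has_integral ap (mode_moment n m U a) Z) {0..T}" if "Q a" for U a
    unfolding mode_moment_def
    using has_integral_linear[OF integrable_integral[OF integrable_continuous_real[OF mode_moment_cont[OF that]]] ap.bounded_linear_left]
    by (simp add: o_def)
  show ?thesis
    unfolding moment_def eq
    by (intro integral_unique has_integral_sum has_integral_cmul has_integral_add hi Q_ctrl_seq Q_shift) simp
qed

lemma moment_mode_control_offdiagonal:
  assumes "1 \<le> m" "1 \<le> n" "n \<noteq> m"
  shows "moment n (mode_control m 0 Z) = 0"
proof -
  have "ap (mode_moment n m (U1 i) (ctrl_seq m i)) Z = 0" for i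
    unfolding ctrl_seq_def mode_moment_qfactors(2)[OF scal_op_U(1) Q_Phi] mode_moment_Phi_offdiagonal[OF scal_op_U(1) assms(2,3)] by (rule qfactors_zero)
  moreover have "ap (mode_moment n m (U2 m i) (shift (ctrl_seq m i))) Z = 0" for i
    unfolding mode_moment_shift[OF Q_ctrl_seq] ap_mult unfolding ctrl_seq_def mode_moment_qfactors(2)[OF scal_op_U(2) Q_Phi]
      mode_moment_Phi_offdiagonal[OF scal_op_U(2) assms(2,3)] qfactors_zero by (rule ap.zero_right)
  ultimately show ?thesis unfolding moment_mode_control_sum[OF assms(1)] by simp
qed

lemma qproduct_commute:
  assumes "X * M m = M m * X" "\<And>k. gs k * X = X * gs k"
  shows "qproduct \<rho> (gen_map \<rho> A m) (scal_map g) d m L (ap X v) = ap X (qproduct \<rho> (gen_map \<rho> A m) (scal_map g) d m L v)"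
proof -
  have "True \<and> ap X (qproduct \<rho> (gen_map \<rho> A m) (scal_map g) d m L v) = qproduct \<rho> (gen_map \<rho> A m) (scal_map g) d m L (ap X v)"
    by (rule qproduct_intertwine[where W = "ap X" and Q = "\<lambda>_. True"])
      (simp_all add: gen_map_def scal_map_def ap.add_right ap.scaleR_right assms flip: ap_mult)
  then show ?thesis by simp
qed

text \<open>By intertwining, \<open>\<Phi>\<^sub>m(M\<^sub>m)\<close> acts after the moments have been taken. It commutes with \<open>M\<^sub>m\<close> and with
the partial products of \<open>g\<^sub>k - A\<close>, so the reachability terms may be summed first, and their sum is the
identity by \<open>reconstruction_sum\<close>.\<close>

lemma moment_mode_control_diagonal:
  assumes m: "1 \<le> m" and lim: "(\<lambda>L. qproduct \<rho> (gen_map \<rho> A m) (scal_map g) d m L Z) \<longlonglongrightarrow> y"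
  shows "moment m (mode_control m 0 Z) = y"
proof -
  let ?p = "\<lambda>L. qproduct \<rho> (gen_map \<rho> A m) (scal_map g) d m L"
  have linp: "linear (?p L)" for L by (intro linear_qproduct linear_gen_map linear_scal_map)
  define w1 where "w1 i = ap (mode_moment m m (U1 i) unit_seq) Z" for i
  define w2 where "w2 i = ap (mode_moment m m (U2 m i) unit_seq) Z" for i
  define y1 where "y1 i = ap (mode_moment m m (U1 i) (Phi m)) Z" for i
  define y2 where "y2 i = ap (mode_moment m m (U2 m i) (Phi m)) Z" for i
  have l1: "(\<lambda>L. ?p L (w1 i)) \<longlonglongrightarrow> y1 i" for i
    unfolding w1_def y1_def by (rule mode_moment_Phi_tendsto[OF scal_op_U(1)])
  have l2: "(\<lambda>L. ?p L (w2 i)) \<longlonglongrightarrow> y2 i" for i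
    unfolding w2_def y2_def by (rule mode_moment_Phi_tendsto[OF scal_op_U(2)])
  have m4: "real m ^ (4 * i) * (1 / real m ^ 4) ^ i = 1" for i
    using m by (simp add: power_mult power_one_over)
  have "real m ^ (4 * i) *\<^sub>R (ap (mode_moment m m (U1 i) (ctrl_seq m i)) Z + ap (mode_moment m m (U2 m i) (shift (ctrl_seq m i))) Z)
     = ap (Sp i) (y1 i) + ap (M m * Sp i) (y2 i)" for i
  proof -
    have a: "ap (mode_moment m m (U1 i) (ctrl_seq m i)) Z = (1 / real m ^ 4) ^ i *\<^sub>R ap (Sp i) (y1 i)"
      unfolding ctrl_seq_def mode_moment_qfactors(2)[OF scal_op_U(1) Q_Phi] qfactors_diagonal[OF m] y1_def ..
    have b: "ap (mode_moment m m (U2 m i) (ctrl_seq m i)) Z = (1 / real m ^ 4) ^ i *\<^sub>R ap (Sp i) (y2 i)"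
      unfolding ctrl_seq_def mode_moment_qfactors(2)[OF scal_op_U(2) Q_Phi] qfactors_diagonal[OF m] y2_def ..
    show ?thesis
      unfolding mode_moment_shift[OF Q_ctrl_seq] ap_mult a b ap.scaleR_right scaleR_add_right scaleR_scaleR m4 by simp
  qed
  then have moment: "moment m (mode_control m 0 Z) = (\<Sum>i<d. ap (Sp i) (y1 i) + ap (M m * Sp i) (y2 i))"
    unfolding moment_mode_control_sum[OF m] by simp
  have sSp: "gs k * Sp i = Sp i * gs k" for k i by (rule scal_op_mat_op)
  have c1: "?p L (ap (Sp i) v) = ap (Sp i) (?p L v)" for L i v
    by (rule qproduct_commute[OF Sp_M sSp])
  have c2: "?p L (ap (M m * Sp i) v) = ap (M m * Sp i) (?p L v)" for L i v
  proof (rule qproduct_commute)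
    show "M m * Sp i * M m = M m * (M m * Sp i)" by (simp only: mult.assoc Sp_M)
    show "gs k * (M m * Sp i) = M m * Sp i * gs k" for k
    proof -
      have "gs k * (M m * Sp i) = (gs k * M m) * Sp i" by (simp only: mult.assoc)
      also have "\<dots> = M m * (gs k * Sp i)" by (simp only: scal_op_gen_op mult.assoc)
      also have "\<dots> = M m * Sp i * gs k" by (simp only: sSp mult.assoc)
      finally show ?thesis .
    qed
  qed
  have "(\<lambda>L. \<Sum>i<d. ap (Sp i) (?p L (w1 i)) + ap (M m * Sp i) (?p L (w2 i))) \<longlonglongrightarrow> moment m (mode_control m 0 Z)"
    unfolding moment
    by (intro tendsto_sum tendsto_add bounded_linear.tendsto[OF ap.bounded_linear_right] l1 l2)
  moreover have "(\<Sum>i<d. ap (Sp i) (?p L (w1 i)) + ap (M m * Sp i) (?p L (w2 i))) = ?p L Z" for L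
  proof -
    have "(\<Sum>i<d. ap (Sp i) (?p L (w1 i)) + ap (M m * Sp i) (?p L (w2 i)))
       = ?p L (\<Sum>i<d. ap (Sp i) (w1 i) + ap (M m * Sp i) (w2 i))"
      unfolding linear_sum[OF linp] linear_add[OF linp] c1 c2 ..
    also have "(\<Sum>i<d. ap (Sp i) (w1 i) + ap (M m * Sp i) (w2 i))
       = ap (\<Sum>i<d. Sp i * mode_moment m m (U1 i) unit_seq + (M m * Sp i) * mode_moment m m (U2 m i) unit_seq) Z"
      unfolding w1_def w2_def by (simp add: ap.sum_left ap.add_left ap_mult)
    also have "(\<Sum>i<d. Sp i * mode_moment m m (U1 i) unit_seq + (M m * Sp i) * mode_moment m m (U2 m i) unit_seq)
       = (\<Sum>i<d. mode_moment m m (Sp i * U1 i + (M m * Sp i) * U2 m i) unit_seq)"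
    proof (rule sum.cong[OF refl])
      fix i
      have "M m * Sp i * M m = M m * (M m * Sp i)" by (simp only: mult.assoc Sp_M)
      from mode_moment_left_mult[OF Q_unit_seq this] mode_moment_left_mult[OF Q_unit_seq Sp_M]
      show "Sp i * mode_moment m m (U1 i) unit_seq + (M m * Sp i) * mode_moment m m (U2 m i) unit_seq
        = mode_moment m m (Sp i * U1 i + (M m * Sp i) * U2 m i) unit_seq"
        by (simp only: mode_moment_U_add[OF Q_unit_seq])
    qed
    also have "\<dots> = mode_moment m m (\<Sum>i<d. Sp i * U1 i + (M m * Sp i) * U2 m i) unit_seq"
      by (rule mode_moment_U_sum[OF Q_unit_seq, symmetric])
    also have "\<dots> = 1" unfolding reconstruction_sum[OF m] by (rule mode_moment_one_unit_seq)
    finally show ?thesis by simp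
  qed
  ultimately have "(\<lambda>L. ?p L Z) \<longlonglongrightarrow> moment m (mode_control m 0 Z)" by simp
  with lim show ?thesis using LIMSEQ_unique by blast
qed

lemma exp_absorb:
  assumes "0 \<le> (D::real)" "1 \<le> x"
  shows "D \<le> exp (D * x)"
proof -
  have "D \<le> exp D" using exp_ge_add_one_self[of D] by linarith
  also have "\<dots> \<le> exp (D * x)" using mult_left_mono[OF assms(2,1)] by simp
  finally show ?thesis .
qed

text \<open>The bump vanishes before \<open>T/3\<close>, so \<open>exp (t M\<^sub>m)\<close> contributes \<open>exp (- c m\<^sup>2)\<close>; the operator of infinite
order and the polynomial factors in \<open>m\<close> cost at most \<open>exp (D m\<^sup>3\<^sup>/\<^sup>2)\<close>.\<close>

lemma mode_control_bound:
  "\<exists>D\<ge>0. \<exists>c>0. \<forall>m\<ge>1. \<forall>j\<le>2. \<forall>Z. \<forall>t\<in>{0..T}. norm (mode_control m j Z t) \<le> exp (D * real m powr (3/2) - c * real m ^ 2) * norm Z"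
proof -
  obtain c C where cC: "c > 0" "C \<ge> 0"
    and decay: "\<forall>m\<ge>1. \<forall>t\<ge>0. norm (exp (t *\<^sub>R M m)) \<le> 2 * exp ((C - c * real m ^ 2) * t)"
    using modal_semigroup_decay[OF rho, of A] by blast
  obtain cM where cM: "cM \<ge> 1" "\<forall>m\<ge>1. norm (M m) \<le> cM * real m ^ 2"
    using norm_gen_op_bound[of \<rho> A] rho by auto
  have GR: "0 \<le> G" "1 \<le> R" using gevrey by (auto simp: gevrey_def)
  define Ca where "Ca = 2 * order_const \<rho> cg d + 12"
  have Ca: "0 \<le> Ca" using ordc0 by (simp add: Ca_def)
  define S where "S = (\<Sum>p. gevrey_term Ca R p)"
  have S0: "0 \<le> S" unfolding S_def
    using summable_gevrey_term[OF Ca, of R] GR cauchy_radius_ge_1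
    by (intro suminf_nonneg) (auto simp: gevrey_term_def cauchy_bound_def intro!: mult_nonneg_nonneg divide_nonneg_nonneg zero_le_power order_trans[OF zero_le_one cauchy_radius_ge_1])
  have "\<forall>i. \<exists>k\<ge>0. \<forall>x. norm (K i *v x) \<le> k * norm x" using matrix_bound by blast
  then obtain kK where kK: "\<And>i. 0 \<le> kK i" "\<And>i x. norm (K i *v x) \<le> kK i * norm x" by metis
  define P where "P = (\<Sum>i<d. kK i * (2 + \<rho>))"
  have P0: "0 \<le> P" unfolding P_def using kK rho by (intro sum_nonneg) auto
  define b where "b = Ca * (1 + 2 * R * cM)"
  have b0: "0 \<le> b" using Ca GR cM by (simp add: b_def)
  define F where "F = P * (G * (S + 1) * (2 * exp (C * T)))"
  have F0: "0 \<le> F" using P0 GR S0 by (simp add: F_def)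
  define D where "D = F + 4 * real d + b"
  have "norm (mode_control m j Z t) \<le> exp (D * real m powr (3/2) - (c * T / 3) * real m ^ 2) * norm Z"
    if m: "1 \<le> m" and j: "j \<le> 2" and t: "t \<in> {0..T}" for m j Z t
  proof (cases "t \<le> T / 3")
    case True
    then show ?thesis by (simp add: mode_control_support)
  next
    case False
    let ?x = "real m powr (3/2)"
    have x1: "1 \<le> ?x" using m by (intro ge_one_powr_ge_zero) auto
    define e where "e = exp (- (c * T / 3) * real m ^ 2)"
    have ez: "norm (exp (t *\<^sub>R M m)) \<le> 2 * exp (C * T) * e"
    proof -
      have le: "(C - c * real m ^ 2) * t \<le> C * T + - (c * T / 3) * real m ^ 2"
      proof -
        have "C * t \<le> C * T" using cC t by (intro mult_left_mono) auto
        moreover have "(c * real m ^ 2) * (T / 3) \<le> (c * real m ^ 2) * t" using cC False by (intro mult_left_mono) auto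
        ultimately show ?thesis by (simp add: algebra_simps)
      qed
      have "norm (exp (t *\<^sub>R M m)) \<le> 2 * exp ((C - c * real m ^ 2) * t)" using decay m t by auto
      also have "\<dots> \<le> 2 * exp (C * T + - (c * T / 3) * real m ^ 2)" using le by simp
      finally show ?thesis by (simp only: e_def exp_add mult.assoc)
    qed
    have gb: "gevrey_bound Ca G R (norm (M m)) \<le> G * (S + 1) * exp (b * ?x)"
    proof -
      have "1 + 2 * R * norm (M m) \<le> real m ^ 2 + 2 * R * (cM * real m ^ 2)"
        using m cM GR by (intro add_mono mult_left_mono) auto
      also have "\<dots> = (1 + 2 * R * cM) * real m ^ 2" by (simp add: algebra_simps)
      finally have "(1 + 2 * R * norm (M m)) powr (3/4) \<le> ((1 + 2 * R * cM) * real m ^ 2) powr (3/4)"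
        using GR by (intro powr_mono2) auto
      also have "\<dots> = (1 + 2 * R * cM) powr (3/4) * (real m ^ 2) powr (3/4)" using GR cM by (simp add: powr_mult)
      also have "(real m ^ 2) powr (3/4) = ?x" using m by (simp add: powr_powr flip: powr_numeral)
      also have "(1 + 2 * R * cM) powr (3/4) \<le> (1 + 2 * R * cM) powr 1" using GR cM by (intro powr_mono) auto
      finally have "(1 + 2 * R * norm (M m)) powr (3/4) \<le> (1 + 2 * R * cM) * ?x" using GR cM by (simp add: mult_right_mono)
      then have "exp (Ca * (1 + 2 * R * norm (M m)) powr (3/4)) \<le> exp (b * ?x)"
        using Ca by (simp add: b_def mult.assoc mult_left_mono)
      moreover have "S * 1 \<le> S * exp (b * ?x)" using S0 b0 x1 by (intro mult_left_mono) auto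
      ultimately have "S + exp (Ca * (1 + 2 * R * norm (M m)) powr (3/4)) \<le> (S + 1) * exp (b * ?x)"
        unfolding distrib_right mult_1 mult_1_right by linarith
      then show ?thesis unfolding gevrey_bound_def S_def[symmetric] using GR by (simp add: mult.assoc mult_left_mono)
    qed
    have gbd0: "0 \<le> gevrey_bound Ca G R (norm (M m))" using GR S0 by (simp add: gevrey_bound_def flip: S_def)
    define N where "N = G * (S + 1) * exp (b * ?x) * (2 * exp (C * T) * e)"
    have N0: "0 \<le> N" using GR S0 by (simp add: N_def e_def)
    have gN: "norm (gevrey_series \<kappa> (M m) ((shift ^^ l) (ctrl_seq m i)) t) \<le> N" if l: "l \<le> 3" and i: "i < d" for l i
    proof -
      have "entire_bound (2 * order_const \<rho> cg d + 4 * real l) ((shift ^^ l) (ctrl_seq m i))"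
        using i by (intro entire_bound_funpow_shift entire_bound_ctrl_seq m) auto
      then have "entire_bound Ca ((shift ^^ l) (ctrl_seq m i))" by (rule entire_bound_mono) (use l in \<open>simp add: Ca_def\<close>)
      from gevrey_family.norm_gevrey_series[OF gevM this Ca]
      have "norm (gevrey_series \<kappa> (M m) ((shift ^^ l) (ctrl_seq m i)) t) \<le> gevrey_bound Ca G R (norm (M m)) * norm (exp (t *\<^sub>R M m))" .
      also have "\<dots> \<le> N" unfolding N_def
        by (rule mult_mono[OF gb ez]) (use GR S0 in auto)
      finally show ?thesis .
    qed
    have m4: "real m ^ (4 * i) \<le> exp (4 * real d * ?x)" if "i < d" for i
    proof -
      have "real m ^ (4 * i) \<le> real m ^ (4 * d)" using m that by (intro power_increasing) auto
      also have "\<dots> \<le> exp ?x ^ (4 * d)"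
      proof (rule power_mono)
        have "real m powr 1 \<le> ?x" using m by (intro powr_mono) auto
        then have "real m \<le> ?x" using m by simp
        then show "real m \<le> exp ?x" using exp_ge_add_one_self[of ?x] by linarith
      qed simp
      also have "\<dots> = exp (4 * real d * ?x)" by (simp flip: exp_of_nat_mult)
      finally show ?thesis .
    qed
    have summand: "norm (real m ^ (4 * i) *\<^sub>R (L1 i Z (gevrey_series \<kappa> (M m) ((shift ^^ j) (ctrl_seq m i)) t)
        + L2 m i Z (gevrey_series \<kappa> (M m) ((shift ^^ Suc j) (ctrl_seq m i)) t))) \<le> exp (4 * real d * ?x) * (kK i * (2 + \<rho>) * (N * norm Z))"
      if i: "i < d" for i
    proof -
      let ?X = "gevrey_series \<kappa> (M m) ((shift ^^ j) (ctrl_seq m i)) t" and ?Y = "gevrey_series \<kappa> (M m) ((shift ^^ Suc j) (ctrl_seq m i)) t"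
      have X: "norm (ap ?X Z) \<le> N * norm Z"
        by (rule order_trans[OF norm_ap mult_right_mono[OF gN]]) (use i j in auto)
      have Y: "norm (ap ?Y Z) \<le> N * norm Z"
        by (rule order_trans[OF norm_ap mult_right_mono[OF gN]]) (use i j in auto)
      have fs: "norm (fst v) \<le> norm v" "norm (snd v) \<le> norm v" for v :: "'n st"
        using norm_fst_le[of "fst v" "snd v"] norm_snd_le[of "snd v" "fst v"] by simp_all
      have "norm (snd (ap ?X Z) + \<rho> *\<^sub>R fst (ap ?X Z)) \<le> N * norm Z + \<rho> * (N * norm Z)"
        by (rule order_trans[OF norm_triangle_ineq])
          (use rho X fs[of "ap ?X Z"] in \<open>auto intro!: add_mono mult_left_mono intro: order_trans\<close>)
      then have 1: "norm (L1 i Z ?X) \<le> kK i * (N * norm Z + \<rho> * (N * norm Z))"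
        unfolding L1_def by (rule order_trans[OF kK(2) mult_left_mono]) (rule kK)
      have "norm ((1 / real m ^ 2) *\<^sub>R fst (ap ?Y Z)) \<le> 1 * (N * norm Z)"
        unfolding norm_scaleR using m Y fs(1)[of "ap ?Y Z"] by (intro mult_mono) (auto intro: order_trans)
      then have 2: "norm (L2 m i Z ?Y) \<le> kK i * (1 * (N * norm Z))"
        unfolding L2_def by (rule order_trans[OF kK(2) mult_left_mono]) (rule kK)
      have "norm (L1 i Z ?X + L2 m i Z ?Y) \<le> kK i * (2 + \<rho>) * (N * norm Z)"
        using norm_triangle_ineq[of "L1 i Z ?X" "L2 m i Z ?Y"] 1 2 by (simp add: algebra_simps)
      then show ?thesis unfolding norm_scaleR using m4[OF i] by (intro mult_mono) auto
    qed
    have "norm (mode_control m j Z t) \<le> (\<Sum>i<d. exp (4 * real d * ?x) * (kK i * (2 + \<rho>) * (N * norm Z)))"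
      unfolding mode_control_def by (rule sum_norm_le) (use summand in auto)
    also have "\<dots> = exp (4 * real d * ?x) * (P * N) * norm Z"
      unfolding P_def sum_distrib_left sum_distrib_right by (simp add: mult_ac)
    also have "\<dots> \<le> exp (4 * real d * ?x) * (exp (F * ?x) * exp (b * ?x) * e) * norm Z"
    proof (intro mult_right_mono mult_left_mono)
      have "P * N = F * exp (b * ?x) * e" by (simp add: N_def F_def)
      also have "\<dots> \<le> exp (F * ?x) * exp (b * ?x) * e"
        using exp_absorb[OF F0 x1] by (intro mult_right_mono) (auto simp: e_def)
      finally show "P * N \<le> exp (F * ?x) * exp (b * ?x) * e" .
    qed auto
    also have "\<dots> = exp (D * ?x - (c * T / 3) * real m ^ 2) * norm Z"
      by (simp add: D_def e_def exp_add[symmetric] algebra_simps)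
    finally show ?thesis .
  qed
  moreover have "0 \<le> D" using F0 b0 by (simp add: D_def)
  moreover have "0 < c * T / 3" using cC T by simp
  ultimately show ?thesis by blast
qed

end

section \<open>The control\<close>

lemma exp_three_halves_summable:
  assumes "0 \<le> D" "0 < (c::real)"
  shows "summable (\<lambda>k. exp (D * real (Suc k) powr (3/2) - c * real (Suc k) ^ 2))"
proof -
  define L where "L = D * (2 * D / c) powr 3"
  have L0: "0 \<le> L" using assms by (simp add: L_def)
  have *: "D * x powr (3/2) \<le> c / 2 * x ^ 2 + L" if "1 \<le> x" for x :: real
  proof (cases "2 * D / c \<le> x powr (1/2)")
    case True
    then have "D \<le> c / 2 * x powr (1/2)" using assms by (simp add: field_simps)
    then have "D * x powr (3/2) \<le> c / 2 * x powr (1/2) * x powr (3/2)" by (rule mult_right_mono) simp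
    also have "\<dots> = c / 2 * x ^ 2"
    proof -
      have "x powr (1/2) * x powr (3/2) = x powr 2" by (simp only: powr_add[symmetric]) simp
      then show ?thesis using that by simp
    qed
    finally show ?thesis using L0 by simp
  next
    case False
    have "x powr (3/2) = (x powr (1/2)) powr 3" by (simp add: powr_powr)
    also have "\<dots> \<le> (2 * D / c) powr 3" using False by (intro powr_mono2) auto
    finally have "D * x powr (3/2) \<le> L" unfolding L_def using assms by (intro mult_left_mono) auto
    moreover have "0 \<le> c / 2 * x ^ 2" using assms by simp
    ultimately show ?thesis by linarith
  qed
  have "exp (D * real (Suc k) powr (3/2) - c * real (Suc k) ^ 2) \<le> exp L * exp (- (c / 2)) ^ k" for k
  proof -
    have "real k \<le> real (Suc k) ^ 2" using self_le_power[of "real (Suc k)" 2] by simp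
    then have "c / 2 * real k \<le> c / 2 * real (Suc k) ^ 2" using assms by (intro mult_left_mono) auto
    then have "D * real (Suc k) powr (3/2) - c * real (Suc k) ^ 2 \<le> L + real k * (- (c / 2))"
      using *[of "real (Suc k)"] by (simp del: of_nat_Suc add: mult.commute)
    then have "exp (D * real (Suc k) powr (3/2) - c * real (Suc k) ^ 2) \<le> exp (L + real k * (- (c / 2)))" by simp
    also have "\<dots> = exp L * exp (- (c / 2)) ^ k" by (simp only: exp_add exp_of_nat_mult)
    finally show ?thesis .
  qed
  then have b: "norm (exp (D * real (Suc k) powr (3/2) - c * real (Suc k) ^ 2)) \<le> exp L * exp (- (c / 2)) ^ k" for k
    by (simp only: real_norm_def abs_exp_cancel)
  have s: "summable (\<lambda>k. exp L * exp (- (c / 2)) ^ k)"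
    using assms by (intro summable_mult summable_geometric) simp
  show ?thesis by (rule summable_comparison_test'[OF s, of 0]) (rule b)
qed

context moment_control
begin

text \<open>Inverts the two operators between the data \<open>Z\<close> of a mode control and the initial state \<open>Y\<close> of the mode:
\<open>\<Phi>\<^sub>m(M\<^sub>m)\<close> and the transfer operator \<open>M\<^sub>m\<^sup>2 + A\<close>.\<close>

lemma modal_targets:
  assumes "spectral_gap \<rho> A" "transfer_gap \<rho> A"
  shows "\<exists>D\<ge>0. \<forall>m\<ge>1. \<forall>Y. \<exists>y Z. (\<lambda>L. qproduct \<rho> (gen_map \<rho> A m) (scal_map g) d m L Z) \<longlonglongrightarrow> y
     \<and> ap (M m * M m + mat_op A) y = (1 / lift_coeff m) *\<^sub>R Y \<and> norm Z \<le> exp (D * real m powr (3/2)) * norm Y"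
proof -
  obtain C where C: "C \<ge> 0" "\<forall>m\<ge>1. \<forall>y. \<exists>z. (\<lambda>L. qproduct \<rho> (gen_map \<rho> A m) (scal_map g) d m L z) \<longlonglongrightarrow> y
     \<and> norm z \<le> exp (C * real m powr (3/2)) * norm y"
    using qproduct_modal_surjective[where g = g and d = d, OF rho assms(1) eig gb] by blast
  obtain c where c: "c > 0" "\<forall>m\<ge>1. \<forall>v. c * norm v \<le> norm (ap (M m * M m + mat_op A) v)"
    using transfer_lower_bound[OF rho assms(2)] by blast
  define D where "D = C + 1 + 2 / c"
  have "\<exists>y Z. (\<lambda>L. qproduct \<rho> (gen_map \<rho> A m) (scal_map g) d m L Z) \<longlonglongrightarrow> y
     \<and> ap (M m * M m + mat_op A) y = (1 / lift_coeff m) *\<^sub>R Y \<and> norm Z \<le> exp (D * real m powr (3/2)) * norm Y"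
    if m: "1 \<le> m" for m Y
  proof -
    let ?x = "real m powr (3/2)"
    have x: "1 \<le> ?x" "real m \<le> ?x"
      using m powr_mono[of 1 "3/2" "real m"] by (auto intro: ge_one_powr_ge_zero)
    let ?L = "ap (M m * M m + mat_op A)"
    have "inj ?L"
      unfolding linear_injective_0[OF linear_ap]
    proof (intro allI impI)
      fix v assume "?L v = 0"
      then have "c * norm v \<le> 0" using c(2)[rule_format, OF m, of v] by simp
      then show "v = 0" using c(1) by (simp add: mult_le_0_iff)
    qed
    then have "surj ?L" by (rule linear_injective_imp_surjective[OF linear_ap _ refl])
    then obtain y where y: "?L y = (1 / lift_coeff m) *\<^sub>R Y" by (metis surjD)
    obtain Z where Z: "(\<lambda>L. qproduct \<rho> (gen_map \<rho> A m) (scal_map g) d m L Z) \<longlonglongrightarrow> y" "norm Z \<le> exp (C * ?x) * norm y"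
      using C(2) m by blast
    have "c * norm y \<le> norm ((1 / lift_coeff m) *\<^sub>R Y)" using c(2) m y by metis
    also have "\<dots> = 1 / \<bar>lift_coeff m\<bar> * norm Y" by simp
    also have "\<dots> \<le> 2 * real m * norm Y" by (intro mult_right_mono lift_coeff_bounds m) auto
    finally have "norm y \<le> (2 / c) * real m * norm Y" using c(1) by (simp add: field_simps)
    also have "\<dots> \<le> exp (2 / c * ?x) * exp ?x * norm Y"
    proof (intro mult_right_mono mult_mono)
      show "2 / c \<le> exp (2 / c * ?x)" using c(1) x by (intro exp_absorb) auto
      show "real m \<le> exp ?x" using x exp_ge_add_one_self[of ?x] by linarith
    qed auto
    finally have "exp (C * ?x) * norm y \<le> exp (C * ?x) * (exp (2 / c * ?x) * exp ?x * norm Y)"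
      by (intro mult_left_mono) auto
    also have "\<dots> = exp (D * ?x) * norm Y"
      by (simp add: D_def exp_add[symmetric] distrib_right algebra_simps)
    finally show ?thesis using Z y by (meson order_trans)
  qed
  moreover have "0 \<le> D" using C(1) c(1) by (simp add: D_def)
  ultimately show ?thesis by blast
qed

lemma moment_deriv:
  assumes "\<And>t. t \<in> {0..T} \<Longrightarrow> (h has_vector_derivative h' t) (at t within {0..T})"
    and "continuous_on {0..T} h'" "h 0 = 0" "h T = 0"
  shows "moment n h' = ap (M n) (moment n h)"
proof -
  define J where "J w = ((0, B *v w) :: 'n st)" for w :: "complex^'l"
  have J: "bounded_linear J"
    unfolding J_def[abs_def] by (intro bounded_linear_Pair bounded_linear_zero bounded_linear_matrix)
  have ch: "continuous_on {0..T} h" by (rule continuous_on_vector_derivative[OF assms(1)])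
  have cont: "continuous_on {0..T} (\<lambda>s. ap (E n s) (J (k s)))" if "continuous_on {0..T} k" for k
    by (intro ap.continuous_on E_continuous continuous_on_compose2[OF linear_continuous_on[OF J, of UNIV] that]) auto
  have "((\<lambda>s. ap (E n s) (J (h s))) has_vector_derivative ap (E n t) (J (h' t)) + ap (- M n * E n t) (J (h t)))
      (at t within {0..T})" if "t \<in> {0..T}" for t
    by (rule ap.has_vector_derivative[OF E_deriv bounded_linear.has_vector_derivative[OF J assms(1)[OF that]]])
  then have "((\<lambda>t. ap (E n t) (J (h' t)) + ap (- M n * E n t) (J (h t))) has_integral
      (ap (E n T) (J (h T)) - ap (E n 0) (J (h 0)))) {0..T}"
    using T by (intro fundamental_theorem_of_calculus) auto
  then have "((\<lambda>t. ap (E n t) (J (h' t)) - ap (M n) (ap (E n t) (J (h t)))) has_integral 0) {0..T}"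
    unfolding assms(3,4) by (simp add: linear_0[OF bounded_linear.linear[OF J]] ap.minus_left ap_mult ap.zero_right)
  moreover have "((\<lambda>t. ap (M n) (ap (E n t) (J (h t)))) has_integral ap (M n) (moment n h)) {0..T}"
    unfolding moment_def J_def[symmetric]
    using has_integral_linear[OF integrable_integral[OF integrable_continuous_real[OF cont[OF ch]]] ap.bounded_linear_right]
    by (simp add: o_def)
  ultimately have "((\<lambda>t. (ap (E n t) (J (h' t)) - ap (M n) (ap (E n t) (J (h t)))) + ap (M n) (ap (E n t) (J (h t))))
     has_integral (0 + ap (M n) (moment n h))) {0..T}"
    by (rule has_integral_add)
  then show ?thesis unfolding moment_def J_def[symmetric] by (simp add: integral_unique)
qed

text \<open>The sum of the mode controls over all modes, which converges uniformly with two derivatives because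
\<open>exp (D m\<^sup>3\<^sup>/\<^sup>2 - c m\<^sup>2)\<close> is summable. Two integrations by parts convert the moments of \<open>f\<close> into
those of the forcing \<open>B f'' + A B f\<close>.\<close>

lemma control_exists:
  assumes gaps: "spectral_gap \<rho> A" "transfer_gap \<rho> A"
  shows "\<exists>C\<ge>0. \<forall>Y N. (\<forall>m\<ge>1. norm (Y m) \<le> N) \<longrightarrow> (\<exists>f f1 f2.
      (\<forall>t\<in>{0..T}. (f has_vector_derivative f1 t) (at t within {0..T}))
    \<and> (\<forall>t\<in>{0..T}. (f1 has_vector_derivative f2 t) (at t within {0..T}))
    \<and> continuous_on {0..T} f2
    \<and> f 0 = 0 \<and> f1 0 = 0 \<and> f T = 0 \<and> f1 T = 0
    \<and> (\<forall>t\<in>{0..T}. norm (f t) \<le> C * N \<and> norm (f1 t) \<le> C * N \<and> norm (f2 t) \<le> C * N)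
    \<and> (\<forall>n\<ge>1. integral {0..T} (\<lambda>s. ap (E n s) (0, B *v f2 s + A *v (B *v f s))) = (1 / lift_coeff n) *\<^sub>R Y n))"
proof -
  obtain D1 where D1: "D1 \<ge> 0" "\<forall>m\<ge>1. \<forall>Y. \<exists>y Z. (\<lambda>L. qproduct \<rho> (gen_map \<rho> A m) (scal_map g) d m L Z) \<longlonglongrightarrow> y
     \<and> ap (M m * M m + mat_op A) y = (1 / lift_coeff m) *\<^sub>R Y \<and> norm Z \<le> exp (D1 * real m powr (3/2)) * norm Y"
    using modal_targets[OF gaps] by blast
  obtain D2 c where D2: "D2 \<ge> 0" "c > 0" "\<forall>m\<ge>1. \<forall>j\<le>2. \<forall>Z. \<forall>t\<in>{0..T}.
     norm (mode_control m j Z t) \<le> exp (D2 * real m powr (3/2) - c * real m ^ 2) * norm Z"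
    using mode_control_bound by blast
  define \<eta> where "\<eta> k = exp ((D1 + D2) * real (Suc k) powr (3/2) - c * real (Suc k) ^ 2)" for k
  have s\<eta>: "summable \<eta>" unfolding \<eta>_def[abs_def] using D1(1) D2 by (intro exp_three_halves_summable) auto
  define C where "C = suminf \<eta>"
  have C0: "0 \<le> C" unfolding C_def using s\<eta> by (intro suminf_nonneg) (auto simp: \<eta>_def)
  have main: "\<exists>f f1 f2.
      (\<forall>t\<in>{0..T}. (f has_vector_derivative f1 t) (at t within {0..T}))
    \<and> (\<forall>t\<in>{0..T}. (f1 has_vector_derivative f2 t) (at t within {0..T}))
    \<and> continuous_on {0..T} f2
    \<and> f 0 = 0 \<and> f1 0 = 0 \<and> f T = 0 \<and> f1 T = 0
    \<and> (\<forall>t\<in>{0..T}. norm (f t) \<le> C * N \<and> norm (f1 t) \<le> C * N \<and> norm (f2 t) \<le> C * N)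
    \<and> (\<forall>n\<ge>1. integral {0..T} (\<lambda>s. ap (E n s) (0, B *v f2 s + A *v (B *v f s))) = (1 / lift_coeff n) *\<^sub>R Y n)"
    if Y: "\<forall>m\<ge>1. norm (Y m) \<le> N" for Y N
  proof -
    have "\<forall>m. \<exists>y Z. 1 \<le> m \<longrightarrow> (\<lambda>L. qproduct \<rho> (gen_map \<rho> A m) (scal_map g) d m L Z) \<longlonglongrightarrow> y
     \<and> ap (M m * M m + mat_op A) y = (1 / lift_coeff m) *\<^sub>R Y m \<and> norm Z \<le> exp (D1 * real m powr (3/2)) * norm (Y m)"
      using D1(2) by blast
    then obtain y Z where yZ: "\<forall>m. 1 \<le> m \<longrightarrow> (\<lambda>L. qproduct \<rho> (gen_map \<rho> A m) (scal_map g) d m L (Z m)) \<longlonglongrightarrow> y m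
     \<and> ap (M m * M m + mat_op A) (y m) = (1 / lift_coeff m) *\<^sub>R Y m \<and> norm (Z m) \<le> exp (D1 * real m powr (3/2)) * norm (Y m)"
      by metis
    define h where "h j k t = mode_control (Suc k) j (Z (Suc k)) t" for j k t
    define F where "F j t = (\<Sum>k. h j k t)" for j t
    have hb: "norm (h j k t) \<le> \<eta> k * N" if "j \<le> 2" "t \<in> {0..T}" for j k t
    proof -
      let ?x = "real (Suc k) powr (3/2)"
      have "norm (h j k t) \<le> exp (D2 * ?x - c * real (Suc k) ^ 2) * norm (Z (Suc k))"
        unfolding h_def by (rule D2(3)[rule_format]) (use that in auto)
      also have "\<dots> \<le> exp (D2 * ?x - c * real (Suc k) ^ 2) * (exp (D1 * ?x) * N)"
      proof (rule mult_left_mono)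
        have "norm (Z (Suc k)) \<le> exp (D1 * ?x) * norm (Y (Suc k))"
          using yZ[rule_format, of "Suc k"] by (simp del: of_nat_Suc)
        also have "\<dots> \<le> exp (D1 * ?x) * N" using Y by (intro mult_left_mono) auto
        finally show "norm (Z (Suc k)) \<le> exp (D1 * ?x) * N" .
      qed simp
      also have "\<dots> = \<eta> k * N" by (simp add: \<eta>_def exp_add[symmetric] algebra_simps del: of_nat_Suc)
      finally show ?thesis .
    qed
    have sN: "summable (\<lambda>k. \<eta> k * N)" by (rule summable_mult2[OF s\<eta>])
    have sumh: "summable (\<lambda>k. h j k t)" if "j \<le> 2" "t \<in> {0..T}" for j t
      by (rule summable_comparison_test'[OF sN, of 0]) (rule hb[OF that])
    have Fb: "norm (F j t) \<le> C * N" if "j \<le> 2" "t \<in> {0..T}" for j t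
      unfolding F_def C_def suminf_mult2[OF s\<eta>]
      by (rule norm_suminf_le[OF hb[OF that] sN])
    have hd: "(h j k has_vector_derivative h (Suc j) k t) (at t within {0..T})" if "t \<in> {0..T}" for j k t
      unfolding h_def[abs_def] by (rule mode_control_deriv[OF that])
    have Fd: "(F j has_vector_derivative F (Suc j) t) (at t within {0..T})" if "j \<le> 1" "t \<in> {0..T}" for j t
      unfolding F_def[abs_def]
    proof (rule has_vector_derivative_suminf[where f = "h j" and b = "\<lambda>k. \<eta> k * N"])
      show "norm (h (Suc j) k t) \<le> \<eta> k * N" if "t \<in> {0..T}" for k t
        using hb[of "Suc j" t k] that \<open>j \<le> 1\<close> by simp
      show "summable (\<lambda>k. h j k t)" if "t \<in> {0..T}" for t
        using sumh[of j t] that \<open>j \<le> 1\<close> by simp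
    qed (use hd sN that in auto)
    have ul: "uniform_limit {0..T} (\<lambda>L t. \<Sum>k<L. h j k t) (F j) sequentially" if "j \<le> 2" for j
      unfolding F_def[abs_def] by (rule Weierstrass_m_test[OF _ sN]) (rule hb[OF that])
    have hc: "continuous_on {0..T} (h j k)" for j k
      by (rule continuous_on_vector_derivative) (rule hd)
    have Fc: "continuous_on {0..T} (F j)" if "j \<le> 2" for j
      by (rule uniform_limit_theorem[OF always_eventually ul[OF that]]) (auto intro!: continuous_on_sum hc)
    have h0: "h j k t = 0" if "t = 0 \<or> t = T" for j k t
      unfolding h_def using that T by (intro mode_control_support) auto
    have F0: "F j t = 0" if "t = 0 \<or> t = T" for j t
      unfolding F_def using h0[OF that] by simp
    have momF: "moment n (F 0) = y n" if n: "1 \<le> n" for n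
    proof -
      define J where "J w = ((0, B *v w) :: 'n st)" for w :: "complex^'l"
      have J: "bounded_linear J"
        unfolding J_def[abs_def] by (intro bounded_linear_Pair bounded_linear_zero bounded_linear_matrix)
      let ?S = "\<lambda>L t. \<Sum>k<L. h 0 k t"
      have u2: "uniform_limit {0..T} (\<lambda>L t. J (?S L t)) (\<lambda>t. J (F 0 t)) sequentially"
        by (rule bounded_linear.uniform_limit[OF J ul]) simp
      have cJ: "continuous_on {0..T} (\<lambda>t. J (k t))" if "continuous_on {0..T} k" for k
        by (intro continuous_on_compose2[OF linear_continuous_on[OF J, of UNIV] that]) auto
      have cS: "continuous_on {0..T} (?S L)" for L by (intro continuous_on_sum hc)
      have bE: "bounded (E n ` {0..T})"
        by (intro compact_imp_bounded compact_continuous_image E_continuous) simp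
      have bJ: "bounded ((\<lambda>t. J (F 0 t)) ` {0..T})"
        by (intro compact_imp_bounded compact_continuous_image cJ Fc) simp_all
      have u3: "uniform_limit {0..T} (\<lambda>L t. ap (E n t) (J (?S L t))) (\<lambda>t. ap (E n t) (J (F 0 t))) sequentially"
        by (rule bounded_bilinear.bounded_uniform_limit[OF bounded_bilinear_ap _ u2 bJ bE]) (rule uniform_limit_const)
      have c3: "continuous_on {0..T} (\<lambda>t. ap (E n t) (J (?S L t)))" for L
        by (intro ap.continuous_on E_continuous cJ cS)
      obtain I I' where I: "\<And>L. ((\<lambda>t. ap (E n t) (J (?S L t))) has_integral I L) {0..T}"
        "((\<lambda>t. ap (E n t) (J (F 0 t))) has_integral I') {0..T}" "I \<longlonglongrightarrow> I'"
      proof (rule uniform_limit_integral[OF u3 c3 trivial_limit_sequentially])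
        fix I I'
        assume "\<And>L. ((\<lambda>t. ap (E n t) (J (?S L t))) has_integral I L) {0..T}"
          "((\<lambda>t. ap (E n t) (J (F 0 t))) has_integral I') {0..T}" "I \<longlonglongrightarrow> I'"
        then show thesis by (rule that[of I I'])
      qed
      have I': "I' = moment n (F 0)" unfolding moment_def J_def[symmetric] by (rule integral_unique[OF I(2), symmetric])
      have hi: "((\<lambda>t. ap (E n t) (J (h 0 k t))) has_integral moment n (h 0 k)) {0..T}" for k
        unfolding moment_def J_def[symmetric]
        by (intro integrable_integral integrable_continuous_real ap.continuous_on E_continuous cJ hc)
      have hs: "((\<lambda>t. \<Sum>k<L. ap (E n t) (J (h 0 k t))) has_integral (\<Sum>k<L. moment n (h 0 k))) {0..T}" for L
        by (rule has_integral_sum[OF finite_lessThan hi])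
      have sw: "ap (E n t) (J (?S L t)) = (\<Sum>k<L. ap (E n t) (J (h 0 k t)))" for L t
        by (simp only: ap.sum_right linear_sum[OF bounded_linear.linear[OF J]])
      have IL: "I L = (\<Sum>k<L. moment n (h 0 k))" for L
        by (rule has_integral_unique[OF I(1)[unfolded sw] hs])
      have "moment n (h 0 k) = (if k = n - 1 then y n else 0)" for k
      proof (cases "k = n - 1")
        case True
        then have "Suc k = n" using n by simp
        then show ?thesis unfolding h_def[abs_def] using moment_mode_control_diagonal[OF n, of "Z n" "y n"] yZ n True by simp
      next
        case False
        then have "n \<noteq> Suc k" by auto
        then show ?thesis unfolding h_def[abs_def] using moment_mode_control_offdiagonal[of "Suc k" n] n False by simp
      qed
      then have "I L = y n" if "n \<le> L" for L
        unfolding IL using that n by (auto simp: sum.delta)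
      then have "I \<longlonglongrightarrow> y n"
        by (intro tendsto_eventually) (auto simp: eventually_sequentially)
      with I(3) I' show ?thesis using LIMSEQ_unique by blast
    qed
    have fin: "integral {0..T} (\<lambda>s. ap (E n s) (0, B *v F 2 s + A *v (B *v F 0 s))) = (1 / lift_coeff n) *\<^sub>R Y n"
      if n: "1 \<le> n" for n
    proof -
      have two: "Suc (Suc 0) = (2::nat)" by simp
      have "moment n (F 2) = ap (M n) (moment n (F 1))"
        by (rule moment_deriv) (use Fd[of 1] Fc[of 2] F0 in \<open>auto simp: two\<close>)
      also have "moment n (F 1) = ap (M n) (moment n (F 0))"
        by (rule moment_deriv) (use Fd[of 0] Fc[of 1] F0 in auto)
      finally have m2: "moment n (F 2) = ap (M n * M n) (y n)" by (simp add: momF[OF n] ap_mult)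
      have cJ: "continuous_on {0..T} (\<lambda>s. ap (E n s) (0, B *v F j s))" if "j \<le> 2" for j
        by (intro ap.continuous_on E_continuous continuous_on_Pair continuous_on_const
            continuous_on_compose2[OF linear_continuous_on[OF bounded_linear_matrix, of UNIV] Fc[OF that]]) auto
      have hi: "((\<lambda>s. ap (E n s) (0, B *v F j s)) has_integral moment n (F j)) {0..T}" if "j \<le> 2" for j
        unfolding moment_def by (intro integrable_integral integrable_continuous_real cJ that)
      have "((\<lambda>s. ap (mat_op A) (ap (E n s) (0, B *v F 0 s))) has_integral ap (mat_op A) (moment n (F 0))) {0..T}"
        using has_integral_linear[OF hi[of 0] ap.bounded_linear_right, of "mat_op A"] by (simp add: o_def)
      from has_integral_add[OF hi[of 2] this]
      have "((\<lambda>s. ap (E n s) (0, B *v F 2 s) + ap (mat_op A) (ap (E n s) (0, B *v F 0 s))) has_integral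
         (ap (M n * M n) (y n) + ap (mat_op A) (y n))) {0..T}"
        by (simp add: m2 momF[OF n])
      moreover have "ap (E n s) (0, B *v F 2 s) + ap (mat_op A) (ap (E n s) (0, B *v F 0 s))
        = ap (E n s) (0, B *v F 2 s + A *v (B *v F 0 s))" for s
      proof -
        have "ap (mat_op A) (ap (E n s) v) = ap (E n s) (ap (mat_op A) v)" for v
          unfolding ap_mult[symmetric] E_commute[OF mat_op_gen_op] ..
        then have "ap (mat_op A) (ap (E n s) (0, B *v F 0 s)) = ap (E n s) (0, A *v (B *v F 0 s))"
          by (simp add: ap_mat_op)
        then show ?thesis by (simp flip: ap.add_right)
      qed
      ultimately show ?thesis using yZ n by (simp add: integral_unique ap.add_left)
    qed
    show ?thesis
    proof (rule exI[of _ "F 0"], rule exI[of _ "F 1"], rule exI[of _ "F 2"], intro conjI)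
      show "\<forall>t\<in>{0..T}. (F 0 has_vector_derivative F 1 t) (at t within {0..T})"
        using Fd[of 0] by simp
      show "\<forall>t\<in>{0..T}. (F 1 has_vector_derivative F 2 t) (at t within {0..T})"
        using Fd[of 1] by (simp add: numeral_2_eq_2)
    qed (use Fc F0 Fb fin in auto)
  qed
  show ?thesis using C0 main by (intro exI[of _ C] conjI allI impI) auto
qed

end

section \<open>The modal initial value problem\<close>

lemma LINT_continuous:
  fixes h :: "real \<Rightarrow> 'a::euclidean_space"
  assumes "continuous_on {a..b} h"
  shows "integrable (lebesgue_on {a..b}) h" "(LINT x|lebesgue_on {a..b}. h x) = integral {a..b} h"
proof -
  show i: "integrable (lebesgue_on {a..b}) h" by (rule continuous_imp_integrable_real[OF assms])
  show "(LINT x|lebesgue_on {a..b}. h x) = integral {a..b} h"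
    by (rule lebesgue_integral_eq_integral[OF i]) simp
qed

lemma primitive_LINT:
  fixes h :: "real \<Rightarrow> 'a::euclidean_space"
  assumes "\<And>t. t \<in> {0..T} \<Longrightarrow> (h has_vector_derivative h' t) (at t within {0..T})"
    and "continuous_on {0..T} h'" "t \<in> {0..T}"
  shows "h t = h 0 + (LINT r|lebesgue_on {0..t}. h' r)"
proof -
  have sub: "{0..t} \<subseteq> {0..T}" using assms(3) by auto
  have "(h' has_integral (h t - h 0)) {0..t}"
    using assms sub by (intro fundamental_theorem_of_calculus has_vector_derivative_within_subset[OF assms(1) sub]) auto
  then have "integral {0..t} h' = h t - h 0" by (rule integral_unique)
  then show ?thesis using LINT_continuous(2)[OF continuous_on_subset[OF assms(2) sub]] by simp
qed

text \<open>The state of mode \<open>m\<close> with initial value \<open>Y\<close> and forcing \<open>- x\<^sub>m h\<close> in the velocity.\<close>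

definition duhamel :: "real \<Rightarrow> complex^'n^'n \<Rightarrow> nat \<Rightarrow> ('n::finite) st \<Rightarrow> (real \<Rightarrow> complex^'n) \<Rightarrow> real \<Rightarrow> 'n st" where
  "duhamel \<rho> A m Y h t = ap (exp (t *\<^sub>R gen_op \<rho> A m))
     (Y - lift_coeff m *\<^sub>R integral {0..t} (\<lambda>s. ap (exp (s *\<^sub>R (- gen_op \<rho> A m))) (0, h s)))"

lemma exp_op_continuous: "continuous_on S (\<lambda>s. exp (s *\<^sub>R (X :: 'a::{real_normed_algebra_1,banach})))"
  by (rule continuous_on_vector_derivative)
    (rule has_vector_derivative_at_within[OF exp_scaleR_has_vector_derivative_left])

lemma forcing_continuous:
  fixes h :: "real \<Rightarrow> complex^'n"
  assumes "continuous_on S h"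
  shows "continuous_on S (\<lambda>s. ap (exp (s *\<^sub>R X)) ((0, h s) :: ('n::finite) st))"
  by (intro ap.continuous_on exp_op_continuous continuous_on_Pair continuous_on_const assms)

lemma exp_op_cancel: "exp (t *\<^sub>R M) * exp (t *\<^sub>R (- M)) = (1 :: 'a::{real_normed_algebra_1,banach})"
  "exp (t *\<^sub>R (- M)) * exp (t *\<^sub>R M) = (1 :: 'a)"
proof -
  have "exp (t *\<^sub>R M + t *\<^sub>R (- M)) = exp (t *\<^sub>R M) * exp (t *\<^sub>R (- M))"
    by (rule exp_add_commuting) simp
  then show "exp (t *\<^sub>R M) * exp (t *\<^sub>R (- M)) = 1" by simp
  have "exp (t *\<^sub>R (- M) + t *\<^sub>R M) = exp (t *\<^sub>R (- M)) * exp (t *\<^sub>R M)"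
    by (rule exp_add_commuting) simp
  then show "exp (t *\<^sub>R (- M)) * exp (t *\<^sub>R M) = 1" by simp
qed

lemma duhamel_deriv:
  fixes A :: "complex^'n^'n"
  assumes h: "continuous_on {0..T} h" and t: "t \<in> {0..T}"
  shows "(duhamel \<rho> A m Y h has_vector_derivative
     ap (gen_op \<rho> A m) (duhamel \<rho> A m Y h t) - lift_coeff m *\<^sub>R (0, h t)) (at t within {0..T})"
proof -
  let ?M = "gen_op \<rho> A m"
  let ?q = "\<lambda>s. ap (exp (s *\<^sub>R (- ?M))) (0, h s)"
  have dI: "((\<lambda>t. integral {0..t} ?q) has_vector_derivative ?q t) (at t within {0..T})"
    by (rule integral_has_vector_derivative[OF forcing_continuous[OF h] t])
  then have dz: "((\<lambda>t. Y - lift_coeff m *\<^sub>R integral {0..t} ?q) has_vector_derivative 0 - lift_coeff m *\<^sub>R ?q t) (at t within {0..T})"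
    by (intro has_vector_derivative_diff has_vector_derivative_const
        bounded_linear.has_vector_derivative[OF bounded_linear_scaleR_right])
  have de: "((\<lambda>t. exp (t *\<^sub>R ?M)) has_vector_derivative ?M * exp (t *\<^sub>R ?M)) (at t within {0..T})"
    by (rule has_vector_derivative_at_within[OF exp_scaleR_has_vector_derivative_left])
  have "ap (exp (t *\<^sub>R ?M)) (0 - lift_coeff m *\<^sub>R ?q t) = - (lift_coeff m *\<^sub>R (0, h t))"
  proof -
    have "ap (exp (t *\<^sub>R ?M)) (?q t) = (0, h t)"
      unfolding ap_mult[symmetric] exp_op_cancel by simp
    then show ?thesis by (simp only: diff_0 ap.minus_right ap.scaleR_right)
  qed
  with ap.has_vector_derivative[OF de dz]
  show ?thesis by (simp only: duhamel_def[abs_def] ap_mult uminus_add_conv_diff)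
qed

lemma duhamel_0: "duhamel \<rho> A m Y h 0 = Y"
  by (simp add: duhamel_def)

text \<open>The forcing gains \<open>m\<^sup>-\<^sup>3\<close>: one power comes from the coefficient of the lift and two from integrating
\<open>exp (- c m\<^sup>2 t)\<close>. This is what puts the solution into the space of order \<open>3\<close>.\<close>

lemma duhamel_bound:
  fixes A :: "complex^'n^'n"
  assumes rho: "0 < \<rho>" "\<rho> < 2" and T: "0 < T"
  shows "\<exists>C\<ge>0. \<forall>m\<ge>1. \<forall>Y h N t. continuous_on {0..T} h \<longrightarrow> (\<forall>s\<in>{0..T}. norm (h s) \<le> N) \<longrightarrow> t \<in> {0..T} \<longrightarrow>
     norm (duhamel \<rho> A m Y h t) \<le> C * (norm Y + N / real m ^ 3)"
proof -
  obtain c C where cC: "c > 0" "C \<ge> 0"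
    and decay: "\<forall>m\<ge>1. \<forall>t\<ge>0. norm (exp (t *\<^sub>R gen_op \<rho> A m)) \<le> 2 * exp ((C - c * real m ^ 2) * t)"
    using modal_semigroup_decay[OF rho, of A] by blast
  define K where "K = 2 * exp (C * T)"
  have K0: "0 < K" by (simp add: K_def)
  have ek: "norm (exp (t *\<^sub>R gen_op \<rho> A m)) \<le> K * exp (- (c * real m ^ 2) * t)" if "1 \<le> m" "t \<in> {0..T}" for m t
  proof -
    have "norm (exp (t *\<^sub>R gen_op \<rho> A m)) \<le> 2 * exp ((C - c * real m ^ 2) * t)" using decay that by auto
    also have "\<dots> = 2 * exp (C * t) * exp (- (c * real m ^ 2) * t)"
      by (simp add: exp_add[symmetric] algebra_simps)
    also have "\<dots> \<le> K * exp (- (c * real m ^ 2) * t)"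
      unfolding K_def using that cC by (intro mult_right_mono mult_left_mono) (auto intro: mult_left_mono)
    finally show ?thesis .
  qed
  have "norm (duhamel \<rho> A m Y h t) \<le> (K + K / c) * (norm Y + N / real m ^ 3)"
    if m: "1 \<le> m" and h: "continuous_on {0..T} h" and N: "\<forall>s\<in>{0..T}. norm (h s) \<le> N" and t: "t \<in> {0..T}" for m Y h N t
  proof -
    let ?M = "gen_op \<rho> A m"
    let ?q = "\<lambda>s. ap (exp (s *\<^sub>R (- ?M))) (0, h s)"
    define l where "l = c * real m ^ 2"
    have l: "0 < l" using cC m by (simp add: l_def)
    have N0: "0 \<le> N" using N T by (meson atLeastAtMost_iff less_imp_le norm_ge_zero order_refl order_trans)
    have ht: "continuous_on {0..t} h" by (rule continuous_on_subset[OF h]) (use t in auto)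
    have "ap (exp (t *\<^sub>R ?M)) (integral {0..t} ?q) = integral {0..t} (\<lambda>s. ap (exp (t *\<^sub>R ?M)) (?q s))"
      by (rule integral_linear[OF integrable_continuous_real[OF forcing_continuous[OF ht]] ap.bounded_linear_right,
            unfolded o_def, symmetric])
    also have "(\<lambda>s. ap (exp (t *\<^sub>R ?M)) (?q s)) = (\<lambda>s. ap (exp ((t - s) *\<^sub>R ?M)) (0, h s))"
    proof
      fix s
      have "exp (t *\<^sub>R ?M + s *\<^sub>R (- ?M)) = exp (t *\<^sub>R ?M) * exp (s *\<^sub>R (- ?M))"
        by (rule exp_add_commuting) simp
      moreover have "t *\<^sub>R ?M + s *\<^sub>R (- ?M) = (t - s) *\<^sub>R ?M" by (simp add: algebra_simps)
      ultimately show "ap (exp (t *\<^sub>R ?M)) (?q s) = ap (exp ((t - s) *\<^sub>R ?M)) (0, h s)"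
        by (simp add: ap_mult)
    qed
    finally have eq: "ap (exp (t *\<^sub>R ?M)) (integral {0..t} ?q) = integral {0..t} (\<lambda>s. ap (exp ((t - s) *\<^sub>R ?M)) (0, h s))" .
    have dE: "((\<lambda>s. K * N / l * exp (- l * (t - s))) has_vector_derivative K * exp (- l * (t - s)) * N) (at s within {0..t})" for s
      unfolding has_real_derivative_iff_has_vector_derivative[symmetric]
      using l by (auto intro!: derivative_eq_intros)
    have hE: "((\<lambda>s. K * exp (- l * (t - s)) * N) has_integral (K * N / l * exp (- l * (t - t)) - K * N / l * exp (- l * (t - 0)))) {0..t}"
      using t by (intro fundamental_theorem_of_calculus dE) auto
    have "norm (integral {0..t} (\<lambda>s. ap (exp ((t - s) *\<^sub>R ?M)) (0, h s))) \<le> integral {0..t} (\<lambda>s. K * exp (- l * (t - s)) * N)"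
    proof (rule integral_norm_bound_integral)
      show "(\<lambda>s. ap (exp ((t - s) *\<^sub>R ?M)) (0, h s)) integrable_on {0..t}"
      proof (intro integrable_continuous_real ap.continuous_on continuous_on_Pair continuous_on_const ht)
        show "continuous_on {0..t} (\<lambda>s. exp ((t - s) *\<^sub>R ?M))"
          by (rule continuous_on_compose2[OF exp_op_continuous[of UNIV]]) (auto intro!: continuous_intros)
      qed
      show "(\<lambda>s. K * exp (- l * (t - s)) * N) integrable_on {0..t}" using hE by blast
      fix s assume s: "s \<in> {0..t}"
      have "norm (ap (exp ((t - s) *\<^sub>R ?M)) (0, h s)) \<le> norm (exp ((t - s) *\<^sub>R ?M)) * norm ((0, h s) :: 'n st)"
        by (rule norm_ap)
      also have "\<dots> \<le> K * exp (- l * (t - s)) * N"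
        using ek[OF m, of "t - s"] s t N by (intro mult_mono) (auto simp: l_def norm_Pair K_def)
      finally show "norm (ap (exp ((t - s) *\<^sub>R ?M)) (0, h s)) \<le> K * exp (- l * (t - s)) * N" .
    qed
    also have "\<dots> \<le> K * N / l"
      unfolding integral_unique[OF hE] using K0 N0 l by simp
    finally have I: "norm (ap (exp (t *\<^sub>R ?M)) (integral {0..t} ?q)) \<le> K * N / l" unfolding eq .
    have "norm (exp (t *\<^sub>R ?M)) \<le> K"
    proof -
      have "exp (- (c * real m ^ 2) * t) \<le> 1" using cC t by (simp add: mult_nonneg_nonneg)
      then have "K * exp (- (c * real m ^ 2) * t) \<le> K * 1" using K0 by (intro mult_left_mono) auto
      with ek[OF m t] show ?thesis by simp
    qed
    then have Y: "norm (ap (exp (t *\<^sub>R ?M)) Y) \<le> K * norm Y"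
      by (rule order_trans[OF norm_ap mult_right_mono]) simp
    have tri: "norm (a - x *\<^sub>R b) \<le> norm a + \<bar>x\<bar> * norm b" for a b :: "'n st" and x
      using norm_triangle_ineq4[of a "x *\<^sub>R b"] by simp
    have dec: "duhamel \<rho> A m Y h t = ap (exp (t *\<^sub>R ?M)) Y - lift_coeff m *\<^sub>R ap (exp (t *\<^sub>R ?M)) (integral {0..t} ?q)"
      by (simp only: duhamel_def ap.diff_right ap.scaleR_right)
    have "norm (duhamel \<rho> A m Y h t) \<le> norm (ap (exp (t *\<^sub>R ?M)) Y) + \<bar>lift_coeff m\<bar> * norm (ap (exp (t *\<^sub>R ?M)) (integral {0..t} ?q))"
      unfolding dec by (rule tri)
    also have "\<dots> \<le> K * norm Y + 1 / real m * (K * N / l)"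
      using Y I lift_coeff_bounds(2)[OF m] by (intro add_mono mult_mono) auto
    also have "1 / real m * (K * N / l) = K / c * (N / real m ^ 3)"
      by (simp add: l_def power2_eq_square power3_eq_cube)
    also have "K * norm Y + K / c * (N / real m ^ 3) \<le> (K + K / c) * (norm Y + N / real m ^ 3)"
    proof -
      have "0 \<le> K / c * norm Y" "0 \<le> K * (N / real m ^ 3)" using K0 cC N0 by auto
      then show ?thesis unfolding distrib_left distrib_right by linarith
    qed
    finally show ?thesis .
  qed
  moreover have "0 \<le> K + K / c" using K0 cC by simp
  ultimately show ?thesis by blast
qed

text \<open>The derivative of \<open>exp (- t M) y(t)\<close> is the weighted forcing, so the integral of the latter decides
about the final state.\<close>

lemma modal_ode_final_value:
  fixes A :: "complex^'n^'n"
  assumes T: "0 < T"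
    and d: "\<And>t. t \<in> {0..T} \<Longrightarrow> (y has_vector_derivative ap (gen_op \<rho> A m) (y t) - lift_coeff m *\<^sub>R (0, h t)) (at t within {0..T})"
    and h: "continuous_on {0..T} h"
    and moment: "lift_coeff m *\<^sub>R integral {0..T} (\<lambda>s. ap (exp (s *\<^sub>R (- gen_op \<rho> A m))) (0, h s)) = y 0"
  shows "y T = 0"
proof -
  let ?M = "gen_op \<rho> A m"
  let ?e = "\<lambda>s. exp (s *\<^sub>R (- ?M))"
  have dd: "((\<lambda>s. ap (?e s) (y s)) has_vector_derivative - (lift_coeff m *\<^sub>R ap (?e t) (0, h t))) (at t within {0..T})"
    if t: "t \<in> {0..T}" for t
  proof -
    have de: "(?e has_vector_derivative - ?M * ?e t) (at t within {0..T})"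
      by (rule has_vector_derivative_at_within[OF exp_scaleR_has_vector_derivative_left])
    have c: "?M * ?e t = ?e t * ?M" by (rule exp_commute) simp
    have "ap (?e t) (ap ?M (y t) - lift_coeff m *\<^sub>R (0, h t)) + ap (- ?M * ?e t) (y t)
      = ap (?e t * ?M) (y t) - lift_coeff m *\<^sub>R ap (?e t) (0, h t) - ap (?M * ?e t) (y t)"
      by (simp only: ap.diff_right ap.scaleR_right ap_mult ap.minus_left minus_mult_left[symmetric] add_uminus_conv_diff)
    also have "\<dots> = - (lift_coeff m *\<^sub>R ap (?e t) (0, h t))" unfolding c by simp
    finally show ?thesis using ap.has_vector_derivative[OF de d[OF t]] by simp
  qed
  have "((\<lambda>t. - (lift_coeff m *\<^sub>R ap (?e t) (0, h t))) has_integral (ap (?e T) (y T) - ap (?e 0) (y 0))) {0..T}"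
    using T by (intro fundamental_theorem_of_calculus dd) auto
  moreover have "((\<lambda>t. - (lift_coeff m *\<^sub>R ap (?e t) (0, h t))) has_integral
      - (lift_coeff m *\<^sub>R integral {0..T} (\<lambda>t. ap (?e t) (0, h t)))) {0..T}"
    by (intro has_integral_neg has_integral_cmul integrable_integral integrable_continuous_real forcing_continuous h)
  ultimately have "ap (?e T) (y T) - ap (?e 0) (y 0) = - (lift_coeff m *\<^sub>R integral {0..T} (\<lambda>t. ap (?e t) (0, h t)))"
    by (rule has_integral_unique)
  then have "ap (?e T) (y T) = 0" unfolding moment by simp
  then have "ap (exp (T *\<^sub>R ?M) * ?e T) (y T) = 0" by (simp only: ap_mult ap.zero_right)
  then show ?thesis unfolding exp_op_cancel by simp
qed

section \<open>Regularity of sine series in time\<close>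

lemma has_vector_derivative_quotient:
  "(f has_vector_derivative d) (at t within S) \<longleftrightarrow>
   ((\<lambda>r. (f r - f t) /\<^sub>R (r - t) - d) \<longlongrightarrow> 0) (at t within S)"
proof -
  have "norm (f r - f t - (r - t) *\<^sub>R d) / norm (r - t) = norm ((f r - f t) /\<^sub>R (r - t) - d)" if "r \<noteq> t" for r
  proof -
    have "(f r - f t) /\<^sub>R (r - t) - d = (f r - f t - (r - t) *\<^sub>R d) /\<^sub>R (r - t)"
      using that by (simp add: scaleR_diff_right)
    then show ?thesis by (simp add: divide_inverse mult.commute)
  qed
  then have "((\<lambda>r. norm (f r - f t - (r - t) *\<^sub>R d) / norm (r - t)) \<longlongrightarrow> 0) (at t within S) \<longleftrightarrow>
    ((\<lambda>r. norm ((f r - f t) /\<^sub>R (r - t) - d)) \<longlongrightarrow> 0) (at t within S)"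
    by (intro Lim_cong_within) auto
  then show ?thesis
    unfolding has_vector_derivative_def has_derivative_iff_norm
    by (simp add: bounded_linear_scaleR_left tendsto_norm_zero_iff)
qed

lemma dominated_spec_space:
  assumes "summable \<beta>" "\<And>k. real (Suc k) powr (2 * s) * (norm (c (Suc k)))\<^sup>2 \<le> \<beta> k"
  shows "c \<in> spec_space s"
  unfolding spec_space_def
  by (simp, rule summable_comparison_test'[OF assms(1), of 0]) (use assms(2) in auto)

lemma lipschitz_from_derivative:
  fixes f :: "real \<Rightarrow> 'a::real_normed_vector"
  assumes "\<And>t. t \<in> {0..T} \<Longrightarrow> (f has_vector_derivative f' t) (at t within {0..T})"
    and "\<And>t. t \<in> {0..T} \<Longrightarrow> norm (f' t) \<le> b" and "t \<in> {0..T}" "r \<in> {0..T}"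
  shows "norm (f r - f t) \<le> b * \<bar>r - t\<bar>"
proof -
  have "norm (f r - f t) \<le> b * norm (r - t)"
  proof (rule differentiable_bound[where S = "{0..T}" and f' = "\<lambda>t x. x *\<^sub>R f' t"])
    show "onorm (\<lambda>x. x *\<^sub>R f' t) \<le> b" if "t \<in> {0..T}" for t
      by (rule onorm_le) (use assms(2)[OF that] in \<open>simp add: mult.commute[of b] mult_left_mono\<close>)
  qed (use assms in \<open>auto simp: has_vector_derivative_def\<close>)
  then show ?thesis by simp
qed

text \<open>The difference quotients are dominated by the bound for the derivative, by the mean value
inequality, so convergence of each coefficient suffices.\<close>

lemma C1_X_sine_series:
  assumes s: "1 \<le> s" and \<beta>: "summable (\<lambda>k. real (Suc k) powr (2 * s) * (b k)\<^sup>2)"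
    and bc: "\<And>t k. t \<in> {0..T} \<Longrightarrow> norm (c t (Suc k)) \<le> b k"
    and be: "\<And>t k. t \<in> {0..T} \<Longrightarrow> norm (e t (Suc k)) \<le> b k"
    and der: "\<And>t k. t \<in> {0..T} \<Longrightarrow> ((\<lambda>t. c t (Suc k)) has_vector_derivative e t (Suc k)) (at t within {0..T})"
    and cont: "\<And>k. continuous_on {0..T} (\<lambda>t. e t (Suc k))" and T: "0 < T"
  shows "C1_X T s (\<lambda>t. sine_series (c t)) (\<lambda>t. sine_series (e t))"
  unfolding C1_X_def
proof (intro conjI ballI)
  have w: "real (Suc k) powr (2 * s) * (norm z)\<^sup>2 \<le> real (Suc k) powr (2 * s) * (b k)\<^sup>2"
    if "norm z \<le> b k" for k and z :: "complex^'n"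
    using that by (intro mult_left_mono power_mono) auto
  have contc: "continuous_on {0..T} (\<lambda>t. c t (Suc k))" for k
    by (rule continuous_on_vector_derivative) (rule der)
  show "C0_X T s (\<lambda>t. sine_series (c t))"
    by (rule C0_X_sine_series[OF s \<beta> w[OF bc] contc T])
  show "C0_X T s (\<lambda>t. sine_series (e t))"
    by (rule C0_X_sine_series[OF s \<beta> w[OF be] cont T])
  fix t assume t: "t \<in> {0..T}"
  have sp: "c r \<in> spec_space s" "e r \<in> spec_space s" if "r \<in> {0..T}" for r
    by (rule dominated_spec_space[OF \<beta> w[OF bc[OF that]]], rule dominated_spec_space[OF \<beta> w[OF be[OF that]]])
  let ?q = "\<lambda>r m. (c r m - c t m) /\<^sub>R (r - t) - e t m"
  have eq: "X_norm s (\<lambda>x. (sine_series (c r) x - sine_series (c t) x) /\<^sub>R (r - t) - sine_series (e t) x) = spec_norm s (?q r)" if r: "r \<in> {0..T}" for r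
    unfolding X_norm_def
  proof (rule spec_norm_cong)
    fix m
    have L: "L2dom (sine_series (c r))" "L2dom (sine_series (c t))" "L2dom (sine_series (e t))"
      using X_space_L2[OF sine_series_X_space[OF sp(1)[OF r] s]] X_space_L2[OF sine_series_X_space[OF sp(1)[OF t] s]]
        X_space_L2[OF sine_series_X_space[OF sp(2)[OF t] s]] by simp_all
    show "sine_coeff (\<lambda>x. (sine_series (c r) x - sine_series (c t) x) /\<^sub>R (r - t) - sine_series (e t) x) (Suc m) = ?q r (Suc m)"
      unfolding sine_coeff_diff[OF L2dom_scaleR[OF L2dom_diff[OF L(1,2)]] L(3)] sine_coeff_scaleR sine_coeff_diff[OF L(1,2)]
      by (simp add: sine_coeff_sine_series[OF spec_space_summable[OF sp(1)[OF r] s]]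
          sine_coeff_sine_series[OF spec_space_summable[OF sp(1)[OF t] s]]
          sine_coeff_sine_series[OF spec_space_summable[OF sp(2)[OF t] s]])
  qed
  have "((\<lambda>r. spec_norm s (?q r)) \<longlongrightarrow> 0) (at t within {0..T})"
  proof (rule spec_norm_tendsto_0[where \<beta> = "\<lambda>k. 4 * (real (Suc k) powr (2 * s) * (b k)\<^sup>2)"])
    show "((\<lambda>r. ?q r (Suc k)) \<longlongrightarrow> 0) (at t within {0..T})" for k
      using der[OF t, of k] unfolding has_vector_derivative_quotient .
    show "at t within {0..T} \<noteq> bot" using t T by (simp add: trivial_limit_within islimpt_Icc)
    show "summable (\<lambda>k. 4 * (real (Suc k) powr (2 * s) * (b k)\<^sup>2))" by (rule summable_mult[OF \<beta>])
    have "real (Suc k) powr (2 * s) * (norm (?q r (Suc k)))\<^sup>2 \<le> 4 * (real (Suc k) powr (2 * s) * (b k)\<^sup>2)"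
      if r: "r \<in> {0..T}" "r \<noteq> t" for r k
    proof -
      have "norm (c r (Suc k) - c t (Suc k)) \<le> b k * \<bar>r - t\<bar>"
        by (rule lipschitz_from_derivative[OF der be t r(1)])
      then have "norm ((c r (Suc k) - c t (Suc k)) /\<^sub>R (r - t)) \<le> b k"
        using r(2) by (simp add: divide_inverse[symmetric] mult.commute[of "inverse _"] pos_divide_le_eq)
      then have "norm (?q r (Suc k)) \<le> 2 * b k"
        using be[OF t, of k] norm_triangle_ineq4[of "(c r (Suc k) - c t (Suc k)) /\<^sub>R (r - t)" "e t (Suc k)"] by linarith
      then have "(norm (?q r (Suc k)))\<^sup>2 \<le> (2 * b k)\<^sup>2" by (rule power_mono) simp
      then have "real (Suc k) powr (2 * s) * (norm (?q r (Suc k)))\<^sup>2 \<le> real (Suc k) powr (2 * s) * (2 * b k)\<^sup>2"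
        by (rule mult_left_mono) simp
      then show ?thesis by (simp add: power_mult_distrib mult.left_commute)
    qed
    then show "\<forall>\<^sub>F r in at t within {0..T}. \<forall>k. real (Suc k) powr (2 * s) * (norm (?q r (Suc k)))\<^sup>2
        \<le> 4 * (real (Suc k) powr (2 * s) * (b k)\<^sup>2)"
      unfolding eventually_at_filter by (intro always_eventually) auto
  qed
  moreover have "\<forall>\<^sub>F r in at t within {0..T}. X_norm s (\<lambda>x. (sine_series (c r) x - sine_series (c t) x) /\<^sub>R (r - t) - sine_series (e t) x) = spec_norm s (?q r)"
    unfolding eventually_at_filter using eq by (intro always_eventually) auto
  ultimately show "((\<lambda>r. X_norm s (\<lambda>x. (sine_series (c r) x - sine_series (c t) x) /\<^sub>R (r - t) - sine_series (e t) x)) \<longlongrightarrow> 0) (at t within {0..T})"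
    by (simp add: tendsto_cong)
qed

lemma H1_spec_dominated:
  assumes \<beta>: "summable \<beta>"
    and bd: "\<And>t k. t \<in> {0..T} \<Longrightarrow> real (Suc k) powr (2 * s) * (norm (w t (Suc k)))\<^sup>2 \<le> \<beta> k"
    and cont: "\<And>m. 1 \<le> m \<Longrightarrow> continuous_on {0..T} (\<lambda>t. w t m)"
    and der: "\<And>t m. t \<in> {0..T} \<Longrightarrow> 1 \<le> m \<Longrightarrow> ((\<lambda>t. c t m) has_vector_derivative w t m) (at t within {0..T})"
  shows "H1_spec T s c w"
  unfolding H1_spec_def
proof (intro conjI allI ballI impI)
  have sp: "w t \<in> spec_space s" if "t \<in> {0..T}" for t by (rule dominated_spec_space[OF \<beta> bd[OF that]])
  show "(\<lambda>t. w t m) \<in> borel_measurable (lebesgue_on {0..T})" if "1 \<le> m" for m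
    by (rule continuous_imp_measurable_on_sets_lebesgue[OF cont[OF that]]) simp
  show "AE t in lebesgue_on {0..T}. w t \<in> spec_space s"
    by (rule AE_I2) (simp add: sp)
  let ?f = "\<lambda>k t. real (Suc k) powr (2 * s) * (norm (w t (Suc k)))\<^sup>2"
  have u: "uniform_limit {0..T} (\<lambda>n t. \<Sum>k<n. ?f k t) (\<lambda>t. \<Sum>k. ?f k t) sequentially"
    by (rule Weierstrass_m_test[OF _ \<beta>]) (use bd in simp)
  have "continuous_on {0..T} (\<lambda>t. \<Sum>k. ?f k t)"
    by (rule uniform_limit_theorem[OF always_eventually u])
      (auto intro!: continuous_intros cont)
  then have "integrable (lebesgue_on {0..T}) (\<lambda>t. \<Sum>k. ?f k t)" by (rule LINT_continuous)
  moreover have "(spec_norm s (w t))\<^sup>2 = (\<Sum>k. ?f k t)" if "t \<in> {0..T}" for t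
    unfolding spec_norm_def using sp[OF that]
    by (intro real_sqrt_pow2 suminf_nonneg) (auto simp: spec_space_def)
  ultimately show "integrable (lebesgue_on {0..T}) (\<lambda>t. (spec_norm s (w t))\<^sup>2)"
    by (subst Bochner_Integration.integrable_cong[OF refl, where g = "\<lambda>t. \<Sum>k. ?f k t"]) simp_all
  show "c t m = c 0 m + (LINT r|lebesgue_on {0..t}. w r m)" if "t \<in> {0..T}" "1 \<le> m" for t m
    by (rule primitive_LINT[OF der[OF _ that(2)] cont[OF that(2)] that(1)])
qed

section \<open>The lifted problem, mode by mode\<close>

definition modal_data :: "(real \<Rightarrow> complex^'n) \<Rightarrow> (real \<Rightarrow> complex^'n) \<Rightarrow> nat \<Rightarrow> ('n::finite) st" where
  "modal_data u0 u1 m = (real m ^ 2 *\<^sub>R sine_coeff u0 m, sine_coeff u1 m)"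

lemma modal_data_bound:
  assumes "u0 \<in> X_space 3" "u1 \<in> X_space 1" "1 \<le> m"
  shows "norm (modal_data u0 u1 m) \<le> X_norm 3 u0 + X_norm 1 u1"
proof -
  have sp: "sine_coeff u0 \<in> spec_space 3" "sine_coeff u1 \<in> spec_space 1" using assms by (auto simp: X_space_def)
  have m: "1 \<le> real m" using assms(3) by simp
  have "norm (real m ^ 2 *\<^sub>R sine_coeff u0 m) \<le> real m powr 3 * norm (sine_coeff u0 m)"
    using m by (simp add: power_increasing mult_right_mono)
  also have "\<dots> \<le> X_norm 3 u0" unfolding X_norm_def by (rule spec_norm_coeff[OF sp(1) assms(3)])
  finally have 1: "norm (real m ^ 2 *\<^sub>R sine_coeff u0 m) \<le> X_norm 3 u0" .
  have "1 * norm (sine_coeff u1 m) \<le> real m powr 1 * norm (sine_coeff u1 m)"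
    using m by (intro mult_right_mono) auto
  also have "\<dots> \<le> X_norm 1 u1" unfolding X_norm_def by (rule spec_norm_coeff[OF sp(2) assms(3)])
  finally show ?thesis
    using 1 norm_Pair_le[of "real m ^ 2 *\<^sub>R sine_coeff u0 m" "sine_coeff u1 m"] by (simp add: modal_data_def)
qed

lemma modal_data_summable:
  assumes "u0 \<in> X_space 3" "u1 \<in> X_space 1"
  shows "summable (\<lambda>k. real (Suc k) ^ 2 * (norm (modal_data u0 u1 (Suc k)))\<^sup>2)"
proof -
  have "summable (\<lambda>k. real (Suc k) powr (2 * 3) * (norm (sine_coeff u0 (Suc k)))\<^sup>2
      + real (Suc k) powr (2 * 1) * (norm (sine_coeff u1 (Suc k)))\<^sup>2)"
    using assms unfolding X_space_def spec_space_def by (intro summable_add) auto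
  moreover have "real (Suc k) powr (2 * 3) * (norm (sine_coeff u0 (Suc k)))\<^sup>2
      + real (Suc k) powr (2 * 1) * (norm (sine_coeff u1 (Suc k)))\<^sup>2
    = real (Suc k) ^ 2 * (norm (modal_data u0 u1 (Suc k)))\<^sup>2" for k
  proof -
    have "(norm (modal_data u0 u1 (Suc k)))\<^sup>2
      = real (Suc k) ^ 4 * (norm (sine_coeff u0 (Suc k)))\<^sup>2 + (norm (sine_coeff u1 (Suc k)))\<^sup>2"
      unfolding modal_data_def norm_Pair
      by (subst real_sqrt_pow2) (auto simp: power_mult_distrib simp flip: power_mult)
    then show ?thesis
      by (simp add: powr_numeral distrib_left mult.assoc[symmetric] del: of_nat_Suc flip: power_add)
  qed
  ultimately show ?thesis by simp
qed

text \<open>All regularity follows from one estimate: the states are bounded by \<open>b m\<close> with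
\<open>\<Sum> m\<^sup>2 (b m)\<^sup>2 < \<infinity>\<close>. As the first component is \<open>m\<^sup>2 v\<^sub>m\<close>, this is order \<open>3\<close> for \<open>v\<close> and order \<open>1\<close> for
its derivative, and the equation then gives order \<open>-1\<close> for the second derivative.\<close>

lemma lifted_solution_exists:
  fixes A :: "complex^'n^'n" and B :: "complex^'l^'n"
  assumes rho: "0 < \<rho>" "\<rho> < 2" and T: "0 < T" and u0: "u0 \<in> X_space 3" and u1: "u1 \<in> X_space 1"
    and G: "continuous_on {0..T} (\<lambda>s. B *v f2 s + A *v (B *v f s))"
  shows "\<exists>v vt. lifted_solution T \<rho> A B f f2 u0 u1 v vt"
proof -
  have sq: "(x + y)\<^sup>2 \<le> 2 * x\<^sup>2 + 2 * y\<^sup>2" for x y :: real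
    using zero_le_power2[of "x - y"] by (simp add: power2_eq_square algebra_simps)
  define G where "G s = B *v f2 s + A *v (B *v f s)" for s
  have Gc: "continuous_on {0..T} G" using G by (simp add: G_def[abs_def])
  obtain N where N: "\<forall>s\<in>{0..T}. norm (G s) \<le> N"
    using compact_imp_bounded[OF compact_continuous_image[OF Gc]] by (auto simp: bounded_iff)
  have N0: "0 \<le> N"
    by (rule order_trans[OF norm_ge_zero N[rule_format, of 0]]) (use T in simp)
  obtain C where C: "C \<ge> 0" and Cb: "\<forall>m\<ge>1. \<forall>Y h N t. continuous_on {0..T} h \<longrightarrow> (\<forall>s\<in>{0..T}. norm (h s) \<le> N) \<longrightarrow>
     t \<in> {0..T} \<longrightarrow> norm (duhamel \<rho> A m Y h t) \<le> C * (norm Y + N / real m ^ 3)"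
    using duhamel_bound[OF rho T, of A] by blast
  obtain cA where cA: "cA \<ge> 0" "\<And>x. norm (A *v x) \<le> cA * norm x"
    using matrix_bound[of A] by blast
  define Y where "Y = modal_data u0 u1"
  define D where "D m t = duhamel \<rho> A m (Y m) G t" for m t
  define c where "c t m = fst (D m t) /\<^sub>R real m ^ 2" for t m
  define e where "e t m = snd (D m t)" for t m
  define w where "w t m = - (real m ^ 4 *\<^sub>R c t m) - (\<rho> * real m ^ 2) *\<^sub>R e t m - A *v c t m - lift_coeff m *\<^sub>R G t" for t m
  \<comment> \<open>A bound for the state of mode \<open>m\<close> on the whole time interval.\<close>
  define b where "b m = C * (norm (Y m) + N / real m ^ 3)" for m
  have b0: "0 \<le> b m" for m using C N0 by (simp add: b_def)
  have Db: "norm (D m t) \<le> b m" if "t \<in> {0..T}" "1 \<le> m" for m t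
    unfolding D_def b_def by (rule Cb[rule_format, OF that(2) Gc N[rule_format] that(1)])
  have cb: "norm (c t m) \<le> b m / real m ^ 2" if "t \<in> {0..T}" "1 \<le> m" for m t
  proof -
    have "norm (fst (D m t)) \<le> b m" using norm_fst_le[of "fst (D m t)" "snd (D m t)"] Db[OF that] by simp
    then show ?thesis by (simp add: c_def divide_inverse mult.commute[of "inverse _"] mult_right_mono)
  qed
  have eb: "norm (e t m) \<le> b m" if "t \<in> {0..T}" "1 \<le> m" for m t
    using norm_snd_le[of "snd (D m t)" "fst (D m t)"] Db[OF that] by (simp add: e_def)
  have cb': "norm (c t m) \<le> b m" if "t \<in> {0..T}" "1 \<le> m" for m t
  proof -
    have "b m / real m ^ 2 \<le> b m / 1" using b0 that by (intro divide_left_mono) auto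
    then show ?thesis using cb[OF that] by simp
  qed
  have fD: "fst (D m t) = real m ^ 2 *\<^sub>R c t m" if "1 \<le> m" for m t using that by (simp add: c_def)
  have Dd: "(D m has_vector_derivative (real m ^ 2 *\<^sub>R e t m, w t m)) (at t within {0..T})"
    if "t \<in> {0..T}" "1 \<le> m" for m t
  proof -
    have eq: "ap (gen_op \<rho> A m) (D m t) - lift_coeff m *\<^sub>R (0, G t) = (real m ^ 2 *\<^sub>R e t m, w t m)"
    proof -
      have "D m t = (real m ^ 2 *\<^sub>R c t m, e t m)" using fD[OF that(2), of t] by (simp add: e_def prod_eq_iff)
      then show ?thesis using that(2)
        by (simp add: ap_gen_op w_def matrix_scaleR flip: power_add)
    qed
    show ?thesis using duhamel_deriv[OF Gc that(1), of \<rho> A m "Y m"]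
      unfolding D_def[symmetric, of m] eq D_def[symmetric, abs_def] by (simp add: D_def[abs_def])
  qed
  have ed: "((\<lambda>t. e t m) has_vector_derivative w t m) (at t within {0..T})" if "t \<in> {0..T}" "1 \<le> m" for m t
    using bounded_linear.has_vector_derivative[OF bounded_linear_snd Dd[OF that]] by (simp add: e_def)
  have cd: "((\<lambda>t. c t m) has_vector_derivative e t m) (at t within {0..T})" if "t \<in> {0..T}" "1 \<le> m" for m t
    using bounded_linear.has_vector_derivative[OF bounded_linear_scaleR_right
        bounded_linear.has_vector_derivative[OF bounded_linear_fst Dd[OF that]], of "inverse (real m ^ 2)"] that(2)
    by (simp add: c_def)
  have ec: "continuous_on {0..T} (\<lambda>t. e t m)" if "1 \<le> m" for m
    by (rule continuous_on_vector_derivative) (rule ed[OF _ that])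
  have cc: "continuous_on {0..T} (\<lambda>t. c t m)" if "1 \<le> m" for m
    by (rule continuous_on_vector_derivative) (rule cd[OF _ that])
  have wc: "continuous_on {0..T} (\<lambda>t. w t m)" if "1 \<le> m" for m
    unfolding w_def
    by (intro continuous_intros ec[OF that] cc[OF that] Gc
        continuous_on_compose2[OF linear_continuous_on[OF bounded_linear_matrix, of UNIV] cc[OF that]]) auto
  have \<beta>: "summable (\<lambda>k. real (Suc k) ^ 2 * (b (Suc k))\<^sup>2)"
  proof (rule summable_comparison_test'[of _ 0])
    show "summable (\<lambda>k. 2 * C\<^sup>2 * (real (Suc k) ^ 2 * (norm (Y (Suc k)))\<^sup>2) + 2 * C\<^sup>2 * N\<^sup>2 * (1 / real (Suc k) ^ 2))"
      using modal_data_summable[OF u0 u1] summable_inverse_squares unfolding Y_def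
      by (intro summable_add summable_mult)
    fix k
    let ?m = "real (Suc k)"
    have "(norm (Y (Suc k)) + N / ?m ^ 3)\<^sup>2 \<le> 2 * (norm (Y (Suc k)))\<^sup>2 + 2 * (N / ?m ^ 3)\<^sup>2"
      by (rule sq)
    then have "C\<^sup>2 * ?m ^ 2 * (norm (Y (Suc k)) + N / ?m ^ 3)\<^sup>2 \<le> C\<^sup>2 * ?m ^ 2 * (2 * (norm (Y (Suc k)))\<^sup>2 + 2 * (N / ?m ^ 3)\<^sup>2)"
      by (intro mult_left_mono) auto
    also have "\<dots> = 2 * C\<^sup>2 * (?m ^ 2 * (norm (Y (Suc k)))\<^sup>2) + 2 * C\<^sup>2 * N\<^sup>2 * (?m ^ 2 / ?m ^ 6)"
      by (simp add: distrib_left power_divide del: of_nat_Suc flip: power_mult)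
    also have "\<dots> \<le> 2 * C\<^sup>2 * (?m ^ 2 * (norm (Y (Suc k)))\<^sup>2) + 2 * C\<^sup>2 * N\<^sup>2 * (1 / ?m ^ 2)"
    proof (intro add_left_mono mult_left_mono)
      have "?m ^ 2 * ?m ^ 2 \<le> ?m ^ 6" unfolding power_add[symmetric] by (rule power_increasing) auto
      then show "?m ^ 2 / ?m ^ 6 \<le> 1 / ?m ^ 2" by (simp add: field_simps del: of_nat_Suc)
    qed simp
    finally show "norm (?m ^ 2 * (b (Suc k))\<^sup>2) \<le> 2 * C\<^sup>2 * (?m ^ 2 * (norm (Y (Suc k)))\<^sup>2) + 2 * C\<^sup>2 * N\<^sup>2 * (1 / ?m ^ 2)"
      by (simp add: b_def power_mult_distrib mult_ac del: of_nat_Suc)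
  qed
  have \<beta>1: "summable (\<lambda>k. real (Suc k) powr (2 * 1) * (b (Suc k))\<^sup>2)"
    using \<beta> by (simp add: powr_numeral del: of_nat_Suc)
  have C0: "C0_X T 3 (\<lambda>t. sine_series (c t))"
  proof (rule C0_X_sine_series[OF _ \<beta>])
    fix t k assume t: "t \<in> {0..T}"
    let ?m = "real (Suc k)"
    have "(norm (c t (Suc k)))\<^sup>2 \<le> (b (Suc k) / ?m ^ 2)\<^sup>2" using cb[OF t, of "Suc k"] by (intro power_mono) auto
    then have "?m ^ 6 * (norm (c t (Suc k)))\<^sup>2 \<le> ?m ^ 6 * (b (Suc k) / ?m ^ 2)\<^sup>2" by (rule mult_left_mono) simp
    also have "\<dots> = ?m ^ 2 * (b (Suc k))\<^sup>2"
      by (simp add: power_divide field_simps del: of_nat_Suc flip: power_mult power_add)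
    finally show "?m powr (2 * 3) * (norm (c t (Suc k)))\<^sup>2 \<le> ?m ^ 2 * (b (Suc k))\<^sup>2"
      by (simp add: powr_numeral del: of_nat_Suc)
  qed (use T cc in auto)
  have C1: "C1_X T 1 (\<lambda>t. sine_series (c t)) (\<lambda>t. sine_series (e t))"
    by (rule C1_X_sine_series[OF _ \<beta>1]) (use cb' eb cd ec T in auto)
  have spe: "e t \<in> spec_space 1" and spc: "c t \<in> spec_space 1" if "t \<in> {0..T}" for t
  proof -
    have "real (Suc k) powr (2 * 1) * (norm z)\<^sup>2 \<le> real (Suc k) powr (2 * 1) * (b (Suc k))\<^sup>2"
      if "norm z \<le> b (Suc k)" for k and z :: "complex^'n"
      using that by (intro mult_left_mono power_mono) auto
    then show "e t \<in> spec_space 1" "c t \<in> spec_space 1"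
      using eb[OF that] cb'[OF that] by (auto intro!: dominated_spec_space[OF \<beta>1])
  qed
  have ce: "sine_coeff (sine_series (e t)) m = e t m" and cc': "sine_coeff (sine_series (c t)) m = c t m"
    if "t \<in> {0..T}" "1 \<le> m" for t m
    using sine_coeff_sine_series[OF spec_space_summable[OF spe[OF that(1)]] that(2)]
      sine_coeff_sine_series[OF spec_space_summable[OF spc[OF that(1)]] that(2)] by simp_all
  have t0: "0 \<in> {0..T}" using T by simp
  have D0: "D m 0 = Y m" for m by (simp add: D_def duhamel_0)
  have i0: "AE x in dom_measure. sine_series (c 0) x = u0 x"
  proof (rule sine_coeff_determines[OF _ u0])
    show "sine_series (c 0) \<in> X_space 3" using C0 t0 unfolding C0_X_def by blast
    show "sine_coeff (sine_series (c 0)) m = sine_coeff u0 m" if "1 \<le> m" for m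
      using that by (simp add: cc'[OF t0 that] c_def D0 Y_def modal_data_def)
  qed
  have i1: "AE x in dom_measure. sine_series (e 0) x = u1 x"
  proof (rule sine_coeff_determines[OF _ u1])
    show "sine_series (e 0) \<in> X_space 1" by (rule sine_series_X_space[OF spe[OF t0]]) simp
    show "sine_coeff (sine_series (e 0)) m = sine_coeff u1 m" if "1 \<le> m" for m
      by (simp add: ce[OF t0 that] e_def D0 Y_def modal_data_def)
  qed
  define K where "K = 1 + \<rho> + cA"
  have H1: "H1_spec T (-1) (\<lambda>t. sine_coeff (sine_series (e t))) w"
  proof (rule H1_spec_dominated)
    show "summable (\<lambda>k. 2 * K\<^sup>2 * (real (Suc k) ^ 2 * (b (Suc k))\<^sup>2) + 2 * N\<^sup>2 * (1 / real (Suc k) ^ 2))"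
      by (intro summable_add summable_mult \<beta> summable_inverse_squares)
    show "((\<lambda>t. sine_coeff (sine_series (e t)) m) has_vector_derivative w t m) (at t within {0..T})"
      if "t \<in> {0..T}" "1 \<le> m" for t m
      by (rule has_vector_derivative_transform[OF that(1) _ ed[OF that]]) (rule ce[OF _ that(2)])
    fix t k assume t: "t \<in> {0..T}"
    let ?m = "real (Suc k)"
    have m1: "1 \<le> ?m" by simp
    have n1: "norm (?m ^ 4 *\<^sub>R c t (Suc k)) \<le> ?m ^ 2 * b (Suc k)"
    proof -
      have "?m ^ 4 * norm (c t (Suc k)) \<le> ?m ^ 4 * (b (Suc k) / ?m ^ 2)"
        using cb[OF t, of "Suc k"] by (intro mult_left_mono) auto
      also have "\<dots> = ?m ^ 2 * b (Suc k)"
        by (simp add: field_simps del: of_nat_Suc flip: power_add)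
      finally show ?thesis by simp
    qed
    have n2: "norm ((\<rho> * ?m ^ 2) *\<^sub>R e t (Suc k)) \<le> \<rho> * (?m ^ 2 * b (Suc k))"
      using mult_left_mono[OF eb[OF t, of "Suc k"], of "\<rho> * ?m ^ 2"] rho by (simp add: abs_mult mult.assoc)
    have n3: "norm (A *v c t (Suc k)) \<le> cA * (?m ^ 2 * b (Suc k))"
    proof -
      have "norm (A *v c t (Suc k)) \<le> cA * b (Suc k)"
        using cA(2)[of "c t (Suc k)"] mult_left_mono[OF cb'[OF t, of "Suc k"] cA(1)] by simp
      also have "b (Suc k) \<le> ?m ^ 2 * b (Suc k)"
        using mult_right_mono[OF one_le_power[OF m1, of 2] b0[of "Suc k"]] by simp
      finally show ?thesis using cA(1) by (simp add: mult_left_mono)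
    qed
    have n4: "norm (lift_coeff (Suc k) *\<^sub>R G t) \<le> N / ?m"
      using mult_mono[OF lift_coeff_bounds(2)[of "Suc k"] N[rule_format, OF t]] by simp
    have "norm (w t (Suc k)) \<le> K * (?m ^ 2 * b (Suc k)) + N / ?m"
    proof -
      have "norm (- x - y - z - u) \<le> norm x + norm y + norm z + norm u" for x y z u :: "complex^'n"
        using norm_triangle_ineq4[of "- x - y - z" u] norm_triangle_ineq4[of "- x - y" z] norm_triangle_ineq4[of "- x" y] by simp
      from this[of "?m ^ 4 *\<^sub>R c t (Suc k)" "(\<rho> * ?m ^ 2) *\<^sub>R e t (Suc k)" "A *v c t (Suc k)" "lift_coeff (Suc k) *\<^sub>R G t"]
      have "norm (w t (Suc k)) \<le> ?m ^ 2 * b (Suc k) + \<rho> * (?m ^ 2 * b (Suc k)) + cA * (?m ^ 2 * b (Suc k)) + N / ?m"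
        unfolding w_def using n1 n2 n3 n4 by linarith
      then show ?thesis by (simp add: K_def distrib_right)
    qed
    then have "(norm (w t (Suc k)))\<^sup>2 \<le> (K * (?m ^ 2 * b (Suc k)) + N / ?m)\<^sup>2" by (rule power_mono) simp
    also have "\<dots> \<le> 2 * (K * (?m ^ 2 * b (Suc k)))\<^sup>2 + 2 * (N / ?m)\<^sup>2"
      by (rule sq)
    finally have "(norm (w t (Suc k)))\<^sup>2 / ?m ^ 2 \<le> (2 * (K * (?m ^ 2 * b (Suc k)))\<^sup>2 + 2 * (N / ?m)\<^sup>2) / ?m ^ 2"
      by (rule divide_right_mono) simp
    also have "\<dots> = 2 * K\<^sup>2 * (?m ^ 2 * (b (Suc k))\<^sup>2) + 2 * N\<^sup>2 * (1 / ?m ^ 4)"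
      by (simp add: field_simps del: of_nat_Suc flip: power_mult power_add)
    also have "\<dots> \<le> 2 * K\<^sup>2 * (?m ^ 2 * (b (Suc k))\<^sup>2) + 2 * N\<^sup>2 * (1 / ?m ^ 2)"
      by (intro add_left_mono mult_left_mono divide_left_mono power_increasing) auto
    finally show "?m powr (2 * - 1) * (norm (w t (Suc k)))\<^sup>2 \<le> 2 * K\<^sup>2 * (?m ^ 2 * (b (Suc k))\<^sup>2) + 2 * N\<^sup>2 * (1 / ?m ^ 2)"
      by (simp add: powr_minus powr_numeral divide_inverse mult.commute del: of_nat_Suc)
  qed (rule wc)
  have pde: "w t m + real m ^ 4 *\<^sub>R sine_coeff (sine_series (c t)) m + (\<rho> * real m ^ 2) *\<^sub>R sine_coeff (sine_series (e t)) m
      + A *v sine_coeff (sine_series (c t)) m = - sine_coeff (\<lambda>x. lift x *\<^sub>R (B *v f2 t + A *v (B *v f t))) m"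
    if "t \<in> {0..T}" "1 \<le> m" for t m
    by (simp add: ce[OF that] cc'[OF that] sine_coeff_lift[OF that(2)] w_def G_def)
  have "lifted_solution T \<rho> A B f f2 u0 u1 (\<lambda>t. sine_series (c t)) (\<lambda>t. sine_series (e t))"
    unfolding lifted_solution_def
  proof (intro conjI exI[of _ w])
    show "AE t in lebesgue_on {0..T}. \<forall>m\<ge>1. w t m + real m ^ 4 *\<^sub>R sine_coeff (sine_series (c t)) m
      + (\<rho> * real m ^ 2) *\<^sub>R sine_coeff (sine_series (e t)) m + A *v sine_coeff (sine_series (c t)) m
      = - sine_coeff (\<lambda>x. lift x *\<^sub>R (B *v f2 t + A *v (B *v f t))) m"
      by (rule AE_I2) (simp add: pde)
  qed (fact C0 C1 i0 i1 H1)+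
  then show ?thesis by blast
qed

section \<open>Every solution reaches rest\<close>

lemma sine_coeff_zero: "sine_coeff (\<lambda>x. 0) m = 0"
  by (simp add: sine_coeff_def)

lemma zero_X_space: "(\<lambda>x. 0) \<in> X_space s"
  by (simp add: X_space_def spec_space_def sine_coeff_def)

lemma sine_coeff_cong_AE:
  assumes "AE x in dom_measure. y x = z x" "L2dom y" "L2dom z"
  shows "sine_coeff y m = sine_coeff z m"
  unfolding sine_coeff_def
proof (rule integral_cong_AE)
  show "AE x in dom_measure. sine_mode m x *\<^sub>R y x = sine_mode m x *\<^sub>R z x"
    using assms(1) by (rule AE_mp) (rule AE_I2, simp)
qed (use assms in \<open>auto dest!: L2dom_integrable intro: borel_measurable_integrable\<close>)

lemma coeff_tendsto:
  assumes "((\<lambda>r. spec_norm s (q r)) \<longlongrightarrow> 0) F" "0 \<le> s" "1 \<le> m" "\<forall>\<^sub>F r in F. q r \<in> spec_space s"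
  shows "((\<lambda>r. q r m) \<longlongrightarrow> 0) F"
proof (rule Lim_null_comparison[OF _ assms(1)])
  have "norm (q r m) \<le> spec_norm s (q r)" if "q r \<in> spec_space s" for r
  proof -
    have "1 \<le> real m powr s" using assms(2,3) by (intro ge_one_powr_ge_zero) auto
    then have "1 * norm (q r m) \<le> real m powr s * norm (q r m)" by (rule mult_right_mono) simp
    with spec_norm_coeff[OF that assms(3)] show ?thesis by simp
  qed
  then show "\<forall>\<^sub>F r in F. norm (q r m) \<le> spec_norm s (q r)"
    using assms(4) by (rule eventually_mono[rotated])
qed

text \<open>Each coefficient is dominated by the norm of order \<open>s \<ge> 0\<close>.\<close>

lemma C1_X_coeff_deriv:
  assumes C1: "C1_X T s v vt" and s: "0 \<le> s" and m: "1 \<le> m" and t: "t \<in> {0..T}"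
  shows "((\<lambda>t. sine_coeff (v t) m) has_vector_derivative sine_coeff (vt t) m) (at t within {0..T})"
    "continuous (at t within {0..T}) (\<lambda>t. sine_coeff (vt t) m)"
proof -
  have X: "v r \<in> X_space s" "vt r \<in> X_space s" if "r \<in> {0..T}" for r
    using C1 that unfolding C1_X_def C0_X_def by blast+
  have L: "L2dom (v r)" "L2dom (vt r)" if "r \<in> {0..T}" for r
    using X[OF that] by (auto dest: X_space_L2)
  have sp: "sine_coeff (v r) \<in> spec_space s" "sine_coeff (vt r) \<in> spec_space s" if "r \<in> {0..T}" for r
    using X[OF that] by (auto simp: X_space_def)
  have ev: "\<forall>\<^sub>F r in at t within {0..T}. P r" if "\<And>r. r \<in> {0..T} \<Longrightarrow> P r" for P
    unfolding eventually_at_filter using that by (intro always_eventually) auto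
  let ?q = "\<lambda>r m. (sine_coeff (v r) m - sine_coeff (v t) m) /\<^sub>R (r - t) - sine_coeff (vt t) m"
  have "((\<lambda>r. spec_norm s (?q r)) \<longlongrightarrow> 0) (at t within {0..T})"
  proof (rule Lim_transform_eventually)
    show "((\<lambda>r. X_norm s (\<lambda>x. (v r x - v t x) /\<^sub>R (r - t) - vt t x)) \<longlongrightarrow> 0) (at t within {0..T})"
      using C1 t unfolding C1_X_def by blast
    show "\<forall>\<^sub>F r in at t within {0..T}. X_norm s (\<lambda>x. (v r x - v t x) /\<^sub>R (r - t) - vt t x) = spec_norm s (?q r)"
    proof (rule ev)
      fix r assume r: "r \<in> {0..T}"
      show "X_norm s (\<lambda>x. (v r x - v t x) /\<^sub>R (r - t) - vt t x) = spec_norm s (?q r)"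
        unfolding X_norm_def
        by (rule spec_norm_cong) (simp add: sine_coeff_diff[OF L2dom_scaleR[OF L2dom_diff[OF L(1)[OF r] L(1)[OF t]]] L(2)[OF t]]
            sine_coeff_scaleR sine_coeff_diff[OF L(1)[OF r] L(1)[OF t]])
    qed
  qed
  then have "((\<lambda>r. ?q r m) \<longlongrightarrow> 0) (at t within {0..T})"
    by (rule coeff_tendsto[OF _ s m]) (intro ev spec_space_diff spec_space_scaleR sp t)
  then show "((\<lambda>t. sine_coeff (v t) m) has_vector_derivative sine_coeff (vt t) m) (at t within {0..T})"
    unfolding has_vector_derivative_quotient .
  have "((\<lambda>r. spec_norm s (\<lambda>m. sine_coeff (vt r) m - sine_coeff (vt t) m)) \<longlongrightarrow> 0) (at t within {0..T})"
  proof (rule Lim_transform_eventually)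
    show "((\<lambda>r. X_norm s (\<lambda>x. vt r x - vt t x)) \<longlongrightarrow> 0) (at t within {0..T})"
      using C1 t unfolding C1_X_def C0_X_def by blast
    show "\<forall>\<^sub>F r in at t within {0..T}. X_norm s (\<lambda>x. vt r x - vt t x)
        = spec_norm s (\<lambda>m. sine_coeff (vt r) m - sine_coeff (vt t) m)"
      unfolding X_norm_def by (intro ev spec_norm_cong) (simp add: sine_coeff_diff[OF L(2) L(2)[OF t]])
  qed
  then have "((\<lambda>r. sine_coeff (vt r) m - sine_coeff (vt t) m) \<longlongrightarrow> 0) (at t within {0..T})"
    by (rule coeff_tendsto[OF _ s m]) (intro ev spec_space_diff sp t)
  then show "continuous (at t within {0..T}) (\<lambda>t. sine_coeff (vt t) m)"
    unfolding continuous_within by (rule LIM_zero_cancel)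
qed

text \<open>The second time derivative of a solution is only known almost everywhere. As the equation identifies
it there with a continuous function, the coefficients are classical solutions.\<close>

lemma primitive_AE_deriv:
  fixes h :: "real \<Rightarrow> 'a::euclidean_space"
  assumes prim: "\<And>t. t \<in> {0..T} \<Longrightarrow> h t = h 0 + (LINT r|lebesgue_on {0..t}. w r)"
    and w: "w \<in> borel_measurable (lebesgue_on {0..T})"
    and ae: "AE t in lebesgue_on {0..T}. w t = W t" and W: "continuous_on {0..T} W"
    and t: "t \<in> {0..T}"
  shows "(h has_vector_derivative W t) (at t within {0..T})"
proof -
  have eq: "h r = h 0 + integral {0..r} W" if r: "r \<in> {0..T}" for r
  proof -
    have sub: "{0..r} \<subseteq> {0..T}" using r by auto
    have "(LINT s|lebesgue_on {0..r}. w s) = (LINT s|lebesgue_on {0..r}. W s)"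
    proof (rule integral_cong_AE)
      show "w \<in> borel_measurable (lebesgue_on {0..r})" by (rule measurable_restrict_mono[OF w sub])
      show "W \<in> borel_measurable (lebesgue_on {0..r})"
        by (rule continuous_imp_measurable_on_sets_lebesgue[OF continuous_on_subset[OF W sub]]) simp
      have "AE t in lebesgue. t \<in> {0..T} \<longrightarrow> w t = W t" using ae by (simp add: AE_restrict_space_iff)
      then have "AE t in lebesgue. t \<in> {0..r} \<longrightarrow> w t = W t"
        by (rule AE_mp) (rule AE_I2, use sub in auto)
      then show "AE s in lebesgue_on {0..r}. w s = W s" by (simp add: AE_restrict_space_iff)
    qed
    then show ?thesis using prim[OF r] LINT_continuous(2)[OF continuous_on_subset[OF W sub]] by simp
  qed
  have "((\<lambda>t. h 0 + integral {0..t} W) has_vector_derivative 0 + W t) (at t within {0..T})"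
    by (intro has_vector_derivative_add has_vector_derivative_const integral_has_vector_derivative[OF W t])
  then have "((\<lambda>t. h 0 + integral {0..t} W) has_vector_derivative W t) (at t within {0..T})" by simp
  then show ?thesis
    by (rule has_vector_derivative_transform[OF t, rotated]) (rule eq)
qed

text \<open>No solution formula enters: the coefficients of an arbitrary solution in the given class satisfy the
modal equations classically, and those determine the final state.\<close>

lemma lifted_solution_final:
  fixes A :: "complex^'n^'n" and B :: "complex^'l^'n"
  assumes T: "0 < T" and u0: "u0 \<in> X_space 3" and u1: "u1 \<in> X_space 1"
    and G: "continuous_on {0..T} (\<lambda>s. B *v f2 s + A *v (B *v f s))"
    and moment: "\<And>m. 1 \<le> m \<Longrightarrow> lift_coeff m *\<^sub>R integral {0..T} (\<lambda>s. ap (exp (s *\<^sub>R (- gen_op \<rho> A m))) (0, B *v f2 s + A *v (B *v f s)))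
      = modal_data u0 u1 m"
    and sol: "lifted_solution T \<rho> A B f f2 u0 u1 v vt"
  shows "AE x in dom_measure. v T x = 0" "AE x in dom_measure. vt T x = 0"
proof -
  define G where "G s = B *v f2 s + A *v (B *v f s)" for s
  have Gc: "continuous_on {0..T} G" using G by (simp add: G_def[abs_def])
  have C0: "C0_X T 3 v" and C1: "C1_X T 1 v vt" using sol by (auto simp: lifted_solution_def)
  have TT: "0 \<in> {0..T}" "T \<in> {0..T}" using T by auto
  have X: "v t \<in> X_space 3" "vt t \<in> X_space 1" if "t \<in> {0..T}" for t
    using C0 C1 that unfolding C1_X_def C0_X_def by blast+
  obtain w where H1: "H1_spec T (-1) (\<lambda>t. sine_coeff (vt t)) w"
    and ae: "AE t in lebesgue_on {0..T}. \<forall>m\<ge>1. w t m + real m ^ 4 *\<^sub>R sine_coeff (v t) m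
                 + (\<rho> * real m ^ 2) *\<^sub>R sine_coeff (vt t) m + A *v sine_coeff (v t) m
               = - sine_coeff (\<lambda>x. lift x *\<^sub>R (B *v f2 t + A *v (B *v f t))) m"
    using sol unfolding lifted_solution_def by blast
  have fin: "sine_coeff (v T) m = 0 \<and> sine_coeff (vt T) m = 0" if m: "1 \<le> m" for m
  proof -
    define c where "c t = sine_coeff (v t) m" for t
    define e where "e t = sine_coeff (vt t) m" for t
    define W where "W t = - (real m ^ 4 *\<^sub>R c t) - (\<rho> * real m ^ 2) *\<^sub>R e t - A *v c t - lift_coeff m *\<^sub>R G t" for t
    have cd: "(c has_vector_derivative e t) (at t within {0..T})" if "t \<in> {0..T}" for t
      using C1_X_coeff_deriv(1)[OF C1 _ m that] unfolding c_def[abs_def] e_def by simp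
    have cc: "continuous_on {0..T} c" by (rule continuous_on_vector_derivative) (rule cd)
    have ec: "continuous_on {0..T} e"
      unfolding continuous_on_eq_continuous_within e_def[abs_def]
      using C1_X_coeff_deriv(2)[OF C1 _ m] by simp
    have Wc: "continuous_on {0..T} W"
      unfolding W_def
      by (intro continuous_intros ec cc Gc
        continuous_on_compose2[OF linear_continuous_on[OF bounded_linear_matrix, of UNIV] cc]) auto
    have ed: "(e has_vector_derivative W t) (at t within {0..T})" if "t \<in> {0..T}" for t
    proof (rule primitive_AE_deriv[OF _ _ _ Wc that])
      show "e t = e 0 + (LINT r|lebesgue_on {0..t}. w r m)" if "t \<in> {0..T}" for t
        using H1 that m unfolding H1_spec_def e_def by blast
      show "(\<lambda>t. w t m) \<in> borel_measurable (lebesgue_on {0..T})"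
        using H1 m unfolding H1_spec_def by blast
      show "AE t in lebesgue_on {0..T}. w t m = W t"
        using ae
      proof (rule AE_mp, intro AE_I2 impI)
        fix t
        assume "\<forall>m\<ge>1. w t m + real m ^ 4 *\<^sub>R sine_coeff (v t) m
                 + (\<rho> * real m ^ 2) *\<^sub>R sine_coeff (vt t) m + A *v sine_coeff (v t) m
               = - sine_coeff (\<lambda>x. lift x *\<^sub>R (B *v f2 t + A *v (B *v f t))) m"
        from this[rule_format, OF m]
        have "w t m + real m ^ 4 *\<^sub>R c t + (\<rho> * real m ^ 2) *\<^sub>R e t + A *v c t = - (lift_coeff m *\<^sub>R G t)"
          unfolding sine_coeff_lift[OF m] c_def e_def G_def .
        then have "w t m = - (lift_coeff m *\<^sub>R G t) - A *v c t - (\<rho> * real m ^ 2) *\<^sub>R e t - real m ^ 4 *\<^sub>R c t"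
          by (simp only: eq_diff_eq)
        then show "w t m = W t" by (simp add: W_def)
      qed
    qed
    define y where "y t = ((real m ^ 2 *\<^sub>R c t, e t) :: 'n st)" for t
    have "y T = 0"
    proof (rule modal_ode_final_value[OF T _ Gc])
      fix t assume t: "t \<in> {0..T}"
      have "(y has_vector_derivative (real m ^ 2 *\<^sub>R e t, W t)) (at t within {0..T})"
        unfolding y_def[abs_def]
        by (intro has_vector_derivative_Pair ed[OF t] bounded_linear.has_vector_derivative[OF bounded_linear_scaleR_right] cd[OF t])
      moreover have "(real m ^ 2 *\<^sub>R e t, W t) = ap (gen_op \<rho> A m) (y t) - lift_coeff m *\<^sub>R (0, G t)"
        using m by (simp add: y_def ap_gen_op W_def matrix_scaleR flip: power_add)
      ultimately show "(y has_vector_derivative ap (gen_op \<rho> A m) (y t) - lift_coeff m *\<^sub>R (0, G t)) (at t within {0..T})" by simp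
    next
      have "c 0 = sine_coeff u0 m"
        unfolding c_def using sol X(1)[OF TT(1)] u0
        by (intro sine_coeff_cong_AE) (auto simp: lifted_solution_def dest: X_space_L2)
      moreover have "e 0 = sine_coeff u1 m"
        unfolding e_def using sol X(2)[OF TT(1)] u1
        by (intro sine_coeff_cong_AE) (auto simp: lifted_solution_def dest: X_space_L2)
      ultimately have "y 0 = modal_data u0 u1 m" by (simp add: y_def modal_data_def)
      then show "lift_coeff m *\<^sub>R integral {0..T} (\<lambda>s. ap (exp (s *\<^sub>R (- gen_op \<rho> A m))) (0, G s)) = y 0"
        using moment[OF m] by (simp only: G_def)
    qed
    then show ?thesis using m by (simp add: y_def c_def e_def zero_prod_def)
  qed
  show "AE x in dom_measure. v T x = 0"
    by (rule sine_coeff_determines[OF X(1)[OF TT(2)] zero_X_space[of 3]]) (simp add: fin sine_coeff_zero)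
  show "AE x in dom_measure. vt T x = 0"
    by (rule sine_coeff_determines[OF X(2)[OF TT(2)] zero_X_space[of 3]]) (simp add: fin sine_coeff_zero)
qed

section \<open>Null controllability\<close>

text \<open>Supplies the data of the construction from the hypotheses on \<open>A\<close> and \<open>B\<close>. The annihilating product
makes the first term of \<open>hautus_reachability\<close> vanish.\<close>

lemma moments_solvable:
  fixes A :: "complex^'n^'n" and B :: "complex^'l^'n"
  assumes T: "0 < T" and rho: "0 < \<rho>" "\<rho> < 2"
    and hautus: "\<And>z. z \<in> eigenvalues A \<Longrightarrow> rank (hautus_matrix A B z) = CARD('n)"
    and gaps: "spectral_gap \<rho> A" "transfer_gap \<rho> A"
  shows "\<exists>C\<ge>0. \<forall>Y N. (\<forall>m\<ge>1. norm (Y m) \<le> N) \<longrightarrow> (\<exists>f f1 f2.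
      (\<forall>t\<in>{0..T}. (f has_vector_derivative f1 t) (at t within {0..T}))
    \<and> (\<forall>t\<in>{0..T}. (f1 has_vector_derivative f2 t) (at t within {0..T}))
    \<and> continuous_on {0..T} f2
    \<and> f 0 = 0 \<and> f1 0 = 0 \<and> f T = 0 \<and> f1 T = 0
    \<and> (\<forall>t\<in>{0..T}. norm (f t) \<le> C * N \<and> norm (f1 t) \<le> C * N \<and> norm (f2 t) \<le> C * N)
    \<and> (\<forall>m\<ge>1. lift_coeff m *\<^sub>R integral {0..T} (\<lambda>s. ap (exp (s *\<^sub>R (- gen_op \<rho> A m))) (0, B *v f2 s + A *v (B *v f s))) = Y m))"
proof -
  obtain d h where h: "\<forall>j<d. h j \<in> eigenvalues A" "shifted_prod A h d = 0"
    using eigenvalues_annihilate[of A] by blast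
  have d: "0 < d"
  proof (rule ccontr)
    assume "\<not> 0 < d"
    then have "(mat 1 :: complex^'n^'n) = 0" using h(2) by simp
    then have "(mat 1 :: complex^'n^'n) $ i $ i = 0" for i by simp
    then show False by (simp add: mat_def)
  qed
  \<comment> \<open>Beyond \<open>d\<close> any eigenvalue will do; there is one because \<open>d > 0\<close>.\<close>
  define g where "g k = (if k < d then h k else h 0)" for k
  have eig: "g k \<in> eigenvalues A" for k using h(1) d by (simp add: g_def)
  have ann: "shifted_prod A g d = 0"
    using shifted_prod_cong[of d g h A] h(2) by (simp add: g_def)
  obtain X K where "shifted_prod A g d ** X + (\<Sum>i<d. shifted_prod A g i ** B ** K i) = mat 1"
    using hautus_reachability[OF hautus, of d g] eig by blast
  then have reach: "(\<Sum>i<d. shifted_prod A g i ** B ** K i) = mat 1" by (simp add: ann)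
  define cg where "cg = (\<Sum>k<d. norm (h k))"
  have gb: "norm (g k) \<le> cg" for k
    using member_le_sum[of "if k < d then k else 0" "{..<d}" "\<lambda>k. norm (h k)"] d by (auto simp: g_def cg_def)
  obtain \<kappa> G R where bump: "gevrey \<kappa> G R" "\<And>k t. t \<le> T / 3 \<or> 2 * T / 3 \<le> t \<Longrightarrow> \<kappa> k t = 0"
    "(\<kappa> 0 has_integral 1) {0..T}"
    using gevrey_bump_exists[OF T] by blast
  interpret moment_control T \<rho> A B g d K \<kappa> G R cg
    by (unfold_locales) (fact T rho eig gb ann reach bump)+
  obtain C where C: "C \<ge> 0" and c: "\<forall>Y N. (\<forall>m\<ge>1. norm (Y m) \<le> N) \<longrightarrow> (\<exists>f f1 f2.
      (\<forall>t\<in>{0..T}. (f has_vector_derivative f1 t) (at t within {0..T}))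
    \<and> (\<forall>t\<in>{0..T}. (f1 has_vector_derivative f2 t) (at t within {0..T}))
    \<and> continuous_on {0..T} f2
    \<and> f 0 = 0 \<and> f1 0 = 0 \<and> f T = 0 \<and> f1 T = 0
    \<and> (\<forall>t\<in>{0..T}. norm (f t) \<le> C * N \<and> norm (f1 t) \<le> C * N \<and> norm (f2 t) \<le> C * N)
    \<and> (\<forall>n\<ge>1. integral {0..T} (\<lambda>s. ap (E n s) (0, B *v f2 s + A *v (B *v f s))) = (1 / lift_coeff n) *\<^sub>R Y n))"
    using control_exists[OF gaps] by blast
  have eq: "lift_coeff m *\<^sub>R I = y" if "1 \<le> m" "I = (1 / lift_coeff m) *\<^sub>R y" for m I and y :: "'n st"
    using that lift_coeff_bounds(1)[OF that(1)] by simp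
  show ?thesis
  proof (intro exI[of _ C] conjI C allI impI)
    fix Y :: "nat \<Rightarrow> 'n st" and N assume "\<forall>m\<ge>1. norm (Y m) \<le> N"
    from c[THEN spec, THEN spec, THEN mp, OF this] obtain f f1 f2 where f:
      "\<forall>t\<in>{0..T}. (f has_vector_derivative f1 t) (at t within {0..T})"
      "\<forall>t\<in>{0..T}. (f1 has_vector_derivative f2 t) (at t within {0..T})"
      "continuous_on {0..T} f2" "f 0 = 0 \<and> f1 0 = 0 \<and> f T = 0 \<and> f1 T = 0"
      "\<forall>t\<in>{0..T}. norm (f t) \<le> C * N \<and> norm (f1 t) \<le> C * N \<and> norm (f2 t) \<le> C * N"
      "\<forall>n\<ge>1. integral {0..T} (\<lambda>s. ap (E n s) (0, B *v f2 s + A *v (B *v f s))) = (1 / lift_coeff n) *\<^sub>R Y n"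
      by blast
    have m: "\<forall>m\<ge>1. lift_coeff m *\<^sub>R integral {0..T} (\<lambda>s. ap (exp (s *\<^sub>R (- gen_op \<rho> A m))) (0, B *v f2 s + A *v (B *v f s))) = Y m"
      using f(6) unfolding E_def by (intro allI impI eq) auto
    show "\<exists>f f1 f2.
      (\<forall>t\<in>{0..T}. (f has_vector_derivative f1 t) (at t within {0..T}))
    \<and> (\<forall>t\<in>{0..T}. (f1 has_vector_derivative f2 t) (at t within {0..T}))
    \<and> continuous_on {0..T} f2
    \<and> f 0 = 0 \<and> f1 0 = 0 \<and> f T = 0 \<and> f1 T = 0
    \<and> (\<forall>t\<in>{0..T}. norm (f t) \<le> C * N \<and> norm (f1 t) \<le> C * N \<and> norm (f2 t) \<le> C * N)
    \<and> (\<forall>m\<ge>1. lift_coeff m *\<^sub>R integral {0..T} (\<lambda>s. ap (exp (s *\<^sub>R (- gen_op \<rho> A m))) (0, B *v f2 s + A *v (B *v f s))) = Y m)"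
      by (rule exI[of _ f], rule exI[of _ f1], rule exI[of _ f2], intro conjI) (use f m in simp_all)
  qed
qed

text \<open>A control that is twice continuously differentiable is in particular of class \<open>H\<^sup>2\<close>.\<close>

lemma smooth_H02_control:
  fixes f :: "real \<Rightarrow> complex^'l"
  assumes T: "0 < T"
    and d1: "\<forall>t\<in>{0..T}. (f has_vector_derivative f1 t) (at t within {0..T})"
    and d2: "\<forall>t\<in>{0..T}. (f1 has_vector_derivative f2 t) (at t within {0..T})"
    and c2: "continuous_on {0..T} f2" and bc: "f 0 = 0 \<and> f1 0 = 0 \<and> f T = 0 \<and> f1 T = 0"
    and b: "\<forall>t\<in>{0..T}. norm (f t) \<le> N \<and> norm (f1 t) \<le> N \<and> norm (f2 t) \<le> N"
  shows "H02_control T f f1 f2" "H2_norm T f f1 f2 \<le> sqrt (3 * T) * N"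
proof -
  have c1: "continuous_on {0..T} f1" by (rule continuous_on_vector_derivative) (use d2 in blast)
  have c0: "continuous_on {0..T} f" by (rule continuous_on_vector_derivative) (use d1 in blast)
  show "H02_control T f f1 f2"
    unfolding H02_control_def H2_control_def
  proof (intro conjI ballI)
    show "f2 \<in> borel_measurable (lebesgue_on {0..T})"
      by (rule continuous_imp_measurable_on_sets_lebesgue[OF c2]) simp
    show "integrable (lebesgue_on {0..T}) (\<lambda>t. (norm (f2 t))\<^sup>2)"
      by (rule LINT_continuous(1)) (intro continuous_intros c2)
    show "f t = f 0 + (LINT r|lebesgue_on {0..t}. f1 r)" if "t \<in> {0..T}" for t
      by (rule primitive_LINT[OF _ c1 that]) (use d1 in blast)
    show "f1 t = f1 0 + (LINT r|lebesgue_on {0..t}. f2 r)" if "t \<in> {0..T}" for t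
      by (rule primitive_LINT[OF _ c2 that]) (use d2 in blast)
  qed (use bc in simp_all)
  let ?s = "\<lambda>t. (norm (f t))\<^sup>2 + (norm (f1 t))\<^sup>2 + (norm (f2 t))\<^sup>2"
  have cs: "continuous_on {0..T} ?s" by (intro continuous_intros c0 c1 c2)
  have N0: "0 \<le> N" by (rule order_trans[OF norm_ge_zero[of "f 0"]]) (use b T in simp)
  have "(LINT t|lebesgue_on {0..T}. ?s t) = integral {0..T} ?s" by (rule LINT_continuous(2)[OF cs])
  also have "\<dots> \<le> integral {0..T} (\<lambda>t. 3 * N\<^sup>2)"
  proof (rule integral_le[OF integrable_continuous_real[OF cs] integrable_const_ivl])
    fix t assume "t \<in> {0..T}"
    then have "(norm (f t))\<^sup>2 \<le> N\<^sup>2" "(norm (f1 t))\<^sup>2 \<le> N\<^sup>2" "(norm (f2 t))\<^sup>2 \<le> N\<^sup>2"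
      using b by (auto intro!: power_mono)
    then show "?s t \<le> 3 * N\<^sup>2" by linarith
  qed
  also have "\<dots> = 3 * T * N\<^sup>2" using T by simp
  finally have "H2_norm T f f1 f2 \<le> sqrt (3 * T * N\<^sup>2)" unfolding H2_norm_def by (rule real_sqrt_le_mono)
  then show "H2_norm T f f1 f2 \<le> sqrt (3 * T) * N" using N0 by (simp add: real_sqrt_mult)
qed

theorem theorem3:
  fixes T \<rho> :: real
    and A :: "complex^'n^'n" and B :: "complex^'l^'n"
    and \<gamma> :: "nat \<Rightarrow> complex" and p0 :: nat
  assumes T: "T > 0"
    and rho: "0 < \<rho>" "\<rho> < 2"
    and spectrum: "bij_betw \<gamma> {1..p0} (eigenvalues A)"
    and hautus: "\<And>z. z \<in> eigenvalues A \<Longrightarrow> rank (hautus_matrix A B z) = CARD('n)"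
    and spectral_nonresonance:
      "\<And>j k m n \<sigma> \<eta>. \<lbrakk>j \<in> {1..p0}; k \<in> {1..p0}; m \<ge> 1; n \<ge> 1; \<sigma> \<in> {1, -1}; \<eta> \<in> {1, -1};
         (j, m) \<noteq> (k, n)\<rbrakk>
       \<Longrightarrow> temporal_root \<rho> (\<gamma> j) \<sigma> m \<noteq> temporal_root \<rho> (\<gamma> k) \<eta> n"
    and transfer_nonresonance:
      "\<And>j m \<sigma>. \<lbrakk>j \<in> {1..p0}; m \<ge> 1; \<sigma> \<in> {1, -1}\<rbrakk>
       \<Longrightarrow> (temporal_root \<rho> (\<gamma> j) \<sigma> m)\<^sup>2 + \<gamma> j \<noteq> 0"
  shows "\<exists>C. \<forall>u0 \<in> X_space 3. \<forall>u1 \<in> X_space 1. \<exists>f f1 f2.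
      H02_control T f f1 f2
      \<and> (\<exists>u ut. controlled_solution T \<rho> A B f f1 f2 u0 u1 u ut)
      \<and> (\<forall>u ut. controlled_solution T \<rho> A B f f1 f2 u0 u1 u ut \<longrightarrow>
            (AE x in dom_measure. u T x = 0) \<and> (AE x in dom_measure. ut T x = 0))
      \<and> H2_norm T f f1 f2 \<le> C * (X_norm 3 u0 + X_norm 1 u1)"
proof -
  have idx: "\<exists>j\<in>{1..p0}. z = \<gamma> j" if "z \<in> eigenvalues A" for z
    using spectrum that by (auto simp: bij_betw_def)
  have gap: "spectral_gap \<rho> A"
    unfolding spectral_gap_def
  proof (intro ballI allI impI)
    fix y z m n \<sigma> \<eta>
    assume "y \<in> eigenvalues A" "z \<in> eigenvalues A" "1 \<le> (m::nat)" "1 \<le> (n::nat)" "m \<noteq> n"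
      and s: "\<sigma> \<in> {1, -1 :: complex}" "\<eta> \<in> {1, -1 :: complex}"
    moreover from this obtain j k where "j \<in> {1..p0}" "y = \<gamma> j" "k \<in> {1..p0}" "z = \<gamma> k"
      using idx by meson
    ultimately show "temporal_root \<rho> y \<sigma> m \<noteq> temporal_root \<rho> z \<eta> n"
      using spectral_nonresonance[of j k m n \<sigma> \<eta>] by simp
  qed
  have tgap: "transfer_gap \<rho> A"
    unfolding transfer_gap_def
  proof (intro ballI allI impI)
    fix z m \<sigma> assume z: "z \<in> eigenvalues A" and m: "1 \<le> (m::nat)" and s: "\<sigma> \<in> {1, -1 :: complex}"
    obtain j where j: "j \<in> {1..p0}" "z = \<gamma> j" using idx[OF z] by blast
    show "(temporal_root \<rho> z \<sigma> m)\<^sup>2 + z \<noteq> 0"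
      unfolding j(2) by (rule transfer_nonresonance[OF j(1) m s])
  qed
  obtain C where C: "C \<ge> 0" and ctl: "\<forall>(Y :: nat \<Rightarrow> 'n st) N. (\<forall>m\<ge>1. norm (Y m) \<le> N) \<longrightarrow> (\<exists>f f1 f2.
      (\<forall>t\<in>{0..T}. (f has_vector_derivative f1 t) (at t within {0..T}))
    \<and> (\<forall>t\<in>{0..T}. (f1 has_vector_derivative f2 t) (at t within {0..T}))
    \<and> continuous_on {0..T} f2
    \<and> f 0 = 0 \<and> f1 0 = 0 \<and> f T = 0 \<and> f1 T = 0
    \<and> (\<forall>t\<in>{0..T}. norm (f t) \<le> C * N \<and> norm (f1 t) \<le> C * N \<and> norm (f2 t) \<le> C * N)
    \<and> (\<forall>m\<ge>1. lift_coeff m *\<^sub>R integral {0..T} (\<lambda>s. ap (exp (s *\<^sub>R (- gen_op \<rho> A m))) (0, B *v f2 s + A *v (B *v f s))) = Y m))"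
    using moments_solvable[OF T rho hautus gap tgap] by blast
  show ?thesis
  proof (intro exI[of _ "sqrt (3 * T) * C"] ballI)
    fix u0 u1 :: "real \<Rightarrow> complex^'n" assume u0: "u0 \<in> X_space 3" and u1: "u1 \<in> X_space 1"
    define N where "N = X_norm 3 u0 + X_norm 1 u1"
    have "norm (modal_data u0 u1 m) \<le> N" if "1 \<le> m" for m
      unfolding N_def by (rule modal_data_bound[OF u0 u1 that])
    then have "\<forall>m\<ge>1. norm (modal_data u0 u1 m) \<le> N" by blast
    from ctl[THEN spec, THEN spec, THEN mp, OF this] obtain f f1 f2 where
      d1: "\<forall>t\<in>{0..T}. (f has_vector_derivative f1 t) (at t within {0..T})"
      and d2: "\<forall>t\<in>{0..T}. (f1 has_vector_derivative f2 t) (at t within {0..T})"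
      and c2: "continuous_on {0..T} f2" and bc: "f 0 = 0 \<and> f1 0 = 0 \<and> f T = 0 \<and> f1 T = 0"
      and b: "\<forall>t\<in>{0..T}. norm (f t) \<le> C * N \<and> norm (f1 t) \<le> C * N \<and> norm (f2 t) \<le> C * N"
      and moment: "\<forall>m\<ge>1. lift_coeff m *\<^sub>R integral {0..T} (\<lambda>s. ap (exp (s *\<^sub>R (- gen_op \<rho> A m))) (0, B *v f2 s + A *v (B *v f s)))
        = modal_data u0 u1 m"
      by blast
    note ctrl = smooth_H02_control[OF T d1 d2 c2 bc b]
    have c0: "continuous_on {0..T} f" by (rule continuous_on_vector_derivative) (use d1 in blast)
    have mc: "continuous_on {0..T} (\<lambda>s. D *v h s)" if "continuous_on {0..T} h" for D :: "complex^'a^'b" and h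
      by (rule continuous_on_compose2[OF linear_continuous_on[OF bounded_linear_matrix, of UNIV] that]) simp
    have G: "continuous_on {0..T} (\<lambda>s. B *v f2 s + A *v (B *v f s))"
      by (intro continuous_on_add mc c0 c2)
    have ex: "\<exists>u ut. controlled_solution T \<rho> A B f f1 f2 u0 u1 u ut"
    proof -
      obtain v vt where v: "lifted_solution T \<rho> A B f f2 u0 u1 v vt"
        using lifted_solution_exists[OF rho T u0 u1 G] by blast
      have "controlled_solution T \<rho> A B f f1 f2 u0 u1 (\<lambda>t x. v t x + lift x *\<^sub>R (B *v f t)) (\<lambda>t x. vt t x + lift x *\<^sub>R (B *v f1 t))"
        using v by (simp add: controlled_solution_def)
      then show ?thesis by blast
    qed
    have rest: "(AE x in dom_measure. u T x = 0) \<and> (AE x in dom_measure. ut T x = 0)"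
      if "controlled_solution T \<rho> A B f f1 f2 u0 u1 u ut" for u ut
      using lifted_solution_final[OF T u0 u1 G moment[rule_format] that[unfolded controlled_solution_def]] bc by simp
    show "\<exists>f f1 f2. H02_control T f f1 f2
      \<and> (\<exists>u ut. controlled_solution T \<rho> A B f f1 f2 u0 u1 u ut)
      \<and> (\<forall>u ut. controlled_solution T \<rho> A B f f1 f2 u0 u1 u ut \<longrightarrow>
            (AE x in dom_measure. u T x = 0) \<and> (AE x in dom_measure. ut T x = 0))
      \<and> H2_norm T f f1 f2 \<le> sqrt (3 * T) * C * (X_norm 3 u0 + X_norm 1 u1)"
      by (rule exI[of _ f], rule exI[of _ f1], rule exI[of _ f2], intro conjI allI impI)
        (use ctrl ex rest in \<open>simp_all add: N_def mult.assoc\<close>)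
  qed
qed

end
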